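(* For each $+$-quadratic form $v$ over $\mathbb Z$ the set $l_1(v)$ is finite; but there are forms $v$ for which $\{[v']\mid [v']\sim[v]\}$ is arbitrarily large, and forms $v$ for which $\mathrm{sbAut}(v)$ is arbitrarily large.
   Context: The ring is $\mathbb Z$ with trivial involution and $\epsilon=+1$; based modules are finitely generated free abelian groups (torsion plays no role). For such $M$, $Q_+(M)$ is the cokernel of $1-T$ on $\mathrm{Hom}(M,M^* )$, $T\phi=\phi^*$. A $+$-quadratic form is $(M,\psi)$, $\psi\in Q_+(M)$; symmetrisation $\psi+\psi^*$; nonsingular if this is an isomorphism. Isometries are isomorphisms preserving $\psi$. $H_+(L)=(L\oplus L^*,\begin{pmatrix}0&1\\0&0\end{pmatrix})$. $[v]$ denotes the $0$-stabilised form of $v$: its class modulo isometry after adding zero forms $(P,0)$; $\mathcal F_0^{zs}(\mathbb Z)$ is the monoid of these. For forms $v,v'$ of equal rank, $v\sim v'$ (equivalently $[v]\sim[v']$) means $[v]+[H_+(\mathbb Z^k)]=[v']+[H_+(\mathbb Z^k)]$ for some $k$. A Lagrangian of $(M,\psi)$ is a direct summand $L$ with $L=L^\perp$ (annihilator with respect to $\psi+\psi^*$) and $\psi|_L=0\in Q_+(L)$. A quasi-formation $(M,\psi;L,V)$ is a nonsingular form with a Lagrangian $L$ and a half-rank direct summand $V$. Isomorphisms are isometries carrying $L$ to $L'$ and $V$ to $V'$; trivial formations are $(H_+(P);P,P^* )$; stable isomorphism is isomorphism after adding trivial formations. $l_1(\mathbb Z)$ is the abelian monoid (direct sum) of stable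 isomorphism classes of quasi-formations modulo $(M,\psi;K,L)\oplus(M,\psi;L,V)\sim(M,\psi;K,V)$ for Lagrangians $K,L$. The monoid map $b\colon l_1(\mathbb Z)\to\mathcal F_0^{zs}(\mathbb Z)\times\mathcal F_0^{zs}(\mathbb Z)$ sends $[M,\psi;L,V]$ to $([V,\psi|_V],[V^\perp,-\psi|_{V^\perp}])$. Put $l_1(v,v')=b^{-1}([v],[v'])$ and $l_1(v)=\bigcup_{v'\sim v}l_1(v,v')$. $\mathrm{sbAut}(v)$: a split skew-quadratic formation $(F,(\begin{pmatrix}\gamma\\\mu\end{pmatrix},\theta)G)$ consists of an embedding $\begin{pmatrix}\gamma\\\mu\end{pmatrix}\colon G\to F\oplus F^*$ of $G$ as a Lagrangian of $H_-(F)$ and $\theta\in Q_+(G)$ with $\gamma^*\mu=\theta+\theta^*$. The boundary of $(K,\psi)$ is $\partial(K,\psi)=(K,(\begin{pmatrix}1\\\psi+\psi^*\end{pmatrix},\psi)K)$; trivial ones are $(P,P^* )=(P,(\begin{pmatrix}0\\1\end{pmatrix},0)P^* )$. An isomorphism to $(F',(\begin{pmatrix}\gamma'\\\mu'\end{pmatrix},\theta')G')$ is $(\alpha,\beta,\nu)$ with isomorphisms $\alpha\colon F\to F'$, $\beta\colon G\to G'$, $\nu\in Q_+(F^* )$, satisfying $\alpha\gamma+\alpha(\nu+\nu^* )^*\mu=\gamma'\beta$, $\alpha^{-*}\mu=\mu'\beta$, $\theta+\mu^*\nu\mu=\beta^*\theta'\beta$; composition is $(\alpha',\beta',\nu')(\alpha,\beta,\nu)=(\alpha'\alpha,\beta'\beta,\nu+\alpha^{-1}\nu'\alpha^{-*})$.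 A homotopy from $(\alpha,\beta,\nu)$ to $(\alpha',\beta',\nu')$ is $\Delta\in\mathrm{Hom}(G^*,F')$ with $\beta'^{-*}-\beta^{-*}=\mu'^*\Delta$, $\alpha'-\alpha=\Delta\mu^*$, $\alpha'\nu'\alpha'^*-\alpha\nu\alpha^*=(-\alpha'\gamma+\Delta\theta)\Delta^*\in Q_+(F'^* )$. A stable isomorphism is an isomorphism after adding trivial formations; two are stably homotopic if homotopic after adding identities of trivial formations and composing with isomorphisms of trivial formations. $\mathrm{Aut}(\partial v)$ is the set of stable homotopy classes of stable automorphisms of $\partial v$; $\mathrm{bAut}(v)$ is its orbit set under $(g,h)\cdot[f]=[\partial h\circ f\circ\partial g^{-1}]$, $g,h\in\mathrm{Aut}(v)$, where $\partial h=(h,h,0)$; and $\mathrm{sbAut}(v)=\varinjlim_Q\mathrm{bAut}(v\oplus(Q,0))$ with maps $[f]\mapsto[f\oplus\partial\mathrm{id}_Q]$. *)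

theory Defs
  imports "Jordan_Normal_Form.Matrix" "HOL-Algebra.AbelCoset"
begin

text \<open>
  Every finitely generated free abelian group is written as \<open>\<int>\<^sup>n\<close> (carrier \<^term>\<open>carrier_vec n\<close>),
  its dual as \<open>\<int>\<^sup>n\<close> with the dual basis, and homomorphisms as integer matrices; the dual of a
  homomorphism is then the transposed matrix. Subgroups of \<open>\<int>\<^sup>n\<close> are sets of vectors.
\<close>

definition mat_sum :: "int mat \<Rightarrow> int mat \<Rightarrow> int mat" (infixr "\<oplus>\<^sub>m" 65) where
  "A \<oplus>\<^sub>m B = four_block_mat A (0\<^sub>m (dim_row A) (dim_col B)) (0\<^sub>m (dim_row B) (dim_col A)) B"

definition set_sum :: "int vec set \<Rightarrow> int vec set \<Rightarrow> int vec set" where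
  "set_sum U W = {u @\<^sub>v w | u w. u \<in> U \<and> w \<in> W}"

definition mat_inv :: "int mat \<Rightarrow> int mat" where
  "mat_inv A = (THE B. B \<in> carrier_mat (dim_col A) (dim_row A) \<and> inverts_mat A B \<and> inverts_mat B A)"

section \<open>Quadratic forms\<close>

text \<open>
  \<open>Q_eq \<epsilon> n A B\<close>: the matrices \<open>A\<close>, \<open>B\<close> represent the same element of
  \<open>Q\<^sub>\<epsilon>(\<int>\<^sup>n) = coker (1 - \<epsilon>T)\<close>. Elements of \<open>Q\<^sub>\<epsilon>(\<int>\<^sup>n)\<close> are throughout given by representing
  matrices; all notions below are invariant under change of the representative.
\<close>

definition Q_eq :: "int \<Rightarrow> nat \<Rightarrow> int mat \<Rightarrow> int mat \<Rightarrow> bool" where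
  "Q_eq \<epsilon> n A B \<longleftrightarrow> A \<in> carrier_mat n n \<and> B \<in> carrier_mat n n \<and>
     (\<exists>X \<in> carrier_mat n n. A - B = X - \<epsilon> \<cdot>\<^sub>m X\<^sup>T)"

definition symm :: "int \<Rightarrow> int mat \<Rightarrow> int mat" where
  "symm \<epsilon> \<psi> = \<psi> + \<epsilon> \<cdot>\<^sub>m \<psi>\<^sup>T"

definition qforms :: "int mat set" where
  "qforms = {\<psi>. square_mat \<psi>}"

definition nonsingular :: "int \<Rightarrow> int mat \<Rightarrow> bool" where
  "nonsingular \<epsilon> \<psi> \<longleftrightarrow> square_mat \<psi> \<and> invertible_mat (symm \<epsilon> \<psi>)"

definition isometry :: "int mat \<Rightarrow> int mat \<Rightarrow> int mat \<Rightarrow> bool" where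
  "isometry \<psi> \<psi>' g \<longleftrightarrow> g \<in> carrier_mat (dim_row \<psi>') (dim_row \<psi>) \<and> invertible_mat g \<and>
     Q_eq 1 (dim_row \<psi>) \<psi> (g\<^sup>T * \<psi>' * g)"

definition hyperbolic :: "nat \<Rightarrow> int mat" where
  "hyperbolic k = four_block_mat (0\<^sub>m k k) (1\<^sub>m k) (0\<^sub>m k k) (0\<^sub>m k k)"

abbreviation zero_form :: "nat \<Rightarrow> int mat" where
  "zero_form q \<equiv> 0\<^sub>m q q"

section \<open>The monoid of \<open>0\<close>-stabilised forms\<close>

definition zs_class :: "int mat \<Rightarrow> int mat set" where
  "zs_class v = {w \<in> qforms. \<exists>p q g. isometry (v \<oplus>\<^sub>m zero_form p) (w \<oplus>\<^sub>m zero_form q) g}"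

definition F0zs :: "int mat set set" where
  "F0zs = zs_class ` qforms"

definition zs_add :: "int mat set \<Rightarrow> int mat set \<Rightarrow> int mat set" where
  "zs_add a b = (\<Union>v\<in>a. \<Union>w\<in>b. zs_class (v \<oplus>\<^sub>m w))"

definition zs_sim :: "int mat set \<Rightarrow> int mat set \<Rightarrow> bool" where
  "zs_sim a b \<longleftrightarrow> (\<exists>k. zs_add a (zs_class (hyperbolic k)) = zs_add b (zs_class (hyperbolic k)))"

definition form_sim :: "int mat \<Rightarrow> int mat \<Rightarrow> bool" where
  "form_sim v w \<longleftrightarrow> dim_row v = dim_row w \<and> zs_sim (zs_class v) (zs_class w)"

section \<open>Direct summands and Lagrangians\<close>

definition direct_summand :: "nat \<Rightarrow> int vec set \<Rightarrow> bool" where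
  "direct_summand n U \<longleftrightarrow> additive_subgroup U (module_vec TYPE(int) n) \<and>
     (\<exists>W. additive_subgroup W (module_vec TYPE(int) n) \<and> U \<inter> W = {0\<^sub>v n} \<and>
          U <+>\<^bsub>module_vec TYPE(int) n\<^esub> W = carrier_vec n)"

definition zbasis :: "nat \<Rightarrow> nat \<Rightarrow> int mat \<Rightarrow> int vec set \<Rightarrow> bool" where
  "zbasis n r B U \<longleftrightarrow> B \<in> carrier_mat n r \<and> bij_betw (\<lambda>x. B *\<^sub>v x) (carrier_vec r) U"

definition perp :: "int \<Rightarrow> int mat \<Rightarrow> int vec set \<Rightarrow> int vec set" where
  "perp \<epsilon> \<psi> U = {x \<in> carrier_vec (dim_row \<psi>). \<forall>u\<in>U. u \<bullet> (symm \<epsilon> \<psi> *\<^sub>v x) = 0}"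

text \<open>
  With respect to a basis \<open>B\<close> of \<open>U\<close> the restriction \<open>\<psi>|\<^sub>U\<close> has the matrix \<open>B\<^sup>T \<psi> B\<close>.
\<close>

definition lagrangian :: "int \<Rightarrow> int mat \<Rightarrow> int vec set \<Rightarrow> bool" where
  "lagrangian \<epsilon> \<psi> L \<longleftrightarrow> direct_summand (dim_row \<psi>) L \<and> L = perp \<epsilon> \<psi> L \<and>
     (\<exists>r B. zbasis (dim_row \<psi>) r B L \<and> Q_eq \<epsilon> r (B\<^sup>T * \<psi> * B) (0\<^sub>m r r))"

text \<open>The class \<open>[U, \<psi>|\<^sub>U]\<close>; all members of the union are equal.\<close>

definition zs_restrict :: "int mat \<Rightarrow> int vec set \<Rightarrow> int mat set" where
  "zs_restrict \<psi> U = \<Union>{zs_class (B\<^sup>T * \<psi> * B) | r B. zbasis (dim_row \<psi>) r B U}"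

section \<open>Quasi-formations and the monoid \<open>l\<^sub>1\<close>\<close>

type_synonym qf = "int mat \<times> int vec set \<times> int vec set"

fun quasi_formation :: "qf \<Rightarrow> bool" where
  "quasi_formation (\<psi>, L, V) \<longleftrightarrow> nonsingular 1 \<psi> \<and> lagrangian 1 \<psi> L \<and>
     direct_summand (dim_row \<psi>) V \<and> (\<exists>r B. zbasis (dim_row \<psi>) r B V \<and> dim_row \<psi> = 2 * r)"

fun qf_sum :: "qf \<Rightarrow> qf \<Rightarrow> qf" where
  "qf_sum (\<psi>, L, V) (\<psi>', L', V') = (\<psi> \<oplus>\<^sub>m \<psi>', set_sum L L', set_sum V V')"

definition qf_triv :: "nat \<Rightarrow> qf" where
  "qf_triv k = (hyperbolic k, set_sum (carrier_vec k) {0\<^sub>v k}, set_sum {0\<^sub>v k} (carrier_vec k))"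

fun qf_iso :: "qf \<Rightarrow> qf \<Rightarrow> bool" where
  "qf_iso (\<psi>, L, V) (\<psi>', L', V') \<longleftrightarrow>
     (\<exists>g. isometry \<psi> \<psi>' g \<and> (\<lambda>x. g *\<^sub>v x) ` L = L' \<and> (\<lambda>x. g *\<^sub>v x) ` V = V')"

definition qf_stably_iso :: "qf \<Rightarrow> qf \<Rightarrow> bool" where
  "qf_stably_iso x y \<longleftrightarrow> (\<exists>k l. qf_iso (qf_sum x (qf_triv k)) (qf_sum y (qf_triv l)))"

text \<open>
  The congruence whose quotient is \<open>l\<^sub>1(\<int>)\<close>: the least equivalence relation on quasi-formations
  that is compatible with direct sums, contains stable isomorphism, and contains the relation
  \<open>(M,\<psi>;K,L) \<oplus> (M,\<psi>;L,V) \<sim> (M,\<psi>;K,V)\<close>. Reflexivity is a case of \<open>stable\<close>.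
\<close>

inductive l1_eq :: "qf \<Rightarrow> qf \<Rightarrow> bool" where
  stable: "quasi_formation x \<Longrightarrow> quasi_formation y \<Longrightarrow> qf_stably_iso x y \<Longrightarrow> l1_eq x y"
| comp: "quasi_formation (\<psi>, L, V) \<Longrightarrow> lagrangian 1 \<psi> K \<Longrightarrow>
    l1_eq (qf_sum (\<psi>, K, L) (\<psi>, L, V)) (\<psi>, K, V)"
| sym: "l1_eq x y \<Longrightarrow> l1_eq y x"
| trans: "l1_eq x y \<Longrightarrow> l1_eq y z \<Longrightarrow> l1_eq x z"
| sum: "l1_eq x y \<Longrightarrow> l1_eq x' y' \<Longrightarrow> l1_eq (qf_sum x x') (qf_sum y y')"

definition l1 :: "qf set set" where
  "l1 = {x. quasi_formation x} // {(x, y). l1_eq x y}"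

fun qf_b :: "qf \<Rightarrow> int mat set \<times> int mat set" where
  "qf_b (\<psi>, L, V) = (zs_restrict \<psi> V, zs_restrict (- \<psi>) (perp 1 \<psi> V))"

text \<open>
  \<open>qf_b\<close> is constant on the classes of \<open>l1_eq\<close>, so \<open>l1_pair v v'\<close> is the preimage of
  \<open>([v], [v'])\<close> under the induced map on \<open>l\<^sub>1(\<int>)\<close>.
\<close>

definition l1_pair :: "int mat \<Rightarrow> int mat \<Rightarrow> qf set set" where
  "l1_pair v v' = {c \<in> l1. \<exists>x\<in>c. qf_b x = (zs_class v, zs_class v')}"

definition l1_form :: "int mat \<Rightarrow> qf set set" where
  "l1_form v = (\<Union>v' \<in> {v' \<in> qforms. form_sim v' v}. l1_pair v v')"

section \<open>Split skew-quadratic formations\<close>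

text \<open>
  \<open>(\<gamma>, \<mu>, \<theta>)\<close> stands for \<open>(F, ((\<gamma>, \<mu>), \<theta>) G)\<close>; the ranks of \<open>F\<close> and \<open>G\<close> are the number of
  rows and of columns of \<open>\<gamma>\<close>.
\<close>

type_synonym sform = "int mat \<times> int mat \<times> int mat"

fun split_formation :: "sform \<Rightarrow> bool" where
  "split_formation (\<gamma>, \<mu>, \<theta>) \<longleftrightarrow>
     (let f = dim_row \<gamma>; g = dim_col \<gamma>; E = \<gamma> @\<^sub>r \<mu> in
       \<mu> \<in> carrier_mat f g \<and> \<theta> \<in> carrier_mat g g \<and>
       inj_on (\<lambda>x. E *\<^sub>v x) (carrier_vec g) \<and>
       lagrangian (-1) (hyperbolic f) ((\<lambda>x. E *\<^sub>v x) ` carrier_vec g) \<and>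
       \<gamma>\<^sup>T * \<mu> = symm 1 \<theta>)"

fun sf_sum :: "sform \<Rightarrow> sform \<Rightarrow> sform" where
  "sf_sum (\<gamma>, \<mu>, \<theta>) (\<gamma>', \<mu>', \<theta>') = (\<gamma> \<oplus>\<^sub>m \<gamma>', \<mu> \<oplus>\<^sub>m \<mu>', \<theta> \<oplus>\<^sub>m \<theta>')"

definition boundary :: "int mat \<Rightarrow> sform" where
  "boundary \<psi> = (1\<^sub>m (dim_row \<psi>), symm 1 \<psi>, \<psi>)"

definition sf_triv :: "nat \<Rightarrow> sform" where
  "sf_triv p = (0\<^sub>m p p, 1\<^sub>m p, 0\<^sub>m p p)"

text \<open>The third component \<open>\<nu>\<close> of a morphism is a representative of an element of \<open>Q\<^sub>+(F\<^sup>* )\<close>.\<close>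

type_synonym smor = "int mat \<times> int mat \<times> int mat"

fun sf_iso :: "sform \<Rightarrow> sform \<Rightarrow> smor \<Rightarrow> bool" where
  "sf_iso (\<gamma>, \<mu>, \<theta>) (\<gamma>', \<mu>', \<theta>') (\<alpha>, \<beta>, \<nu>) \<longleftrightarrow>
     \<alpha> \<in> carrier_mat (dim_row \<gamma>') (dim_row \<gamma>) \<and> invertible_mat \<alpha> \<and>
     \<beta> \<in> carrier_mat (dim_col \<gamma>') (dim_col \<gamma>) \<and> invertible_mat \<beta> \<and>
     \<nu> \<in> carrier_mat (dim_row \<gamma>) (dim_row \<gamma>) \<and>
     \<alpha> * \<gamma> + \<alpha> * (symm 1 \<nu>)\<^sup>T * \<mu> = \<gamma>' * \<beta> \<and>
     (mat_inv \<alpha>)\<^sup>T * \<mu> = \<mu>' * \<beta> \<and>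
     Q_eq 1 (dim_col \<gamma>) (\<theta> + \<mu>\<^sup>T * \<nu> * \<mu>) (\<beta>\<^sup>T * \<theta>' * \<beta>)"

fun sf_comp :: "smor \<Rightarrow> smor \<Rightarrow> smor" where
  "sf_comp (\<alpha>', \<beta>', \<nu>') (\<alpha>, \<beta>, \<nu>) =
     (\<alpha>' * \<alpha>, \<beta>' * \<beta>, \<nu> + mat_inv \<alpha> * \<nu>' * (mat_inv \<alpha>)\<^sup>T)"

fun mor_sum :: "smor \<Rightarrow> smor \<Rightarrow> smor" where
  "mor_sum (\<alpha>, \<beta>, \<nu>) (\<alpha>', \<beta>', \<nu>') = (\<alpha> \<oplus>\<^sub>m \<alpha>', \<beta> \<oplus>\<^sub>m \<beta>', \<nu> \<oplus>\<^sub>m \<nu>')"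

definition bd_mor :: "int mat \<Rightarrow> smor" where
  "bd_mor h = (h, h, 0\<^sub>m (dim_col h) (dim_col h))"

definition triv_id :: "nat \<Rightarrow> smor" where
  "triv_id p = (1\<^sub>m p, 1\<^sub>m p, 0\<^sub>m p p)"

fun homotopic :: "sform \<Rightarrow> sform \<Rightarrow> smor \<Rightarrow> smor \<Rightarrow> bool" where
  "homotopic (\<gamma>, \<mu>, \<theta>) (\<gamma>', \<mu>', \<theta>') (\<alpha>, \<beta>, \<nu>) (\<alpha>', \<beta>', \<nu>') \<longleftrightarrow>
     (\<exists>\<Delta> \<in> carrier_mat (dim_row \<gamma>') (dim_col \<gamma>).
        (mat_inv \<beta>')\<^sup>T - (mat_inv \<beta>)\<^sup>T = \<mu>'\<^sup>T * \<Delta> \<and>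
        \<alpha>' - \<alpha> = \<Delta> * \<mu>\<^sup>T \<and>
        Q_eq 1 (dim_row \<gamma>') (\<alpha>' * \<nu>' * \<alpha>'\<^sup>T - \<alpha> * \<nu> * \<alpha>\<^sup>T) ((- (\<alpha>' * \<gamma>) + \<Delta> * \<theta>) * \<Delta>\<^sup>T))"

section \<open>Stable automorphisms of a boundary\<close>

text \<open>
  Trivial formations are added on the left, so that \<open>T\<^sub>p \<oplus> \<partial>(v \<oplus> (Q,0))\<close> is literally
  \<open>(T\<^sub>p \<oplus> \<partial>v) \<oplus> \<partial>(Q,0)\<close>. For reasons of rank, the trivial formations added to source and target
  of a stable automorphism are of the same rank \<open>p\<close>, which is recorded with the automorphism.
  All formations occurring here are split formations by \<open>split_formation_stab_bd\<close> below.
\<close>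

abbreviation stab_bd :: "nat \<Rightarrow> int mat \<Rightarrow> sform" where
  "stab_bd p v \<equiv> sf_sum (sf_triv p) (boundary v)"

definition stable_auts :: "int mat \<Rightarrow> (nat \<times> smor) set" where
  "stable_auts v = {(p, f). sf_iso (stab_bd p v) (stab_bd p v) f}"

fun stably_homotopic :: "int mat \<Rightarrow> nat \<times> smor \<Rightarrow> nat \<times> smor \<Rightarrow> bool" where
  "stably_homotopic v (p, f) (p', f') \<longleftrightarrow>
     (\<exists>r r' s t. r + p = r' + p' \<and>
        sf_iso (sf_triv (r + p)) (sf_triv (r + p)) s \<and>
        sf_iso (sf_triv (r + p)) (sf_triv (r + p)) t \<and>
        homotopic (stab_bd (r + p) v) (stab_bd (r + p) v)
          (mor_sum (triv_id r) f)
          (sf_comp (mor_sum t (bd_mor (1\<^sub>m (dim_row v))))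
            (sf_comp (mor_sum (triv_id r') f') (mor_sum s (bd_mor (1\<^sub>m (dim_row v)))))))"

definition sh_class :: "int mat \<Rightarrow> nat \<times> smor \<Rightarrow> (nat \<times> smor) set" where
  "sh_class v x = {y \<in> stable_auts v. stably_homotopic v x y}"

definition Aut_bd :: "int mat \<Rightarrow> (nat \<times> smor) set set" where
  "Aut_bd v = sh_class v ` stable_auts v"

definition Aut :: "int mat \<Rightarrow> int mat set" where
  "Aut v = {g. isometry v v g}"

fun bd_act :: "int mat \<Rightarrow> int mat \<Rightarrow> nat \<times> smor \<Rightarrow> nat \<times> smor" where
  "bd_act g h (p, f) =
     (p, sf_comp (mor_sum (triv_id p) (bd_mor h))
           (sf_comp f (mor_sum (triv_id p) (bd_mor (mat_inv g)))))"

text \<open>The orbit of \<open>[x] \<in> Aut(\<partial>v)\<close>.\<close>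

definition bAut_class :: "int mat \<Rightarrow> nat \<times> smor \<Rightarrow> (nat \<times> smor) set set" where
  "bAut_class v x = {sh_class v (bd_act g h x) | g h. g \<in> Aut v \<and> h \<in> Aut v}"

definition bAut :: "int mat \<Rightarrow> (nat \<times> smor) set set set" where
  "bAut v = bAut_class v ` stable_auts v"

fun add_zero :: "nat \<Rightarrow> nat \<times> smor \<Rightarrow> nat \<times> smor" where
  "add_zero k (p, f) = (p, mor_sum f (bd_mor (1\<^sub>m k)))"

text \<open>
  The direct limit of the \<open>bAut (v \<oplus> (\<int>\<^sup>q, 0))\<close>: pairs \<open>(q, c)\<close> with
  \<open>c \<in> bAut (v \<oplus> (\<int>\<^sup>q, 0))\<close>, identified if they become equal at a later stage.
\<close>

definition sbAut_rel ::
  "int mat \<Rightarrow> ((nat \<times> (nat \<times> smor) set set) \<times> (nat \<times> (nat \<times> smor) set set)) set" where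
  "sbAut_rel v = {((q, c), (q', c')). \<exists>x x' k k'.
     x \<in> stable_auts (v \<oplus>\<^sub>m zero_form q) \<and> c = bAut_class (v \<oplus>\<^sub>m zero_form q) x \<and>
     x' \<in> stable_auts (v \<oplus>\<^sub>m zero_form q') \<and> c' = bAut_class (v \<oplus>\<^sub>m zero_form q') x' \<and>
     q + k = q' + k' \<and>
     bAut_class (v \<oplus>\<^sub>m zero_form (q + k)) (add_zero k x) =
     bAut_class (v \<oplus>\<^sub>m zero_form (q' + k')) (add_zero k' x')}"

definition sbAut :: "int mat \<Rightarrow> (nat \<times> (nat \<times> smor) set set) set set" where
  "sbAut v = (SIGMA q:UNIV. bAut (v \<oplus>\<^sub>m zero_form q)) // sbAut_rel v"

section \<open>Stabilised boundaries are split formations\<close>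

lemma zsubgroupI:
  assumes "U \<subseteq> carrier_vec n" "0\<^sub>v n \<in> U" "\<And>x y. x \<in> U \<Longrightarrow> y \<in> U \<Longrightarrow> x + y \<in> U"
    "\<And>x. x \<in> U \<Longrightarrow> - x \<in> U"
  shows "additive_subgroup U (module_vec TYPE(int) n)"
proof (rule additive_subgroupI, unfold_locales)
  let ?M = "add_monoid (module_vec TYPE(int) n)"
  fix x assume x: "x \<in> U"
  hence xc: "x \<in> carrier_vec n" using assms(1) by auto
  have "inv\<^bsub>?M\<^esub> x = - x"
    unfolding m_inv_def
  proof (rule the_equality)
    show "- x \<in> carrier ?M \<and> x \<otimes>\<^bsub>?M\<^esub> - x = \<one>\<^bsub>?M\<^esub> \<and> - x \<otimes>\<^bsub>?M\<^esub> x = \<one>\<^bsub>?M\<^esub>"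
      using xc by (auto simp: module_vec_simps)
    fix y assume y: "y \<in> carrier ?M \<and> x \<otimes>\<^bsub>?M\<^esub> y = \<one>\<^bsub>?M\<^esub> \<and> y \<otimes>\<^bsub>?M\<^esub> x = \<one>\<^bsub>?M\<^esub>"
    hence yc: "y \<in> carrier_vec n" and e: "x + y = 0\<^sub>v n" by (auto simp: module_vec_simps)
    show "y = - x"
    proof (rule eq_vecI)
      fix i assume "i < dim_vec (- x)"
      hence i: "i < n" using xc by auto
      have "(x + y) $ i = 0" using e i by simp
      thus "y $ i = (- x) $ i" using i xc yc by auto
    qed (use xc yc in auto)
  qed
  thus "inv\<^bsub>?M\<^esub> x \<in> U" using assms(4)[OF x] by simp
qed (use assms in \<open>auto simp: module_vec_simps\<close>)

lemma symm_hyperbolic_mult: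
  assumes y: "y \<in> carrier_vec m" and z: "z \<in> carrier_vec m"
  shows "symm (-1) (hyperbolic m) *\<^sub>v (y @\<^sub>v z) = z @\<^sub>v (- y)"
proof -
  have e: "symm (-1) (hyperbolic m) = four_block_mat (0\<^sub>m m m) (1\<^sub>m m) (- 1\<^sub>m m) (0\<^sub>m m m)"
    unfolding symm_def hyperbolic_def by (rule eq_matI) auto
  show ?thesis unfolding e
    by (subst four_block_mat_mult_vec[OF _ _ _ _ y z]) (use y z in auto)
qed

lemma hyperbolic_restrict:
  assumes E: "E \<in> carrier_mat m r" and G: "G \<in> carrier_mat m r"
  shows "(E @\<^sub>r G)\<^sup>T * hyperbolic m * (E @\<^sub>r G) = E\<^sup>T * G"
proof -
  have et: "(E @\<^sub>r G)\<^sup>T = four_block_mat (E\<^sup>T) (G\<^sup>T) (0\<^sub>m 0 m) (0\<^sub>m 0 m)"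
    unfolding append_rows_def using E G by (intro eq_matI) auto
  have 1: "(E @\<^sub>r G)\<^sup>T * hyperbolic m
      = four_block_mat (0\<^sub>m r m) (E\<^sup>T) (0\<^sub>m 0 m) (0\<^sub>m 0 m)"
    unfolding et hyperbolic_def
    by (subst mult_four_block_mat[of _ r m _ m _ 0 _ _ m _ m])
      (use E G in auto)
  have eg: "E @\<^sub>r G = four_block_mat E (0\<^sub>m m 0) G (0\<^sub>m m 0)"
    unfolding append_rows_def using E G by auto
  show ?thesis unfolding 1 unfolding eg
    by (subst mult_four_block_mat[of _ r m _ m _ 0 _ _ r _ 0])
      (use E G in \<open>auto intro!: eq_matI\<close>)
qed

lemma split_formation_projections:
  fixes \<gamma> \<mu> \<pi> :: "int mat"
  assumes c: "\<gamma> \<in> carrier_mat m m" "\<mu> \<in> carrier_mat m m" "\<pi> \<in> carrier_mat m m"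
    and t: "\<gamma>\<^sup>T = \<gamma>" "\<mu>\<^sup>T = \<mu>"
    and one: "\<gamma> + \<pi> = 1\<^sub>m m"
    and i: "\<gamma> * \<gamma> = \<gamma>" "\<pi> * \<gamma> = 0\<^sub>m m m" "\<gamma> * \<pi> = 0\<^sub>m m m" "\<pi> * \<pi> = \<pi>"
    and p: "\<pi> * \<mu> = \<pi>" "\<mu> * \<pi> = \<pi>" "\<gamma> * \<mu> = \<mu> * \<gamma>"
    and th: "\<theta> \<in> carrier_mat m m" "\<gamma> * \<mu> = symm 1 \<theta>"
  shows "split_formation (\<gamma>, \<mu>, \<theta>)"
proof -
  let ?E = "\<gamma> @\<^sub>r \<mu>"
  let ?L = "(\<lambda>x. ?E *\<^sub>v x) ` carrier_vec m"
  let ?W = "{(\<pi> *\<^sub>v a) @\<^sub>v (\<gamma> *\<^sub>v b) | a b. a \<in> carrier_vec m \<and> b \<in> carrier_vec m}"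
  have Ec: "?E \<in> carrier_mat (2*m) m" using carrier_append_rows[OF c(1) c(2)] by (simp add: mult_2)
  have Ev: "?E *\<^sub>v x = (\<gamma> *\<^sub>v x) @\<^sub>v (\<mu> *\<^sub>v x)" if "x \<in> carrier_vec m" for x
    by (rule mat_mult_append[OF c(1) c(2) that])
  have mv: "A *\<^sub>v x \<in> carrier_vec m" if "A \<in> carrier_mat m m" for A :: "int mat" and x
    using that by (auto intro!: carrier_vecI)
  note mvc = mv[OF c(1)] mv[OF c(2)] mv[OF c(3)]
  have as: "A *\<^sub>v (B *\<^sub>v x) = (A * B) *\<^sub>v x"
    if "A \<in> carrier_mat m m" "B \<in> carrier_mat m m" "x \<in> carrier_vec m" for A B :: "int mat" and x
    using assoc_mult_mat_vec[OF that] by simp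
  have dec: "x = \<gamma> *\<^sub>v x + \<pi> *\<^sub>v x" if "x \<in> carrier_vec m" for x
    using add_mult_distrib_mat_vec[OF c(1) c(3) that] one that by simp
  have hd: "dim_row (hyperbolic m) = 2 * m" unfolding hyperbolic_def by simp
  have gz: "0\<^sub>m m m *\<^sub>v x = 0\<^sub>v m" if "x \<in> carrier_vec m" for x :: "int vec" using that by auto
  have key: "x = \<gamma> *\<^sub>v x + \<pi> *\<^sub>v (\<mu> *\<^sub>v x)" if "x \<in> carrier_vec m" for x
    using dec[OF that] as[OF c(3) c(2) that] p by simp
  have inj: "inj_on (\<lambda>x. ?E *\<^sub>v x) (carrier_vec m)"
  proof (rule inj_onI)
    fix x y assume x: "x \<in> carrier_vec m" and y: "y \<in> carrier_vec m" and e: "?E *\<^sub>v x = ?E *\<^sub>v y"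
    have "\<gamma> *\<^sub>v x = \<gamma> *\<^sub>v y \<and> \<mu> *\<^sub>v x = \<mu> *\<^sub>v y"
      using e unfolding Ev[OF x] Ev[OF y] by (subst (asm) append_vec_eq[OF mvc(1) mvc(1)])
    thus "x = y" using key[OF x] key[OF y] by simp
  qed
  have perpL: "?L = perp (-1) (hyperbolic m) ?L"
  proof (intro equalityI subsetI)
    fix w assume "w \<in> ?L"
    then obtain x where x: "x \<in> carrier_vec m" and w: "w = (\<gamma> *\<^sub>v x) @\<^sub>v (\<mu> *\<^sub>v x)" using Ev by auto
    have "u \<bullet> (symm (-1) (hyperbolic m) *\<^sub>v w) = 0" if "u \<in> ?L" for u
    proof -
      from that obtain y where y: "y \<in> carrier_vec m" and u: "u = (\<gamma> *\<^sub>v y) @\<^sub>v (\<mu> *\<^sub>v y)" using Ev by auto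
      have "u \<bullet> (symm (-1) (hyperbolic m) *\<^sub>v w) = (\<gamma> *\<^sub>v y) \<bullet> (\<mu> *\<^sub>v x) + (\<mu> *\<^sub>v y) \<bullet> (- (\<gamma> *\<^sub>v x))"
        unfolding u w symm_hyperbolic_mult[OF mvc(1) mvc(2)]
        by (rule scalar_prod_append) (use mvc in auto)
      also have "\<dots> = y \<bullet> (\<gamma> *\<^sub>v (\<mu> *\<^sub>v x)) - y \<bullet> (\<mu> *\<^sub>v (\<gamma> *\<^sub>v x))"
        using transpose_vec_mult_scalar[OF c(1) mvc(2) y] transpose_vec_mult_scalar[OF c(2) mvc(1) y] t
        using scalar_prod_uminus_right[of "\<gamma> *\<^sub>v x" "\<mu> *\<^sub>v y"] mvc c
        by simp
      also have "\<dots> = 0" using as[OF c(1) c(2) x] as[OF c(2) c(1) x] p by simp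
      finally show ?thesis .
    qed
    thus "w \<in> perp (-1) (hyperbolic m) ?L"
      unfolding perp_def hd w using append_carrier_vec[OF mvc(1)[of x] mvc(2)[of x]] by (auto simp: mult_2)
  next
    fix w assume "w \<in> perp (-1) (hyperbolic m) ?L"
    hence wc: "w \<in> carrier_vec (m + m)" and wp: "\<And>u. u \<in> ?L \<Longrightarrow> u \<bullet> (symm (-1) (hyperbolic m) *\<^sub>v w) = 0"
      unfolding perp_def hd by (auto simp: mult_2)
    define y where "y = vec_first w m" define z where "z = vec_last w m"
    have w: "w = y @\<^sub>v z" unfolding y_def z_def using wc by simp
    have y: "y \<in> carrier_vec m" and z: "z \<in> carrier_vec m" unfolding y_def z_def by auto
    have o: "x \<bullet> (\<gamma> *\<^sub>v z - \<mu> *\<^sub>v y) = 0" if x: "x \<in> carrier_vec m" for x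
    proof -
      have "0 = (?E *\<^sub>v x) \<bullet> (symm (-1) (hyperbolic m) *\<^sub>v w)" using wp x by simp
      also have "\<dots> = (\<gamma> *\<^sub>v x) \<bullet> z + (\<mu> *\<^sub>v x) \<bullet> (- y)"
        unfolding Ev[OF x] w symm_hyperbolic_mult[OF y z]
        by (rule scalar_prod_append) (use mvc y z in auto)
      also have "\<dots> = x \<bullet> (\<gamma> *\<^sub>v z) - x \<bullet> (\<mu> *\<^sub>v y)"
        using transpose_vec_mult_scalar[OF c(1) z x] transpose_vec_mult_scalar[OF c(2) y x] t
        using scalar_prod_uminus_right[of "y" "\<mu> *\<^sub>v x"] mvc c y
          comm_scalar_prod[OF z mvc(1)[of x]] comm_scalar_prod[OF y mvc(2)[of x]]
          comm_scalar_prod[OF x mvc(1)[of z]] comm_scalar_prod[OF x mvc(2)[of y]]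
        by simp
      also have "\<dots> = x \<bullet> (\<gamma> *\<^sub>v z - \<mu> *\<^sub>v y)"
        using scalar_prod_minus_distrib[OF x mvc(1) mvc(2)] by simp
      finally show ?thesis by simp
    qed
    have e: "\<gamma> *\<^sub>v z = \<mu> *\<^sub>v y"
    proof (rule eq_vecI)
      fix k assume "k < dim_vec (\<mu> *\<^sub>v y)"
      hence k: "k < m" using c by auto
      have "unit_vec m k \<bullet> (\<gamma> *\<^sub>v z - \<mu> *\<^sub>v y) = (\<gamma> *\<^sub>v z - \<mu> *\<^sub>v y) $ k"
        by (rule scalar_prod_left_unit) (use k mvc in auto)
      thus "(\<gamma> *\<^sub>v z) $ k = (\<mu> *\<^sub>v y) $ k" using o[of "unit_vec m k"] k c by auto
    qed (use c in auto)
    have py: "\<pi> *\<^sub>v y = 0\<^sub>v m"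
      using arg_cong[OF e, of "\<lambda>v. \<pi> *\<^sub>v v"] as[OF c(3) c(1) z] as[OF c(3) c(2) y] p i gz[OF z] by simp
    have gy: "\<gamma> *\<^sub>v y = y" using dec[OF y] py mvc(1)[of y] by simp
    define x where "x = y + \<pi> *\<^sub>v z"
    have x: "x \<in> carrier_vec m" unfolding x_def using y mvc by auto
    have "\<gamma> *\<^sub>v x = y" unfolding x_def
      using mult_add_distrib_mat_vec[OF c(1) y mvc(3)] gy as[OF c(1) c(3) z] i gz[OF z] y by simp
    moreover have "\<mu> *\<^sub>v x = z" unfolding x_def
      using mult_add_distrib_mat_vec[OF c(2) y mvc(3)] as[OF c(2) c(3) z] p e dec[OF z] by simp
    ultimately have "w = ?E *\<^sub>v x" using Ev[OF x] w by simp
    thus "w \<in> ?L" using x by auto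
  qed
  have subL: "additive_subgroup ?L (module_vec TYPE(int) (2*m))"
  proof (rule zsubgroupI)
    show "?L \<subseteq> carrier_vec (2*m)" using Ec by auto
    have "?E *\<^sub>v 0\<^sub>v m = 0\<^sub>v (2*m)" using Ec by auto
    thus "0\<^sub>v (2*m) \<in> ?L" by (metis image_eqI zero_carrier_vec)
    fix u assume "u \<in> ?L" then obtain a where a: "a \<in> carrier_vec m" "u = ?E *\<^sub>v a" by auto
    have "- u = ?E *\<^sub>v (- a)" using a Ec by (auto intro!: eq_vecI)
    thus "- u \<in> ?L" using a by auto
    fix v assume "v \<in> ?L" then obtain b where b: "b \<in> carrier_vec m" "v = ?E *\<^sub>v b" by auto
    have "u + v = ?E *\<^sub>v (a + b)" using mult_add_distrib_mat_vec[OF Ec a(1) b(1)] a b by simp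
    thus "u + v \<in> ?L" using a b by auto
  qed
  have subW: "additive_subgroup ?W (module_vec TYPE(int) (2*m))"
  proof (rule zsubgroupI)
    show "?W \<subseteq> carrier_vec (2*m)" using append_carrier_vec[OF mvc(3) mvc(1)] by (auto simp: mult_2)
    have "(\<pi> *\<^sub>v 0\<^sub>v m) @\<^sub>v (\<gamma> *\<^sub>v 0\<^sub>v m) = 0\<^sub>v (2*m)" using c by (intro eq_vecI) auto
    thus "0\<^sub>v (2*m) \<in> ?W" by (smt (verit, best) mem_Collect_eq zero_carrier_vec)
    fix u assume "u \<in> ?W" then obtain a b where a: "a \<in> carrier_vec m" "b \<in> carrier_vec m" 
      and u: "u = (\<pi> *\<^sub>v a) @\<^sub>v (\<gamma> *\<^sub>v b)" by auto
    have "- u = (\<pi> *\<^sub>v (- a)) @\<^sub>v (\<gamma> *\<^sub>v (- b))" using a c unfolding u by (intro eq_vecI) auto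
    thus "- u \<in> ?W" using a by (intro CollectI exI[of _ "- a"] exI[of _ "- b"]) auto
    fix v assume "v \<in> ?W" then obtain a' b' where a': "a' \<in> carrier_vec m" "b' \<in> carrier_vec m" 
      and v: "v = (\<pi> *\<^sub>v a') @\<^sub>v (\<gamma> *\<^sub>v b')" by auto
    have "u + v = (\<pi> *\<^sub>v (a + a')) @\<^sub>v (\<gamma> *\<^sub>v (b + b'))"
      unfolding u v append_vec_add[OF mvc(3) mvc(3) mvc(1) mvc(1)]
      using mult_add_distrib_mat_vec[OF c(3) a(1) a'(1)] mult_add_distrib_mat_vec[OF c(1) a(2) a'(2)] by simp
    thus "u + v \<in> ?W" using a a' by (intro CollectI exI[of _ "a + a'"] exI[of _ "b + b'"]) auto
  qed
  have int: "?L \<inter> ?W = {0\<^sub>v (2*m)}"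
  proof
    show "{0\<^sub>v (2*m)} \<subseteq> ?L \<inter> ?W"
      using additive_subgroup.zero_closed[OF subL] additive_subgroup.zero_closed[OF subW]
      by (simp add: module_vec_simps)
    show "?L \<inter> ?W \<subseteq> {0\<^sub>v (2*m)}"
    proof
      fix w assume "w \<in> ?L \<inter> ?W"
      then obtain x a b where x: "x \<in> carrier_vec m" and a: "a \<in> carrier_vec m" and b: "b \<in> carrier_vec m"
        and w: "w = ?E *\<^sub>v x" and w2: "w = (\<pi> *\<^sub>v a) @\<^sub>v (\<gamma> *\<^sub>v b)" by auto
      have e: "\<gamma> *\<^sub>v x = \<pi> *\<^sub>v a \<and> \<mu> *\<^sub>v x = \<gamma> *\<^sub>v b"
        using w w2 unfolding Ev[OF x] by (metis append_vec_eq mvc(1) mvc(3))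
      have "\<gamma> *\<^sub>v x = 0\<^sub>v m"
        using arg_cong[OF conjunct1[OF e], of "\<lambda>v. \<gamma> *\<^sub>v v"] as[OF c(1) c(1) x] as[OF c(1) c(3) a] i gz[OF a] by simp
      moreover have "\<pi> *\<^sub>v (\<mu> *\<^sub>v x) = 0\<^sub>v m"
        using arg_cong[OF conjunct2[OF e], of "\<lambda>v. \<pi> *\<^sub>v v"] as[OF c(3) c(1) b] i gz[OF b] by simp
      ultimately have "x = 0\<^sub>v m" using key[OF x] by simp
      thus "w \<in> {0\<^sub>v (2*m)}" unfolding w using Ec by auto
    qed
  qed
  have sum: "?L <+>\<^bsub>module_vec TYPE(int) (2*m)\<^esub> ?W = carrier_vec (2*m)"
  proof
    show "?L <+>\<^bsub>module_vec TYPE(int) (2*m)\<^esub> ?W \<subseteq> carrier_vec (2*m)"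
      using additive_subgroup.a_subset[OF subL] additive_subgroup.a_subset[OF subW]
      by (auto simp: set_add_def' module_vec_simps intro!: add_carrier_vec)
    show "carrier_vec (2*m) \<subseteq> ?L <+>\<^bsub>module_vec TYPE(int) (2*m)\<^esub> ?W"
    proof
      fix w :: "int vec" assume "w \<in> carrier_vec (2*m)"
      hence wc: "w \<in> carrier_vec (m + m)" by (simp add: mult_2)
      define y where "y = vec_first w m" define z where "z = vec_last w m"
      have w: "w = y @\<^sub>v z" unfolding y_def z_def using wc by simp
      have y: "y \<in> carrier_vec m" and z: "z \<in> carrier_vec m" unfolding y_def z_def by auto
      define x where "x = \<gamma> *\<^sub>v y + \<pi> *\<^sub>v z"
      have x: "x \<in> carrier_vec m" unfolding x_def using mvc by auto
      have 1: "\<gamma> *\<^sub>v x = \<gamma> *\<^sub>v y" unfolding x_def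
        using mult_add_distrib_mat_vec[OF c(1) mvc(1) mvc(3)] as[OF c(1) c(1) y] as[OF c(1) c(3) z] i gz[OF z]
          mvc(1)[of y] by simp
      have 2: "\<mu> *\<^sub>v x = \<gamma> *\<^sub>v (\<mu> *\<^sub>v y) + \<pi> *\<^sub>v z" unfolding x_def
        using mult_add_distrib_mat_vec[OF c(2) mvc(1) mvc(3)] as[OF c(2) c(1) y] as[OF c(1) c(2) y]
          as[OF c(2) c(3) z] p by simp
      have "?E *\<^sub>v x + ((\<pi> *\<^sub>v y) @\<^sub>v (\<gamma> *\<^sub>v (z - \<mu> *\<^sub>v y)))
          = (\<gamma> *\<^sub>v y + \<pi> *\<^sub>v y) @\<^sub>v (\<gamma> *\<^sub>v (\<mu> *\<^sub>v y) + \<pi> *\<^sub>v z + \<gamma> *\<^sub>v (z - \<mu> *\<^sub>v y))"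
        unfolding Ev[OF x] 1 2 by (rule append_vec_add) (use mvc in auto)
      also have "\<gamma> *\<^sub>v (z - \<mu> *\<^sub>v y) = \<gamma> *\<^sub>v z - \<gamma> *\<^sub>v (\<mu> *\<^sub>v y)"
        by (rule mult_minus_distrib_mat_vec[OF c(1) z mvc(2)])
      also have "\<gamma> *\<^sub>v (\<mu> *\<^sub>v y) + \<pi> *\<^sub>v z + (\<gamma> *\<^sub>v z - \<gamma> *\<^sub>v (\<mu> *\<^sub>v y)) = \<gamma> *\<^sub>v z + \<pi> *\<^sub>v z"
        using c by (intro eq_vecI) auto
      finally have "w = ?E *\<^sub>v x + ((\<pi> *\<^sub>v y) @\<^sub>v (\<gamma> *\<^sub>v (z - \<mu> *\<^sub>v y)))"
        using w dec[OF y, symmetric] dec[OF z, symmetric]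
          mult_minus_distrib_mat_vec[OF c(1) z mvc(2)[of y]] by simp
      moreover have "?E *\<^sub>v x \<in> ?L" using x by auto
      moreover have "(\<pi> *\<^sub>v y) @\<^sub>v (\<gamma> *\<^sub>v (z - \<mu> *\<^sub>v y)) \<in> ?W" using y z mvc(2)
        by (intro CollectI exI[of _ y] exI[of _ "z - \<mu> *\<^sub>v y"]) auto
      ultimately show "w \<in> ?L <+>\<^bsub>module_vec TYPE(int) (2*m)\<^esub> ?W"
        unfolding set_add_def' module_vec_simps by blast
    qed
  qed
  have q: "Q_eq (-1) m (?E\<^sup>T * hyperbolic m * ?E) (0\<^sub>m m m)"
    unfolding hyperbolic_restrict[OF c(1) c(2)] t th(2) Q_eq_def
    by (intro conjI bexI[of _ \<theta>]) (use th in \<open>auto simp: symm_def intro!: eq_matI\<close>)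
  have "lagrangian (-1) (hyperbolic m) ?L"
    unfolding lagrangian_def direct_summand_def hd zbasis_def bij_betw_def
    using subL subW int sum perpL Ec inj q by blast
  thus ?thesis using c th inj t by (simp add: Let_def)
qed

lemma split_formation_stab_bd:
  assumes "\<psi> \<in> qforms"
  shows "split_formation (stab_bd p \<psi>)"
proof -
  obtain n where n: "\<psi> \<in> carrier_mat n n" using assms unfolding qforms_def by auto
  let ?b = "\<lambda>A D. four_block_mat A (0\<^sub>m p n) (0\<^sub>m n p) D :: int mat"
  have [simp]: "A \<oplus>\<^sub>m D = ?b A D" if "A \<in> carrier_mat p p" "D \<in> carrier_mat n n" for A D
    unfolding mat_sum_def using that by auto
  have sc: "symm 1 \<psi> \<in> carrier_mat n n" unfolding symm_def using n by auto
  have s: "(symm 1 \<psi>)\<^sup>T = symm 1 \<psi>" unfolding symm_def using n by (intro eq_matI) auto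
  have mb: "?b A D * ?b A' D' = ?b (A * A') (D * D')"
    if "A \<in> carrier_mat p p" "D \<in> carrier_mat n n" "A' \<in> carrier_mat p p" "D' \<in> carrier_mat n n" for A D A' D'
    by (subst mult_four_block_mat[OF that(1) _ _ that(2) that(3) _ _ that(4)]) (use that in auto)
  have ts: "(?b A D)\<^sup>T = ?b (A\<^sup>T) (D\<^sup>T)"
    if "A \<in> carrier_mat p p" "D \<in> carrier_mat n n" for A D
    by (subst transpose_four_block_mat[OF that(1) _ _ that(2)]) auto
  have e: "stab_bd p \<psi> = (?b (0\<^sub>m p p) (1\<^sub>m n), ?b (1\<^sub>m p) (symm 1 \<psi>), ?b (0\<^sub>m p p) \<psi>)"
    unfolding sf_triv_def boundary_def using n sc by auto
  show ?thesis unfolding e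
  proof (rule split_formation_projections[where m = "p + n" and \<pi> = "?b (1\<^sub>m p) (0\<^sub>m n n)"])
    show "?b (0\<^sub>m p p) (1\<^sub>m n) * ?b (1\<^sub>m p) (symm 1 \<psi>) = symm 1 (?b (0\<^sub>m p p) \<psi>)"
      by (subst mb) (use n sc in \<open>auto simp: symm_def intro!: eq_matI\<close>)
    show "?b (0\<^sub>m p p) (1\<^sub>m n) + ?b (1\<^sub>m p) (0\<^sub>m n n) = 1\<^sub>m (p + n)"
      by (rule eq_matI) auto
  qed (use n sc s in \<open>auto simp: mb ts\<close>)
qed

end

theory Submission
  imports Defs "Jordan_Normal_Form.Determinant"
begin

text \<open>
  A quadratic form over \<open>\<int>\<close> is the same as a symmetric matrix with even diagonal, its symmetrisation
  (\<open>Q_eq_iff_symm\<close>), and two forms have the same class in \<open>F\<^sub>0\<^sup>z\<^sup>s(\<int>)\<close> iff their quotients by the radicals are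
  isometric (\<open>zs_equiv\<close>). All three parts are thereby reduced to statements about integral lattices.

  Finiteness of \<open>l\<^sub>1(v)\<close>. Let \<open>(M, \<psi>; L, V)\<close> be a quasi-formation. A vector \<open>y\<close> in the radical of the
  restriction of \<open>\<psi>\<close> to \<open>V\<close> is isotropic. The Lagrangian may be exchanged, without changing the class, for one that contains \<open>y\<close>
  (\<open>isotropic_column_in_lagrangian\<close>), and then \<open>y\<close> may be divided out (\<open>reduce_common_column\<close>). Iterating, every class is
  represented by \<open>(H(\<int>\<^sup>m); \<int>\<^sup>m, V)\<close> with nondegenerate restriction to \<open>V\<close> (\<open>nonsingular_representative\<close>); if \<open>V\<close> is itself a Lagrangian,
  nothing remains, which is the vanishing of \<open>L\<^sub>1(\<int>)\<close> (\<open>l1_null_lagrangians\<close>). Consequently the class depends only on the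
  orbit of \<open>V\<close> under the isometries of \<open>H(\<int>\<^sup>m)\<close>. The restriction to \<open>V\<close> is determined by \<open>[v]\<close> up to isometry, so \<open>m\<close>
  and its determinant are fixed. Then \<open>V\<close> and a multiple of the projection of a complement to \<open>V\<^sup>\<bottom>\<close>
  span a sublattice of fixed index whose Gram matrix
  is a direct sum of two forms of bounded determinant. By the finiteness of class numbers (\<open>finite_class_number\<close>, proved with
  Hermite's reduction) there are finitely many such Gram matrices, and a lattice has finitely many overlattices
  of given index, which leaves finitely many orbits (\<open>finite_std_codes\<close>, \<open>same_std_code\<close>).

  Many stably equivalent forms. The plane with symmetrisation \<open>(0, n; n, 2 s\<^sup>2)\<close> has a discriminant form that does not depend
  on \<open>s\<close> as long as \<open>s\<close> is invertible modulo \<open>n\<close>, and its isometry class no longer depends on \<open>s\<close> after adding a hyperbolic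
  plane (\<open>skew_plane_stably_equiv\<close>). But \<open>s\<^sup>2\<close> modulo \<open>n\<close> can be read off from its isotropic lines up to inversion. If \<open>s\<close> divides \<open>n - 1\<close> and all products of squares are
  smaller than \<open>n\<close>, distinct \<open>s\<close> yield distinct forms.

  Many automorphisms of boundaries. For the hyperbolic plane scaled by \<open>n\<close>, automorphisms of the boundary act on
  the discriminant group \<open>(\<int>/n)\<^sup>2\<close>, and stably homotopic ones act equally. Isometries of the form, even after adding zero forms,
  act by signed permutation matrices only. The automorphisms acting by \<open>diag (s\<^sup>-\<^sup>1, s)\<close> for suitable \<open>s\<close>
  therefore have different classes in \<open>sbAut\<close> (\<open>entry_invariant_bAut_class\<close>).
\<close>

section \<open>Integer matrices\<close>

lemma mat_assoc: "dim_col A = dim_row B \<Longrightarrow> dim_col B = dim_row C \<Longrightarrow> (A * B) * C = A * (B * (C :: int mat))"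
  by (rule assoc_mult_mat[of _ "dim_row A" "dim_col A" _ "dim_col B" _ "dim_col C"]) auto

lemma mat_add_mult: "dim_row A = dim_row B \<Longrightarrow> dim_col A = dim_col B \<Longrightarrow> dim_col A = dim_row C \<Longrightarrow>
    (A + B) * C = A * C + B * (C :: int mat)"
  by (rule add_mult_distrib_mat[of _ "dim_row A" "dim_col A" _ _ "dim_col C"]) auto

lemma mat_mult_add: "dim_row B = dim_row C \<Longrightarrow> dim_col B = dim_col C \<Longrightarrow> dim_col A = dim_row C \<Longrightarrow>
    A * (B + C) = A * B + A * (C :: int mat)"
  by (rule mult_add_distrib_mat[of _ "dim_row A" "dim_col A" _ "dim_col C"]) auto

lemma mat_minus_mult: "dim_row A = dim_row B \<Longrightarrow> dim_col A = dim_col B \<Longrightarrow> dim_col A = dim_row C \<Longrightarrow>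
    (A - B) * C = A * C - B * (C :: int mat)"
  by (rule minus_mult_distrib_mat[of _ "dim_row A" "dim_col A" _ _ "dim_col C"]) auto

lemma mat_mult_minus: "dim_row B = dim_row C \<Longrightarrow> dim_col B = dim_col C \<Longrightarrow> dim_col A = dim_row C \<Longrightarrow>
    A * (B - C) = A * B - A * (C :: int mat)"
  by (rule mult_minus_distrib_mat[of _ "dim_row A" "dim_col A" _ "dim_col C"]) auto

lemma mat_transpose_mult: "dim_col A = dim_row B \<Longrightarrow> (A * B)\<^sup>T = B\<^sup>T * (A :: int mat)\<^sup>T"
  by (rule transpose_mult[of _ "dim_row A" "dim_col A" _ "dim_col B"]) auto

lemma mat_transpose_add: "dim_row A = dim_row B \<Longrightarrow> dim_col A = dim_col B \<Longrightarrow> (A + B)\<^sup>T = A\<^sup>T + (B :: int mat)\<^sup>T"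
  by (intro eq_matI) auto

lemma mat_transpose_minus: "dim_row A = dim_row B \<Longrightarrow> dim_col A = dim_col B \<Longrightarrow> (A - B)\<^sup>T = A\<^sup>T - (B :: int mat)\<^sup>T"
  by (intro eq_matI) auto

lemma mat_one_mult: "dim_row A = n \<Longrightarrow> 1\<^sub>m n * A = (A :: int mat)"
  by (rule left_mult_one_mat[of _ _ "dim_col A"]) auto

lemma mat_mult_one: "dim_col A = n \<Longrightarrow> A * 1\<^sub>m n = (A :: int mat)"
  by (rule right_mult_one_mat[of _ "dim_row A"]) auto

lemma mat_zero_mult: "dim_row A = n \<Longrightarrow> 0\<^sub>m m n * A = (0\<^sub>m m (dim_col A) :: int mat)"
  by (rule left_mult_zero_mat[of _ _ "dim_col A"]) auto

lemma mat_mult_zero: "dim_col A = n \<Longrightarrow> A * 0\<^sub>m n m = (0\<^sub>m (dim_row A) m :: int mat)"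
  by (rule right_mult_zero_mat[of _ "dim_row A"]) auto

lemma mat_add_zero: "dim_row A = n \<Longrightarrow> dim_col A = m \<Longrightarrow> A + 0\<^sub>m n m = (A :: int mat)"
  by (intro eq_matI) auto

lemma mat_zero_add: "dim_row A = n \<Longrightarrow> dim_col A = m \<Longrightarrow> 0\<^sub>m n m + A = (A :: int mat)"
  by (intro eq_matI) auto

lemma mat_minus_zero: "dim_row A = n \<Longrightarrow> dim_col A = m \<Longrightarrow> A - 0\<^sub>m n m = (A :: int mat)"
  by (intro eq_matI) auto

lemma mat_uminus_zero: "- 0\<^sub>m n m = (0\<^sub>m n m :: int mat)"
  by (intro eq_matI) auto

lemma mat_minus_self: "A - A = (0\<^sub>m (dim_row A) (dim_col A) :: int mat)"
  by (intro eq_matI) auto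

lemma mat_smult_mult: "dim_col A = dim_row B \<Longrightarrow> (k \<cdot>\<^sub>m A) * B = k \<cdot>\<^sub>m (A * (B :: int mat))"
  by (rule mult_smult_assoc_mat[of _ "dim_row A" "dim_col A" _ "dim_col B"]) auto

lemma mat_mult_smult: "dim_col A = dim_row B \<Longrightarrow> A * (k \<cdot>\<^sub>m B) = k \<cdot>\<^sub>m (A * (B :: int mat))"
  by (rule mult_smult_distrib[of _ "dim_row A" "dim_col A" _ "dim_col B"]) auto

lemma mat_transpose_smult: "(k \<cdot>\<^sub>m A)\<^sup>T = k \<cdot>\<^sub>m (A :: int mat)\<^sup>T"
  by (intro eq_matI) auto

lemma mat_one_smult: "1 \<cdot>\<^sub>m A = (A :: int mat)"
  by (rule eq_matI) auto

lemmas mat_arith = mat_assoc mat_add_mult mat_mult_add mat_minus_mult mat_mult_minus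
  mat_transpose_mult mat_transpose_add mat_transpose_minus mat_one_mult mat_mult_one
  mat_zero_mult mat_mult_zero mat_add_zero mat_zero_add mat_minus_zero mat_uminus_zero mat_minus_self mat_smult_mult mat_mult_smult
  mat_transpose_smult

subsection \<open>Unimodular matrices\<close>

definition unimod :: "nat \<Rightarrow> int mat \<Rightarrow> bool" where
  "unimod n U \<longleftrightarrow> U \<in> carrier_mat n n \<and> (\<exists>V \<in> carrier_mat n n. U * V = 1\<^sub>m n \<and> V * U = 1\<^sub>m n)"

lemma unimod_iff_det: "unimod n U \<longleftrightarrow> U \<in> carrier_mat n n \<and> \<bar>det U\<bar> = 1"
proof
  assume "unimod n U"
  then obtain V where U: "U \<in> carrier_mat n n" and V: "V \<in> carrier_mat n n" "U * V = 1\<^sub>m n"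
    unfolding unimod_def by auto
  have "det U * det V = 1" using det_mult[OF U V(1)] V(2) by simp
  thus "U \<in> carrier_mat n n \<and> \<bar>det U\<bar> = 1" using U
    by (metis dvdI zdvd1_eq)
next
  assume a: "U \<in> carrier_mat n n \<and> \<bar>det U\<bar> = 1"
  hence U: "U \<in> carrier_mat n n" and d: "det U * det U = 1" by (auto simp: abs_if split: if_splits) 
  let ?V = "det U \<cdot>\<^sub>m adj_mat U"
  note ad = adj_mat[OF U]
  have "U * ?V = 1\<^sub>m n" using mult_smult_distrib[OF U ad(1), of "det U"] ad(2) d
    by (auto intro!: eq_matI)
  moreover have "?V * U = 1\<^sub>m n" using mult_smult_assoc_mat[OF ad(1) U, of "det U"] ad(3) d
    by (auto intro!: eq_matI)
  ultimately show "unimod n U" unfolding unimod_def using U ad(1) by (intro conjI bexI[of _ ?V]) auto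
qed

lemma unimod_carrier: "unimod n U \<Longrightarrow> U \<in> carrier_mat n n"
  unfolding unimod_def by auto

lemma unimodI:
  assumes U: "U \<in> carrier_mat n n" and V: "V \<in> carrier_mat n n" and e: "U * V = 1\<^sub>m n"
  shows "unimod n U" "unimod n V" "V * U = 1\<^sub>m n"
proof -
  have d: "det U * det V = 1" using det_mult[OF U V(1)] e by simp
  show u: "unimod n U" using U d unfolding unimod_iff_det by (metis dvdI zdvd1_eq)
  show "unimod n V" using V d unfolding unimod_iff_det by (metis dvdI mult.commute zdvd1_eq)
  obtain W where W: "W \<in> carrier_mat n n" "W * U = 1\<^sub>m n" using u unfolding unimod_def by auto
  have "W = W * (U * V)" using W e by simp
  also have "\<dots> = V" using W U V assoc_mult_mat[OF W(1) U V] by simp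
  finally show "V * U = 1\<^sub>m n" using W by simp
qed

lemma invertible_mat_iff: "U \<in> carrier_mat n n \<Longrightarrow> invertible_mat U \<longleftrightarrow> unimod n U"
  (is "?c \<Longrightarrow> ?l \<longleftrightarrow> ?r")
proof
  assume U: ?c
  { assume ?l
    then obtain V where V: "U * V = 1\<^sub>m (dim_row U)" "V * U = 1\<^sub>m (dim_row V)"
      unfolding invertible_mat_def inverts_mat_def by auto
    have "dim_col V = n" using arg_cong[OF V(1), of dim_col] U by simp
    moreover have "dim_row V = n" using arg_cong[OF V(2), of dim_col] U by simp
    ultimately show ?r using V U unfolding unimod_def by (intro conjI bexI[of _ V]) auto }
  { assume ?r
    thus ?l using U unfolding invertible_mat_def unimod_def inverts_mat_def by auto }
qed

lemma invertible_mat_unimod: "invertible_mat U \<longleftrightarrow> unimod (dim_row U) U"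
proof
  assume i: "invertible_mat U"
  hence "U \<in> carrier_mat (dim_row U) (dim_row U)" unfolding invertible_mat_def by auto
  thus "unimod (dim_row U) U" using i invertible_mat_iff by blast
next
  assume i: "unimod (dim_row U) U"
  thus "invertible_mat U" using invertible_mat_iff[OF unimod_carrier[OF i]] by simp
qed

lemma carrier_invertible_iff: "U \<in> carrier_mat n n \<and> invertible_mat U \<longleftrightarrow> unimod n U"
proof
  assume "U \<in> carrier_mat n n \<and> invertible_mat U"
  thus "unimod n U" by (elim conjE) (rule invertible_mat_iff[THEN iffD1])
next
  assume u: "unimod n U"
  show "U \<in> carrier_mat n n \<and> invertible_mat U"
    by (rule conjI[OF unimod_carrier[OF u] iffD2[OF invertible_mat_iff[OF unimod_carrier[OF u]] u]])
qed

lemma mat_inv_eqI: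
  assumes U: "U \<in> carrier_mat n n" and V: "V \<in> carrier_mat n n" and e: "U * V = 1\<^sub>m n"
  shows "mat_inv U = V"
proof -
  have e': "V * U = 1\<^sub>m n" by (rule unimodI[OF assms])
  show ?thesis unfolding mat_inv_def
  proof (rule the_equality)
    show "V \<in> carrier_mat (dim_col U) (dim_row U) \<and> inverts_mat U V \<and> inverts_mat V U"
      using U V e e' unfolding inverts_mat_def by auto
    fix W assume "W \<in> carrier_mat (dim_col U) (dim_row U) \<and> inverts_mat U W \<and> inverts_mat W U"
    hence W: "W \<in> carrier_mat n n" "W * U = 1\<^sub>m n" using U unfolding inverts_mat_def by auto
    have "W = W * (U * V)" using W e by simp
    also have "\<dots> = V" using W U V assoc_mult_mat[OF W(1) U V] by simp
    finally show "W = V" .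
  qed
qed

lemma unimod_inverse:
  assumes "unimod n U"
  obtains V where "unimod n V" "V \<in> carrier_mat n n" "U * V = 1\<^sub>m n" "V * U = 1\<^sub>m n" "mat_inv U = V"
proof -
  obtain V where V: "V \<in> carrier_mat n n" "U * V = 1\<^sub>m n" "V * U = 1\<^sub>m n"
    using assms unfolding unimod_def by auto
  have U: "U \<in> carrier_mat n n" using assms by (rule unimod_carrier)
  show ?thesis
    by (rule that[OF unimodI(2)[OF U V(1,2)] V mat_inv_eqI[OF U V(1,2)]])
qed

lemma unimod_one [simp]: "unimod n (1\<^sub>m n)"
  unfolding unimod_iff_det by auto

lemma unimod_mult: "unimod n U \<Longrightarrow> unimod n V \<Longrightarrow> unimod n (U * V)"
  unfolding unimod_iff_det by (auto simp: det_mult abs_mult)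

lemma unimod_transpose: "unimod n U \<Longrightarrow> unimod n U\<^sup>T"
  unfolding unimod_iff_det by (auto simp: det_transpose)

subsection \<open>Block matrices\<close>

lemma four_block_mult:
  assumes "dim_row B = dim_row A" "dim_col C = dim_col A" "dim_row D = dim_row C" "dim_col D = dim_col B"
    "dim_row A' = dim_col A" "dim_row B' = dim_col A" "dim_row C' = dim_col B" "dim_row D' = dim_col B"
    "dim_col C' = dim_col A'" "dim_col D' = dim_col B'"
  shows "four_block_mat A B C D * four_block_mat A' B' C' D' =
    four_block_mat (A * A' + B * C') (A * B' + B * D') (C * A' + D * C') (C * B' + D * (D' :: int mat))"
  by (rule mult_four_block_mat[of _ "dim_row A" "dim_col A" _ "dim_col B" _ "dim_row C" _ _ "dim_col A'" _ "dim_col B'"])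
    (rule carrier_matI; simp add: assms)+

lemma four_block_transpose:
  assumes "dim_row B = dim_row A" "dim_col C = dim_col A" "dim_row D = dim_row C" "dim_col D = dim_col B"
  shows "(four_block_mat A B C D)\<^sup>T = four_block_mat A\<^sup>T C\<^sup>T B\<^sup>T (D :: int mat)\<^sup>T"
  by (rule transpose_four_block_mat[of _ "dim_row A" "dim_col A" _ "dim_col B" _ "dim_row C"])
    (rule carrier_matI; simp add: assms)+

definition append_cols :: "int mat \<Rightarrow> int mat \<Rightarrow> int mat" (infixr "@\<^sub>c" 65) where
  "A @\<^sub>c B = four_block_mat A B (0\<^sub>m 0 (dim_col A)) (0\<^sub>m 0 (dim_col B))"

lemma append_cols_dim [simp]:
  "dim_row (A @\<^sub>c B) = dim_row A" "dim_col (A @\<^sub>c B) = dim_col A + dim_col B"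
  unfolding append_cols_def by auto

lemma append_rows_dim [simp]:
  "dim_row (A @\<^sub>r B) = dim_row A + dim_row B" "dim_col (A @\<^sub>r B) = dim_col A"
  unfolding append_rows_def by auto

lemma mat_sum_dim [simp]:
  "dim_row (A \<oplus>\<^sub>m B) = dim_row A + dim_row B" "dim_col (A \<oplus>\<^sub>m B) = dim_col A + dim_col B"
  unfolding mat_sum_def by auto

lemma mat_sum_carrier [simp, intro]:
  "A \<in> carrier_mat n m \<Longrightarrow> B \<in> carrier_mat p q \<Longrightarrow> A \<oplus>\<^sub>m B \<in> carrier_mat (n + p) (m + q)"
  unfolding mat_sum_def by auto

lemma append_cols_carrier [simp, intro]:
  "A \<in> carrier_mat n r \<Longrightarrow> B \<in> carrier_mat n s \<Longrightarrow> A @\<^sub>c B \<in> carrier_mat n (r + s)"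
  by (auto intro!: carrier_matI)

lemma append_cols_index:
  "i < dim_row A \<Longrightarrow> j < dim_col A + dim_col B \<Longrightarrow> dim_row A = dim_row B \<Longrightarrow>
    (A @\<^sub>c B) $$ (i, j) = (if j < dim_col A then A $$ (i, j) else B $$ (i, j - dim_col A))"
  unfolding append_cols_def by (subst index_mat_four_block(1)) auto

lemma append_cols_split:
  assumes "M \<in> carrier_mat n (r + s)"
  obtains A B where "A \<in> carrier_mat n r" "B \<in> carrier_mat n s" "M = A @\<^sub>c (B :: int mat)"
proof
  let ?A = "mat n r (\<lambda>(i, j). M $$ (i, j))" and ?B = "mat n s (\<lambda>(i, j). M $$ (i, j + r))"
  show "?A \<in> carrier_mat n r" "?B \<in> carrier_mat n s" by auto
  show "M = ?A @\<^sub>c ?B" using assms by (intro eq_matI) (auto simp: append_cols_index)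
qed

lemma four_block_split:
  assumes "M \<in> carrier_mat (n + m) (r + s)"
  obtains A B C D where "A \<in> carrier_mat n r" "B \<in> carrier_mat n s" "C \<in> carrier_mat m r" "D \<in> carrier_mat m s"
    "M = four_block_mat A B C (D :: int mat)"
proof
  let ?A = "mat n r (\<lambda>(i, j). M $$ (i, j))" and ?B = "mat n s (\<lambda>(i, j). M $$ (i, j + r))"
  let ?C = "mat m r (\<lambda>(i, j). M $$ (i + n, j))" and ?D = "mat m s (\<lambda>(i, j). M $$ (i + n, j + r))"
  show "?A \<in> carrier_mat n r" "?B \<in> carrier_mat n s" "?C \<in> carrier_mat m r" "?D \<in> carrier_mat m s" by auto
  show "M = four_block_mat ?A ?B ?C ?D" using assms by (intro eq_matI) auto
qed

lemma four_block_inj: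
  assumes "A \<in> carrier_mat n r" "B \<in> carrier_mat n s" "C \<in> carrier_mat m r" "D \<in> carrier_mat m s"
    "A' \<in> carrier_mat n r" "B' \<in> carrier_mat n s" "C' \<in> carrier_mat m r" "D' \<in> carrier_mat m s"
    and e: "four_block_mat A B C D = four_block_mat A' B' C' (D' :: int mat)"
  shows "A = A'" "B = B'" "C = C'" "D = D'"
proof -
  note s = assms(1-8)[THEN carrier_matD(1)] assms(1-8)[THEN carrier_matD(2)]
  have e': "four_block_mat A B C D $$ (i, j) = four_block_mat A' B' C' D' $$ (i, j)" for i j using e by simp
  show "A = A'"
  proof (rule eq_matI)
    fix i j assume "i < dim_row A'" "j < dim_col A'" thus "A $$ (i, j) = A' $$ (i, j)" using e'[of i j] s by simp
  qed (use s in auto)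
  show "B = B'"
  proof (rule eq_matI)
    fix i j assume "i < dim_row B'" "j < dim_col B'" thus "B $$ (i, j) = B' $$ (i, j)" using e'[of i "j + r"] s by simp
  qed (use s in auto)
  show "C = C'"
  proof (rule eq_matI)
    fix i j assume "i < dim_row C'" "j < dim_col C'" thus "C $$ (i, j) = C' $$ (i, j)" using e'[of "i + n" j] s by simp
  qed (use s in auto)
  show "D = D'"
  proof (rule eq_matI)
    fix i j assume "i < dim_row D'" "j < dim_col D'" thus "D $$ (i, j) = D' $$ (i, j)" using e'[of "i + n" "j + r"] s by simp
  qed (use s in auto)
qed

lemma four_block_eqD:
  assumes e: "four_block_mat A B C D = four_block_mat A' B' C' (D' :: int mat)"
    and d: "dim_row A = dim_row A'" "dim_col A = dim_col A'" "dim_row D = dim_row D'" "dim_col D = dim_col D'"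
      "dim_row B = dim_row A'" "dim_col B = dim_col D'" "dim_row C = dim_row D'" "dim_col C = dim_col A'"
      "dim_row B' = dim_row A'" "dim_col B' = dim_col D'" "dim_row C' = dim_row D'" "dim_col C' = dim_col A'"
  shows "A = A'" "B = B'" "C = C'" "D = D'"
  by (rule four_block_inj[OF _ _ _ _ _ _ _ _ e, of "dim_row A'" "dim_col A'" "dim_col D'" "dim_row D'"];
      rule carrier_matI; simp add: d)+

lemma mult_append_cols:
  "dim_col X = dim_row A \<Longrightarrow> dim_row A = dim_row B \<Longrightarrow> X * (A @\<^sub>c B) = X * A @\<^sub>c X * B"
proof (rule eq_matI)
  assume d: "dim_col X = dim_row A" "dim_row A = dim_row B"
  fix i j assume "i < dim_row (X * A @\<^sub>c X * B)" "j < dim_col (X * A @\<^sub>c X * B)"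
  hence i: "i < dim_row X" and j: "j < dim_col A + dim_col B" by auto
  have "col (A @\<^sub>c B) j = (if j < dim_col A then col A j else col B (j - dim_col A))"
    using j d by (intro eq_vecI) (auto simp: append_cols_index)
  thus "(X * (A @\<^sub>c B)) $$ (i, j) = (X * A @\<^sub>c X * B) $$ (i, j)" using i j d by (simp add: append_cols_index)
qed auto

lemma transpose_append_cols: "dim_row A = dim_row B \<Longrightarrow> (A @\<^sub>c B)\<^sup>T = A\<^sup>T @\<^sub>r B\<^sup>T"
  unfolding append_rows_def by (intro eq_matI) (auto simp: append_cols_index)

lemma append_rows_mult:
  assumes "dim_col A = dim_col B" "dim_col A = dim_row X"
  shows "(A @\<^sub>r B) * X = A * X @\<^sub>r B * (X :: int mat)"
proof -
  have "(A @\<^sub>r B) * X = ((X\<^sup>T * (A\<^sup>T @\<^sub>c B\<^sup>T)))\<^sup>T" using assms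
    by (simp add: mat_transpose_mult transpose_append_cols)
  also have "\<dots> = A * X @\<^sub>r B * X" using assms
    by (simp add: mult_append_cols mat_transpose_mult transpose_append_cols)
  finally show ?thesis .
qed

lemma append_cols_rows: 
  assumes "dim_row A = dim_row B" "dim_row C = dim_row D" "dim_col A = dim_col C" "dim_col B = dim_col D"
  shows "(A @\<^sub>c B) @\<^sub>r (C @\<^sub>c D) = four_block_mat A B C D"
  unfolding append_rows_def using assms by (intro eq_matI) (auto simp: append_cols_index)

lemma append_rows_mult_cols:
  assumes "dim_col A = dim_col B" "dim_row C = dim_row D" "dim_col A = dim_row C"
  shows "(A @\<^sub>r B) * (C @\<^sub>c D) = four_block_mat (A * C) (A * D) (B * C) (B * (D :: int mat))"
  using assms by (subst append_rows_mult) (simp_all add: mult_append_cols append_cols_rows)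

lemma append_cols_mult_rows:
  assumes "dim_row A = dim_row B" "dim_col C = dim_col D" "dim_col A = dim_row C" "dim_col B = dim_row D"
  shows "(A @\<^sub>c B) * (C @\<^sub>r D) = A * C + B * (D :: int mat)"
proof -
  have "(A @\<^sub>c B) * (C @\<^sub>r D) = four_block_mat (A * C + B * D)
      (A * 0\<^sub>m (dim_row C) 0 + B * 0\<^sub>m (dim_row D) 0)
      (0\<^sub>m 0 (dim_col A) * C + 0\<^sub>m 0 (dim_col B) * D)
      (0\<^sub>m 0 (dim_col A) * 0\<^sub>m (dim_row C) 0 + 0\<^sub>m 0 (dim_col B) * 0\<^sub>m (dim_row D) 0)"
    unfolding append_cols_def append_rows_def
    by (rule mult_four_block_mat[of _ "dim_row A" "dim_col A" _ "dim_col B" _ 0 _ _ "dim_col C" _ 0])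
      (rule carrier_matI; simp add: assms)+
  also have "\<dots> = A * C + B * D"
    by (rule eq_matI) (use assms in simp_all)
  finally show ?thesis .
qed

lemma mat_sum_rows: 
  "A \<oplus>\<^sub>m B = (A @\<^sub>c 0\<^sub>m (dim_row A) (dim_col B)) @\<^sub>r (0\<^sub>m (dim_row B) (dim_col A) @\<^sub>c B)"
  unfolding mat_sum_def by (subst append_cols_rows) auto

lemma append_cols_add:
  assumes "dim_row A = dim_row B" "dim_row C = dim_row D" "dim_col A = dim_col C" "dim_col B = dim_col D" "dim_row A = dim_row C"
  shows "(A @\<^sub>c B) + (C @\<^sub>c D) = (A + C) @\<^sub>c (B + (D :: int mat))"
  using assms by (intro eq_matI) (auto simp: append_cols_index)

lemma append_cols_mult_sum:
  assumes "dim_row A = dim_row B" "dim_col A = dim_row C" "dim_col B = dim_row D"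
  shows "(A @\<^sub>c B) * (C \<oplus>\<^sub>m D) = A * C @\<^sub>c B * (D :: int mat)"
  using assms unfolding mat_sum_rows
  by (subst append_cols_mult_rows) (auto simp: mult_append_cols append_cols_add mat_arith)

lemma mat_sum_mult:
  assumes "dim_col A = dim_row C" "dim_col B = dim_row D"
  shows "(A \<oplus>\<^sub>m B) * (C \<oplus>\<^sub>m D) = A * C \<oplus>\<^sub>m B * (D :: int mat)"
  unfolding mat_sum_def using assms by (simp add: four_block_mult mat_arith)

lemma mat_sum_transpose: "(A \<oplus>\<^sub>m B)\<^sup>T = A\<^sup>T \<oplus>\<^sub>m B\<^sup>T"
  unfolding mat_sum_def by (intro eq_matI) auto

lemma mat_sum_one: "1\<^sub>m n \<oplus>\<^sub>m 1\<^sub>m m = 1\<^sub>m (n + m)"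
  unfolding mat_sum_def by auto

lemma mat_sum_smult: "k \<cdot>\<^sub>m (A \<oplus>\<^sub>m B) = (k \<cdot>\<^sub>m A) \<oplus>\<^sub>m (k \<cdot>\<^sub>m B)"
  unfolding mat_sum_def by (intro eq_matI) auto

lemma mat_sum_add:
  "dim_row A = dim_row C \<Longrightarrow> dim_col A = dim_col C \<Longrightarrow> dim_row B = dim_row D \<Longrightarrow> dim_col B = dim_col D \<Longrightarrow>
   (A \<oplus>\<^sub>m B) + (C \<oplus>\<^sub>m D) = (A + C) \<oplus>\<^sub>m (B + D)"
  unfolding mat_sum_def by (intro eq_matI) auto

lemma mat_sum_assoc: "(A \<oplus>\<^sub>m B) \<oplus>\<^sub>m C = A \<oplus>\<^sub>m (B \<oplus>\<^sub>m C)"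
  unfolding mat_sum_def by (rule assoc_four_block_mat[symmetric])

lemma mat_sum_zero: "0\<^sub>m n m \<oplus>\<^sub>m 0\<^sub>m p q = 0\<^sub>m (n + p) (m + q)"
  unfolding mat_sum_def by (intro eq_matI) auto

lemma mat_sum_empty [simp]: "A \<oplus>\<^sub>m 0\<^sub>m 0 0 = A" "0\<^sub>m 0 0 \<oplus>\<^sub>m A = A"
  unfolding mat_sum_def by (rule eq_matI; simp)+

lemma det_mat_sum: "A \<in> carrier_mat n n \<Longrightarrow> B \<in> carrier_mat m m \<Longrightarrow> det (A \<oplus>\<^sub>m B) = det A * det B"
  unfolding mat_sum_def by (rule det_four_block_mat_lower_left_zero) auto

lemma unimod_mat_sum: "unimod n U \<Longrightarrow> unimod m V \<Longrightarrow> unimod (n + m) (U \<oplus>\<^sub>m V)"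
  unfolding unimod_iff_det using det_mat_sum[of U n V m] by (auto simp: abs_mult)

section \<open>Forms over the integers are even symmetric matrices\<close>

lemma symm_dim [simp]: "dim_row (symm e \<psi>) = dim_col \<psi>" "dim_col (symm e \<psi>) = dim_row \<psi>"
  unfolding symm_def by auto

lemma symm_carrier [simp, intro]: "\<psi> \<in> carrier_mat n n \<Longrightarrow> symm e \<psi> \<in> carrier_mat n n"
  unfolding symm_def by auto

lemma symm_transpose: "\<psi> \<in> carrier_mat n n \<Longrightarrow> (symm 1 \<psi>)\<^sup>T = symm 1 \<psi>"
  unfolding symm_def by (intro eq_matI) auto

lemma symm_congruence:
  assumes "\<psi> \<in> carrier_mat n n" "g \<in> carrier_mat n m"
  shows "symm 1 (g\<^sup>T * \<psi> * g) = g\<^sup>T * symm 1 \<psi> * g"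
  using assms unfolding symm_def by (simp add: mat_arith)

lemma symm_mat_sum:
  "\<psi> \<in> carrier_mat n n \<Longrightarrow> \<psi>' \<in> carrier_mat m m \<Longrightarrow> symm e (\<psi> \<oplus>\<^sub>m \<psi>') = symm e \<psi> \<oplus>\<^sub>m symm e \<psi>'"
  unfolding symm_def mat_sum_transpose mat_sum_smult by (subst mat_sum_add) auto

lemma symm_add:
  "A \<in> carrier_mat n n \<Longrightarrow> B \<in> carrier_mat n n \<Longrightarrow> symm e (A + B) = symm e A + symm e B"
  unfolding symm_def by (intro eq_matI) (auto simp: algebra_simps)

lemma symm_zero [simp]: "symm e (0\<^sub>m n n) = 0\<^sub>m n n"
  unfolding symm_def by auto

text \<open>
  An element of \<open>Q\<^sub>+(\<int>\<^sup>n)\<close> is determined by its symmetrisation, because \<open>2\<close> is not a zero divisor: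
  the strictly upper triangular part of a difference with vanishing symmetrisation is a witness.
\<close>

lemma Q_eq_iff_symm:
  assumes A: "A \<in> carrier_mat n n" and B: "B \<in> carrier_mat n n"
  shows "Q_eq 1 n A B \<longleftrightarrow> symm 1 A = symm 1 B"
proof
  assume "Q_eq 1 n A B"
  then obtain X where X: "X \<in> carrier_mat n n" and e: "A - B = X - 1 \<cdot>\<^sub>m X\<^sup>T"
    unfolding Q_eq_def by auto
  have d: "A $$ (i, j) - B $$ (i, j) = X $$ (i, j) - X $$ (j, i)" if "i < n" "j < n" for i j
    using arg_cong[OF e, of "\<lambda>M. M $$ (i, j)"] A B X that by simp
  show "symm 1 A = symm 1 B"
  proof (rule eq_matI)
    fix i j assume "i < dim_row (symm 1 B)" "j < dim_col (symm 1 B)"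
    hence i: "i < n" "j < n" using B by auto
    thus "symm 1 A $$ (i, j) = symm 1 B $$ (i, j)"
      using d[OF i] d[OF i(2) i(1)] A B by (simp add: symm_def)
  qed (use A B in auto)
next
  assume e: "symm 1 A = symm 1 B"
  have d: "A $$ (i, j) + A $$ (j, i) = B $$ (i, j) + B $$ (j, i)" if "i < n" "j < n" for i j
    using arg_cong[OF e, of "\<lambda>M. M $$ (i, j)"] A B that by (simp add: symm_def)
  let ?X = "mat n n (\<lambda>(i, j). if i < j then A $$ (i, j) - B $$ (i, j) else 0)"
  have "A - B = ?X - 1 \<cdot>\<^sub>m ?X\<^sup>T"
  proof (rule eq_matI)
    fix i j assume "i < dim_row (?X - 1 \<cdot>\<^sub>m ?X\<^sup>T)" "j < dim_col (?X - 1 \<cdot>\<^sub>m ?X\<^sup>T)"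
    hence i: "i < n" "j < n" by auto
    show "(A - B) $$ (i, j) = (?X - 1 \<cdot>\<^sub>m ?X\<^sup>T) $$ (i, j)"
      using d[OF i] i A B by (cases "i < j"; cases "j < i") auto
  qed (use A B in auto)
  thus "Q_eq 1 n A B" unfolding Q_eq_def using A B by (intro conjI bexI[of _ ?X]) auto
qed

lemma trace_one_mult_comm:
  assumes A: "A \<in> carrier_mat n m" and B: "B \<in> carrier_mat m n"
    and "A * B = (1\<^sub>m n :: int mat)" "B * A = 1\<^sub>m m"
  shows "n = m"
proof -
  have "int n = (\<Sum>i<n. (A * B) $$ (i, i))" using assms by simp
  also have "\<dots> = (\<Sum>i<n. \<Sum>k<m. A $$ (i, k) * B $$ (k, i))"
    using A B by (intro sum.cong) (auto simp: scalar_prod_def lessThan_atLeast0)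
  also have "\<dots> = (\<Sum>k<m. \<Sum>i<n. B $$ (k, i) * A $$ (i, k))"
    by (subst sum.swap) (simp add: mult.commute)
  also have "\<dots> = (\<Sum>k<m. (B * A) $$ (k, k))"
    using A B by (intro sum.cong) (auto simp: scalar_prod_def lessThan_atLeast0)
  also have "\<dots> = int m" using assms by simp
  finally show ?thesis by simp
qed

lemma isometry_iff:
  assumes \<psi>: "\<psi> \<in> carrier_mat n n" and \<psi>': "\<psi>' \<in> carrier_mat m m"
  shows "isometry \<psi> \<psi>' g \<longleftrightarrow> m = n \<and> unimod n g \<and> symm 1 \<psi> = g\<^sup>T * symm 1 \<psi>' * g"
proof -
  have "m = n \<and> unimod n g" if "g \<in> carrier_mat m n" "invertible_mat g"
  proof -
    have "m = n" using that unfolding invertible_mat_def square_mat.simps by auto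
    thus ?thesis using that invertible_mat_iff by auto
  qed
  moreover have "Q_eq 1 n \<psi> (g\<^sup>T * \<psi>' * g) \<longleftrightarrow> symm 1 \<psi> = g\<^sup>T * symm 1 \<psi>' * g" if "g \<in> carrier_mat m n"
  proof -
    have "g\<^sup>T * \<psi>' * g \<in> carrier_mat n n" by (rule carrier_matI) (use that in auto)
    thus ?thesis using Q_eq_iff_symm[OF \<psi>] symm_congruence[OF \<psi>' that] by simp
  qed
  ultimately show ?thesis unfolding isometry_def using \<psi> \<psi>' invertible_mat_iff[of g n] unimod_carrier[of n g] by auto
qed

section \<open>Stabilisation by zero forms\<close>

text \<open>
  Up to zero forms only the quotient by the radical matters. An isometry between these quotients is a
  pair of matrices \<open>X\<close>, \<open>Y\<close> that preserve the forms and are inverse to each other modulo the radicals;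
  this description composes and adds up without any bookkeeping of the zero forms.
\<close>

definition zs_equiv :: "int mat \<Rightarrow> int mat \<Rightarrow> bool" where
  "zs_equiv v w \<longleftrightarrow> (\<exists>X \<in> carrier_mat (dim_row w) (dim_row v). \<exists>Y \<in> carrier_mat (dim_row v) (dim_row w).
     symm 1 v = X\<^sup>T * symm 1 w * X \<and> symm 1 w * X * Y = symm 1 w)"

lemma zs_equivI:
  assumes "v \<in> carrier_mat n n" "w \<in> carrier_mat m m" "X \<in> carrier_mat m n" "Y \<in> carrier_mat n m"
    "symm 1 v = X\<^sup>T * symm 1 w * X" "symm 1 w * X * Y = symm 1 w"
  shows "zs_equiv v w"
  using assms unfolding zs_equiv_def by auto

lemma zs_equivE:
  assumes "zs_equiv v w" "v \<in> carrier_mat n n" "w \<in> carrier_mat m m"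
  obtains X Y where "X \<in> carrier_mat m n" "Y \<in> carrier_mat n m"
    "symm 1 v = X\<^sup>T * symm 1 w * X" "symm 1 w * X * Y = symm 1 w"
    "symm 1 w = Y\<^sup>T * symm 1 v * Y" "symm 1 v * Y * X = symm 1 v" "symm 1 w * X = Y\<^sup>T * symm 1 v"
proof -
  obtain X Y where X: "X \<in> carrier_mat m n" and Y: "Y \<in> carrier_mat n m"
    and 1: "symm 1 v = X\<^sup>T * symm 1 w * X" and 2: "symm 1 w * X * Y = symm 1 w"
    using assms unfolding zs_equiv_def by auto
  note [simp] = carrier_matD[OF X] carrier_matD[OF Y] carrier_matD[OF assms(2)] carrier_matD[OF assms(3)]
  have 3: "Y\<^sup>T * (X\<^sup>T * symm 1 w) = symm 1 w"
    using arg_cong[OF 2, of transpose_mat] symm_transpose[OF assms(3)] by (simp add: mat_arith)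
  have 4: "Y\<^sup>T * symm 1 v = symm 1 w * X"
  proof -
    have "Y\<^sup>T * symm 1 v = Y\<^sup>T * (X\<^sup>T * symm 1 w) * X" unfolding 1 by (simp add: mat_arith)
    thus ?thesis unfolding 3 .
  qed
  show ?thesis
  proof (rule that[OF X Y 1 2 _ _ 4[symmetric]])
    show "symm 1 w = Y\<^sup>T * symm 1 v * Y" unfolding 4 2 ..
    have "symm 1 v * Y * X = X\<^sup>T * (symm 1 w * X * Y) * X" unfolding 1 by (simp add: mat_arith)
    thus "symm 1 v * Y * X = symm 1 v" unfolding 2 1 .
  qed
qed

lemma zs_equiv_refl: "v \<in> carrier_mat n n \<Longrightarrow> zs_equiv v v"
  by (rule zs_equivI[of _ n _ n "1\<^sub>m n" "1\<^sub>m n"]) (auto simp: mat_arith)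

lemma zs_equiv_sym:
  assumes "zs_equiv v w" "v \<in> carrier_mat n n" "w \<in> carrier_mat m m"
  shows "zs_equiv w v"
  using zs_equivE[OF assms] zs_equivI[OF assms(3,2)] by metis

lemma zs_equiv_trans:
  assumes "zs_equiv v w" "zs_equiv w u"
    and c: "v \<in> carrier_mat n n" "w \<in> carrier_mat m m" "u \<in> carrier_mat k k"
  shows "zs_equiv v u"
proof -
  obtain X Y where X: "X \<in> carrier_mat m n" and Y: "Y \<in> carrier_mat n m"
    and 1: "symm 1 v = X\<^sup>T * symm 1 w * X" and 2: "symm 1 w * X * Y = symm 1 w"
    using zs_equivE[OF assms(1) c(1,2)] by metis
  obtain X' Y' where X': "X' \<in> carrier_mat k m" and Y': "Y' \<in> carrier_mat m k"
    and 3: "symm 1 w = X'\<^sup>T * symm 1 u * X'" and 4: "symm 1 u * X' * Y' = symm 1 u"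
      "symm 1 u * X' = Y'\<^sup>T * symm 1 w"
    using zs_equivE[OF assms(2) c(2,3)] by metis
  note [simp] = carrier_matD[OF X] carrier_matD[OF Y] carrier_matD[OF X'] carrier_matD[OF Y'] c[THEN carrier_matD(1)] c[THEN carrier_matD(2)]
  show ?thesis
  proof (rule zs_equivI[OF c(1,3)])
    show "X' * X \<in> carrier_mat k n" "Y * Y' \<in> carrier_mat n k" using X X' Y Y' by auto
    show "symm 1 v = (X' * X)\<^sup>T * symm 1 u * (X' * X)" unfolding 1 3 by (simp add: mat_arith)
    have "symm 1 u * (X' * X) * (Y * Y') = symm 1 u * X' * (X * Y * Y')" by (simp add: mat_arith)
    also have "\<dots> = Y'\<^sup>T * (symm 1 w * X * Y) * Y'" unfolding 4(2) by (simp add: mat_arith)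
    also have "\<dots> = symm 1 u * X' * Y'" unfolding 2 4(2) ..
    finally show "symm 1 u * (X' * X) * (Y * Y') = symm 1 u" unfolding 4(1) .
  qed
qed

lemma zs_equiv_sum:
  assumes "zs_equiv v w" "zs_equiv v' w'"
    and c: "v \<in> carrier_mat n n" "w \<in> carrier_mat m m" "v' \<in> carrier_mat n' n'" "w' \<in> carrier_mat m' m'"
  shows "zs_equiv (v \<oplus>\<^sub>m v') (w \<oplus>\<^sub>m w')"
proof -
  obtain X Y where X: "X \<in> carrier_mat m n" and Y: "Y \<in> carrier_mat n m"
    and 1: "symm 1 v = X\<^sup>T * symm 1 w * X" and 2: "symm 1 w * X * Y = symm 1 w"
    using zs_equivE[OF assms(1) c(1,2)] by metis
  obtain X' Y' where X': "X' \<in> carrier_mat m' n'" and Y': "Y' \<in> carrier_mat n' m'"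
    and 3: "symm 1 v' = X'\<^sup>T * symm 1 w' * X'" and 4: "symm 1 w' * X' * Y' = symm 1 w'"
    using zs_equivE[OF assms(2) c(3,4)] by metis
  note [simp] = carrier_matD[OF X] carrier_matD[OF Y] carrier_matD[OF X'] carrier_matD[OF Y'] c[THEN carrier_matD(1)] c[THEN carrier_matD(2)]
  show ?thesis
  proof (rule zs_equivI[of _ "n + n'" _ "m + m'" "X \<oplus>\<^sub>m X'" "Y \<oplus>\<^sub>m Y'"])
    show "symm 1 (v \<oplus>\<^sub>m v') = (X \<oplus>\<^sub>m X')\<^sup>T * symm 1 (w \<oplus>\<^sub>m w') * (X \<oplus>\<^sub>m X')"
      unfolding symm_mat_sum[OF c(1,3)] symm_mat_sum[OF c(2,4)]
      by (simp add: mat_sum_transpose mat_sum_mult 1 3)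
    show "symm 1 (w \<oplus>\<^sub>m w') * (X \<oplus>\<^sub>m X') * (Y \<oplus>\<^sub>m Y') = symm 1 (w \<oplus>\<^sub>m w')"
      unfolding symm_mat_sum[OF c(2,4)] by (simp add: mat_sum_mult 2 4)
  qed (use c X Y X' Y' in auto)
qed

lemma zs_equiv_nonsingular:
  assumes e: "zs_equiv v w" and c: "v \<in> carrier_mat n n" "w \<in> carrier_mat m m"
    and d: "det (symm 1 v) \<noteq> 0" "det (symm 1 w) \<noteq> 0"
  shows "n = m" "\<exists>X. unimod n X \<and> symm 1 v = X\<^sup>T * symm 1 w * X"
proof -
  obtain X Y where X: "X \<in> carrier_mat m n" and Y: "Y \<in> carrier_mat n m"
    and 1: "symm 1 v = X\<^sup>T * symm 1 w * X" and 2: "symm 1 w * X * Y = symm 1 w"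
    and 3: "symm 1 v * Y * X = symm 1 v"
    using zs_equivE[OF e c] by metis
  have canc: "Z = 1\<^sub>m k" if "S \<in> carrier_mat k k" "det S \<noteq> 0" "Z \<in> carrier_mat k k" "S * Z = S" for S Z :: "int mat" and k
  proof -
    note a = adj_mat[OF that(1)]
    have "det S \<cdot>\<^sub>m Z = adj_mat S * S * Z" using a that by (simp add: mat_smult_mult mat_one_mult)
    also have "\<dots> = adj_mat S * (S * Z)" by (rule mat_assoc) (use a that in auto)
    also have "\<dots> = det S \<cdot>\<^sub>m 1\<^sub>m k" using a that by simp
    finally have "det S \<cdot>\<^sub>m Z = det S \<cdot>\<^sub>m 1\<^sub>m k" .
    hence f: "(det S \<cdot>\<^sub>m Z) $$ (i, j) = (det S \<cdot>\<^sub>m 1\<^sub>m k) $$ (i, j)" for i j by simp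
    show ?thesis
    proof (rule eq_matI)
      fix i j assume "i < dim_row (1\<^sub>m k :: int mat)" "j < dim_col (1\<^sub>m k :: int mat)"
      thus "Z $$ (i, j) = 1\<^sub>m k $$ (i, j)" using f[of i j] that by simp
    qed (use that in auto)
  qed
  have XY: "X * Y = 1\<^sub>m m" using canc[OF _ d(2), of m "X * Y"] 2 X Y c by (simp add: mat_assoc)
  have YX: "Y * X = 1\<^sub>m n" using canc[OF _ d(1), of n "Y * X"] 3 X Y c by (simp add: mat_assoc)
  show nm: "n = m" by (rule trace_one_mult_comm[OF Y X YX XY])
  show "\<exists>X. unimod n X \<and> symm 1 v = X\<^sup>T * symm 1 w * X"
  proof (intro exI conjI)
    show "unimod n X" by (rule unimodI(1)[of X n Y]) (use X Y XY nm in auto)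
    show "symm 1 v = X\<^sup>T * symm 1 w * X" by (rule 1)
  qed
qed

lemma qforms_carrier: "v \<in> qforms \<Longrightarrow> v \<in> carrier_mat (dim_row v) (dim_row v)"
  unfolding qforms_def by auto

lemma carrier_qforms: "v \<in> carrier_mat n n \<Longrightarrow> v \<in> qforms"
  unfolding qforms_def by auto

lemma zs_class_iff:
  assumes v: "v \<in> qforms"
  shows "w \<in> zs_class v \<longleftrightarrow> w \<in> qforms \<and> zs_equiv v w"
proof -
  define n m where "n = dim_row v" and "m = dim_row w"
  have vc: "v \<in> carrier_mat n n" unfolding n_def by (rule qforms_carrier[OF v])
  have "(\<exists>p q g. isometry (v \<oplus>\<^sub>m zero_form p) (w \<oplus>\<^sub>m zero_form q) g) \<longleftrightarrow> zs_equiv v w" if "w \<in> qforms"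
  proof -
    have wc: "w \<in> carrier_mat m m" unfolding m_def by (rule qforms_carrier[OF that])
    have sv: "symm 1 (v \<oplus>\<^sub>m zero_form p) = four_block_mat (symm 1 v) (0\<^sub>m n p) (0\<^sub>m p n) (0\<^sub>m p p)" for p
      unfolding symm_mat_sum[OF vc zero_carrier_mat] using vc by (simp add: mat_sum_def)
    have sw: "symm 1 (w \<oplus>\<^sub>m zero_form p) = four_block_mat (symm 1 w) (0\<^sub>m m p) (0\<^sub>m p m) (0\<^sub>m p p)" for p
      unfolding symm_mat_sum[OF wc zero_carrier_mat] using wc by (simp add: mat_sum_def)
    show ?thesis
    proof
      assume "\<exists>p q g. isometry (v \<oplus>\<^sub>m zero_form p) (w \<oplus>\<^sub>m zero_form q) g"
      then obtain p q g where i: "isometry (v \<oplus>\<^sub>m zero_form p) (w \<oplus>\<^sub>m zero_form q) g" by blast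
      have vp: "v \<oplus>\<^sub>m zero_form p \<in> carrier_mat (n + p) (n + p)" using vc by auto
      have wq: "w \<oplus>\<^sub>m zero_form q \<in> carrier_mat (m + q) (m + q)" using wc by auto
      from i isometry_iff[OF vp wq]
      have nm: "m + q = n + p" and g: "unimod (n + p) g"
        and s: "symm 1 (v \<oplus>\<^sub>m zero_form p) = g\<^sup>T * symm 1 (w \<oplus>\<^sub>m zero_form q) * g" by auto
      obtain h where h: "h \<in> carrier_mat (n + p) (n + p)" "g * h = 1\<^sub>m (n + p)" "h * g = 1\<^sub>m (n + p)"
        using unimod_inverse[OF g] by metis
      obtain A B C D where g4: "A \<in> carrier_mat m n" "B \<in> carrier_mat m p" "C \<in> carrier_mat q n" "D \<in> carrier_mat q p"
        and ge: "g = four_block_mat A B C D"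
        using four_block_split[of g m q n p] unimod_carrier[OF g] nm by metis
      obtain A' B' C' D' where h4: "A' \<in> carrier_mat n m" "B' \<in> carrier_mat n q" "C' \<in> carrier_mat p m" "D' \<in> carrier_mat p q"
        and he: "h = four_block_mat A' B' C' D'"
        using four_block_split[of h n p m q] h nm by metis
      note [simp] = g4[THEN carrier_matD(1)] g4[THEN carrier_matD(2)] h4[THEN carrier_matD(1)] h4[THEN carrier_matD(2)]
        carrier_matD[OF vc] carrier_matD[OF wc]
      note gc = unimod_carrier[OF g]
      have gt: "g\<^sup>T = four_block_mat A\<^sup>T C\<^sup>T B\<^sup>T D\<^sup>T" unfolding ge by (simp add: four_block_transpose)
      have ht: "h\<^sup>T = four_block_mat A'\<^sup>T C'\<^sup>T B'\<^sup>T D'\<^sup>T" unfolding he by (simp add: four_block_transpose)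
      have Sg: "symm 1 (w \<oplus>\<^sub>m zero_form q) * g = four_block_mat (symm 1 w * A) (symm 1 w * B) (0\<^sub>m q n) (0\<^sub>m q p)"
        unfolding sw ge by (simp add: four_block_mult mat_arith)
      have gSg: "g\<^sup>T * symm 1 (w \<oplus>\<^sub>m zero_form q) * g = four_block_mat (A\<^sup>T * (symm 1 w * A)) (A\<^sup>T * (symm 1 w * B))
          (B\<^sup>T * (symm 1 w * A)) (B\<^sup>T * (symm 1 w * B))"
      proof -
        have "g\<^sup>T * symm 1 (w \<oplus>\<^sub>m zero_form q) * g = g\<^sup>T * (symm 1 (w \<oplus>\<^sub>m zero_form q) * g)"
          using gc nm by (simp add: mat_assoc)
        also have "\<dots> = four_block_mat (A\<^sup>T * (symm 1 w * A)) (A\<^sup>T * (symm 1 w * B))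
          (B\<^sup>T * (symm 1 w * A)) (B\<^sup>T * (symm 1 w * B))" unfolding Sg gt
          by (simp add: four_block_mult mat_arith)
        finally show ?thesis .
      qed
      have 1: "symm 1 v = A\<^sup>T * (symm 1 w * A)"
        by (rule four_block_eqD(1)[OF s[unfolded sv gSg]]) simp_all
      have "h\<^sup>T * g\<^sup>T = 1\<^sub>m (n + p)" using arg_cong[OF h(2), of transpose_mat] gc h(1) by (simp add: mat_transpose_mult)
      hence "symm 1 (w \<oplus>\<^sub>m zero_form q) * g = h\<^sup>T * g\<^sup>T * (symm 1 (w \<oplus>\<^sub>m zero_form q) * g)"
        using gc nm by (simp add: mat_arith)
      also have "\<dots> = h\<^sup>T * symm 1 (v \<oplus>\<^sub>m zero_form p)" unfolding s using gc h(1) nm by (simp add: mat_assoc)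
      also have "\<dots> = four_block_mat (A'\<^sup>T * symm 1 v) (0\<^sub>m m p) (B'\<^sup>T * symm 1 v) (0\<^sub>m q p)"
        unfolding sv ht by (simp add: four_block_mult mat_arith)
      finally have 2: "symm 1 w * B = 0\<^sub>m m p"
        unfolding Sg by (rule four_block_eqD(2)) simp_all
      have "g * h = four_block_mat (A * A' + B * C') (A * B' + B * D') (C * A' + D * C') (C * B' + D * D')"
        unfolding ge he by (simp add: four_block_mult)
      hence "four_block_mat (A * A' + B * C') (A * B' + B * D') (C * A' + D * C') (C * B' + D * D')
          = four_block_mat (1\<^sub>m m) (0\<^sub>m m q) (0\<^sub>m q m) (1\<^sub>m q)" using h(2) nm by simp
      hence 3: "A * A' + B * C' = 1\<^sub>m m" 
        by (rule four_block_eqD(1)) simp_all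
      have "symm 1 w * A * A' = symm 1 w * (A * A' + B * C') - symm 1 w * B * C'"
        by (simp add: mat_arith) (rule eq_matI, auto)
      also have "\<dots> = symm 1 w" unfolding 2 3 by (simp add: mat_arith)
      finally have 4: "symm 1 w * A * A' = symm 1 w" .
      show "zs_equiv v w" by (rule zs_equivI[OF vc wc g4(1) h4(1) _ 4]) (use 1 in \<open>simp add: mat_arith\<close>)
    next
      assume "zs_equiv v w"
      then obtain X Y where X: "X \<in> carrier_mat m n" and Y: "Y \<in> carrier_mat n m"
        and 1: "symm 1 v = X\<^sup>T * symm 1 w * X" and 2: "symm 1 w * X * Y = symm 1 w"
        using zs_equivE[OF _ vc wc] by metis
      note [simp] = carrier_matD[OF X] carrier_matD[OF Y] carrier_matD[OF vc] carrier_matD[OF wc]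
      define g where "g = four_block_mat X (1\<^sub>m m - X * Y) (1\<^sub>m n) (- Y)"
      define h where "h = four_block_mat Y (1\<^sub>m n - Y * X) (1\<^sub>m m) (- X)"
      have gc: "g \<in> carrier_mat (m + n) (n + m)" unfolding g_def by auto
      have hc: "h \<in> carrier_mat (n + m) (m + n)" unfolding h_def by auto
      have c: "X * (1\<^sub>m n - Y * X) + (1\<^sub>m m - X * Y) * - X = 0\<^sub>m m n"
        by (simp add: mat_arith) (rule eq_matI, auto)
      have "g * h = four_block_mat (X * Y + (1\<^sub>m m - X * Y) * 1\<^sub>m m) (X * (1\<^sub>m n - Y * X) + (1\<^sub>m m - X * Y) * - X)
          (1\<^sub>m n * Y + - Y * 1\<^sub>m m) (1\<^sub>m n * (1\<^sub>m n - Y * X) + - Y * - X)"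
        unfolding g_def h_def by (simp add: four_block_mult)
      also have "\<dots> = four_block_mat (1\<^sub>m m) (0\<^sub>m m n) (0\<^sub>m n m) (1\<^sub>m n)"
        unfolding c by (intro cong_four_block_mat; rule eq_matI) (use X Y in \<open>auto simp: mat_arith\<close>)
      finally have gh: "g * h = 1\<^sub>m (n + m)" by (simp add: add.commute)
      have u: "unimod (n + m) g" by (rule unimodI(1)[OF _ _ gh]) (use gc hc in \<open>auto simp: add.commute\<close>)
      have z: "symm 1 w * (1\<^sub>m m - X * Y) = 0\<^sub>m m m"
        using 2 by (simp add: mat_arith)
      have Sg: "symm 1 (w \<oplus>\<^sub>m zero_form n) * g = four_block_mat (symm 1 w * X) (0\<^sub>m m m) (0\<^sub>m n n) (0\<^sub>m n m)"
        unfolding sw g_def z[symmetric]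
        by (simp add: four_block_mult mat_arith)
      have gt: "g\<^sup>T = four_block_mat X\<^sup>T (1\<^sub>m n) (1\<^sub>m m - X * Y)\<^sup>T (- Y)\<^sup>T"
        unfolding g_def by (simp add: four_block_transpose)
      have zt: "(1\<^sub>m m - X * Y)\<^sup>T * symm 1 w = 0\<^sub>m m m"
        using arg_cong[OF z, of transpose_mat] symm_transpose[OF wc] by (simp add: mat_transpose_mult)
      have zx: "(1\<^sub>m m - X * Y)\<^sup>T * (symm 1 w * X) = 0\<^sub>m m n"
      proof -
        have "(1\<^sub>m m - X * Y)\<^sup>T * (symm 1 w * X) = (1\<^sub>m m - X * Y)\<^sup>T * symm 1 w * X" by (simp add: mat_assoc)
        thus ?thesis unfolding zt by (simp add: mat_arith)
      qed
      have "g\<^sup>T * symm 1 (w \<oplus>\<^sub>m zero_form n) * g = g\<^sup>T * (symm 1 (w \<oplus>\<^sub>m zero_form n) * g)"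
        using gc by (simp add: mat_assoc)
      also have "\<dots> = four_block_mat (X\<^sup>T * (symm 1 w * X)) (0\<^sub>m n m) (0\<^sub>m m n) (0\<^sub>m m m)"
        unfolding Sg gt zx[symmetric]
        by (simp add: four_block_mult mat_arith)
      also have "\<dots> = symm 1 (v \<oplus>\<^sub>m zero_form m)" unfolding sv 1 by (simp add: mat_assoc)
      finally have s: "symm 1 (v \<oplus>\<^sub>m zero_form m) = g\<^sup>T * symm 1 (w \<oplus>\<^sub>m zero_form n) * g" ..
      have "isometry (v \<oplus>\<^sub>m zero_form m) (w \<oplus>\<^sub>m zero_form n) g"
        by (subst isometry_iff[of _ "n + m" _ "m + n"]) (use vc wc u s in auto)
      thus "\<exists>p q g. isometry (v \<oplus>\<^sub>m zero_form p) (w \<oplus>\<^sub>m zero_form q) g" by blast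
    qed
  qed
  thus ?thesis unfolding zs_class_def by auto
qed

lemma zs_class_eq_iff:
  assumes v: "v \<in> qforms" and w: "w \<in> qforms"
  shows "zs_class v = zs_class w \<longleftrightarrow> zs_equiv v w"
proof
  assume "zs_class v = zs_class w"
  moreover have "w \<in> zs_class w" using zs_class_iff[OF w] zs_equiv_refl[OF qforms_carrier[OF w]] w by auto
  ultimately show "zs_equiv v w" using zs_class_iff[OF v] by auto
next
  assume e: "zs_equiv v w"
  note c = qforms_carrier[OF v] qforms_carrier[OF w]
  have "u \<in> zs_class v \<longleftrightarrow> u \<in> zs_class w" for u
    unfolding zs_class_iff[OF v] zs_class_iff[OF w]
    using zs_equiv_trans[OF e _ c qforms_carrier[of u]]
      zs_equiv_trans[OF zs_equiv_sym[OF e c] _ c(2,1) qforms_carrier[of u]] by blast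
  thus "zs_class v = zs_class w" by blast
qed

lemma zs_add_class:
  assumes v: "v \<in> qforms" and w: "w \<in> qforms"
  shows "zs_add (zs_class v) (zs_class w) = zs_class (v \<oplus>\<^sub>m w)"
proof -
  have q: "a \<oplus>\<^sub>m b \<in> qforms" if "a \<in> qforms" "b \<in> qforms" for a b
    by (rule carrier_qforms[OF mat_sum_carrier[OF that[THEN qforms_carrier]]])
  have "zs_class (a \<oplus>\<^sub>m b) = zs_class (v \<oplus>\<^sub>m w)" if "a \<in> zs_class v" "b \<in> zs_class w" for a b
  proof -
    have a: "a \<in> qforms" "zs_equiv v a" and b: "b \<in> qforms" "zs_equiv w b"
      using that zs_class_iff[OF v] zs_class_iff[OF w] by auto
    note c = qforms_carrier[OF v] qforms_carrier[OF a(1)] qforms_carrier[OF w] qforms_carrier[OF b(1)]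
    have "zs_equiv (v \<oplus>\<^sub>m w) (a \<oplus>\<^sub>m b)" by (rule zs_equiv_sum[OF a(2) b(2) c])
    thus ?thesis using zs_class_eq_iff[OF q[OF v w] q[OF a(1) b(1)]] by simp
  qed
  moreover have "v \<in> zs_class v" "w \<in> zs_class w"
    using zs_class_iff[OF w] zs_class_iff[OF v] zs_equiv_refl[OF qforms_carrier[OF v]]
      zs_equiv_refl[OF qforms_carrier[OF w]] v w by auto
  ultimately show ?thesis unfolding zs_add_def
    by (intro equalityI UN_least) (blast | auto)+
qed

section \<open>Stably equivalent forms that are not equivalent\<close>

lemma mat2_index:
  assumes "A \<in> carrier_mat 2 2" "B \<in> carrier_mat 2 2" "i < 2" "j < 2"
  shows "(A * B) $$ (i, j) = A $$ (i, 0) * B $$ (0, j) + A $$ (i, 1) * (B $$ (1, j) :: int)"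
  using assms by (simp add: scalar_prod_def numeral_2_eq_2)

lemma mat4_index:
  assumes "A \<in> carrier_mat 4 4" "B \<in> carrier_mat 4 4" "i < 4" "j < 4"
  shows "(A * B) $$ (i, j) = A $$ (i, 0) * B $$ (0, j) + A $$ (i, 1) * B $$ (1, j)
    + A $$ (i, 2) * B $$ (2, j) + A $$ (i, 3) * (B $$ (3, j) :: int)"
  using assms by (simp add: scalar_prod_def numeral_eq_Suc)

lemma mat4_eqI:
  assumes "A \<in> carrier_mat 4 4" "B \<in> carrier_mat 4 4"
    and "\<And>i j. i \<in> {0, 1, 2, 3} \<Longrightarrow> j \<in> {0, 1, 2, 3} \<Longrightarrow> A $$ (i, j) = (B $$ (i, j) :: int)"
  shows "A = B"
proof (rule eq_matI)
  fix i j assume "i < dim_row B" "j < dim_col B"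
  hence "i < 4" "j < 4" using assms by auto
  hence "i \<in> {0, 1, 2, 3}" "j \<in> {0, 1, 2, 3}" by auto
  thus "A $$ (i, j) = B $$ (i, j)" by (rule assms(3))
qed (use assms in auto)

definition mat2 :: "int \<Rightarrow> int \<Rightarrow> int \<Rightarrow> int \<Rightarrow> int mat" where
  "mat2 a b c d = mat 2 2 (\<lambda>(i, j). [[a, b], [c, d]] ! i ! j)"

lemma mat2_carrier [simp]: "mat2 a b c d \<in> carrier_mat 2 2" "dim_row (mat2 a b c d) = 2" "dim_col (mat2 a b c d) = 2"
  unfolding mat2_def by auto

definition mat4 :: "int list list \<Rightarrow> int mat" where
  "mat4 L = mat 4 4 (\<lambda>(i, j). L ! i ! j)"

lemma mat4_carrier [simp]: "mat4 L \<in> carrier_mat 4 4" "dim_row (mat4 L) = 4" "dim_col (mat4 L) = 4"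
  unfolding mat4_def by auto

lemma mat4_mult:
  "mat4 [[a1, a2, a3, a4], [b1, b2, b3, b4], [c1, c2, c3, c4], [d1, d2, d3, d4]] *
    mat4 [[w1, w2, w3, w4], [x1, x2, x3, x4], [y1, y2, y3, y4], [z1, z2, z3, z4]] =
    mat4 [[a1 * w1 + a2 * x1 + a3 * y1 + a4 * z1,
       a1 * w2 + a2 * x2 + a3 * y2 + a4 * z2,
       a1 * w3 + a2 * x3 + a3 * y3 + a4 * z3,
       a1 * w4 + a2 * x4 + a3 * y4 + a4 * z4],
      [b1 * w1 + b2 * x1 + b3 * y1 + b4 * z1,
       b1 * w2 + b2 * x2 + b3 * y2 + b4 * z2,
       b1 * w3 + b2 * x3 + b3 * y3 + b4 * z3,
       b1 * w4 + b2 * x4 + b3 * y4 + b4 * z4],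
      [c1 * w1 + c2 * x1 + c3 * y1 + c4 * z1,
       c1 * w2 + c2 * x2 + c3 * y2 + c4 * z2,
       c1 * w3 + c2 * x3 + c3 * y3 + c4 * z3,
       c1 * w4 + c2 * x4 + c3 * y4 + c4 * z4],
      [d1 * w1 + d2 * x1 + d3 * y1 + d4 * z1,
       d1 * w2 + d2 * x2 + d3 * y2 + d4 * z2,
       d1 * w3 + d2 * x3 + d3 * y3 + d4 * z3,
       d1 * w4 + d2 * x4 + d3 * y4 + d4 * z4]]"
proof (rule mat4_eqI)
  fix i j :: nat assume i: "i \<in> {0, 1, 2, 3}" and j: "j \<in> {0, 1, 2, 3}"
  hence "i < 4" "j < 4" by auto
  note e = mat4_index[OF mat4_carrier(1) mat4_carrier(1) this]
  show "(mat4 [[a1, a2, a3, a4], [b1, b2, b3, b4], [c1, c2, c3, c4], [d1, d2, d3, d4]] *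
    mat4 [[w1, w2, w3, w4], [x1, x2, x3, x4], [y1, y2, y3, y4], [z1, z2, z3, z4]]) $$ (i, j) =
    mat4 [[a1 * w1 + a2 * x1 + a3 * y1 + a4 * z1,
       a1 * w2 + a2 * x2 + a3 * y2 + a4 * z2,
       a1 * w3 + a2 * x3 + a3 * y3 + a4 * z3,
       a1 * w4 + a2 * x4 + a3 * y4 + a4 * z4],
      [b1 * w1 + b2 * x1 + b3 * y1 + b4 * z1,
       b1 * w2 + b2 * x2 + b3 * y2 + b4 * z2,
       b1 * w3 + b2 * x3 + b3 * y3 + b4 * z3,
       b1 * w4 + b2 * x4 + b3 * y4 + b4 * z4],
      [c1 * w1 + c2 * x1 + c3 * y1 + c4 * z1,
       c1 * w2 + c2 * x2 + c3 * y2 + c4 * z2,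
       c1 * w3 + c2 * x3 + c3 * y3 + c4 * z3,
       c1 * w4 + c2 * x4 + c3 * y4 + c4 * z4],
      [d1 * w1 + d2 * x1 + d3 * y1 + d4 * z1,
       d1 * w2 + d2 * x2 + d3 * y2 + d4 * z2,
       d1 * w3 + d2 * x3 + d3 * y3 + d4 * z3,
       d1 * w4 + d2 * x4 + d3 * y4 + d4 * z4]] $$ (i, j)"
    unfolding e using i j by (elim insertE emptyE; simp add: mat4_def)
qed auto

lemma mat4_transpose:
  "(mat4 [[a1, a2, a3, a4], [b1, b2, b3, b4], [c1, c2, c3, c4], [d1, d2, d3, d4]])\<^sup>T =
    mat4 [[a1, b1, c1, d1], [a2, b2, c2, d2], [a3, b3, c3, d3], [a4, b4, c4, d4]]"
  by (rule mat4_eqI) (auto simp: mat4_def)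

lemma mat4_one: "1\<^sub>m 4 = mat4 [[1, 0, 0, 0], [0, 1, 0, 0], [0, 0, 1, 0], [0, 0, 0, 1]]"
  by (rule mat4_eqI) (auto simp: mat4_def)

lemma mat2_mult: "mat2 a b c d * mat2 a' b' c' d' = mat2 (a * a' + b * c') (a * b' + b * d') (c * a' + d * c') (c * b' + d * d')"
proof (rule eq_matI)
  fix i j assume "i < dim_row (mat2 (a * a' + b * c') (a * b' + b * d') (c * a' + d * c') (c * b' + d * d'))"
    "j < dim_col (mat2 (a * a' + b * c') (a * b' + b * d') (c * a' + d * c') (c * b' + d * d'))"
  hence i: "i < 2" "j < 2" by auto
  show "(mat2 a b c d * mat2 a' b' c' d') $$ (i, j) =
      mat2 (a * a' + b * c') (a * b' + b * d') (c * a' + d * c') (c * b' + d * d') $$ (i, j)"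
    unfolding mat2_index[OF mat2_carrier(1) mat2_carrier(1) i]
    using i by (auto simp: mat2_def less_2_cases_iff)
qed auto

lemma mat2_transpose: "(mat2 a b c d)\<^sup>T = mat2 a c b d"
  by (rule eq_matI) (auto simp: mat2_def less_2_cases_iff)

lemma mat2_eq_iff: "mat2 a b c d = mat2 a' b' c' d' \<longleftrightarrow> a = a' \<and> b = b' \<and> c = c' \<and> d = d'" (is "?l \<longleftrightarrow> ?r")
proof
  assume e: ?l
  have "mat2 a b c d $$ (i, j) = mat2 a' b' c' d' $$ (i, j)" for i j using e by simp
  from this[of 0 0] this[of 0 1] this[of 1 0] this[of 1 1] show ?r by (simp add: mat2_def)
qed simp

lemma mat2_cases:
  assumes "X \<in> carrier_mat 2 2"
  obtains a b c d where "X = mat2 a b c d"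
proof
  show "X = mat2 (X $$ (0, 0)) (X $$ (0, 1)) (X $$ (1, 0)) (X $$ (1, 1))"
    using assms by (intro eq_matI) (auto simp: mat2_def less_2_cases_iff)
qed

lemma mat2_scalar: "k \<cdot>\<^sub>m 1\<^sub>m 2 = mat2 k 0 0 k"
  by (rule eq_matI) (auto simp: mat2_def less_2_cases_iff)

text \<open>
  One modulus \<open>n\<close> that serves a whole range of parameters: a multiple of all of them plus one,
  and larger than all products of their squares.
\<close>

lemma common_modulus:
  obtains n :: int where "n > 1" "\<And>s. s \<in> {2..int N + 1} \<Longrightarrow> s dvd n - 1"
    "\<And>s s'. s \<in> {2..int N + 1} \<Longrightarrow> s' \<in> {2..int N + 1} \<Longrightarrow> (s * s')\<^sup>2 < n"
proof -
  define F :: int where "F = fact (N + 1)"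
  have F: "F \<ge> 1" unfolding F_def by (rule fact_ge_1)
  have le: "s \<le> F \<and> s dvd F" if s: "s \<in> {2..int N + 1}" for s
  proof -
    have "nat s dvd fact (N + 1)" using s by (intro dvd_fact) auto
    hence "int (nat s) dvd int (fact (N + 1))" by (simp only: int_dvd_int_iff)
    moreover have "int (fact (N + 1)) = F" unfolding F_def by (rule of_nat_fact)
    ultimately have "s dvd F" using s by simp
    thus ?thesis using F zdvd_imp_le[of s F] by simp
  qed
  show ?thesis
  proof (rule that[of "F ^ 4 + 1"])
    show "F ^ 4 + 1 > 1" using F by simp
    show "s dvd F ^ 4 + 1 - 1" if "s \<in> {2..int N + 1}" for s
      using le[OF that] by (simp add: power4_eq_xxxx)
    show "(s * s')\<^sup>2 < F ^ 4 + 1" if s: "s \<in> {2..int N + 1}" "s' \<in> {2..int N + 1}" for s s'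
    proof -
      have "s * s' \<le> F * F" by (rule mult_mono) (use le[OF s(1)] le[OF s(2)] s F in auto)
      hence "(s * s')\<^sup>2 \<le> (F * F)\<^sup>2" by (rule power_mono) (use s in auto)
      thus ?thesis by (simp add: power2_eq_square power4_eq_xxxx)
    qed
  qed
qed

text \<open>
  Rescaling the basis vectors \<open>e, f\<close> by \<open>s\<^sup>-\<^sup>1\<close> and \<open>s\<close> identifies the plane for \<open>1\<close> with the one for \<open>s\<close> over the rationals.
  If \<open>s\<close> is prime to \<open>n\<close>, the planes are even isometric over all localisations of \<open>\<int>\<close>: at primes dividing \<open>n\<close> the
  factor \<open>s\<close> is a unit, and at the other ones both planes are hyperbolic.
\<close>

definition skew_plane :: "int \<Rightarrow> int \<Rightarrow> int mat" where
  "skew_plane n s = mat2 0 n 0 (s\<^sup>2)"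

lemma skew_plane_carrier [simp]: "skew_plane n s \<in> carrier_mat 2 2"
  unfolding skew_plane_def by simp

lemma skew_plane_qforms: "skew_plane n s \<in> qforms"
  by (rule carrier_qforms[OF skew_plane_carrier])

lemma symm_skew_plane: "symm 1 (skew_plane n s) = mat2 0 n n (2 * s\<^sup>2)"
  unfolding skew_plane_def symm_def mat2_def by (rule eq_matI) (auto simp: less_2_cases_iff)

lemma hyperbolic_carrier [simp]: "hyperbolic k \<in> carrier_mat (k + k) (k + k)"
  unfolding hyperbolic_def by auto

lemma hyperbolic_qforms: "hyperbolic k \<in> qforms"
  by (rule carrier_qforms[OF hyperbolic_carrier])

lemma symm_hyperbolic: "symm 1 (hyperbolic k) = four_block_mat (0\<^sub>m k k) (1\<^sub>m k) (1\<^sub>m k) (0\<^sub>m k k)"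
  unfolding symm_def hyperbolic_def by (rule eq_matI) auto

lemma symm_skew_plane_hyperbolic:
  "symm 1 (skew_plane n s \<oplus>\<^sub>m hyperbolic 1) = mat4 [[0, n, 0, 0], [n, 2 * s\<^sup>2, 0, 0], [0, 0, 0, 1], [0, 0, 1, 0]]"
  unfolding symm_mat_sum[OF skew_plane_carrier hyperbolic_carrier] symm_skew_plane symm_hyperbolic
  by (rule mat4_eqI) (auto simp: mat_sum_def mat2_def mat4_def carrier_matI)

text \<open>
  After adding a hyperbolic plane with basis \<open>x, y\<close> to the plane with basis \<open>e, f\<close>, the columns of \<open>?X\<close>
  are a basis of the same shape with \<open>1\<close> replaced by \<open>s\<^sup>2\<close>. They lift the multiplication
  of \<open>e/n\<close> by \<open>s\<^sup>-\<^sup>1\<close> and of \<open>f\<close> by \<open>s\<close>, which is an isomorphism of the discriminant forms.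
\<close>

lemma skew_plane_stably_equiv:
  assumes n: "n = s * m + 1"
  shows "zs_equiv (skew_plane n s \<oplus>\<^sub>m hyperbolic 1) (skew_plane n 1 \<oplus>\<^sub>m hyperbolic 1)"
proof (rule zs_equivI)
  let ?X = "mat4 [[-m, -2*s, -1, 1], [0, s, 0, -1], [n, 2*s\<^sup>2, s, -s], [0, n, 0, -m]]"
  let ?Y = "mat4 [[s, 0, 1, 0], [0, -m, 0, 1], [-n, n - 2, -m, -s], [0, -n, 0, s]]"
  show "?X \<in> carrier_mat 4 4" "?Y \<in> carrier_mat 4 4" by auto
  have "skew_plane n s \<oplus>\<^sub>m hyperbolic 1 \<in> carrier_mat (2 + (1 + 1)) (2 + (1 + 1))" for s
    by (rule mat_sum_carrier[OF skew_plane_carrier hyperbolic_carrier])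
  thus "skew_plane n s \<oplus>\<^sub>m hyperbolic 1 \<in> carrier_mat 4 4" "skew_plane n 1 \<oplus>\<^sub>m hyperbolic 1 \<in> carrier_mat 4 4" by simp_all
  have "?X * ?Y = 1\<^sub>m 4"
    unfolding mat4_mult mat4_one n by (simp add: algebra_simps power2_eq_square)
  thus "symm 1 (skew_plane n 1 \<oplus>\<^sub>m hyperbolic 1) * ?X * ?Y = symm 1 (skew_plane n 1 \<oplus>\<^sub>m hyperbolic 1)"
    unfolding symm_skew_plane_hyperbolic by (subst mat_assoc) (simp_all add: mat_mult_one)
  show "symm 1 (skew_plane n s \<oplus>\<^sub>m hyperbolic 1) = ?X\<^sup>T * symm 1 (skew_plane n 1 \<oplus>\<^sub>m hyperbolic 1) * ?X"
    unfolding symm_skew_plane_hyperbolic mat4_transpose mat4_mult n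
    by (simp add: algebra_simps power2_eq_square)
qed

text \<open>
  An isometry maps \<open>e\<close> to an isotropic vector, and there are only two isotropic lines. On the line of \<open>e\<close> one reads
  off \<open>s\<^sup>2\<close> modulo \<open>n\<close>, on the other one its inverse.
\<close>

lemma skew_plane_equivD:
  assumes e: "zs_equiv (skew_plane n s) (skew_plane n s')" and n: "n \<noteq> 0" and cop: "coprime n s'"
  shows "n dvd s\<^sup>2 - s'\<^sup>2 \<or> n dvd (s * s')\<^sup>2 - 1"
proof -
  have det: "det (symm 1 (skew_plane n s)) \<noteq> 0" for s
  proof -
    have "symm 1 (skew_plane n s) * mat2 (- 2 * s\<^sup>2) n n 0 = n\<^sup>2 \<cdot>\<^sub>m 1\<^sub>m 2"
      unfolding symm_skew_plane mat2_mult mat2_scalar mat2_eq_iff by (simp add: power2_eq_square)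
    hence "det (symm 1 (skew_plane n s)) * det (mat2 (- 2 * s\<^sup>2) n n 0) = det (n\<^sup>2 \<cdot>\<^sub>m 1\<^sub>m 2)"
      using det_mult[of "symm 1 (skew_plane n s)" 2 "mat2 (- 2 * s\<^sup>2) n n 0"] by (simp add: symm_skew_plane)
    also have "\<dots> = (n\<^sup>2)\<^sup>2" by simp
    finally show ?thesis using n by auto
  qed
  obtain X where X: "unimod 2 X" and eq: "mat2 0 n n (2 * s\<^sup>2) = X\<^sup>T * mat2 0 n n (2 * s'\<^sup>2) * X"
    using zs_equiv_nonsingular(2)[OF e skew_plane_carrier skew_plane_carrier det det] unfolding symm_skew_plane by auto
  obtain a b c d where Xe: "X = mat2 a b c d" using mat2_cases[OF unimod_carrier[OF X]] by metis
  have 1: "n * a * c + s'\<^sup>2 * c\<^sup>2 = 0" and 2: "n * (a * d + b * c) + 2 * s'\<^sup>2 * c * d = n"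
    and 3: "n * b * d + s'\<^sup>2 * d\<^sup>2 = s\<^sup>2"
    using eq unfolding Xe mat2_transpose mat2_mult mat2_eq_iff by (simp_all add: algebra_simps power2_eq_square)
  show ?thesis
  proof (cases "c = 0")
    case True
    hence "a * d = 1" using 2 n by simp
    hence "d\<^sup>2 = 1" unfolding zmult_eq_1_iff by auto
    hence "s\<^sup>2 - s'\<^sup>2 = n * (b * d)" using 3 by simp
    thus ?thesis by (metis dvd_triv_left)
  next
    case False
    have "c * (n * a + s'\<^sup>2 * c) = 0" using 1 by (simp add: algebra_simps power2_eq_square)
    hence na: "n * a = - (s'\<^sup>2 * c)" using False by simp
    hence "n dvd s'\<^sup>2 * c" by (metis dvd_minus_iff dvd_triv_left)
    moreover have "coprime n (s'\<^sup>2)" using cop by simp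
    ultimately have "n dvd c" by (metis coprime_dvd_mult_right_iff)
    then obtain k where k: "c = n * k" by (elim dvdE)
    have "n * a = n * (- (s'\<^sup>2 * k))" using na unfolding k by (simp add: algebra_simps)
    hence a: "a = - (s'\<^sup>2 * k)" by (simp only: mult_left_cancel[OF n])
    have "n * (k * (n * b + s'\<^sup>2 * d)) = n * 1" using 2 unfolding a k by (simp add: algebra_simps)
    hence u: "k * (n * b + s'\<^sup>2 * d) = 1" by (simp only: mult_left_cancel[OF n])
    hence k1: "k * k = 1" unfolding zmult_eq_1_iff by auto
    have "d * (n * b + s'\<^sup>2 * d) = s\<^sup>2" using 3 by (simp add: algebra_simps power2_eq_square)
    moreover have "d * (k * (n * b + s'\<^sup>2 * d)) = k * (d * (n * b + s'\<^sup>2 * d))" by (rule mult.left_commute)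
    ultimately have d: "d = s\<^sup>2 * k" unfolding u by (simp add: mult.commute)
    have "k * n * b + s'\<^sup>2 * s\<^sup>2 * (k * k) = 1" using u unfolding d by (simp add: algebra_simps)
    hence "(s * s')\<^sup>2 - 1 = n * (- (k * b))" unfolding k1 by (simp add: algebra_simps power_mult_distrib)
    thus ?thesis by (metis dvd_triv_left)
  qed
qed

theorem many_stably_equivalent_forms:
  "\<exists>v \<in> qforms. \<exists>S \<subseteq> {c \<in> F0zs. zs_sim c (zs_class v)}. finite S \<and> card S = N"
proof -
  obtain n where n: "n > 1" and dv: "\<And>s. s \<in> {2..int N + 1} \<Longrightarrow> s dvd n - 1"
    and lt: "\<And>s s'. s \<in> {2..int N + 1} \<Longrightarrow> s' \<in> {2..int N + 1} \<Longrightarrow> (s * s')\<^sup>2 < n"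
    using common_modulus[of N] by metis
  let ?I = "{2..int N + 1}" and ?c = "\<lambda>s. zs_class (skew_plane n s)"
  have sim: "zs_sim (?c s) (?c 1)" if "s \<in> ?I" for s
  proof -
    from dv[OF that] obtain m where "n - 1 = s * m" by (elim dvdE)
    hence "zs_equiv (skew_plane n s \<oplus>\<^sub>m hyperbolic 1) (skew_plane n 1 \<oplus>\<^sub>m hyperbolic 1)"
      by (intro skew_plane_stably_equiv[of n s m]) simp
    moreover have "skew_plane n s \<oplus>\<^sub>m hyperbolic 1 \<in> qforms" for s
      by (rule carrier_qforms[OF mat_sum_carrier[OF skew_plane_carrier hyperbolic_carrier], simplified])
    ultimately show ?thesis unfolding zs_sim_def
      by (intro exI[of _ 1]) (simp add: zs_add_class skew_plane_qforms hyperbolic_qforms zs_class_eq_iff)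
  qed
  have inj: "inj_on ?c ?I"
  proof (rule inj_onI)
    fix s s' assume s: "s \<in> ?I" "s' \<in> ?I" and e: "?c s = ?c s'"
    have "coprime n s'"
    proof (rule coprimeI)
      fix x assume "x dvd n" "x dvd s'"
      hence "x dvd n - (n - 1)" using dv[OF s(2)] by (meson dvd_diff dvd_trans)
      thus "is_unit x" by simp
    qed
    hence "n dvd s\<^sup>2 - s'\<^sup>2 \<or> n dvd (s * s')\<^sup>2 - 1"
      using skew_plane_equivD[of n s s'] e n zs_class_eq_iff[OF skew_plane_qforms skew_plane_qforms] by auto
    moreover have "\<not> n dvd (s * s')\<^sup>2 - 1"
    proof
      have ss: "s * s' \<ge> 2 * 2" by (rule mult_mono) (use s in auto)
      hence "(s * s')\<^sup>2 \<ge> 4 * 4" unfolding power2_eq_square by (intro mult_mono) auto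
      moreover assume "n dvd (s * s')\<^sup>2 - 1"
      ultimately show False using lt[OF s] zdvd_imp_le[of n "(s * s')\<^sup>2 - 1"] by simp
    qed
    ultimately have d: "n dvd s\<^sup>2 - s'\<^sup>2" by blast
    have b: "u\<^sup>2 < n" "u\<^sup>2 \<ge> 0" if "u \<in> ?I" for u
    proof -
      have "u * 1 \<le> u * u" using that by (intro mult_left_mono) auto
      hence "u\<^sup>2 \<le> (u * u)\<^sup>2" using that by (intro power_mono) auto
      thus "u\<^sup>2 < n" using lt[OF that that] by simp
    qed simp
    have "s\<^sup>2 = s'\<^sup>2"
    proof (rule ccontr)
      assume "s\<^sup>2 \<noteq> s'\<^sup>2"
      hence "\<bar>n\<bar> \<le> \<bar>s\<^sup>2 - s'\<^sup>2\<bar>" using d by (intro dvd_imp_le_int) auto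
      thus False using b[OF s(1)] b[OF s(2)] by linarith
    qed
    thus "s = s'" using s by (simp add: power2_eq_iff_nonneg)
  qed
  have "card (?c ` ?I) = N" by (simp add: card_image[OF inj])
  moreover have "?c ` ?I \<subseteq> {c \<in> F0zs. zs_sim c (?c 1)}" using sim skew_plane_qforms unfolding F0zs_def by auto
  ultimately show ?thesis using skew_plane_qforms by (intro bexI[of _ "skew_plane n 1"] exI[of _ "?c ` ?I"]) auto
qed

section \<open>Reduction of integer matrices\<close>

text \<open>
  Among all unimodular images of a column one with the least sum of absolute values has at most one
  nonzero entry; this is the Euclidean algorithm.
\<close>

lemma unimod_column:
  fixes c :: "int mat"
  assumes c: "c \<in> carrier_mat (1 + k) 1"
  obtains h d where "unimod (1 + k) h" "h * c = d \<cdot>\<^sub>m 1\<^sub>m 1 @\<^sub>r 0\<^sub>m k 1"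
proof -
  define n where "n = 1 + k"
  note c = c[folded n_def]
  define f where "f h = (\<Sum>i<n. nat \<bar>(h * c) $$ (i, 0)\<bar>)" for h
  obtain h where h: "unimod n h" and min: "\<And>g. unimod n g \<Longrightarrow> f h \<le> f g"
    using ex_has_least_nat[of "unimod n" "1\<^sub>m n" f] unimod_one by blast
  note hc = unimod_carrier[OF h]
  define x where "x i = (h * c) $$ (i, 0)" for i
  have one: "x i = 0 \<or> x j = 0" if ij: "i < n" "j < n" "i \<noteq> j" "\<bar>x j\<bar> \<le> \<bar>x i\<bar>" for i j
  proof (rule ccontr)
    assume "\<not> (x i = 0 \<or> x j = 0)"
    hence nz: "x i \<noteq> 0" "x j \<noteq> 0" by auto
    let ?s = "- (sgn (x i) * sgn (x j))"
    let ?E = "addrow_mat n ?s i j"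
    have E: "unimod n ?E" unfolding unimod_iff_det by (simp add: det_addrow_mat[OF ij(3)])
    have e: "(?E * h * c) $$ (l, 0) = (if l = i then x i + ?s * x j else x l)" if l: "l < n" for l
    proof -
      have "?E * h * c = ?E * (h * c)" using hc c by (simp add: mat_assoc)
      also have "\<dots> = addrow ?s i j (h * c)" by (rule addrow_mat[symmetric, where nc = 1]) (use hc c ij in auto)
      finally show ?thesis using l ij hc c unfolding x_def by simp
    qed
    have lt: "nat \<bar>x i + ?s * x j\<bar> < nat \<bar>x i\<bar>" using nz ij(4) by (auto simp: sgn_if abs_if split: if_splits)
    have "f (?E * h) < f h" unfolding f_def
    proof (rule sum_strict_mono_ex1)
      show "\<forall>l\<in>{..<n}. nat \<bar>(?E * h * c) $$ (l, 0)\<bar> \<le> nat \<bar>(h * c) $$ (l, 0)\<bar>"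
        using e lt unfolding x_def by auto
      show "\<exists>l\<in>{..<n}. nat \<bar>(?E * h * c) $$ (l, 0)\<bar> < nat \<bar>(h * c) $$ (l, 0)\<bar>"
        using e[OF ij(1)] lt ij(1) unfolding x_def by (intro bexI[of _ i]) auto
    qed simp
    thus False using min[OF unimod_mult[OF E h]] by simp
  qed
  have "\<exists>i<n. \<forall>j<n. j \<noteq> i \<longrightarrow> x j = 0"
  proof (cases "\<exists>i<n. x i \<noteq> 0")
    case True
    then obtain i where i: "i < n" "x i \<noteq> 0" by blast
    have "x j = 0" if "j < n" "j \<noteq> i" for j
      using one[OF i(1) that(1) that(2)[symmetric]] one[OF that(1) i(1) that(2)] i(2) by linarith
    thus ?thesis using i by blast
  next
    case False
    thus ?thesis by (intro exI[of _ 0]) (simp add: n_def)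
  qed
  then obtain i where i: "i < n" and z: "\<And>j. j < n \<Longrightarrow> j \<noteq> i \<Longrightarrow> x j = 0" by blast
  have res: "g * c = x i \<cdot>\<^sub>m 1\<^sub>m 1 @\<^sub>r 0\<^sub>m k 1" if g: "g \<in> carrier_mat n n" "\<And>j. j < n \<Longrightarrow> (g * c) $$ (j, 0) = (if j = 0 then x i else 0)" for g
  proof (rule eq_matI)
    fix a b assume ab: "a < dim_row (x i \<cdot>\<^sub>m 1\<^sub>m 1 @\<^sub>r 0\<^sub>m k 1)" "b < dim_col (x i \<cdot>\<^sub>m 1\<^sub>m 1 @\<^sub>r 0\<^sub>m k 1)"
    hence b: "b = 0" and a: "a < n" unfolding n_def by auto
    show "(g * c) $$ (a, b) = (x i \<cdot>\<^sub>m 1\<^sub>m 1 @\<^sub>r 0\<^sub>m k 1) $$ (a, b)"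
      using g(2)[OF a] a unfolding b append_rows_def n_def by simp
  qed (use g c in \<open>auto simp: n_def\<close>)
  show ?thesis
  proof (cases "i = 0")
    case True
    show ?thesis by (rule that[OF h[unfolded n_def] res[OF hc]]) (use z True in \<open>auto simp: x_def\<close>)
  next
    case False
    let ?P = "swaprows_mat n 0 i"
    have i0: "0 < n" "0 \<noteq> i" using False by (auto simp: n_def)
    have P: "unimod n ?P" unfolding unimod_iff_det using det_swaprows_mat[OF i0(1) i i0(2), where 'a = int] by simp
    have "(?P * h * c) $$ (j, 0) = (if j = 0 then x i else 0)" if j: "j < n" for j
    proof -
      have "?P * h * c = ?P * (h * c)" using hc c by (simp add: mat_assoc)
      also have "\<dots> = swaprows 0 i (h * c)"
        by (rule swaprows_mat[OF mult_carrier_mat[OF hc c] i0(1) i, symmetric])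
      finally show ?thesis using j i hc c z False unfolding x_def by (auto simp: x_def)
    qed
    note Ph = this
    show ?thesis
      by (rule that[OF unimod_mult[OF P h, unfolded n_def] res[OF unimod_carrier[OF unimod_mult[OF P h]], unfolded n_def]])
        (rule Ph[unfolded n_def])
  qed
qed

section \<open>Finiteness of the class number\<close>

lemma finite_mats:
  assumes "finite A"
  shows "finite {M \<in> carrier_mat n m. \<forall>i<n. \<forall>j<m. M $$ (i, j) \<in> A}"
proof (rule finite_subset)
  show "finite ((\<lambda>f. mat n m f) ` (({0..<n} \<times> {0..<m}) \<rightarrow>\<^sub>E A))"
    by (intro finite_imageI finite_PiE) (use assms in auto)
  show "{M \<in> carrier_mat n m. \<forall>i<n. \<forall>j<m. M $$ (i, j) \<in> A} \<subseteq> (\<lambda>f. mat n m f) ` (({0..<n} \<times> {0..<m}) \<rightarrow>\<^sub>E A)"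
  proof
    fix M assume M: "M \<in> {M \<in> carrier_mat n m. \<forall>i<n. \<forall>j<m. M $$ (i, j) \<in> A}"
    let ?f = "restrict (\<lambda>p. M $$ p) ({0..<n} \<times> {0..<m})"
    have "M = mat n m ?f" using M by (intro eq_matI) auto
    moreover have "?f \<in> ({0..<n} \<times> {0..<m}) \<rightarrow>\<^sub>E A" using M by auto
    ultimately show "M \<in> (\<lambda>f. mat n m f) ` (({0..<n} \<times> {0..<m}) \<rightarrow>\<^sub>E A)" by blast
  qed
qed

text \<open>
  Sublattices of index \<open>e\<close> contain \<open>e \<int>\<^sup>n\<close>, so a basis matrix is determined by its residues modulo
  \<open>e\<close> up to a unimodular factor: the quotient of two such matrices is integral by Cramer's rule.
\<close>

lemma unimod_quotient:
  assumes B: "B \<in> carrier_mat n n" and B': "B' \<in> carrier_mat n n"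
    and e: "\<bar>det B\<bar> = e" "\<bar>det B'\<bar> = e" "e \<noteq> 0"
    and r: "map_mat (\<lambda>x. x mod e) B = map_mat (\<lambda>x. x mod e) B'"
  obtains U where "unimod n U" "B' = U * B"
proof -
  let ?A = "adj_mat B"
  note A = adj_mat[OF B]
  have "e dvd B' $$ (i, j) - B $$ (i, j)" if "i < n" "j < n" for i j
    using arg_cong[OF r[symmetric], of "\<lambda>M. M $$ (i, j)"] that B B' by (simp add: mod_eq_dvd_iff)
  hence d: "e * ((B' $$ (i, j) - B $$ (i, j)) div e) = B' $$ (i, j) - B $$ (i, j)" if "i < n" "j < n" for i j
    using that by simp
  define M where "M = mat n n (\<lambda>(i, j). (B' $$ (i, j) - B $$ (i, j)) div e)"
  have M: "M \<in> carrier_mat n n" unfolding M_def by simp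
  have B'e: "B' = B + e \<cdot>\<^sub>m M" unfolding M_def using B B' d by (intro eq_matI) auto
  obtain \<sigma> where \<sigma>: "det B = \<sigma> * e" "\<sigma> * \<sigma> = 1"
    using e(1) by (cases "det B \<ge> 0") (auto intro: that[of 1] that[of "-1"])
  define X where "X = 1\<^sub>m n + \<sigma> \<cdot>\<^sub>m (M * ?A)"
  have X: "X \<in> carrier_mat n n" unfolding X_def using M A by auto
  note dm = carrier_matD[OF B] carrier_matD[OF A(1)] carrier_matD[OF M]
  have "X * B = B + \<sigma> \<cdot>\<^sub>m (M * (?A * B))" unfolding X_def by (simp add: mat_arith dm)
  also have "M * (?A * B) = (\<sigma> * e) \<cdot>\<^sub>m M" unfolding A(3) \<sigma>(1) by (simp add: mat_arith dm)
  also have "\<sigma> \<cdot>\<^sub>m ((\<sigma> * e) \<cdot>\<^sub>m M) = e \<cdot>\<^sub>m M"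
    by (rule eq_matI) (simp_all add: mult.assoc[symmetric] \<sigma>(2))
  finally have XB: "B' = X * B" unfolding B'e ..
  have "\<bar>det X\<bar> * e = 1 * e" using det_mult[OF X B] XB e by (simp add: abs_mult)
  hence "unimod n X" unfolding unimod_iff_det using X e(3) by simp
  thus ?thesis using XB by (rule that)
qed

lemma congruence_cancel:
  assumes B: "B \<in> carrier_mat n n" and S: "S \<in> carrier_mat n n" and S': "S' \<in> carrier_mat n n"
    and d: "det B \<noteq> (0 :: int)" and e: "B\<^sup>T * S * B = B\<^sup>T * S' * B"
  shows "S = S'"
proof -
  let ?A = "adj_mat B"
  note A = adj_mat[OF B]
  note dm = carrier_matD[OF B] carrier_matD[OF A(1)] carrier_matD[OF S] carrier_matD[OF S']
  have AT: "?A\<^sup>T * B\<^sup>T = det B \<cdot>\<^sub>m 1\<^sub>m n"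
    using arg_cong[OF A(2), of transpose_mat] dm by (simp add: mat_transpose_mult mat_transpose_smult)
  have k: "?A\<^sup>T * (B\<^sup>T * X * B) * ?A = (det B * det B) \<cdot>\<^sub>m X" if X: "X \<in> carrier_mat n n" for X
  proof -
    have "?A\<^sup>T * (B\<^sup>T * X * B) * ?A = (?A\<^sup>T * B\<^sup>T) * X * (B * ?A)"
      using X dm by (simp add: mat_assoc)
    also have "\<dots> = (det B * det B) \<cdot>\<^sub>m X" unfolding AT A(2) using X
      by (simp add: mat_arith) (rule eq_matI, auto)
    finally show ?thesis .
  qed
  have "(det B * det B) \<cdot>\<^sub>m S = (det B * det B) \<cdot>\<^sub>m S'" using k[OF S] k[OF S'] e by simp
  hence e': "((det B * det B) \<cdot>\<^sub>m S) $$ (i, j) = ((det B * det B) \<cdot>\<^sub>m S') $$ (i, j)" for i j by simp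
  show ?thesis
  proof (rule eq_matI)
    fix i j assume "i < dim_row S'" "j < dim_col S'"
    thus "S $$ (i, j) = S' $$ (i, j)" using e'[of i j] d dm by simp
  qed (use dm in auto)
qed

lemma congruence_mult:
  assumes "S \<in> carrier_mat n n" "A \<in> carrier_mat n m" "B \<in> carrier_mat m k"
  shows "(A * B)\<^sup>T * S * (A * B) = B\<^sup>T * (A\<^sup>T * S * A) * (B :: int mat)"
  using assms by (simp add: mat_arith)

lemma det_congruence:
  assumes "S \<in> carrier_mat n n" "B \<in> carrier_mat n n"
  shows "det (B\<^sup>T * S * B) = det B * det B * det (S :: int mat)"
  using assms det_mult[of "B\<^sup>T * S" n B] det_mult[of "B\<^sup>T" n S] det_transpose[of B n] by simp

text \<open>
  A form is determined up to isometry by the Gram matrix of a sublattice of finite index and the residues of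
  its basis modulo the index, so bounded index and finitely many Gram matrices leave finitely many classes.
\<close>

lemma finite_classes_of_sublattices:
  fixes F :: "int mat set"
  assumes F: "finite F" and X: "\<And>S. S \<in> X \<Longrightarrow> S \<in> carrier_mat n n"
    and sub: "\<And>S. S \<in> X \<Longrightarrow> \<exists>B \<in> carrier_mat n n. det B \<noteq> 0 \<and> \<bar>det B\<bar> \<le> E \<and> B\<^sup>T * S * B \<in> F"
  shows "\<exists>R. finite R \<and> (\<forall>S \<in> X. \<exists>U. unimod n U \<and> U\<^sup>T * S * U \<in> R)"
proof -
  obtain b where b: "\<And>S. S \<in> X \<Longrightarrow> b S \<in> carrier_mat n n \<and> det (b S) \<noteq> 0 \<and> \<bar>det (b S)\<bar> \<le> E \<and> (b S)\<^sup>T * S * b S \<in> F"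
    using sub by metis
  define code where "code S = ((b S)\<^sup>T * S * b S, \<bar>det (b S)\<bar>, map_mat (\<lambda>x. x mod \<bar>det (b S)\<bar>) (b S))" for S
  let ?K = "F \<times> {0..E} \<times> {M \<in> carrier_mat n n. \<forall>i<n. \<forall>j<n. M $$ (i, j) \<in> {0..E}}"
  have "code ` X \<subseteq> ?K"
  proof
    fix k assume "k \<in> code ` X"
    then obtain S where S: "S \<in> X" and k: "k = code S" by blast
    note bS = b[OF S]
    have "x mod \<bar>det (b S)\<bar> \<in> {0..E}" for x
    proof -
      have d: "0 < \<bar>det (b S)\<bar>" "\<bar>det (b S)\<bar> \<le> E" using bS by auto
      have "x mod \<bar>det (b S)\<bar> \<le> E" using pos_mod_bound[OF d(1), of x] d(2) by linarith
      thus ?thesis using pos_mod_sign[OF d(1), of x] by (intro iffD2[OF atLeastAtMost_iff] conjI)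
    qed
    thus "k \<in> ?K" unfolding k code_def using bS by auto
  qed
  moreover have "finite ?K" using F finite_mats[of "{0..E}"] by auto
  ultimately have fin: "finite (code ` X)" by (rule finite_subset)
  define R where "R = inv_into X code ` (code ` X)"
  have "\<exists>U. unimod n U \<and> U\<^sup>T * S * U \<in> R" if S: "S \<in> X" for S
  proof -
    define S' where "S' = inv_into X code (code S)"
    have S'X: "S' \<in> X" unfolding S'_def by (rule inv_into_into) (use S in blast)
    have S'R: "S' \<in> R" unfolding R_def S'_def using S by blast
    have c: "code S' = code S" unfolding S'_def by (rule f_inv_into_f) (use S in blast)
    have ce: "(b S')\<^sup>T * S' * b S' = (b S)\<^sup>T * S * b S" "\<bar>det (b S')\<bar> = \<bar>det (b S)\<bar>"
      "map_mat (\<lambda>x. x mod \<bar>det (b S)\<bar>) (b S') = map_mat (\<lambda>x. x mod \<bar>det (b S)\<bar>) (b S)"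
      using c unfolding code_def by auto
    have bc: "b S' \<in> carrier_mat n n" "b S \<in> carrier_mat n n" "det (b S') \<noteq> 0" "\<bar>det (b S)\<bar> \<noteq> 0"
      using b[OF S] b[OF S'X] by auto
    obtain U where U: "unimod n U" "b S = U * b S'"
      by (rule unimod_quotient[OF bc(1,2) ce(2) refl bc(4) ce(3)])
    note Uc = unimod_carrier[OF U(1)]
    have "(b S')\<^sup>T * S' * b S' = (b S')\<^sup>T * (U\<^sup>T * S * U) * b S'"
      unfolding ce(1) U(2) by (rule congruence_mult[OF X[OF S] Uc bc(1)])
    hence eq: "S' = U\<^sup>T * S * U"
      by (intro congruence_cancel[OF bc(1) X[OF S'X] _ bc(3)]) (use Uc X[OF S] in \<open>auto intro: carrier_matI\<close>)
    show ?thesis by (rule exI[of _ U], rule conjI[OF U(1) S'R[unfolded eq]])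
  qed
  moreover have "finite R" unfolding R_def using fin by (rule finite_imageI)
  ultimately show ?thesis by (intro exI[of _ R] conjI ballI)
qed

text \<open>
  The orthogonal complement of a vector of length \<open>a\<close>, in coordinates: \<open>a\<close> times the projection of the other basis vectors.
\<close>

lemma complement_congruence:
  fixes w S :: "int mat" and a :: int
  assumes w: "w \<in> carrier_mat 1 k" and S: "S \<in> carrier_mat k k"
  defines "A \<equiv> four_block_mat (a \<cdot>\<^sub>m 1\<^sub>m 1) w w\<^sup>T S" and "B \<equiv> four_block_mat (1\<^sub>m 1) (- w) (0\<^sub>m k 1) (a \<cdot>\<^sub>m 1\<^sub>m k)"
  shows "B\<^sup>T * A * B = (a \<cdot>\<^sub>m 1\<^sub>m 1) \<oplus>\<^sub>m (a \<cdot>\<^sub>m (a \<cdot>\<^sub>m S - w\<^sup>T * w))" "det B = a ^ k"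
proof -
  note d = carrier_matD[OF w] carrier_matD[OF S]
  have t: "B\<^sup>T = four_block_mat (1\<^sub>m 1) (0\<^sub>m 1 k) (- w\<^sup>T) (a \<cdot>\<^sub>m 1\<^sub>m k)"
    unfolding B_def by (simp add: four_block_transpose d mat_transpose_smult transpose_uminus)
  have um: "(- X) * Y = - (X * Y)" "X * (- Y) = - (X * Y)" if "dim_col X = dim_row Y" for X Y :: "int mat"
    using that by auto
  have AB: "A * B = four_block_mat (a \<cdot>\<^sub>m 1\<^sub>m 1) (0\<^sub>m 1 k) w\<^sup>T (a \<cdot>\<^sub>m S - w\<^sup>T * w)"
    unfolding A_def B_def
    apply (simp add: four_block_mult d mat_arith um)
    apply (intro cong_four_block_mat)
    by (rule eq_matI; use d in simp)+
  have "B\<^sup>T * A * B = B\<^sup>T * (A * B)" unfolding A_def B_def by (simp add: mat_assoc d)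
  also have "\<dots> = (a \<cdot>\<^sub>m 1\<^sub>m 1) \<oplus>\<^sub>m (a \<cdot>\<^sub>m (a \<cdot>\<^sub>m S - w\<^sup>T * w))"
    unfolding AB t mat_sum_def
    apply (simp add: four_block_mult d mat_arith um)
    apply (intro cong_four_block_mat)
    by (rule eq_matI; use d in \<open>simp add: right_diff_distrib\<close>)+
  finally show "B\<^sup>T * A * B = (a \<cdot>\<^sub>m 1\<^sub>m 1) \<oplus>\<^sub>m (a \<cdot>\<^sub>m (a \<cdot>\<^sub>m S - w\<^sup>T * w))" .
  show "det B = a ^ k" unfolding B_def
    by (subst det_four_block_mat_lower_left_zero[of _ 1 _ k]) (use w in \<open>auto simp: det_smult\<close>)
qed

lemma symmetric_split:
  fixes S :: "int mat"
  assumes S: "S \<in> carrier_mat (1 + k) (1 + k)" and t: "S\<^sup>T = S"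
  obtains w S' where "w \<in> carrier_mat 1 k" "S' \<in> carrier_mat k k" "S'\<^sup>T = S'"
    "S = four_block_mat (S $$ (0, 0) \<cdot>\<^sub>m 1\<^sub>m 1) w w\<^sup>T S'"
proof -
  obtain A B C D where b: "A \<in> carrier_mat 1 1" "B \<in> carrier_mat 1 k" "C \<in> carrier_mat k 1" "D \<in> carrier_mat k k"
    and e: "S = four_block_mat A B C D" using four_block_split[OF S] by metis
  note d = b[THEN carrier_matD(1)] b[THEN carrier_matD(2)]
  have "four_block_mat A\<^sup>T C\<^sup>T B\<^sup>T D\<^sup>T = four_block_mat A B C D" using t unfolding e by (simp add: four_block_transpose d)
  hence "C\<^sup>T = B" "D\<^sup>T = D" by (rule four_block_eqD; simp add: d)+
  hence "C = B\<^sup>T" by (metis transpose_transpose)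
  moreover have "A = S $$ (0, 0) \<cdot>\<^sub>m 1\<^sub>m 1" unfolding e by (rule eq_matI) (use d in auto)
  ultimately show ?thesis using that[OF b(2) b(4) \<open>D\<^sup>T = D\<close>] e by simp
qed

definition hermite_value :: "int mat \<Rightarrow> int mat \<Rightarrow> int" where
  "hermite_value S U = (U\<^sup>T * S * U) $$ (0, 0)"

lemma exists_nonzero_value:
  fixes S :: "int mat"
  assumes S: "S \<in> carrier_mat (1 + k) (1 + k)" and t: "S\<^sup>T = S" and d: "det S \<noteq> 0"
  shows "\<exists>U. unimod (1 + k) U \<and> hermite_value S U \<noteq> 0"
proof (rule ccontr)
  assume no: "\<not> ?thesis"
  define n where "n = 1 + k"
  note Sn = S[folded n_def]
  have z: "(c\<^sup>T * S * c) $$ (0, 0) = 0" if c: "c \<in> carrier_mat n 1" for c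
  proof -
    obtain h x where h: "unimod (1 + k) h" and hc: "h * c = x \<cdot>\<^sub>m 1\<^sub>m 1 @\<^sub>r 0\<^sub>m k 1"
      using unimod_column[OF c[unfolded n_def]] by metis
    obtain g where g: "unimod n g" "g \<in> carrier_mat n n" "g * h = 1\<^sub>m n"
      using unimod_inverse[OF h] unfolding n_def by metis
    let ?T = "g\<^sup>T * S * g" and ?e = "x \<cdot>\<^sub>m 1\<^sub>m 1 @\<^sub>r 0\<^sub>m k 1"
    note hn = unimod_carrier[OF h[folded n_def]]
    have T: "?T \<in> carrier_mat (1 + k) (1 + k)" using g(2) S unfolding n_def by (intro carrier_matI) auto
    have e: "?e \<in> carrier_mat n 1" unfolding n_def by auto
    have "c = g * ?e" unfolding hc[symmetric] using g hn c by (simp add: mat_assoc[symmetric] mat_one_mult)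
    hence "c\<^sup>T * S * c = ?e\<^sup>T * ?T * ?e" using congruence_mult[OF Sn g(2) e] by simp
    also have "\<dots> $$ (0, 0) = x * x * ?T $$ (0, 0)"
    proof -
      obtain A B C D where b: "A \<in> carrier_mat 1 1" "B \<in> carrier_mat 1 k" "C \<in> carrier_mat k 1" "D \<in> carrier_mat k k"
        and Te: "?T = four_block_mat A B C D" using four_block_split[OF T] by metis
      note bd = b[THEN carrier_matD(1)] b[THEN carrier_matD(2)]
      have ee: "?e = four_block_mat (x \<cdot>\<^sub>m 1\<^sub>m 1) (0\<^sub>m 1 0) (0\<^sub>m k 1) (0\<^sub>m k 0)" unfolding append_rows_def by simp
      have "?e\<^sup>T * ?T * ?e = four_block_mat (x \<cdot>\<^sub>m (x \<cdot>\<^sub>m A)) (0\<^sub>m 1 0) (0\<^sub>m 0 1) (0\<^sub>m 0 0)"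
        unfolding Te unfolding ee by (simp add: four_block_mult four_block_transpose mat_arith bd)
      thus ?thesis unfolding Te using bd by simp
    qed
    also have "?T $$ (0, 0) = 0" using no g(1) unfolding hermite_value_def n_def by blast
    finally show ?thesis by simp
  qed
  define e :: "nat \<Rightarrow> int mat" where "e i = mat n 1 (\<lambda>(a, b). if a = i then 1 else 0)" for i
  have ec: "e i \<in> carrier_mat n 1" for i unfolding e_def by simp
  note ed = carrier_matD[OF ec] carrier_matD[OF Sn]
  have ent: "((e i)\<^sup>T * S * e j) $$ (0, 0) = S $$ (i, j)" if ij: "i < n" "j < n" for i j
  proof -
    have dl: "(\<Sum>l = 0..<n. f l * (if l = m then 1 else 0)) = f m"
      "(\<Sum>l = 0..<n. (if l = m then 1 else 0) * f l) = f m" if "m < n" for f :: "nat \<Rightarrow> int" and m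
      using that by (simp_all add: if_distrib[of "\<lambda>z. _ * z"] if_distrib[of "\<lambda>z. z * _"] sum.delta cong: if_cong)
    have Se: "S * e j = mat n 1 (\<lambda>(a, b). S $$ (a, j))"
      by (rule eq_matI) (use ij ed in \<open>auto simp: e_def scalar_prod_def dl\<close>)
    have "(e i)\<^sup>T * S * e j = (e i)\<^sup>T * (S * e j)" by (simp add: mat_assoc ed)
    also have "\<dots> $$ (0, 0) = S $$ (i, j)" unfolding Se
      using ij ed by (simp add: e_def scalar_prod_def dl)
    finally show ?thesis .
  qed
  have "S $$ (i, j) = 0" if ij: "i < n" "j < n" for i j
  proof -
    have "S $$ (i, j) = S $$ (j, i)" using arg_cong[OF t, of "\<lambda>M. M $$ (j, i)"] ij ed by simp
    moreover have "((e i + e j)\<^sup>T * S * (e i + e j)) $$ (0, 0) = S $$ (i, i) + S $$ (i, j) + (S $$ (j, i) + S $$ (j, j))"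
      using ent ij ed by (simp add: mat_transpose_add mat_add_mult mat_mult_add)
    moreover have "S $$ (i, i) = 0" "S $$ (j, j) = 0" using z[OF ec] ent ij by metis+
    ultimately show ?thesis using z[of "e i + e j"] ec by simp
  qed
  hence "S = 0 \<cdot>\<^sub>m 1\<^sub>m n" using ed by (intro eq_matI) auto
  hence "det S = 0" by (simp add: n_def)
  thus False using d by simp
qed

text \<open>Hermite's bound for the least nonzero value of a binary form that is attained by a primitive vector.\<close>

lemma binary_form_minimum:
  fixes a x c :: int
  assumes a: "a \<noteq> 0" and b: "a * c - x * x \<noteq> 0"
    and min: "\<And>p q r u. p * u - q * r = 1 \<Longrightarrow> a * p * p + 2 * x * p * q + c * q * q \<noteq> 0 \<Longrightarrow>
      \<bar>a\<bar> \<le> \<bar>a * p * p + 2 * x * p * q + c * q * q\<bar>"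
  shows "a * a \<le> 4 * \<bar>a * c - x * x\<bar>"
proof -
  define b where "b = a * c - x * x"
  have "\<exists>t. 2 * \<bar>x + a * t\<bar> \<le> \<bar>a\<bar>"
  proof -
    define r where "r = x mod \<bar>a\<bar>"
    have r: "0 \<le> r" "r < \<bar>a\<bar>" using a unfolding r_def by auto
    have xr: "x = \<bar>a\<bar> * (x div \<bar>a\<bar>) + r" unfolding r_def by simp
    have sa: "x + a * (- (sgn a * z)) = x - \<bar>a\<bar> * z" for z
      by (simp add: abs_sgn algebra_simps)
    show ?thesis
    proof (cases "2 * r \<le> \<bar>a\<bar>")
      case True
      have "x + a * (- (sgn a * (x div \<bar>a\<bar>))) = r" using xr unfolding sa by linarith
      thus ?thesis using True r by (metis abs_of_nonneg)
    next
      case False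
      have "x + a * (- (sgn a * (x div \<bar>a\<bar> + 1))) = x - \<bar>a\<bar> * (x div \<bar>a\<bar> + 1)" by (rule sa)
      also have "\<dots> = r - \<bar>a\<bar>" using xr unfolding distrib_left by linarith
      finally have "x + a * (- (sgn a * (x div \<bar>a\<bar> + 1))) = r - \<bar>a\<bar>" .
      moreover have "\<bar>r - \<bar>a\<bar>\<bar> = \<bar>a\<bar> - r" using r by simp
      moreover have "2 * (\<bar>a\<bar> - r) \<le> \<bar>a\<bar>" using False by presburger
      ultimately show ?thesis by metis
    qed
  qed
  then obtain t where t: "2 * \<bar>x + a * t\<bar> \<le> \<bar>a\<bar>" by blast
  define y where "y = x + a * t"
  have y2: "4 * (y * y) \<le> a * a"
  proof -
    have "(2 * y)\<^sup>2 \<le> a\<^sup>2"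
      by (rule iffD1[OF abs_le_square_iff]) (use t in \<open>simp only: y_def[symmetric] abs_mult abs_numeral\<close>)
    thus ?thesis by (simp add: power2_eq_square)
  qed
  define f :: int where "f = a * t * t + 2 * x * t + c"
  have af: "a * f = y * y + b" unfolding f_def y_def b_def by (simp add: algebra_simps)
  show ?thesis
  proof (cases "f = 0")
    case False
    hence "\<bar>a\<bar> \<le> \<bar>f\<bar>" using min[of t 0 1 "-1"] unfolding f_def by simp
    hence "\<bar>a\<bar> * \<bar>a\<bar> \<le> \<bar>a\<bar> * \<bar>f\<bar>" by (intro mult_left_mono) auto
    hence "a * a \<le> \<bar>y * y + b\<bar>" unfolding af[symmetric] abs_mult abs_mult_self_eq .
    hence "a * a \<le> y * y + \<bar>b\<bar>" using abs_triangle_ineq[of "y * y" b] by simp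
    moreover have "A \<le> 4 * B" if "A \<le> Y + B" "4 * Y \<le> A" "0 \<le> A" for A Y B :: int
      using that by presburger
    ultimately show ?thesis using y2 zero_le_square[of a] unfolding b_def by blast
  next
    case True
    hence bb: "b = - (y * y)" using af by simp
    hence y0: "y \<noteq> 0" using assms(2) unfolding b_def by auto
    have v: "a * (1 + q * t) * (1 + q * t) + 2 * x * (1 + q * t) * q + c * q * q = a + 2 * y * q + q * q * f" for q
      unfolding f_def y_def by (simp add: algebra_simps)
    have "\<exists>q. a + 2 * y * q \<noteq> 0 \<and> \<bar>a + 2 * y * q\<bar> \<le> 2 * \<bar>y\<bar>"
    proof (cases "2 * y dvd a")
      case True
      then obtain k where "a = 2 * y * k" by (elim dvdE)
      hence "a + 2 * y * (1 - k) = 2 * y" by (simp add: algebra_simps)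
      thus ?thesis using y0 by (intro exI[of _ "1 - k"]) simp
    next
      case False
      have "a + 2 * y * (- (a div (2 * y))) = a mod (2 * y)" by (simp add: minus_mult_div_eq_mod[symmetric])
      moreover have "a mod (2 * y) \<noteq> 0" using False by (simp add: dvd_eq_mod_eq_0)
      moreover have "\<bar>a mod (2 * y)\<bar> \<le> 2 * \<bar>y\<bar>" using abs_mod_less[of "2 * y" a] y0 by (simp add: abs_mult)
      ultimately show ?thesis by metis
    qed
    then obtain q where q: "a + 2 * y * q \<noteq> 0" "\<bar>a + 2 * y * q\<bar> \<le> 2 * \<bar>y\<bar>" by blast
    have "\<bar>a\<bar> \<le> 2 * \<bar>y\<bar>" using min[of "1 + q * t" 1 q t] q unfolding v True by simp
    hence "a\<^sup>2 \<le> (2 * y)\<^sup>2"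
      by (intro iffD1[OF abs_le_square_iff]) (simp only: abs_mult abs_numeral)
    moreover have "\<bar>b\<bar> = y * y" unfolding bb by simp
    ultimately show ?thesis unfolding b_def[symmetric] by (simp add: power2_eq_square)
  qed
qed

text \<open>
  Hermite: a form of determinant \<open>d\<close> attains at some primitive vector a nonzero value \<open>a\<close> with \<open>\<bar>a\<bar>\<^sup>n\<close> bounded
  by a multiple of \<open>\<bar>d\<bar>\<close>. The bound for \<open>n\<close> variables follows from the bound for the complement of a minimal
  vector and from the bound for binary forms.
\<close>

fun hermite_const :: "nat \<Rightarrow> int" where
  "hermite_const 0 = 1"
| "hermite_const (Suc n) = 4 ^ n * hermite_const n"

lemma hermite_const_pos: "hermite_const n > 0"
  by (induction n) auto

lemma hermite_bound:
  fixes S :: "int mat"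
  assumes "S \<in> carrier_mat (1 + k) (1 + k)" "S\<^sup>T = S" "det S \<noteq> 0"
  shows "\<exists>U. unimod (1 + k) U \<and> hermite_value S U \<noteq> 0 \<and>
    \<bar>hermite_value S U\<bar> ^ (1 + k) \<le> hermite_const (1 + k) * \<bar>det S\<bar>"
  using assms
proof (induction k arbitrary: S)
  case 0
  hence S: "S \<in> carrier_mat 1 1" by simp
  have "det S = S $$ (0, 0)" by (rule det_single[OF S])
  moreover have "hermite_value S (1\<^sub>m 1) = S $$ (0, 0)" unfolding hermite_value_def using S by (simp add: mat_arith)
  ultimately show ?case using 0(3) by (intro exI[of _ "1\<^sub>m 1"]) simp
next
  case (Suc m)
  define k where "k = 1 + m"
  have S: "S \<in> carrier_mat (1 + k) (1 + k)" using Suc.prems(1) unfolding k_def by simp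
  note t = Suc.prems(2) and dS = Suc.prems(3)
  have "\<exists>U. (unimod (1 + k) U \<and> hermite_value S U \<noteq> 0) \<and>
      (\<forall>U'. unimod (1 + k) U' \<and> hermite_value S U' \<noteq> 0 \<longrightarrow> nat \<bar>hermite_value S U\<bar> \<le> nat \<bar>hermite_value S U'\<bar>)"
    using ex_has_least_nat[of "\<lambda>U. unimod (1 + k) U \<and> hermite_value S U \<noteq> 0" _ "\<lambda>U. nat \<bar>hermite_value S U\<bar>"]
      exists_nonzero_value[OF S t dS] by metis
  then obtain U where U: "unimod (1 + k) U" and nz: "hermite_value S U \<noteq> 0"
    and min: "\<And>U'. unimod (1 + k) U' \<Longrightarrow> hermite_value S U' \<noteq> 0 \<Longrightarrow> \<bar>hermite_value S U\<bar> \<le> \<bar>hermite_value S U'\<bar>"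
    by (metis nat_le_eq_zle abs_ge_zero)
  define a where "a = hermite_value S U"
  note Uc = unimod_carrier[OF U]
  note dims = carrier_matD[OF S] carrier_matD[OF Uc]
  let ?S1 = "U\<^sup>T * S * U"
  have S1: "?S1 \<in> carrier_mat (1 + k) (1 + k)" by (rule carrier_matI) (simp_all add: dims)
  have S1t: "?S1\<^sup>T = ?S1" using t by (simp add: mat_arith dims)
  obtain w S' where w: "w \<in> carrier_mat 1 k" and S': "S' \<in> carrier_mat k k" "S'\<^sup>T = S'"
    and S1e: "?S1 = four_block_mat (a \<cdot>\<^sub>m 1\<^sub>m 1) w w\<^sup>T S'"
    using symmetric_split[OF S1 S1t] unfolding a_def hermite_value_def by metis
  define R where "R = a \<cdot>\<^sub>m S' - w\<^sup>T * w"
  have R: "R \<in> carrier_mat k k" unfolding R_def using S'(1) w by (intro carrier_matI) auto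
  have Rt: "R\<^sup>T = R" unfolding R_def using S' w by (simp add: mat_transpose_minus mat_transpose_smult mat_transpose_mult)
  let ?B = "four_block_mat (1\<^sub>m 1) (- w) (0\<^sub>m k 1) (a \<cdot>\<^sub>m 1\<^sub>m k)"
  note cc = complement_congruence[OF w S'(1), of a, folded S1e R_def]
  have Bc: "?B \<in> carrier_mat (1 + k) (1 + k)" using w by auto
  have dU: "det U * det U = 1" using U unfolding unimod_iff_det by (auto simp: abs_if split: if_splits)
  have d1: "det (?B\<^sup>T * ?S1 * ?B) = a ^ k * a ^ k * det S"
    unfolding det_congruence[OF S1 Bc] det_congruence[OF S Uc] cc(2) dU by simp
  have d2: "det ((a \<cdot>\<^sub>m 1\<^sub>m 1) \<oplus>\<^sub>m (a \<cdot>\<^sub>m R)) = a * (a ^ k * det R)"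
    using det_mat_sum[of "a \<cdot>\<^sub>m 1\<^sub>m 1" 1 "a \<cdot>\<^sub>m R" k] R by simp
  have ak: "a ^ k = a * a ^ m" unfolding k_def by simp
  have "a * (a ^ k * det R) = a ^ k * a ^ k * det S" using d1 unfolding cc(1) d2 .
  hence d3: "(a * (a * a ^ m)) * det R = (a * (a * a ^ m)) * (a ^ m * det S)" unfolding ak by (simp only: mult_ac)
  have "a * (a * a ^ m) \<noteq> 0" using nz unfolding a_def[symmetric] by simp
  note nzp = this
  have dR: "det R = a ^ m * det S" using d3 by (simp only: mult_left_cancel[OF nzp])
  have dR0: "det R \<noteq> 0" unfolding dR using nz dS unfolding a_def[symmetric] by simp
  obtain V where V: "unimod k V" and bnz: "hermite_value R V \<noteq> 0"
    and bb: "\<bar>hermite_value R V\<bar> ^ k \<le> hermite_const k * \<bar>det R\<bar>"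
    using Suc.IH[OF R[unfolded k_def] Rt dR0] unfolding k_def[symmetric] by (elim exE conjE)
  define b where "b = hermite_value R V"
  note Vc = unimod_carrier[OF V]
  note dims2 = carrier_matD[OF w] carrier_matD[OF S'(1)] carrier_matD[OF Vc] carrier_matD[OF R]
  define x where "x = (w * V) $$ (0, 0)"
  define c where "c = (V\<^sup>T * S' * V) $$ (0, 0)"
  have k0: "0 < k" unfolding k_def by simp
  have be: "b = a * c - x * x"
  proof -
    have "V\<^sup>T * R * V = a \<cdot>\<^sub>m (V\<^sup>T * S' * V) - (w * V)\<^sup>T * (w * V)"
      unfolding R_def by (simp add: mat_arith dims2)
    moreover have "((w * V)\<^sup>T * (w * V)) $$ (0, 0) = x * x"
      unfolding x_def using k0 dims2 by (simp add: scalar_prod_def)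
    ultimately show ?thesis unfolding b_def hermite_value_def c_def using k0 dims2 by simp
  qed
  have "a * a \<le> 4 * \<bar>a * c - x * x\<bar>"
  proof (rule binary_form_minimum)
    show "a \<noteq> 0" using nz unfolding a_def .
    show "a * c - x * x \<noteq> 0" using bnz unfolding b_def[symmetric] be .
    fix p q r u :: int assume det1: "p * u - q * r = 1" and f: "a * p * p + 2 * x * p * q + c * q * q \<noteq> 0"
    \<comment> \<open>The first column of \<open>?U'\<close> is \<open>p\<close> times the first one of \<open>U\<close> plus \<open>q\<close> times the second one of \<open>U (1 \<oplus> V)\<close>.\<close>
    let ?W = "mat 2 2 (\<lambda>(i, j). [[p, r], [q, u]] ! i ! j)" and ?W' = "mat 2 2 (\<lambda>(i, j). [[u, - r], [- q, p]] ! i ! j)"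
    have "?W * ?W' = 1\<^sub>m 2" using det1
      by (intro eq_matI) (auto simp: scalar_prod_def numeral_2_eq_2 less_Suc_eq algebra_simps)
    hence W: "unimod 2 ?W" by (intro unimodI(1)[of _ _ ?W']) auto
    let ?C = "?W \<oplus>\<^sub>m 1\<^sub>m m" and ?D = "1\<^sub>m 1 \<oplus>\<^sub>m V"
    have C: "unimod (1 + k) ?C" using unimod_mat_sum[OF W unimod_one[of m]] unfolding k_def by simp
    have D: "unimod (1 + k) ?D" by (rule unimod_mat_sum[OF unimod_one V])
    let ?U' = "U * (?D * ?C)" and ?S2 = "?D\<^sup>T * ?S1 * ?D"
    note Cc = unimod_carrier[OF C] and Dc = unimod_carrier[OF D]
    have U': "unimod (1 + k) ?U'" by (rule unimod_mult[OF U unimod_mult[OF D C]])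
    have S2: "?S2 \<in> carrier_mat (1 + k) (1 + k)" by (rule carrier_matI) (simp_all add: dims2)
    have S2m: "?S2 \<in> carrier_mat (2 + m) (2 + m)" by (rule carrier_matI) (simp_all add: dims2 k_def)
    have S2e: "?S2 = four_block_mat (a \<cdot>\<^sub>m 1\<^sub>m 1) (w * V) (w * V)\<^sup>T (V\<^sup>T * S' * V)"
      unfolding S1e mat_sum_def by (simp add: four_block_mult four_block_transpose dims2 mat_arith)
    have ent: "?S2 $$ (0, 0) = a" "?S2 $$ (0, 1) = x" "?S2 $$ (1, 0) = x" "?S2 $$ (1, 1) = c"
      unfolding S2e x_def c_def using k0 dims2 by (simp_all add: x_def c_def)
    obtain P Q Q' Z where b4: "P \<in> carrier_mat 2 2" "Q \<in> carrier_mat 2 m" "Q' \<in> carrier_mat m 2" "Z \<in> carrier_mat m m"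
      and S2b: "?S2 = four_block_mat P Q Q' Z"
      by (rule four_block_split[OF S2m])
    note d4 = b4[THEN carrier_matD(1)] b4[THEN carrier_matD(2)]
    have Pe: "P $$ (i, j) = ?S2 $$ (i, j)" if ij: "i < 2" "j < 2" for i j
    proof -
      have "four_block_mat P Q Q' Z $$ (i, j) = P $$ (i, j)" using ij d4 by simp
      thus ?thesis unfolding S2b ..
    qed
    have P: "P $$ (0, 0) = a" "P $$ (0, 1) = x" "P $$ (1, 0) = x" "P $$ (1, 1) = c"
      by (rule HOL.trans[OF Pe ent(1)], simp, simp) (rule HOL.trans[OF Pe ent(2)], simp, simp,
        rule HOL.trans[OF Pe ent(3)], simp, simp, rule HOL.trans[OF Pe ent(4)], simp, simp)
    have "?C\<^sup>T * ?S2 * ?C = four_block_mat (?W\<^sup>T * (P * ?W)) (?W\<^sup>T * Q) (Q' * ?W) Z"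
      unfolding S2b mat_sum_def[of ?W] by (simp add: four_block_mult four_block_transpose mat_arith d4)
    hence "(?C\<^sup>T * ?S2 * ?C) $$ (0, 0) = (?W\<^sup>T * (P * ?W)) $$ (0, 0)" using d4 by simp
    also have "\<dots> = a * p * p + 2 * x * p * q + c * q * q"
      using d4 P by (simp add: scalar_prod_def numeral_2_eq_2 algebra_simps)
    also have "?C\<^sup>T * ?S2 * ?C = ?U'\<^sup>T * S * ?U'"
      unfolding congruence_mult[OF S Uc mult_carrier_mat[OF Dc Cc]] congruence_mult[OF S1 Dc Cc] ..
    finally have "hermite_value S ?U' = a * p * p + 2 * x * p * q + c * q * q" unfolding hermite_value_def .
    thus "\<bar>a\<bar> \<le> \<bar>a * p * p + 2 * x * p * q + c * q * q\<bar>" using min[OF U'] f unfolding a_def by simp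
  qed
  hence ab: "a * a \<le> 4 * \<bar>b\<bar>" unfolding be .
  have "\<bar>a\<bar> ^ m * \<bar>a\<bar> ^ (1 + k) = \<bar>a\<bar> ^ (2 * k)"
    unfolding power_add[symmetric] by (rule arg_cong[where f = "\<lambda>z. \<bar>a\<bar> ^ z"]) (simp add: k_def)
  also have "\<dots> = (a * a) ^ k" unfolding power_mult by (simp add: power2_eq_square)
  also have "\<dots> \<le> (4 * \<bar>b\<bar>) ^ k" by (rule power_mono[OF ab]) simp
  also have "\<dots> = 4 ^ k * \<bar>b\<bar> ^ k" by (rule power_mult_distrib)
  also have "\<dots> \<le> 4 ^ k * (hermite_const k * \<bar>det R\<bar>)" using bb unfolding b_def by (intro mult_left_mono) simp_all
  also have "\<dots> = \<bar>a\<bar> ^ m * (hermite_const (1 + k) * \<bar>det S\<bar>)" unfolding dR by (simp add: abs_mult power_abs mult_ac)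
  finally have "\<bar>a\<bar> ^ (1 + k) \<le> hermite_const (1 + k) * \<bar>det S\<bar>"
    using nz unfolding a_def[symmetric] by (simp only: mult_le_cancel_left_pos zero_less_power zero_less_abs_iff not_False_eq_True)
  thus ?case using U nz unfolding a_def k_def by (intro exI[of _ U]) simp
qed

theorem finite_class_number:
  "\<exists>R. finite R \<and> (\<forall>S \<in> carrier_mat n n. S\<^sup>T = S \<longrightarrow> det S \<noteq> 0 \<longrightarrow> \<bar>det S\<bar> \<le> (D :: int) \<longrightarrow>
     (\<exists>U. unimod n U \<and> U\<^sup>T * S * U \<in> R))"
proof (induction n arbitrary: D)
  case 0
  have "U\<^sup>T * S * U = 0\<^sub>m 0 0" if "S \<in> carrier_mat 0 0" "U \<in> carrier_mat 0 0" for S U :: "int mat"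
    using that by (intro eq_matI) auto
  thus ?case by (intro exI[of _ "{0\<^sub>m 0 0}"]) (metis finite.emptyI finite.insertI insertI1 unimod_one one_carrier_mat)
next
  case (Suc k)
  define H where "H = hermite_const (1 + k) * D"
  define D' where "D' = H ^ k * H ^ k * D"
  obtain R where R: "finite R"
    and Rp: "\<And>S. S \<in> carrier_mat k k \<Longrightarrow> S\<^sup>T = S \<Longrightarrow> det S \<noteq> 0 \<Longrightarrow> \<bar>det S\<bar> \<le> D' \<Longrightarrow> \<exists>U. unimod k U \<and> U\<^sup>T * S * U \<in> R"
    using Suc.IH[of D'] by blast
  let ?X = "{S \<in> carrier_mat (1 + k) (1 + k). S\<^sup>T = S \<and> det S \<noteq> 0 \<and> \<bar>det S\<bar> \<le> D}"
  let ?F = "(\<lambda>(a, T). (a \<cdot>\<^sub>m 1\<^sub>m 1) \<oplus>\<^sub>m T) ` ({- H..H} \<times> R)"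
  have sub: "\<exists>B \<in> carrier_mat (1 + k) (1 + k). det B \<noteq> 0 \<and> \<bar>det B\<bar> \<le> H ^ k \<and> B\<^sup>T * S * B \<in> ?F" if "S \<in> ?X" for S
  proof -
    have S: "S \<in> carrier_mat (1 + k) (1 + k)" and t: "S\<^sup>T = S" and d: "det S \<noteq> 0" "\<bar>det S\<bar> \<le> D" using that by auto
    obtain U where U: "unimod (1 + k) U" and nz: "hermite_value S U \<noteq> 0"
      and le: "\<bar>hermite_value S U\<bar> ^ (1 + k) \<le> hermite_const (1 + k) * \<bar>det S\<bar>"
      using hermite_bound[OF S t d(1)] by blast
    define a where "a = hermite_value S U"
    have a1: "1 \<le> \<bar>a\<bar>" using nz unfolding a_def by simp
    have "\<bar>a\<bar> ^ 1 \<le> \<bar>a\<bar> ^ (1 + k)" by (rule power_increasing) (use a1 in auto)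
    also have "\<dots> \<le> hermite_const (1 + k) * \<bar>det S\<bar>" using le unfolding a_def .
    also have "\<dots> \<le> H" unfolding H_def by (rule mult_left_mono[OF d(2)]) (use hermite_const_pos[of "1 + k"] in simp)
    finally have aH: "\<bar>a\<bar> \<le> H" by simp
    note Uc = unimod_carrier[OF U]
    note dims = carrier_matD[OF S] carrier_matD[OF Uc]
    let ?S1 = "U\<^sup>T * S * U"
    have S1: "?S1 \<in> carrier_mat (1 + k) (1 + k)" by (rule carrier_matI) (simp_all add: dims)
    have S1t: "?S1\<^sup>T = ?S1" using t by (simp add: mat_arith dims)
    obtain w S' where w: "w \<in> carrier_mat 1 k" and S': "S' \<in> carrier_mat k k" "S'\<^sup>T = S'"
      and S1e: "?S1 = four_block_mat (a \<cdot>\<^sub>m 1\<^sub>m 1) w w\<^sup>T S'"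
      using symmetric_split[OF S1 S1t] unfolding a_def hermite_value_def by metis
    define T where "T = a \<cdot>\<^sub>m (a \<cdot>\<^sub>m S' - w\<^sup>T * w)"
    have T: "T \<in> carrier_mat k k" unfolding T_def using S'(1) w by (intro carrier_matI) auto
    have Tt: "T\<^sup>T = T" unfolding T_def using S' w by (simp add: mat_transpose_minus mat_transpose_smult mat_transpose_mult)
    let ?B = "four_block_mat (1\<^sub>m 1) (- w) (0\<^sub>m k 1) (a \<cdot>\<^sub>m 1\<^sub>m k)"
    note cc = complement_congruence[OF w S'(1), of a, folded S1e T_def]
    have Bc: "?B \<in> carrier_mat (1 + k) (1 + k)" using w by auto
    have dU: "det U * det U = 1" using U unfolding unimod_iff_det by (auto simp: abs_if split: if_splits)
    have "a ^ k * a ^ k * det S = det (?B\<^sup>T * ?S1 * ?B)"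
      unfolding det_congruence[OF S1 Bc] det_congruence[OF S Uc] cc(2) dU by simp
    also have "\<dots> = a * det T" unfolding cc(1) using det_mat_sum[of "a \<cdot>\<^sub>m 1\<^sub>m 1" 1 T k] T by simp
    finally have dT: "a ^ k * a ^ k * det S = a * det T" .
    have "det T \<noteq> 0" using dT d(1) a1 by auto
    moreover have "\<bar>det T\<bar> \<le> D'"
    proof -
      have "1 * \<bar>det T\<bar> \<le> \<bar>a\<bar> * \<bar>det T\<bar>" by (rule mult_right_mono[OF a1]) simp
      also have "\<dots> = \<bar>a\<bar> ^ k * \<bar>a\<bar> ^ k * \<bar>det S\<bar>" using arg_cong[OF dT, of abs] by (simp add: abs_mult power_abs)
      also have "\<dots> \<le> H ^ k * H ^ k * D"
        by (intro mult_mono power_mono aH d(2)) (use aH in auto)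
      finally show ?thesis unfolding D'_def by simp
    qed
    ultimately obtain V where V: "unimod k V" "V\<^sup>T * T * V \<in> R" using Rp[OF T Tt] by blast
    note Vc = unimod_carrier[OF V(1)]
    let ?V = "1\<^sub>m 1 \<oplus>\<^sub>m V"
    have Vu: "unimod (1 + k) ?V" by (rule unimod_mat_sum[OF unimod_one V(1)])
    note V'c = unimod_carrier[OF Vu]
    let ?M = "U * (?B * ?V)"
    have BV: "?B * ?V \<in> carrier_mat (1 + k) (1 + k)" by (rule mult_carrier_mat[OF Bc V'c])
    have M: "?M \<in> carrier_mat (1 + k) (1 + k)" by (rule mult_carrier_mat[OF Uc BV])
    have "?M\<^sup>T * S * ?M = ?V\<^sup>T * (?B\<^sup>T * ?S1 * ?B) * ?V"
      unfolding congruence_mult[OF S Uc BV] congruence_mult[OF S1 Bc V'c] ..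
    also have "\<dots> = (a \<cdot>\<^sub>m 1\<^sub>m 1) \<oplus>\<^sub>m (V\<^sup>T * T * V)"
      unfolding cc(1) using carrier_matD[OF Vc] carrier_matD[OF T] by (simp add: mat_sum_transpose mat_sum_mult mat_arith)
    also have "\<dots> \<in> ?F" using V(2) aH by (intro image_eqI[of _ _ "(a, V\<^sup>T * T * V)"]) auto
    finally have F: "?M\<^sup>T * S * ?M \<in> ?F" .
    have "\<bar>det ?M\<bar> = \<bar>a\<bar> ^ k"
      using U Vu det_mult[OF Uc BV] det_mult[OF Bc V'c] cc(2) unfolding unimod_iff_det
      by (simp add: abs_mult power_abs)
    moreover have "\<bar>a\<bar> ^ k \<le> H ^ k" by (rule power_mono[OF aH]) simp
    moreover have "\<bar>a\<bar> ^ k \<noteq> 0" using a1 by simp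
    ultimately have "det ?M \<noteq> 0" "\<bar>det ?M\<bar> \<le> H ^ k" by auto
    thus ?thesis using F M by (intro bexI[of _ ?M] conjI)
  qed
  have fin: "finite ?F" using R by simp
  have "\<exists>R'. finite R' \<and> (\<forall>S \<in> ?X. \<exists>U. unimod (1 + k) U \<and> U\<^sup>T * S * U \<in> R')"
    by (rule finite_classes_of_sublattices[OF fin _ sub]) (elim CollectE conjE)
  then obtain R' where R': "finite R'" "\<forall>S \<in> ?X. \<exists>U. unimod (1 + k) U \<and> U\<^sup>T * S * U \<in> R'" by (elim exE conjE)
  show ?case
  proof (rule exI[of _ R'], intro conjI ballI impI R'(1))
    fix S :: "int mat" assume "S \<in> carrier_mat (Suc k) (Suc k)" "S\<^sup>T = S" "det S \<noteq> 0" "\<bar>det S\<bar> \<le> D"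
    hence "S \<in> ?X" by simp
    thus "\<exists>U. unimod (Suc k) U \<and> U\<^sup>T * S * U \<in> R'" using R'(2) unfolding plus_1_eq_Suc by (rule bspec[rotated])
  qed
qed

section \<open>Direct summands and Lagrangians as matrices\<close>

definition primitive_mat :: "nat \<Rightarrow> nat \<Rightarrow> int mat \<Rightarrow> bool" where
  "primitive_mat n r B \<longleftrightarrow> B \<in> carrier_mat n r \<and> (\<exists>C \<in> carrier_mat r n. C * B = 1\<^sub>m r)"

definition mat_image :: "int mat \<Rightarrow> int vec set" where
  "mat_image B = (\<lambda>x. B *\<^sub>v x) ` carrier_vec (dim_col B)"

lemma primitive_carrier: "primitive_mat n r B \<Longrightarrow> B \<in> carrier_mat n r"
  unfolding primitive_mat_def by simp

lemma primitive_matI: "B \<in> carrier_mat n r \<Longrightarrow> C \<in> carrier_mat r n \<Longrightarrow> C * B = 1\<^sub>m r \<Longrightarrow> primitive_mat n r B"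
  unfolding primitive_mat_def by (intro conjI bexI[of _ C])

lemma primitive_matE:
  assumes "primitive_mat n r B"
  obtains C where "B \<in> carrier_mat n r" "C \<in> carrier_mat r n" "C * B = 1\<^sub>m r"
  using assms unfolding primitive_mat_def by (elim conjE bexE)

lemma mat_vec_assoc:
  "A \<in> carrier_mat n m \<Longrightarrow> B \<in> carrier_mat m k \<Longrightarrow> x \<in> carrier_vec k \<Longrightarrow> (A * B) *\<^sub>v x = A *\<^sub>v (B *\<^sub>v (x :: int vec))"
  by (rule assoc_mult_mat_vec)

lemma mat_vec_carrier: "A \<in> carrier_mat n m \<Longrightarrow> A *\<^sub>v x \<in> carrier_vec n"
  by (intro carrier_vecI) simp

lemma mat_image_mult:
  assumes "A \<in> carrier_mat n m" "B \<in> carrier_mat m k"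
  shows "mat_image (A * B) = (\<lambda>x. A *\<^sub>v x) ` mat_image B"
  using mat_vec_assoc[OF assms] assms unfolding mat_image_def image_image by (intro image_cong) simp_all

lemma mat_image_unimod:
  assumes B: "B \<in> carrier_mat n m" and U: "unimod m U"
  shows "mat_image (B * U) = mat_image B"
proof -
  obtain V where V: "V \<in> carrier_mat m m" "U * V = 1\<^sub>m m" using unimod_inverse[OF U] by metis
  note Uc = unimod_carrier[OF U]
  have "(\<lambda>x. U *\<^sub>v x) ` carrier_vec m = carrier_vec m"
  proof
    show "(\<lambda>x. U *\<^sub>v x) ` carrier_vec m \<subseteq> carrier_vec m" using mat_vec_carrier[OF Uc] by (intro image_subsetI)
    show "carrier_vec m \<subseteq> (\<lambda>x. U *\<^sub>v x) ` carrier_vec m"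
    proof
      fix x :: "int vec" assume x: "x \<in> carrier_vec m"
      have "U *\<^sub>v (V *\<^sub>v x) = x" using mat_vec_assoc[OF Uc V(1) x] V(2) x by simp
      thus "x \<in> (\<lambda>x. U *\<^sub>v x) ` carrier_vec m" using mat_vec_carrier[OF V(1), of x] by (metis imageI)
    qed
  qed
  moreover have "mat_image U = (\<lambda>x. U *\<^sub>v x) ` carrier_vec m" unfolding mat_image_def using Uc by simp
  ultimately have "mat_image U = carrier_vec m" by simp
  thus ?thesis unfolding mat_image_mult[OF B Uc] unfolding mat_image_def using B by simp
qed

lemma mat_eq_by_vec:
  assumes "A \<in> carrier_mat n m" "B \<in> carrier_mat n m" "\<And>x. x \<in> carrier_vec m \<Longrightarrow> A *\<^sub>v x = B *\<^sub>v (x :: int vec)"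
  shows "A = B"
proof (rule eq_matI)
  fix i j assume ij: "i < dim_row B" "j < dim_col B"
  have "A *\<^sub>v unit_vec m j = B *\<^sub>v unit_vec m j" by (rule assms(3)) simp
  hence "(A *\<^sub>v unit_vec m j) $ i = (B *\<^sub>v unit_vec m j) $ i" by simp
  thus "A $$ (i, j) = B $$ (i, j)" using ij assms(1,2) by (simp add: scalar_prod_right_unit)
qed (use assms in auto)

lemma mat_of_vec_function:
  fixes f :: "int vec \<Rightarrow> int vec"
  assumes f: "\<And>x. x \<in> carrier_vec m \<Longrightarrow> f x \<in> carrier_vec n"
    and add: "\<And>x y. x \<in> carrier_vec m \<Longrightarrow> y \<in> carrier_vec m \<Longrightarrow> f (x + y) = f x + f y"
  shows "\<exists>A. A \<in> carrier_mat n m \<and> (\<forall>x \<in> carrier_vec m. A *\<^sub>v x = f x)"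
proof -
  have f0: "f (0\<^sub>v m) = 0\<^sub>v n"
  proof -
    have "f (0\<^sub>v m) = f (0\<^sub>v m) + f (0\<^sub>v m)" using add[of "0\<^sub>v m" "0\<^sub>v m"] by simp
    hence "f (0\<^sub>v m) $ i = f (0\<^sub>v m) $ i + f (0\<^sub>v m) $ i" if "i < n" for i using f[of "0\<^sub>v m"] that
      by (metis index_add_vec(1) carrier_vecD zero_carrier_vec)
    thus ?thesis using f[of "0\<^sub>v m"] by (intro eq_vecI) auto
  qed
  define coord where "coord i x = f x $ i" for i x
  have cadd: "coord i (x + y) = coord i x + coord i y" if "i < n" "x \<in> carrier_vec m" "y \<in> carrier_vec m" for i x y
    unfolding coord_def add[OF that(2,3)] using f[OF that(3)] that(1) by simp
  have c0: "coord i (0\<^sub>v m) = 0" if "i < n" for i unfolding coord_def f0 using that by simp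
  have cneg: "coord i (- x) = - coord i x" if "i < n" "x \<in> carrier_vec m" for i x
  proof -
    have "coord i (x + - x) = coord i x + coord i (- x)" by (rule cadd) (use that in auto)
    moreover have "x + - x = 0\<^sub>v m" using that(2) by (intro eq_vecI) auto
    ultimately show ?thesis using c0[OF that(1)] by simp
  qed
  have cnat: "coord i (int k \<cdot>\<^sub>v x) = int k * coord i x" if "i < n" "x \<in> carrier_vec m" for i x k
  proof (induction k)
    case 0
    have "int 0 \<cdot>\<^sub>v x = 0\<^sub>v m" using that(2) by (intro eq_vecI) auto
    thus ?case using c0[OF that(1)] by simp
  next
    case (Suc k)
    have "int (Suc k) \<cdot>\<^sub>v x = int k \<cdot>\<^sub>v x + x" using that(2) by (intro eq_vecI) (auto simp: algebra_simps)
    thus ?case using cadd[OF that(1), of "int k \<cdot>\<^sub>v x" x] Suc that(2) by (simp add: algebra_simps)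
  qed
  have csm: "coord i (z \<cdot>\<^sub>v x) = z * coord i x" if "i < n" "x \<in> carrier_vec m" for i x z
  proof (cases "z \<ge> 0")
    case True
    thus ?thesis using cnat[OF that, of "nat z"] by simp
  next
    case False
    have "z \<cdot>\<^sub>v x = - (int (nat (- z)) \<cdot>\<^sub>v x)" using False that(2) by (intro eq_vecI) auto
    thus ?thesis using cneg[OF that(1), of "int (nat (- z)) \<cdot>\<^sub>v x"] cnat[OF that, of "nat (- z)"] False that(2) by simp
  qed
  define A where "A = mat n m (\<lambda>(i, j). f (unit_vec m j) $ i)"
  have A: "A \<in> carrier_mat n m" unfolding A_def by simp
  have part: "coord i (vec m (\<lambda>j. if j < k then x $ j else 0)) = (\<Sum>j<k. x $ j * coord i (unit_vec m j))"
    if "i < n" "x \<in> carrier_vec m" "k \<le> m" for i x k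
    using that(3)
  proof (induction k)
    case 0
    have "vec m (\<lambda>j. if j < 0 then x $ j else 0) = 0\<^sub>v m" by (intro eq_vecI) auto
    thus ?case using c0[OF that(1)] by simp
  next
    case (Suc k)
    have "vec m (\<lambda>j. if j < Suc k then x $ j else 0) = vec m (\<lambda>j. if j < k then x $ j else 0) + x $ k \<cdot>\<^sub>v unit_vec m k"
      using Suc.prems by (intro eq_vecI) (auto simp: less_Suc_eq)
    thus ?case using Suc cadd[OF that(1), of "vec m (\<lambda>j. if j < k then x $ j else 0)" "x $ k \<cdot>\<^sub>v unit_vec m k"] csm[OF that(1), of "unit_vec m k" "x $ k"]
      by (simp add: add.commute)
  qed
  have "A *\<^sub>v x = f x" if x: "x \<in> carrier_vec m" for x
  proof (rule eq_vecI)
    fix i assume "i < dim_vec (f x)"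
    hence i: "i < n" using f[OF x] by simp
    have "vec m (\<lambda>j. if j < m then x $ j else 0) = x" using x by (intro eq_vecI) auto
    hence "f x $ i = (\<Sum>j<m. x $ j * coord i (unit_vec m j))" using part[OF i x order_refl] unfolding coord_def by simp
    also have "\<dots> = (A *\<^sub>v x) $ i" using i x unfolding A_def coord_def
      by (simp add: scalar_prod_def lessThan_atLeast0 mult.commute)
    finally show "(A *\<^sub>v x) $ i = f x $ i" ..
  qed (use f[OF x] in \<open>simp add: A_def\<close>)
  thus ?thesis by (intro exI[of _ A] conjI ballI A)
qed

lemma zsubgroupD:
  assumes "additive_subgroup U (module_vec TYPE(int) n)"
  shows "U \<subseteq> carrier_vec n" "0\<^sub>v n \<in> U" "\<And>x y. x \<in> U \<Longrightarrow> y \<in> U \<Longrightarrow> x + y \<in> U"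
  using additive_subgroup.a_subset[OF assms] additive_subgroup.zero_closed[OF assms]
    additive_subgroup.a_closed[OF assms] by (simp_all add: module_vec_simps)

text \<open>A projection to a direct summand, composed with the coordinates of a basis, is a left inverse of the basis matrix.\<close>

lemma summand_basis_primitive:
  assumes s: "direct_summand n U" and z: "zbasis n r B U"
  shows "primitive_mat n r B" "U = mat_image B"
proof -
  have B: "B \<in> carrier_mat n r" and bij: "bij_betw (\<lambda>x. B *\<^sub>v x) (carrier_vec r) U" using z unfolding zbasis_def by simp_all
  show UB: "U = mat_image B" using bij B unfolding mat_image_def bij_betw_def by simp
  have inj: "inj_on (\<lambda>x. B *\<^sub>v x) (carrier_vec r)" using bij unfolding bij_betw_def by simp
  obtain W where Us: "additive_subgroup U (module_vec TYPE(int) n)" and Ws: "additive_subgroup W (module_vec TYPE(int) n)"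
    and int: "U \<inter> W = {0\<^sub>v n}" and sum: "U <+>\<^bsub>module_vec TYPE(int) n\<^esub> W = carrier_vec n"
    using s unfolding direct_summand_def by (elim conjE exE)
  have ex: "\<exists>c w. c \<in> carrier_vec r \<and> w \<in> W \<and> x = B *\<^sub>v c + w" if "x \<in> carrier_vec n" for x
  proof -
    have "x \<in> U <+>\<^bsub>module_vec TYPE(int) n\<^esub> W" using that sum by simp
    then obtain u w where uw: "u \<in> U" "w \<in> W" "x = u + w" unfolding set_add_def' module_vec_simps by auto
    then obtain c where "c \<in> carrier_vec r" "u = B *\<^sub>v c" using UB B unfolding mat_image_def by auto
    thus ?thesis using uw by auto
  qed
  have Wneg: "- w \<in> W" if "w \<in> W" for w
  proof -
    let ?M = "add_monoid (module_vec TYPE(int) n)"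
    have wc: "w \<in> carrier_vec n" by (rule subsetD[OF zsubgroupD(1)[OF Ws] that])
    have "inv\<^bsub>?M\<^esub> w = - w"
      unfolding m_inv_def
    proof (rule the_equality)
      show "- w \<in> carrier ?M \<and> w \<otimes>\<^bsub>?M\<^esub> - w = \<one>\<^bsub>?M\<^esub> \<and> - w \<otimes>\<^bsub>?M\<^esub> w = \<one>\<^bsub>?M\<^esub>"
        using wc by (auto simp: module_vec_simps)
      fix y assume y: "y \<in> carrier ?M \<and> w \<otimes>\<^bsub>?M\<^esub> y = \<one>\<^bsub>?M\<^esub> \<and> y \<otimes>\<^bsub>?M\<^esub> w = \<one>\<^bsub>?M\<^esub>"
      hence yc: "y \<in> carrier_vec n" and e: "w + y = 0\<^sub>v n" by (auto simp: module_vec_simps)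
      show "y = - w"
      proof (rule eq_vecI)
        fix i assume "i < dim_vec (- w)"
        hence i: "i < n" using wc by auto
        have "(w + y) $ i = 0" using e i by simp
        thus "y $ i = (- w) $ i" using i wc yc by auto
      qed (use wc yc in auto)
    qed
    moreover have "inv\<^bsub>?M\<^esub> w \<in> W"
      by (rule subgroup.m_inv_closed[OF additive_subgroup.a_subgroup[OF Ws] that])
    ultimately show ?thesis by simp
  qed
  have uniq: "c = c'" if "c \<in> carrier_vec r" "c' \<in> carrier_vec r" "w \<in> W" "w' \<in> W" "B *\<^sub>v c + w = B *\<^sub>v c' + w'" for c c' w w'
  proof -
    have wc: "w \<in> carrier_vec n" "w' \<in> carrier_vec n" by (rule subsetD[OF zsubgroupD(1)[OF Ws]], rule that)+
    note bc = mat_vec_carrier[OF B, of c] mat_vec_carrier[OF B, of c']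
    have "B *\<^sub>v (c - c') = B *\<^sub>v c - B *\<^sub>v c'" by (rule mult_minus_distrib_mat_vec[OF B that(1,2)])
    also have "\<dots> = w' + - w"
    proof (rule eq_vecI)
      fix i assume "i < dim_vec (w' + - w)"
      hence i: "i < n" using wc by simp
      have "(B *\<^sub>v c + w) $ i = (B *\<^sub>v c' + w') $ i" using that(5) by simp
      hence "(B *\<^sub>v c) $ i + w $ i = (B *\<^sub>v c') $ i + w' $ i" using i wc by simp
      moreover have "(B *\<^sub>v c - B *\<^sub>v c') $ i = (B *\<^sub>v c) $ i - (B *\<^sub>v c') $ i" "(w' + - w) $ i = w' $ i - w $ i"
        using i wc B by simp_all
      ultimately show "(B *\<^sub>v c - B *\<^sub>v c') $ i = (w' + - w) $ i" by linarith
    qed (use wc B in simp)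
    finally have e: "B *\<^sub>v (c - c') = w' + - w" .
    have "B *\<^sub>v (c - c') \<in> U" unfolding UB mat_image_def using B that by (intro imageI) simp
    moreover have "w' + - w \<in> W" by (rule zsubgroupD(3)[OF Ws that(4) Wneg[OF that(3)]])
    ultimately have "B *\<^sub>v (c - c') \<in> U \<inter> W" unfolding e by (rule IntI)
    hence "B *\<^sub>v (c - c') = 0\<^sub>v n" unfolding int by simp
    also have "\<dots> = B *\<^sub>v 0\<^sub>v r" using B by (intro eq_vecI) auto
    finally have z: "B *\<^sub>v (c - c') = B *\<^sub>v 0\<^sub>v r" .
    have "c - c' = 0\<^sub>v r" by (rule inj_onD[OF inj z]) (simp_all add: that)
    hence "(c - c') $ i = 0" if "i < r" for i using that by simp
    thus "c = c'" using that(1,2) by (intro eq_vecI) auto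
  qed
  define f where "f x = (SOME c. c \<in> carrier_vec r \<and> (\<exists>w \<in> W. x = B *\<^sub>v c + w))" for x
  have f: "f x \<in> carrier_vec r \<and> (\<exists>w \<in> W. x = B *\<^sub>v f x + w)" if "x \<in> carrier_vec n" for x
    unfolding f_def by (rule someI_ex) (use ex[OF that] in auto)
  have feq: "f (B *\<^sub>v c + w) = c" if "c \<in> carrier_vec r" "w \<in> W" for c w
  proof -
    have "B *\<^sub>v c + w \<in> carrier_vec n" using mat_vec_carrier[OF B] zsubgroupD(1)[OF Ws] that by (intro add_carrier_vec) auto
    from f[OF this] obtain w' where w': "w' \<in> W" "B *\<^sub>v c + w = B *\<^sub>v f (B *\<^sub>v c + w) + w'" "f (B *\<^sub>v c + w) \<in> carrier_vec r" by auto
    show ?thesis by (rule uniq[OF that(1) w'(3) that(2) w'(1,2), symmetric])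
  qed
  have fc: "f x \<in> carrier_vec r" if "x \<in> carrier_vec n" for x using f[OF that] by simp
  have fadd: "f (x + y) = f x + f y" if xy: "x \<in> carrier_vec n" "y \<in> carrier_vec n" for x y
    proof -
      obtain w where w: "w \<in> W" "x = B *\<^sub>v f x + w" using f[OF xy(1)] by auto
      obtain w' where w': "w' \<in> W" "y = B *\<^sub>v f y + w'" using f[OF xy(2)] by auto
      have fc: "f x \<in> carrier_vec r" "f y \<in> carrier_vec r" using f[OF xy(1)] f[OF xy(2)] by simp_all
      have wc: "w \<in> carrier_vec n" "w' \<in> carrier_vec n"
        by (rule subsetD[OF zsubgroupD(1)[OF Ws]], rule w(1) w'(1))+
      have "B *\<^sub>v (f x + f y) = B *\<^sub>v f x + B *\<^sub>v f y" by (rule mult_add_distrib_mat_vec[OF B fc])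
      hence "B *\<^sub>v (f x + f y) + (w + w') = (B *\<^sub>v f x + w) + (B *\<^sub>v f y + w')"
        using wc B by (intro eq_vecI) auto
      also have "\<dots> = x + y" using w(2) w'(2) by simp
      finally have "x + y = B *\<^sub>v (f x + f y) + (w + w')" ..
      thus ?thesis using feq[OF _ zsubgroupD(3)[OF Ws w(1) w'(1)], of "f x + f y"] fc by simp
    qed
  have "\<exists>C. C \<in> carrier_mat r n \<and> (\<forall>x \<in> carrier_vec n. C *\<^sub>v x = f x)"
    by (rule mat_of_vec_function[OF fc fadd])
  then obtain C where C: "C \<in> carrier_mat r n" "\<forall>x \<in> carrier_vec n. C *\<^sub>v x = f x" by (elim exE conjE)
  have "C * B = 1\<^sub>m r"
  proof (rule mat_eq_by_vec[of _ r r])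
    fix x :: "int vec" assume x: "x \<in> carrier_vec r"
    have "B *\<^sub>v x = B *\<^sub>v x + 0\<^sub>v n" using mat_vec_carrier[OF B, of x] by simp
    hence "f (B *\<^sub>v x) = x" using feq[OF x zsubgroupD(2)[OF Ws]] by simp
    thus "C * B *\<^sub>v x = 1\<^sub>m r *\<^sub>v x" unfolding mat_vec_assoc[OF C(1) B x] using bspec[OF C(2) mat_vec_carrier[OF B]] x by simp
  qed (use B C in auto)
  thus "primitive_mat n r B" by (rule primitive_matI[OF B C(1)])
qed

lemma primitive_zbasis:
  assumes "primitive_mat n r B"
  shows "zbasis n r B (mat_image B)" "direct_summand n (mat_image B)"
proof -
  obtain C where B: "B \<in> carrier_mat n r" and C: "C \<in> carrier_mat r n" "C * B = 1\<^sub>m r" by (rule primitive_matE[OF assms])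
  have CB: "C *\<^sub>v (B *\<^sub>v x) = x" if "x \<in> carrier_vec r" for x using mat_vec_assoc[OF C(1) B that] C(2) that by simp
  have "inj_on (\<lambda>x. B *\<^sub>v x) (carrier_vec r)" by (rule inj_on_inverseI[of _ "\<lambda>x. C *\<^sub>v x"]) (rule CB)
  thus "zbasis n r B (mat_image B)" unfolding zbasis_def bij_betw_def mat_image_def using B by simp
  let ?W = "{x \<in> carrier_vec n. C *\<^sub>v x = 0\<^sub>v r}"
  have neg: "A *\<^sub>v (- x) = - (A *\<^sub>v x)" if "A \<in> carrier_mat p q" "x \<in> carrier_vec q" for A :: "int mat" and p q x
    using that by (intro eq_vecI) auto
  have z: "A *\<^sub>v 0\<^sub>v q = 0\<^sub>v p" if "A \<in> carrier_mat p q" for A :: "int mat" and p q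
    using that by (intro eq_vecI) auto
  have img: "y \<in> mat_image B \<longleftrightarrow> (\<exists>x \<in> carrier_vec r. y = B *\<^sub>v x)" for y unfolding mat_image_def using B by auto
  have U: "additive_subgroup (mat_image B) (module_vec TYPE(int) n)"
  proof (rule zsubgroupI)
    show "mat_image B \<subseteq> carrier_vec n" using img mat_vec_carrier[OF B] by auto
    show "0\<^sub>v n \<in> mat_image B" unfolding img using z[OF B] by (intro bexI[of _ "0\<^sub>v r"]) simp_all
    fix x assume "x \<in> mat_image B" then obtain a where a: "a \<in> carrier_vec r" "x = B *\<^sub>v a" unfolding img by auto
    show "- x \<in> mat_image B" unfolding img a(2) using neg[OF B a(1)] a(1) by (intro bexI[of _ "- a"]) simp_all
    fix y assume "y \<in> mat_image B" then obtain b where b: "b \<in> carrier_vec r" "y = B *\<^sub>v b" unfolding img by auto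
    show "x + y \<in> mat_image B" unfolding img a(2) b(2)
      using mult_add_distrib_mat_vec[OF B a(1) b(1)] a(1) b(1) by (intro bexI[of _ "a + b"]) simp_all
  qed
  have W: "additive_subgroup ?W (module_vec TYPE(int) n)"
    by (rule zsubgroupI) (auto simp: z[OF C(1)] neg[OF C(1)] mult_add_distrib_mat_vec[OF C(1)])
  have "mat_image B \<inter> ?W = {0\<^sub>v n}"
  proof
    show "mat_image B \<inter> ?W \<subseteq> {0\<^sub>v n}"
    proof
      fix x assume "x \<in> mat_image B \<inter> ?W"
      hence x: "x \<in> mat_image B" "C *\<^sub>v x = 0\<^sub>v r" by simp_all
      from x(1) obtain a where a: "a \<in> carrier_vec r" "x = B *\<^sub>v a" unfolding img by (rule bexE)
      have "a = 0\<^sub>v r" using CB[OF a(1)] x(2) unfolding a(2) by simp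
      thus "x \<in> {0\<^sub>v n}" using a z[OF B] by simp
    qed
    show "{0\<^sub>v n} \<subseteq> mat_image B \<inter> ?W" using zsubgroupD(2)[OF U] z[OF C(1)] by simp
  qed
  moreover have "mat_image B <+>\<^bsub>module_vec TYPE(int) n\<^esub> ?W = carrier_vec n"
  proof
    show "mat_image B <+>\<^bsub>module_vec TYPE(int) n\<^esub> ?W \<subseteq> carrier_vec n"
      using zsubgroupD(1)[OF U] by (auto simp: set_add_def' module_vec_simps intro!: add_carrier_vec)
    show "carrier_vec n \<subseteq> mat_image B <+>\<^bsub>module_vec TYPE(int) n\<^esub> ?W"
    proof
      fix x :: "int vec" assume x: "x \<in> carrier_vec n"
      let ?u = "B *\<^sub>v (C *\<^sub>v x)"
      have u: "?u \<in> carrier_vec n" by (rule mat_vec_carrier[OF B])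
      have "C *\<^sub>v (x - ?u) = C *\<^sub>v x - C *\<^sub>v ?u" by (rule mult_minus_distrib_mat_vec[OF C(1) x u])
      also have "\<dots> = 0\<^sub>v r" using CB[OF mat_vec_carrier[OF C(1)]] mat_vec_carrier[OF C(1), of x] by simp
      finally have "x - ?u \<in> ?W" using x u by simp
      moreover have "?u \<in> mat_image B" unfolding img by (rule bexI[OF refl mat_vec_carrier[OF C(1)]])
      moreover have "x = ?u + (x - ?u)" using x B by (intro eq_vecI) auto
      ultimately show "x \<in> mat_image B <+>\<^bsub>module_vec TYPE(int) n\<^esub> ?W"
        unfolding set_add_def' module_vec_simps by (intro UN_I[of ?u] UN_I[of "x - ?u"]) simp_all
    qed
  qed
  ultimately show "direct_summand n (mat_image B)" unfolding direct_summand_def by (intro conjI exI[of _ ?W] U W)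
qed

section \<open>Quasi-formations in coordinates\<close>

text \<open>A Lagrangian has a complementary isotropic family that is dual to a given basis: lift the dual basis and make it isotropic.\<close>

lemma dual_basis:
  assumes \<psi>: "\<psi> \<in> carrier_mat n n" and ns: "unimod n (symm 1 \<psi>)"
    and p: "primitive_mat n k E" and iso: "E\<^sup>T * symm 1 \<psi> * E = 0\<^sub>m k k"
  obtains F where "F \<in> carrier_mat n k" "F\<^sup>T * symm 1 \<psi> * F = 0\<^sub>m k k" "E\<^sup>T * symm 1 \<psi> * F = 1\<^sub>m k"
    "F\<^sup>T * symm 1 \<psi> * E = 1\<^sub>m k"
proof -
  obtain C where E: "E \<in> carrier_mat n k" and C: "C \<in> carrier_mat k n" "C * E = 1\<^sub>m k" by (rule primitive_matE[OF p])
  obtain T where T: "T \<in> carrier_mat n n" "symm 1 \<psi> * T = 1\<^sub>m n" using unimod_inverse[OF ns] by metis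
  define S where "S = symm 1 \<psi>"
  have S: "S \<in> carrier_mat n n" "S\<^sup>T = S" "S * T = 1\<^sub>m n" and iso: "E\<^sup>T * (S * E) = 0\<^sub>m k k"
    unfolding S_def using \<psi> symm_transpose[OF \<psi>] T iso carrier_matD[OF E] by (simp_all add: mat_assoc)
  define F0 where "F0 = T * C\<^sup>T"
  have F0: "F0 \<in> carrier_mat n k" unfolding F0_def using T C by simp
  note d = carrier_matD[OF E] carrier_matD[OF C(1)] carrier_matD[OF S(1)] carrier_matD[OF T(1)] carrier_matD[OF F0] carrier_matD[OF \<psi>]
  have "S * F0 = (S * T) * C\<^sup>T" unfolding F0_def by (simp add: mat_assoc d)
  hence SF0: "S * F0 = C\<^sup>T" unfolding S(3) by (simp add: mat_one_mult d)
  have EF0: "E\<^sup>T * (S * F0) = 1\<^sub>m k" unfolding SF0 using arg_cong[OF C(2), of transpose_mat] by (simp add: mat_transpose_mult d)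
  have FE0: "F0\<^sup>T * (S * E) = 1\<^sub>m k"
    using arg_cong[OF EF0, of transpose_mat] S(2) by (simp add: mat_transpose_mult mat_assoc d)
  define X where "X = F0\<^sup>T * \<psi> * F0"
  have X: "X \<in> carrier_mat k k" unfolding X_def by (rule carrier_matI) (simp_all add: d)
  have FF0: "F0\<^sup>T * (S * F0) = X + X\<^sup>T"
  proof -
    have "symm 1 X = F0\<^sup>T * S * F0" using symm_congruence[OF \<psi> F0] unfolding X_def[symmetric] S_def[symmetric] .
    hence "X + X\<^sup>T = F0\<^sup>T * S * F0" unfolding symm_def mat_one_smult .
    thus ?thesis by (simp add: mat_assoc d)
  qed
  define F where "F = F0 - E * X"
  have F: "F \<in> carrier_mat n k" unfolding F_def by (rule carrier_matI) (simp_all add: d carrier_matD[OF X])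
  note d = d carrier_matD[OF X] carrier_matD[OF F]
  have SF: "S * F = S * F0 - S * E * X" unfolding F_def by (simp add: mat_mult_minus mat_assoc d)
  have EF: "E\<^sup>T * (S * F) = 1\<^sub>m k"
  proof -
    have "E\<^sup>T * (S * F) = E\<^sup>T * (S * F0) - (E\<^sup>T * (S * E)) * X" unfolding SF by (simp add: mat_mult_minus mat_assoc d)
    thus ?thesis unfolding EF0 iso by (simp add: mat_arith d)
  qed
  have "F0\<^sup>T * (S * F) = F0\<^sup>T * (S * F0) - (F0\<^sup>T * (S * E)) * X" unfolding SF by (simp add: mat_mult_minus mat_assoc d)
  also have "\<dots> = X\<^sup>T" unfolding FE0 FF0 by (simp add: mat_one_mult d) (rule eq_matI, auto simp: d)
  finally have F0F: "F0\<^sup>T * (S * F) = X\<^sup>T" .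
  have "F\<^sup>T * (S * F) = F0\<^sup>T * (S * F) - X\<^sup>T * (E\<^sup>T * (S * F))"
    by (subst F_def) (simp add: mat_transpose_minus mat_transpose_mult mat_minus_mult mat_assoc d)
  also have "\<dots> = 0\<^sub>m k k" unfolding F0F EF by (simp add: mat_arith d)
  finally have FF: "F\<^sup>T * (S * F) = 0\<^sub>m k k" .
  have FE: "F\<^sup>T * (S * E) = 1\<^sub>m k"
    using arg_cong[OF EF, of transpose_mat] S(2) by (simp add: mat_transpose_mult mat_assoc d)
  show ?thesis by (rule that[OF F]) (use FF EF FE in \<open>simp_all add: S_def[symmetric] mat_assoc d\<close>)
qed

lemma hyperbolic_basis_inverse:
  assumes S: "S \<in> carrier_mat n n" "S\<^sup>T = S" and E: "E \<in> carrier_mat n k" and F: "F \<in> carrier_mat n k"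
    and g: "E\<^sup>T * S * E = 0\<^sub>m k k" "F\<^sup>T * S * F = 0\<^sub>m k k" "E\<^sup>T * S * F = 1\<^sub>m k" "F\<^sup>T * S * E = (1\<^sub>m k :: int mat)"
  shows "((F\<^sup>T * S) @\<^sub>r (E\<^sup>T * S)) * (E @\<^sub>c F) = 1\<^sub>m (k + k)"
    "(E @\<^sub>c F) * ((F\<^sup>T * S) @\<^sub>r (E\<^sup>T * S)) = E * (F\<^sup>T * S) + F * (E\<^sup>T * S)"
proof -
  note d = carrier_matD[OF E] carrier_matD[OF F] carrier_matD[OF S(1)]
  show "((F\<^sup>T * S) @\<^sub>r (E\<^sup>T * S)) * (E @\<^sub>c F) = 1\<^sub>m (k + k)"
    by (subst append_rows_mult_cols) (simp_all add: d g)
  show "(E @\<^sub>c F) * ((F\<^sup>T * S) @\<^sub>r (E\<^sup>T * S)) = E * (F\<^sup>T * S) + F * (E\<^sup>T * S)"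
    by (rule append_cols_mult_rows) (simp_all add: d)
qed

lemma perp_mat_image:
  assumes \<psi>: "\<psi> \<in> carrier_mat n n" and E: "E \<in> carrier_mat n k"
  shows "perp 1 \<psi> (mat_image E) = {x \<in> carrier_vec n. (E\<^sup>T * symm 1 \<psi>) *\<^sub>v x = 0\<^sub>v k}"
proof -
  have S: "symm 1 \<psi> \<in> carrier_mat n n" using \<psi> by simp
  have "(\<forall>u \<in> mat_image E. u \<bullet> (symm 1 \<psi> *\<^sub>v x) = 0) \<longleftrightarrow> (E\<^sup>T * symm 1 \<psi>) *\<^sub>v x = 0\<^sub>v k" if x: "x \<in> carrier_vec n" for x
  proof -
    let ?y = "symm 1 \<psi> *\<^sub>v x"
    have y: "?y \<in> carrier_vec n" by (rule mat_vec_carrier[OF S])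
    have Ey: "(E\<^sup>T * symm 1 \<psi>) *\<^sub>v x = E\<^sup>T *\<^sub>v ?y" by (rule mat_vec_assoc[OF _ S x]) (use E in simp)
    have Eyc: "E\<^sup>T *\<^sub>v ?y \<in> carrier_vec k" by (rule mat_vec_carrier[of _ k n]) (use E in simp)
    have sc: "(E *\<^sub>v a) \<bullet> ?y = (E\<^sup>T *\<^sub>v ?y) \<bullet> a" if a: "a \<in> carrier_vec k" for a
      using transpose_vec_mult_scalar[OF E a y] comm_scalar_prod[OF y mat_vec_carrier[OF E, of a]] by simp
    have "(\<forall>u \<in> mat_image E. u \<bullet> ?y = 0) \<longleftrightarrow> (\<forall>a \<in> carrier_vec k. (E\<^sup>T *\<^sub>v ?y) \<bullet> a = 0)"
      unfolding mat_image_def using sc E by simp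
    also have "\<dots> \<longleftrightarrow> E\<^sup>T *\<^sub>v ?y = 0\<^sub>v k"
    proof
      assume a: "\<forall>a \<in> carrier_vec k. (E\<^sup>T *\<^sub>v ?y) \<bullet> a = 0"
      show "E\<^sup>T *\<^sub>v ?y = 0\<^sub>v k"
      proof (rule eq_vecI)
        fix i assume "i < dim_vec (0\<^sub>v k :: int vec)"
        hence i: "i < k" by simp
        have e: "(E\<^sup>T *\<^sub>v ?y) \<bullet> unit_vec k i = (E\<^sup>T *\<^sub>v ?y) $ i" by (rule scalar_prod_right_unit[OF i])
        have "(E\<^sup>T *\<^sub>v ?y) $ i = 0" by (rule HOL.trans[OF e[symmetric] bspec[OF a unit_vec_carrier]])
        thus "(E\<^sup>T *\<^sub>v ?y) $ i = 0\<^sub>v k $ i" using i by (simp only: index_zero_vec)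
      qed (use E in simp)
    next
      assume "E\<^sup>T *\<^sub>v ?y = 0\<^sub>v k"
      thus "\<forall>a \<in> carrier_vec k. (E\<^sup>T *\<^sub>v ?y) \<bullet> a = 0" by (intro ballI) simp
    qed
    finally show ?thesis unfolding Ey .
  qed
  thus ?thesis unfolding perp_def using \<psi> by auto
qed

text \<open>The rank of a Lagrangian is half the rank of the form since it and its dual family together form a basis.\<close>

lemma lagrangian_iff:
  assumes \<psi>: "\<psi> \<in> carrier_mat n n" and ns: "unimod n (symm 1 \<psi>)"
  shows "lagrangian 1 \<psi> L \<longleftrightarrow>
    (\<exists>k E. n = k + k \<and> primitive_mat n k E \<and> E\<^sup>T * symm 1 \<psi> * E = 0\<^sub>m k k \<and> L = mat_image E)"
proof -
  let ?S = "symm 1 \<psi>"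
  have S: "?S \<in> carrier_mat n n" "?S\<^sup>T = ?S" using \<psi> symm_transpose[OF \<psi>] by simp_all
  have dr: "dim_row \<psi> = n" using \<psi> by simp
  have Q: "Q_eq 1 k (E\<^sup>T * \<psi> * E) (0\<^sub>m k k) \<longleftrightarrow> E\<^sup>T * ?S * E = 0\<^sub>m k k" if E: "E \<in> carrier_mat n k" for k E
  proof -
    have "E\<^sup>T * \<psi> * E \<in> carrier_mat k k" by (rule carrier_matI) (use E in simp_all)
    thus ?thesis using Q_eq_iff_symm[of "E\<^sup>T * \<psi> * E" k "0\<^sub>m k k"] symm_congruence[OF \<psi> E] by simp
  qed
  have fw: "\<exists>k E. n = k + k \<and> primitive_mat n k E \<and> E\<^sup>T * symm 1 \<psi> * E = 0\<^sub>m k k \<and> L = mat_image E" if l: "lagrangian 1 \<psi> L"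
  proof -
    from l obtain k E where ds: "direct_summand n L" and Lp: "L = perp 1 \<psi> L" and zb: "zbasis n k E L"
      and q: "Q_eq 1 k (E\<^sup>T * \<psi> * E) (0\<^sub>m k k)" unfolding lagrangian_def dr by (elim conjE exE)
    note p = summand_basis_primitive[OF ds zb]
    note E = primitive_carrier[OF p(1)]
    have iso: "E\<^sup>T * ?S * E = 0\<^sub>m k k" using q Q[OF E] by simp
    obtain F where F: "F \<in> carrier_mat n k" and FF: "F\<^sup>T * ?S * F = 0\<^sub>m k k" and EF: "E\<^sup>T * ?S * F = 1\<^sub>m k"
      and FE: "F\<^sup>T * ?S * E = 1\<^sub>m k" by (rule dual_basis[OF \<psi> ns p(1) iso])
    note d = carrier_matD[OF E] carrier_matD[OF F] carrier_matD[OF S(1)] carrier_matD[OF \<psi>]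
    note hi = hyperbolic_basis_inverse[OF S E F iso FF EF FE]
    let ?H = "E * (F\<^sup>T * ?S) + F * (E\<^sup>T * ?S)"
    have Hc: "?H \<in> carrier_mat n n" by (rule carrier_matI) (simp_all add: d)
    have H: "?H = 1\<^sub>m n"
    proof (rule mat_eq_by_vec[OF Hc one_carrier_mat])
      fix x :: "int vec" assume x: "x \<in> carrier_vec n"
      have K: "(E\<^sup>T * ?S) * (1\<^sub>m n - ?H) = 0\<^sub>m k n"
      proof -
        have "(E\<^sup>T * ?S) * ?H = (E\<^sup>T * ?S * E) * (F\<^sup>T * ?S) + (E\<^sup>T * ?S * F) * (E\<^sup>T * ?S)"
          by (simp add: mat_mult_add mat_assoc d)
        also have "\<dots> = E\<^sup>T * ?S" unfolding iso EF by (simp add: mat_zero_mult mat_one_mult mat_zero_add d)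
        finally show ?thesis by (simp add: mat_mult_minus mat_mult_one mat_minus_self d)
      qed
      let ?x = "(1\<^sub>m n - ?H) *\<^sub>v x"
      have xc: "?x \<in> carrier_vec n" by (rule mat_vec_carrier[OF minus_carrier_mat[OF Hc]])
      have "(E\<^sup>T * ?S) *\<^sub>v ?x = ((E\<^sup>T * ?S) * (1\<^sub>m n - ?H)) *\<^sub>v x"
        by (rule mat_vec_assoc[symmetric, OF mult_carrier_mat[OF _ S(1)] minus_carrier_mat[OF Hc] x]) (use E in simp)
      also have "\<dots> = 0\<^sub>v k" unfolding K using x by (intro eq_vecI) auto
      finally have "?x \<in> perp 1 \<psi> (mat_image E)" unfolding perp_mat_image[OF \<psi> E] using xc by simp
      hence "?x \<in> mat_image E" using Lp unfolding p(2) by simp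
      then obtain y where y: "y \<in> carrier_vec k" "?x = E *\<^sub>v y" unfolding mat_image_def using E by auto
      have K2: "(F\<^sup>T * ?S) * (1\<^sub>m n - ?H) = 0\<^sub>m k n"
      proof -
        have "(F\<^sup>T * ?S) * ?H = (F\<^sup>T * ?S * E) * (F\<^sup>T * ?S) + (F\<^sup>T * ?S * F) * (E\<^sup>T * ?S)"
          by (simp add: mat_mult_add mat_assoc d)
        also have "\<dots> = F\<^sup>T * ?S" unfolding FE FF by (simp add: mat_zero_mult mat_one_mult mat_add_zero d)
        finally show ?thesis by (simp add: mat_mult_minus mat_mult_one mat_minus_self d)
      qed
      have FSc: "F\<^sup>T * ?S \<in> carrier_mat k n" by (rule carrier_matI) (simp_all add: d)
      have "(F\<^sup>T * ?S) *\<^sub>v ?x = ((F\<^sup>T * ?S) * (1\<^sub>m n - ?H)) *\<^sub>v x"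
        by (rule mat_vec_assoc[symmetric, OF FSc minus_carrier_mat[OF Hc] x])
      also have "\<dots> = 0\<^sub>v k" unfolding K2 using x by (intro eq_vecI) auto
      finally have "(F\<^sup>T * ?S * E) *\<^sub>v y = 0\<^sub>v k" unfolding y(2) mat_vec_assoc[OF FSc E y(1)] .
      hence "y = 0\<^sub>v k" unfolding FE using y(1) by simp
      hence x0: "?x = 0\<^sub>v n" unfolding y(2) using E by (intro eq_vecI) auto
      have "x - ?H *\<^sub>v x = ?x" by (subst minus_mult_distrib_mat_vec[OF one_carrier_mat Hc x]) (use x in simp)
      hence e: "(x - ?H *\<^sub>v x) $ i = 0" if "i < n" for i using x0 that by simp
      have Hx: "?H *\<^sub>v x \<in> carrier_vec n" by (rule mat_vec_carrier[OF Hc])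
      show "?H *\<^sub>v x = 1\<^sub>m n *\<^sub>v x"
      proof (rule eq_vecI)
        fix i assume "i < dim_vec (1\<^sub>m n *\<^sub>v x)"
        hence i: "i < n" by simp
        have "(x - ?H *\<^sub>v x) $ i = x $ i - (?H *\<^sub>v x) $ i" by (rule index_minus_vec(1)) (use i carrier_vecD[OF Hx] in simp)
        thus "(?H *\<^sub>v x) $ i = (1\<^sub>m n *\<^sub>v x) $ i" using e[OF i] x by simp
      qed (use carrier_vecD[OF Hx] in simp)
    qed
    have "k + k = n"
      by (rule trace_one_mult_comm[OF _ _ hi(1) HOL.trans[OF hi(2) H]]) (rule carrier_matI; simp add: d)+
    thus ?thesis by (intro exI[of _ k] exI[of _ E] conjI p iso) simp
  qed
  have bw: "lagrangian 1 \<psi> L"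
    if ex: "\<exists>k E. n = k + k \<and> primitive_mat n k E \<and> E\<^sup>T * symm 1 \<psi> * E = 0\<^sub>m k k \<and> L = mat_image E"
  proof -
    from ex obtain k E where n: "n = k + k" and p: "primitive_mat n k E" and iso: "E\<^sup>T * symm 1 \<psi> * E = 0\<^sub>m k k"
      and L: "L = mat_image E" by (elim exE conjE)
    note E = primitive_carrier[OF p]
    obtain F where F: "F \<in> carrier_mat n k" and FF: "F\<^sup>T * ?S * F = 0\<^sub>m k k" and EF: "E\<^sup>T * ?S * F = 1\<^sub>m k"
      and FE: "F\<^sup>T * ?S * E = 1\<^sub>m k" by (rule dual_basis[OF \<psi> ns p iso])
    note d = carrier_matD[OF E] carrier_matD[OF F] carrier_matD[OF S(1)] carrier_matD[OF \<psi>]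
    note hi = hyperbolic_basis_inverse[OF S E F iso FF EF FE]
    have H: "E * (F\<^sup>T * ?S) + F * (E\<^sup>T * ?S) = 1\<^sub>m n" unfolding hi(2)[symmetric] n
      by (rule unimodI(3)[OF _ _ hi(1)]) (rule carrier_matI; simp add: d n[symmetric])+
    have ESc: "E\<^sup>T * ?S \<in> carrier_mat k n" and FSc: "F\<^sup>T * ?S \<in> carrier_mat k n"
      by (rule carrier_matI; simp add: d)+
    have "perp 1 \<psi> L = L"
    proof
      show "perp 1 \<psi> L \<subseteq> L"
      proof
        fix x assume "x \<in> perp 1 \<psi> L"
        hence x: "x \<in> carrier_vec n" and z: "(E\<^sup>T * ?S) *\<^sub>v x = 0\<^sub>v k" unfolding L perp_mat_image[OF \<psi> E] by simp_all
        have "x = 1\<^sub>m n *\<^sub>v x" using x by simp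
        also have "\<dots> = (E * (F\<^sup>T * ?S)) *\<^sub>v x + (F * (E\<^sup>T * ?S)) *\<^sub>v x" unfolding H[symmetric]
          by (rule add_mult_distrib_mat_vec[OF mult_carrier_mat[OF E FSc] mult_carrier_mat[OF F ESc] x])
        also have "\<dots> = E *\<^sub>v ((F\<^sup>T * ?S) *\<^sub>v x)"
          unfolding mat_vec_assoc[OF E FSc x] mat_vec_assoc[OF F ESc x] z using E F by (intro eq_vecI) auto
        finally have "x = E *\<^sub>v ((F\<^sup>T * ?S) *\<^sub>v x)" .
        moreover have "(F\<^sup>T * ?S) *\<^sub>v x \<in> carrier_vec (dim_col E)" using mat_vec_carrier[OF FSc, of x] E by simp
        ultimately show "x \<in> L" unfolding L mat_image_def by (rule image_eqI)
      qed
      show "L \<subseteq> perp 1 \<psi> L"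
      proof
        fix x assume "x \<in> L"
        then obtain a where a: "a \<in> carrier_vec k" "x = E *\<^sub>v a" unfolding L mat_image_def using E by auto
        have "(E\<^sup>T * ?S) *\<^sub>v x = 0\<^sub>v k" unfolding a(2) mat_vec_assoc[OF ESc E a(1), symmetric] iso using a(1) by (intro eq_vecI) auto
        thus "x \<in> perp 1 \<psi> L" unfolding L perp_mat_image[OF \<psi> E] a(2) using mat_vec_carrier[OF E] by simp
      qed
    qed
    thus ?thesis unfolding lagrangian_def dr
      using primitive_zbasis[OF p] Q[OF E] iso unfolding L by (intro conjI exI[of _ k] exI[of _ E]) simp_all
  qed
  show ?thesis by (rule iffI[OF fw bw])
qed

text \<open>
  Quasi-formations are handled through matrices \<open>E\<close>, \<open>B\<close> whose columns are bases of the Lagrangian and of the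
  half-rank summand; every quasi-formation arises in this way.
\<close>

definition qf_valid :: "nat \<Rightarrow> nat \<Rightarrow> int mat \<Rightarrow> int mat \<Rightarrow> int mat \<Rightarrow> bool" where
  "qf_valid n k \<psi> E B \<longleftrightarrow> n = k + k \<and> \<psi> \<in> carrier_mat n n \<and> unimod n (symm 1 \<psi>) \<and> primitive_mat n k E \<and>
     E\<^sup>T * symm 1 \<psi> * E = 0\<^sub>m k k \<and> primitive_mat n k B"

definition qf_of :: "int mat \<Rightarrow> int mat \<Rightarrow> int mat \<Rightarrow> qf" where
  "qf_of \<psi> E B = (\<psi>, mat_image E, mat_image B)"

lemma qf_validD:
  assumes "qf_valid n k \<psi> E B"
  shows "n = k + k" "\<psi> \<in> carrier_mat n n" "unimod n (symm 1 \<psi>)" "primitive_mat n k E"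
    "E\<^sup>T * symm 1 \<psi> * E = 0\<^sub>m k k" "primitive_mat n k B" "E \<in> carrier_mat n k" "B \<in> carrier_mat n k"
proof -
  note v = assms[unfolded qf_valid_def]
  note c = v[THEN conjunct2] v[THEN conjunct2, THEN conjunct2] v[THEN conjunct2, THEN conjunct2, THEN conjunct2]
    v[THEN conjunct2, THEN conjunct2, THEN conjunct2, THEN conjunct2]
  show "n = k + k" by (rule v[THEN conjunct1])
  show "\<psi> \<in> carrier_mat n n" by (rule c(1)[THEN conjunct1])
  show "unimod n (symm 1 \<psi>)" by (rule c(2)[THEN conjunct1])
  show E: "primitive_mat n k E" by (rule c(3)[THEN conjunct1])
  show "E\<^sup>T * symm 1 \<psi> * E = 0\<^sub>m k k" by (rule c(4)[THEN conjunct1])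
  show B: "primitive_mat n k B" by (rule c(4)[THEN conjunct2])
  show "E \<in> carrier_mat n k" "B \<in> carrier_mat n k" by (rule primitive_carrier[OF E], rule primitive_carrier[OF B])
qed

lemma quasi_formation_iff:
  "quasi_formation x \<longleftrightarrow> (\<exists>n k \<psi> E B. qf_valid n k \<psi> E B \<and> x = qf_of \<psi> E B)"
proof -
  obtain \<psi> L V where x: "x = (\<psi>, L, V)" by (metis surj_pair)
  show ?thesis
  proof
    assume q: "quasi_formation x"
    define n where "n = dim_row \<psi>"
    note q' = q[unfolded x quasi_formation.simps]
    have "square_mat \<psi>" "invertible_mat (symm 1 \<psi>)" using conjunct1[OF q'] unfolding nonsingular_def by simp_all
    hence \<psi>: "\<psi> \<in> carrier_mat n n" and ns: "unimod n (symm 1 \<psi>)"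
      unfolding n_def using invertible_mat_unimod[of "symm 1 \<psi>"] by (auto intro!: carrier_matI)
    obtain k E where E: "n = k + k" "primitive_mat n k E" "E\<^sup>T * symm 1 \<psi> * E = 0\<^sub>m k k" "L = mat_image E"
      using conjunct1[OF conjunct2[OF q']] unfolding lagrangian_iff[OF \<psi> ns] by blast
    have ds: "direct_summand n V" and ex: "\<exists>r B. zbasis n r B V \<and> n = 2 * r"
      using q unfolding x quasi_formation.simps n_def by simp_all
    from ex obtain r B where zb: "zbasis n r B V" "n = 2 * r" by blast
    note V = ds zb
    have "r = k" using V(3) E(1) by simp
    hence "qf_valid n k \<psi> E B" unfolding qf_valid_def using E \<psi> ns summand_basis_primitive(1)[OF V(1,2)] by simp
    moreover have "x = qf_of \<psi> E B" unfolding x qf_of_def E(4) summand_basis_primitive(2)[OF V(1,2)] ..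
    ultimately show "\<exists>n k \<psi> E B. qf_valid n k \<psi> E B \<and> x = qf_of \<psi> E B" by (intro exI conjI)
  next
    assume "\<exists>n k \<psi> E B. qf_valid n k \<psi> E B \<and> x = qf_of \<psi> E B"
    then obtain n k \<psi> E B where v: "qf_valid n k \<psi> E B" and x: "x = qf_of \<psi> E B" by blast
    note n = qf_validD(1)[OF v] and \<psi> = qf_validD(2)[OF v] and ns = qf_validD(3)[OF v] and E = qf_validD(4,5)[OF v]
      and B = qf_validD(6)[OF v]
    have dr: "dim_row \<psi> = n" using \<psi> by simp
    have 1: "nonsingular 1 \<psi>" unfolding nonsingular_def using \<psi> ns invertible_mat_unimod[of "symm 1 \<psi>"] by simp
    have 2: "lagrangian 1 \<psi> (mat_image E)" unfolding lagrangian_iff[OF \<psi> ns] by (intro exI[of _ k] exI[of _ E] conjI n E refl)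
    have 3: "\<exists>r Ba. zbasis n r Ba (mat_image B) \<and> n = 2 * r"
      by (intro exI[of _ k] exI[of _ B] conjI primitive_zbasis(1)[OF B]) (simp add: n)
    show "quasi_formation x"
      unfolding x qf_of_def quasi_formation.simps dr by (rule conjI[OF 1 conjI[OF 2 conjI[OF primitive_zbasis(2)[OF B] 3]]])
  qed
qed

lemma qf_valid_quasi_formation: "qf_valid n k \<psi> E B \<Longrightarrow> quasi_formation (qf_of \<psi> E B)"
  unfolding quasi_formation_iff by (rule exI, rule exI, rule exI, rule exI, rule exI, rule conjI, assumption, rule refl)

lemma qf_validI:
  assumes "n = k + k" "\<psi> \<in> carrier_mat n n" "unimod n (symm 1 \<psi>)" "primitive_mat n k E"
    "E\<^sup>T * symm 1 \<psi> * E = 0\<^sub>m k k" "primitive_mat n k B"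
  shows "qf_valid n k \<psi> E B"
  unfolding qf_valid_def by (intro conjI assms)

lemma mat_image_sum:
  assumes A: "A \<in> carrier_mat n k" and B: "B \<in> carrier_mat m l"
  shows "set_sum (mat_image A) (mat_image B) = mat_image (A \<oplus>\<^sub>m B)"
proof -
  have e: "(A \<oplus>\<^sub>m B) *\<^sub>v (a @\<^sub>v b) = (A *\<^sub>v a) @\<^sub>v (B *\<^sub>v b)" if a: "a \<in> carrier_vec k" and b: "b \<in> carrier_vec l" for a b
  proof -
    have "(A \<oplus>\<^sub>m B) *\<^sub>v (a @\<^sub>v b) = (A *\<^sub>v a + 0\<^sub>m n l *\<^sub>v b) @\<^sub>v (0\<^sub>m m k *\<^sub>v a + B *\<^sub>v b)"
      unfolding mat_sum_def using A B by (simp add: four_block_mat_mult_vec[OF A _ _ B a b])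
    moreover have "0\<^sub>m n l *\<^sub>v b = 0\<^sub>v n" "0\<^sub>m m k *\<^sub>v a = 0\<^sub>v m" using a b by (intro eq_vecI; simp)+
    ultimately show ?thesis using mat_vec_carrier[OF A, of a] mat_vec_carrier[OF B, of b] by simp
  qed
  show ?thesis
  proof
    show "set_sum (mat_image A) (mat_image B) \<subseteq> mat_image (A \<oplus>\<^sub>m B)"
    proof
      fix x assume "x \<in> set_sum (mat_image A) (mat_image B)"
      then obtain a b where ab: "a \<in> carrier_vec k" "b \<in> carrier_vec l" "x = (A *\<^sub>v a) @\<^sub>v (B *\<^sub>v b)"
        unfolding set_sum_def mat_image_def using A B by auto
      show "x \<in> mat_image (A \<oplus>\<^sub>m B)" unfolding mat_image_def
        by (rule image_eqI[of _ _ "a @\<^sub>v b"]) (use ab e A B in simp_all)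
    qed
    show "mat_image (A \<oplus>\<^sub>m B) \<subseteq> set_sum (mat_image A) (mat_image B)"
    proof
      fix x assume "x \<in> mat_image (A \<oplus>\<^sub>m B)"
      then obtain c where c: "c \<in> carrier_vec (k + l)" "x = (A \<oplus>\<^sub>m B) *\<^sub>v c" unfolding mat_image_def using A B by auto
      have ce: "c = vec_first c k @\<^sub>v vec_last c l" using c(1) by simp
      have "x = (A *\<^sub>v vec_first c k) @\<^sub>v (B *\<^sub>v vec_last c l)" unfolding c(2) by (subst ce, rule e) simp_all
      moreover have "A *\<^sub>v vec_first c k \<in> mat_image A" "B *\<^sub>v vec_last c l \<in> mat_image B"
        unfolding mat_image_def using A B by (auto intro!: imageI)
      ultimately show "x \<in> set_sum (mat_image A) (mat_image B)" unfolding set_sum_def by (intro CollectI exI conjI)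
    qed
  qed
qed

lemma qf_sum_of:
  assumes "E \<in> carrier_mat n k" "E' \<in> carrier_mat n' k'" "B \<in> carrier_mat m l" "B' \<in> carrier_mat m' l'"
  shows "qf_sum (qf_of \<psi> E B) (qf_of \<psi>' E' B') = qf_of (\<psi> \<oplus>\<^sub>m \<psi>') (E \<oplus>\<^sub>m E') (B \<oplus>\<^sub>m B')"
  unfolding qf_of_def using assms by (simp add: mat_image_sum)

lemma primitive_sum:
  assumes "primitive_mat n k A" "primitive_mat m l B"
  shows "primitive_mat (n + m) (k + l) (A \<oplus>\<^sub>m B)"
proof -
  obtain C where A: "A \<in> carrier_mat n k" and C: "C \<in> carrier_mat k n" "C * A = 1\<^sub>m k" by (rule primitive_matE[OF assms(1)])
  obtain D where B: "B \<in> carrier_mat m l" and D: "D \<in> carrier_mat l m" "D * B = 1\<^sub>m l" by (rule primitive_matE[OF assms(2)])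
  show ?thesis by (rule primitive_matI[of _ _ _ "C \<oplus>\<^sub>m D"]) (use A B C D in \<open>simp_all add: mat_sum_mult mat_sum_one\<close>)
qed

lemma qf_valid_sum:
  assumes "qf_valid n k \<psi> E B" "qf_valid n' k' \<psi>' E' B'"
  shows "qf_valid (n + n') (k + k') (\<psi> \<oplus>\<^sub>m \<psi>') (E \<oplus>\<^sub>m E') (B \<oplus>\<^sub>m B')"
proof -
  note a = qf_validD[OF assms(1)] and b = qf_validD[OF assms(2)]
  note d = carrier_matD[OF a(2)] carrier_matD[OF b(2)] carrier_matD[OF a(7)] carrier_matD[OF b(7)]
  show ?thesis
  proof (rule qf_validI)
    show "(E \<oplus>\<^sub>m E')\<^sup>T * symm 1 (\<psi> \<oplus>\<^sub>m \<psi>') * (E \<oplus>\<^sub>m E') = 0\<^sub>m (k + k') (k + k')"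
      unfolding symm_mat_sum[OF a(2) b(2)] mat_sum_transpose by (simp add: mat_sum_mult d a(5) b(5) mat_sum_zero)
    show "unimod (n + n') (symm 1 (\<psi> \<oplus>\<^sub>m \<psi>'))"
      unfolding symm_mat_sum[OF a(2) b(2)] by (rule unimod_mat_sum[OF a(3) b(3)])
  qed (use a b in \<open>simp_all add: primitive_sum\<close>)
qed

section \<open>Relations between quasi-formations\<close>

lemma qf_iso_of:
  assumes g: "unimod n g" and \<psi>: "\<psi> \<in> carrier_mat n n" "\<psi>' \<in> carrier_mat n n"
    and s: "symm 1 \<psi> = g\<^sup>T * symm 1 \<psi>' * g" and E: "E \<in> carrier_mat n k" and B: "B \<in> carrier_mat n l"
  shows "qf_iso (qf_of \<psi> E B) (qf_of \<psi>' (g * E) (g * B))"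
proof -
  note gc = unimod_carrier[OF g]
  have "isometry \<psi> \<psi>' g" unfolding isometry_iff[OF \<psi>] using g s by simp
  moreover have "(\<lambda>x. g *\<^sub>v x) ` mat_image E = mat_image (g * E)" "(\<lambda>x. g *\<^sub>v x) ` mat_image B = mat_image (g * B)"
    using mat_image_mult[OF gc E] mat_image_mult[OF gc B] by simp_all
  ultimately show ?thesis unfolding qf_of_def qf_iso.simps by (intro exI[of _ g] conjI)
qed

definition std_lag :: "nat \<Rightarrow> int mat" where "std_lag k = 1\<^sub>m k @\<^sub>r 0\<^sub>m k k"
definition std_colag :: "nat \<Rightarrow> int mat" where "std_colag k = 0\<^sub>m k k @\<^sub>r 1\<^sub>m k"

lemma std_lag_carrier [simp]: "std_lag k \<in> carrier_mat (k + k) k" "std_colag k \<in> carrier_mat (k + k) k"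
  "dim_row (std_lag k) = k + k" "dim_col (std_lag k) = k" "dim_row (std_colag k) = k + k" "dim_col (std_colag k) = k"
  unfolding std_lag_def std_colag_def by auto

lemma mat_image_zero: "mat_image (0\<^sub>m n k) = {0\<^sub>v n}"
proof
  have z: "0\<^sub>m n k *\<^sub>v x = (0\<^sub>v n :: int vec)" if "x \<in> carrier_vec k" for x using that by (intro eq_vecI) auto
  show "mat_image (0\<^sub>m n k) \<subseteq> {0\<^sub>v n}" unfolding mat_image_def using z by auto
  show "{0\<^sub>v n} \<subseteq> mat_image (0\<^sub>m n k)" unfolding mat_image_def using z[of "0\<^sub>v k"] by (auto intro!: image_eqI[of _ _ "0\<^sub>v k"])
qed

lemma mat_image_append_rows:
  assumes A: "A \<in> carrier_mat n k" and C: "C \<in> carrier_mat m k"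
  shows "mat_image (A @\<^sub>r C) = (\<lambda>x. (A *\<^sub>v x) @\<^sub>v (C *\<^sub>v x)) ` carrier_vec k"
  unfolding mat_image_def using mat_mult_append[OF A C] A by (intro image_cong) simp_all

lemma qf_triv_eq: "qf_triv k = qf_of (hyperbolic k) (std_lag k) (std_colag k)"
proof -
  have z: "0\<^sub>m k k *\<^sub>v x = (0\<^sub>v k :: int vec)" if "x \<in> carrier_vec k" for x using that by (intro eq_vecI) auto
  have "set_sum (carrier_vec k) {0\<^sub>v k} = mat_image (std_lag k)"
    unfolding std_lag_def mat_image_append_rows[OF one_carrier_mat zero_carrier_mat] set_sum_def
    using z by (auto intro!: image_eqI)
  moreover have "set_sum {0\<^sub>v k} (carrier_vec k) = mat_image (std_colag k)"
    unfolding std_colag_def mat_image_append_rows[OF zero_carrier_mat one_carrier_mat] set_sum_def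
    using z by (auto intro!: image_eqI)
  ultimately show ?thesis unfolding qf_triv_def qf_of_def by simp
qed

lemma hyperbolic_0: "hyperbolic 0 = 0\<^sub>m 0 0"
  unfolding hyperbolic_def by (rule eq_matI) auto

lemma std_lag_0: "std_lag 0 = 0\<^sub>m 0 0" "std_colag 0 = 0\<^sub>m 0 0"
  unfolding std_lag_def std_colag_def by (rule eq_matI; simp)+

lemma set_sum_nil: "set_sum U {0\<^sub>v 0} = U" "set_sum {0\<^sub>v 0} U = U"
proof -
  have a: "u @\<^sub>v 0\<^sub>v 0 = u" "0\<^sub>v 0 @\<^sub>v u = u" for u :: "int vec" by (rule eq_vecI; simp)+
  show "set_sum U {0\<^sub>v 0} = U" "set_sum {0\<^sub>v 0} U = U" unfolding set_sum_def using a by simp_all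
qed

lemma qf_triv_0: "qf_triv 0 = (0\<^sub>m 0 0, {0\<^sub>v 0}, {0\<^sub>v 0})"
  unfolding qf_triv_eq qf_of_def hyperbolic_0 std_lag_0 mat_image_zero ..

lemma qf_sum_unit: "qf_sum x (qf_triv 0) = x" "qf_sum (qf_triv 0) x = x"
proof -
  obtain \<psi> L V where x: "x = (\<psi>, L, V)" by (rule prod_cases3)
  show "qf_sum x (qf_triv 0) = x" "qf_sum (qf_triv 0) x = x"
    unfolding x qf_triv_0 qf_sum.simps mat_sum_empty set_sum_nil by (rule refl)+
qed

lemma qf_stably_isoI: "qf_iso x y \<Longrightarrow> qf_stably_iso x y"
  unfolding qf_stably_iso_def by (rule exI[of _ 0], rule exI[of _ 0]) (simp add: qf_sum_unit)

lemma qf_iso_refl: "qf_valid n k \<psi> E B \<Longrightarrow> qf_iso (qf_of \<psi> E B) (qf_of \<psi> E B)"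
proof -
  assume v: "qf_valid n k \<psi> E B"
  note d = qf_validD[OF v]
  have "symm 1 \<psi> = (1\<^sub>m n)\<^sup>T * symm 1 \<psi> * 1\<^sub>m n" using d(2) by (simp add: mat_arith)
  from qf_iso_of[OF unimod_one d(2) d(2) this d(7,8)] show ?thesis using d(7,8) by (simp add: mat_arith)
qed

lemma l1_eq_refl: "quasi_formation x \<Longrightarrow> l1_eq x x"
  using l1_eq.stable[OF _ _ qf_stably_isoI] qf_iso_refl unfolding quasi_formation_iff by (metis quasi_formation_iff)

lemma quasi_formation_sum: "quasi_formation x \<Longrightarrow> quasi_formation y \<Longrightarrow> quasi_formation (qf_sum x y)"
proof -
  assume "quasi_formation x" "quasi_formation y"
  then obtain n k \<psi> E B n' k' \<psi>' E' B' where v: "qf_valid n k \<psi> E B" "x = qf_of \<psi> E B" and v': "qf_valid n' k' \<psi>' E' B'" "y = qf_of \<psi>' E' B'"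
    unfolding quasi_formation_iff by blast
  have "qf_sum x y = qf_of (\<psi> \<oplus>\<^sub>m \<psi>') (E \<oplus>\<^sub>m E') (B \<oplus>\<^sub>m B')"
    unfolding v(2) v'(2) by (rule qf_sum_of[OF qf_validD(7)[OF v(1)] qf_validD(7)[OF v'(1)] qf_validD(8)[OF v(1)] qf_validD(8)[OF v'(1)]])
  thus ?thesis using qf_valid_quasi_formation[OF qf_valid_sum[OF v(1) v'(1)]] by simp
qed

lemma quasi_formation_lagrangians:
  assumes q: "quasi_formation (\<psi>, L, V)" and K: "lagrangian 1 \<psi> K"
  shows "quasi_formation (\<psi>, K, V)" "quasi_formation (\<psi>, K, L)"
proof -
  show "quasi_formation (\<psi>, K, V)" using q K by simp
  obtain n k \<psi>' E B where v: "qf_valid n k \<psi>' E B" "(\<psi>, L, V) = qf_of \<psi>' E B" using q unfolding quasi_formation_iff by blast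
  note d = qf_validD[OF v(1)]
  have e: "\<psi>' = \<psi>" "L = mat_image E" using v(2) unfolding qf_of_def by simp_all
  have "qf_valid n k \<psi>' E E" by (rule qf_validI[OF d(1-5,4)])
  from qf_valid_quasi_formation[OF this] have "quasi_formation (\<psi>, L, L)" unfolding qf_of_def e .
  thus "quasi_formation (\<psi>, K, L)" using K by simp
qed

lemma l1_eq_quasi_formation: "l1_eq x y \<Longrightarrow> quasi_formation x \<and> quasi_formation y"
proof (induction rule: l1_eq.induct)
  case (comp \<psi> L V K)
  note q = quasi_formation_lagrangians[OF comp]
  show ?case by (rule conjI[OF quasi_formation_sum[OF q(2) comp(1)] q(1)])
next
  case (sum x y x' y')
  show ?case
    by (rule conjI[OF quasi_formation_sum[OF conjunct1[OF sum.IH(1)] conjunct1[OF sum.IH(2)]]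
          quasi_formation_sum[OF conjunct2[OF sum.IH(1)] conjunct2[OF sum.IH(2)]]])
qed (simp_all only: simp_thms)

definition l1_null :: "qf \<Rightarrow> bool" where "l1_null x \<longleftrightarrow> l1_eq x (qf_triv 0)"

lemma l1_null_sum: "l1_null x \<Longrightarrow> quasi_formation y \<Longrightarrow> l1_eq (qf_sum x y) y"
  using l1_eq.sum[of x "qf_triv 0" y y] l1_eq_refl[of y] unfolding l1_null_def qf_sum_unit by simp

lemma l1_null_add: "l1_null x \<Longrightarrow> l1_null y \<Longrightarrow> l1_null (qf_sum x y)"
  using l1_eq.sum[of x "qf_triv 0" y "qf_triv 0"] unfolding l1_null_def qf_sum_unit by simp

lemma l1_null_eq: "l1_eq x y \<Longrightarrow> l1_null y \<Longrightarrow> l1_null x"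
  unfolding l1_null_def by (rule l1_eq.trans)

lemma unimod_hyperbolic: "unimod (k + k) (symm 1 (hyperbolic k))"
proof (rule unimodI(1))
  show "symm 1 (hyperbolic k) * symm 1 (hyperbolic k) = 1\<^sub>m (k + k)"
    unfolding symm_hyperbolic by (simp add: four_block_mult mat_arith)
qed simp_all

lemma std_lag_gram:
  "(std_lag k)\<^sup>T * symm 1 (hyperbolic k) * std_lag k = 0\<^sub>m k k"
  "(std_colag k)\<^sup>T * symm 1 (hyperbolic k) * std_colag k = 0\<^sub>m k k"
  "symm 1 (hyperbolic k) * std_lag k = std_colag k" "symm 1 (hyperbolic k) * std_colag k = std_lag k"
proof -
  have J: "symm 1 (hyperbolic k) = (0\<^sub>m k k @\<^sub>c 1\<^sub>m k) @\<^sub>r (1\<^sub>m k @\<^sub>c 0\<^sub>m k k)"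
    unfolding symm_hyperbolic by (subst append_cols_rows) simp_all
  show 3: "symm 1 (hyperbolic k) * std_lag k = std_colag k" and 4: "symm 1 (hyperbolic k) * std_colag k = std_lag k"
    unfolding J std_lag_def std_colag_def
    by (subst append_rows_mult, simp, simp, subst append_cols_mult_rows, simp_all add: mat_arith append_cols_mult_rows)+
  have t: "(std_lag k)\<^sup>T = 1\<^sub>m k @\<^sub>c 0\<^sub>m k k" "(std_colag k)\<^sup>T = 0\<^sub>m k k @\<^sub>c 1\<^sub>m k"
    unfolding std_lag_def std_colag_def by (rule eq_matI; auto simp: append_cols_index append_rows_def)+
  have a: "(std_lag k)\<^sup>T * symm 1 (hyperbolic k) * std_lag k = (std_lag k)\<^sup>T * (symm 1 (hyperbolic k) * std_lag k)"
    "(std_colag k)\<^sup>T * symm 1 (hyperbolic k) * std_colag k = (std_colag k)\<^sup>T * (symm 1 (hyperbolic k) * std_colag k)"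
    by (rule mat_assoc; simp add: carrier_matD[OF hyperbolic_carrier])+
  show "(std_lag k)\<^sup>T * symm 1 (hyperbolic k) * std_lag k = 0\<^sub>m k k"
    unfolding a(1) 3 unfolding t std_colag_def by (subst append_cols_mult_rows) (simp_all add: mat_arith)
  show "(std_colag k)\<^sup>T * symm 1 (hyperbolic k) * std_colag k = 0\<^sub>m k k"
    unfolding a(2) 4 unfolding t std_lag_def by (subst append_cols_mult_rows) (simp_all add: mat_arith)
qed

lemma std_primitive: "primitive_mat (k + k) k (std_lag k)" "primitive_mat (k + k) k (std_colag k)"
proof -
  show "primitive_mat (k + k) k (std_lag k)"
    by (rule primitive_matI[of _ _ _ "1\<^sub>m k @\<^sub>c 0\<^sub>m k k"]) (auto simp: std_lag_def append_cols_mult_rows mat_arith)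
  show "primitive_mat (k + k) k (std_colag k)"
    by (rule primitive_matI[of _ _ _ "0\<^sub>m k k @\<^sub>c 1\<^sub>m k"]) (auto simp: std_colag_def append_cols_mult_rows mat_arith)
qed

lemma std_valid:
  "primitive_mat (k + k) k B \<Longrightarrow> qf_valid (k + k) k (hyperbolic k) (std_lag k) B"
  "primitive_mat (k + k) k B \<Longrightarrow> qf_valid (k + k) k (hyperbolic k) (std_colag k) B"
  by (rule qf_validI; simp add: unimod_hyperbolic std_primitive std_lag_gram)+

lemma qf_valid_lagrangian: "qf_valid n k \<psi> E B \<Longrightarrow> lagrangian 1 \<psi> (mat_image E)"
  using qf_valid_quasi_formation[of n k \<psi> E B] unfolding qf_of_def by simp

lemma l1_eq_comp:
  assumes "qf_valid n k \<psi> E B" "qf_valid n k \<psi> E' B"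
  shows "l1_eq (qf_sum (qf_of \<psi> E' E) (qf_of \<psi> E B)) (qf_of \<psi> E' B)"
  using l1_eq.comp[of \<psi> "mat_image E" "mat_image B" "mat_image E'"] qf_valid_quasi_formation[OF assms(1)]
    qf_valid_lagrangian[OF assms(2)] unfolding qf_of_def by simp

text \<open>
  The defining relation of \<open>l\<^sub>1\<close> says that replacing a Lagrangian \<open>L\<close> by \<open>K\<close> changes the class by that of \<open>(K, L)\<close>,
  so related quasi-formations result as soon as \<open>(K, L)\<close> is trivial.
\<close>

lemma l1_change_lagrangian:
  assumes v: "qf_valid n k \<psi> E B" "qf_valid n k \<psi> E' B" and nl: "l1_null (qf_of \<psi> E' E)"
  shows "l1_eq (qf_of \<psi> E B) (qf_of \<psi> E' B)"
  by (rule l1_eq.trans[OF l1_eq.sym[OF l1_null_sum[OF nl qf_valid_quasi_formation[OF v(1)]]] l1_eq_comp[OF v]])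

lemma l1_eq_isoI:
  assumes v: "qf_valid n k \<psi> E B" and g: "unimod n g" and \<psi>': "\<psi>' \<in> carrier_mat n n" and s: "symm 1 \<psi> = g\<^sup>T * symm 1 \<psi>' * g"
  shows "l1_eq (qf_of \<psi> E B) (qf_of \<psi>' (g * E) (g * B))" "qf_valid n k \<psi>' (g * E) (g * B)"
proof -
  note d = qf_validD[OF v] and gc = unimod_carrier[OF g]
  obtain h where h: "h \<in> carrier_mat n n" "h * g = 1\<^sub>m n" "g * h = 1\<^sub>m n" using unimod_inverse[OF g] by metis
  note dm = carrier_matD[OF d(7)] carrier_matD[OF d(8)] carrier_matD[OF gc] carrier_matD[OF h(1)] carrier_matD[OF \<psi>']
  have pr: "primitive_mat n k (g * X)" if X: "primitive_mat n k X" for X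
  proof -
    obtain C where Xc: "X \<in> carrier_mat n k" and C: "C \<in> carrier_mat k n" "C * X = 1\<^sub>m k" by (rule primitive_matE[OF X])
    have "C * h * (g * X) = C * (h * g) * X" using Xc C dm by (simp add: mat_assoc)
    hence "C * h * (g * X) = 1\<^sub>m k" unfolding h(2) using C by (simp add: mat_mult_one)
    thus ?thesis using Xc C(1) gc h(1) by (intro primitive_matI[of _ _ _ "C * h"]) simp_all
  qed
  have dS: "det g * det g * det (symm 1 \<psi>') = det (symm 1 \<psi>)" unfolding s using det_congruence[of "symm 1 \<psi>'" n g] \<psi>' gc by simp
  have "unimod n (symm 1 \<psi>')" using dS d(3) g \<psi>' unfolding unimod_iff_det by (auto simp: abs_mult[symmetric] abs_if split: if_splits)
  moreover have "(g * E)\<^sup>T * symm 1 \<psi>' * (g * E) = 0\<^sub>m k k"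
    using congruence_mult[of "symm 1 \<psi>'" n g n E k] \<psi>' gc d(5,7) unfolding s[symmetric] by simp
  ultimately show v': "qf_valid n k \<psi>' (g * E) (g * B)" by (intro qf_validI d(1) \<psi>' pr d(4,6))
  show "l1_eq (qf_of \<psi> E B) (qf_of \<psi>' (g * E) (g * B))"
    by (rule l1_eq.stable[OF qf_valid_quasi_formation[OF v] qf_valid_quasi_formation[OF v'] qf_stably_isoI])
      (rule qf_iso_of[OF g d(2) \<psi>' s d(7,8)])
qed

lemma l1_null_triv: "l1_null (qf_of (hyperbolic k) (std_lag k) (std_colag k))"
proof -
  have q: "quasi_formation (qf_triv k)" for k
    unfolding qf_triv_eq by (rule qf_valid_quasi_formation[OF std_valid(1)[OF std_primitive(2)]])
  have "qf_iso (qf_triv k) (qf_triv k)" unfolding qf_triv_eq by (rule qf_iso_refl[OF std_valid(1)[OF std_primitive(2)]])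
  hence "qf_stably_iso (qf_triv k) (qf_triv 0)"
    unfolding qf_stably_iso_def by (intro exI[of _ 0] exI[of _ k]) (simp add: qf_sum_unit)
  thus ?thesis unfolding l1_null_def qf_triv_eq[symmetric] by (rule l1_eq.stable[OF q q])
qed

text \<open>
  The symmetrisation of the hyperbolic form is itself an isometry, and it interchanges the two standard Lagrangians.
\<close>

lemma l1_null_flip: "l1_null (qf_of (hyperbolic k) (std_colag k) (std_lag k))"
proof -
  have c: "hyperbolic k \<in> carrier_mat (k + k) (k + k)" by simp
  have "symm 1 (hyperbolic k) = (symm 1 (hyperbolic k))\<^sup>T * symm 1 (hyperbolic k) * symm 1 (hyperbolic k)"
    unfolding symm_transpose[OF c] unfolding symm_hyperbolic by (simp add: four_block_mult mat_arith)
  from l1_eq_isoI(1)[OF std_valid(2)[OF std_primitive(1)] unimod_hyperbolic c this]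
  have "l1_eq (qf_of (hyperbolic k) (std_colag k) (std_lag k)) (qf_of (hyperbolic k) (std_lag k) (std_colag k))"
    unfolding std_lag_gram(3,4) .
  thus ?thesis by (rule l1_null_eq[OF _ l1_null_triv])
qed

text \<open>
  The relation for the Lagrangians \<open>L\<close>, \<open>L\<^sup>*\<close> and the summand \<open>L\<close> reads \<open>(L, L\<^sup>*) + (L\<^sup>*, L) = (L, L)\<close>.
\<close>

lemma l1_null_same: "l1_null (qf_of (hyperbolic k) (std_lag k) (std_lag k))"
proof -
  have "l1_eq (qf_sum (qf_of (hyperbolic k) (std_lag k) (std_colag k)) (qf_of (hyperbolic k) (std_colag k) (std_lag k)))
      (qf_of (hyperbolic k) (std_lag k) (std_lag k))"
    by (rule l1_eq_comp[OF std_valid(2)[OF std_primitive(1)] std_valid(1)[OF std_primitive(1)]])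
  from l1_eq.trans[OF l1_eq.sym[OF this] l1_null_add[OF l1_null_triv l1_null_flip, unfolded l1_null_def]]
  show ?thesis unfolding l1_null_def .
qed

lemma gram_append_cols:
  assumes S: "S \<in> carrier_mat n n" and "dim_row A = n" "dim_row B = n" "dim_row C = n" "dim_row D = n"
  shows "(A @\<^sub>c B)\<^sup>T * S * (C @\<^sub>c D) = four_block_mat (A\<^sup>T * S * C) (A\<^sup>T * S * D) (B\<^sup>T * S * C) (B\<^sup>T * S * (D :: int mat))"
proof -
  have 1: "(A @\<^sub>c B)\<^sup>T * S = A\<^sup>T * S @\<^sub>r B\<^sup>T * S"
    using assms by (simp add: transpose_append_cols append_rows_mult carrier_matD[OF S])
  show ?thesis unfolding 1 by (rule append_rows_mult_cols) (use assms in \<open>simp_all add: carrier_matD[OF S]\<close>)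
qed

text \<open>
  A pair of dual isotropic families starting with \<open>p\<close> and \<open>q\<close> splits the form into the hyperbolic plane
  of \<open>p, q\<close> and the hyperbolic form spanned by the rest.
\<close>

lemma split_hyperbolic_plane:
  assumes \<psi>: "\<psi> \<in> carrier_mat n n" and ns: "unimod n (symm 1 \<psi>)" and n: "n = (1 + j) + (1 + j)"
    and c: "p \<in> carrier_mat n 1" "q \<in> carrier_mat n 1" "E0 \<in> carrier_mat n j" "F0 \<in> carrier_mat n j"
    and EE: "(p @\<^sub>c E0)\<^sup>T * symm 1 \<psi> * (p @\<^sub>c E0) = 0\<^sub>m (1 + j) (1 + j)"
    and FF: "(q @\<^sub>c F0)\<^sup>T * symm 1 \<psi> * (q @\<^sub>c F0) = 0\<^sub>m (1 + j) (1 + j)"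
    and EF: "(p @\<^sub>c E0)\<^sup>T * symm 1 \<psi> * (q @\<^sub>c F0) = 1\<^sub>m (1 + j)"
  defines "g \<equiv> (p @\<^sub>c q) @\<^sub>c (E0 @\<^sub>c F0)"
  shows "unimod n g" "symm 1 (hyperbolic 1 \<oplus>\<^sub>m hyperbolic j) = g\<^sup>T * symm 1 \<psi> * g"
    "hyperbolic 1 \<oplus>\<^sub>m hyperbolic j \<in> carrier_mat n n"
    "\<And>X l. X \<in> carrier_mat (j + j) l \<Longrightarrow> g * (std_lag 1 \<oplus>\<^sub>m X) = p @\<^sub>c (E0 @\<^sub>c F0) * X"
    "\<And>X l. X \<in> carrier_mat (j + j) l \<Longrightarrow> g * (std_colag 1 \<oplus>\<^sub>m X) = q @\<^sub>c (E0 @\<^sub>c F0) * X"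
    "(E0 @\<^sub>c F0) * std_lag j = E0"
proof -
  define S where "S = symm 1 \<psi>"
  have S: "S \<in> carrier_mat n n" "S\<^sup>T = S" unfolding S_def using \<psi> symm_transpose[OF \<psi>] by simp_all
  note d = c[THEN carrier_matD(1)] c[THEN carrier_matD(2)] carrier_matD[OF S(1)]
  note gram = gram_append_cols[OF S(1)]
  have z: "0\<^sub>m (1 + j) (1 + j) = four_block_mat (0\<^sub>m 1 1) (0\<^sub>m 1 j) (0\<^sub>m j 1) (0\<^sub>m j j)" by simp
  have o: "1\<^sub>m (1 + j) = four_block_mat (1\<^sub>m 1) (0\<^sub>m 1 j) (0\<^sub>m j 1) (1\<^sub>m j)" by simp
  have EE': "four_block_mat (p\<^sup>T * S * p) (p\<^sup>T * S * E0) (E0\<^sup>T * S * p) (E0\<^sup>T * S * E0) = four_block_mat (0\<^sub>m 1 1) (0\<^sub>m 1 j) (0\<^sub>m j 1) (0\<^sub>m j j)"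
    using EE unfolding S_def[symmetric] z by (simp only: gram d)
  have FF': "four_block_mat (q\<^sup>T * S * q) (q\<^sup>T * S * F0) (F0\<^sup>T * S * q) (F0\<^sup>T * S * F0) = four_block_mat (0\<^sub>m 1 1) (0\<^sub>m 1 j) (0\<^sub>m j 1) (0\<^sub>m j j)"
    using FF unfolding S_def[symmetric] z by (simp only: gram d)
  have EF': "four_block_mat (p\<^sup>T * S * q) (p\<^sup>T * S * F0) (E0\<^sup>T * S * q) (E0\<^sup>T * S * F0) = four_block_mat (1\<^sub>m 1) (0\<^sub>m 1 j) (0\<^sub>m j 1) (1\<^sub>m j)"
    using EF unfolding S_def[symmetric] o by (simp only: gram d)
  have e: "p\<^sup>T * S * p = 0\<^sub>m 1 1" "p\<^sup>T * S * E0 = 0\<^sub>m 1 j" "E0\<^sup>T * S * p = 0\<^sub>m j 1" "E0\<^sup>T * S * E0 = 0\<^sub>m j j"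
    by (rule four_block_eqD[OF EE']; simp add: d)+
  have f: "q\<^sup>T * S * q = 0\<^sub>m 1 1" "q\<^sup>T * S * F0 = 0\<^sub>m 1 j" "F0\<^sup>T * S * q = 0\<^sub>m j 1" "F0\<^sup>T * S * F0 = 0\<^sub>m j j"
    by (rule four_block_eqD[OF FF']; simp add: d)+
  have ef: "p\<^sup>T * S * q = 1\<^sub>m 1" "p\<^sup>T * S * F0 = 0\<^sub>m 1 j" "E0\<^sup>T * S * q = 0\<^sub>m j 1" "E0\<^sup>T * S * F0 = 1\<^sub>m j"
    by (rule four_block_eqD[OF EF']; simp add: d)+
  have fe: "q\<^sup>T * S * p = 1\<^sub>m 1" "F0\<^sup>T * S * p = 0\<^sub>m j 1" "q\<^sup>T * S * E0 = 0\<^sub>m 1 j" "F0\<^sup>T * S * E0 = 1\<^sub>m j"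
    using ef[THEN arg_cong[where f = transpose_mat]] S(2) by (simp_all add: mat_transpose_mult mat_assoc d)
  show c': "hyperbolic 1 \<oplus>\<^sub>m hyperbolic j \<in> carrier_mat n n"
    unfolding n by (rule carrier_matI) (simp_all add: carrier_matD[OF hyperbolic_carrier])
  have zz: "four_block_mat (0\<^sub>m a b) (0\<^sub>m a b') (0\<^sub>m a' b) (0\<^sub>m a' b') = (0\<^sub>m (a + a') (b + b') :: int mat)" for a b a' b' by simp
  have "g\<^sup>T * S * g = four_block_mat (symm 1 (hyperbolic 1)) (0\<^sub>m (1 + 1) (j + j)) (0\<^sub>m (j + j) (1 + 1)) (symm 1 (hyperbolic j))"
    unfolding g_def symm_hyperbolic by (simp only: gram append_cols_dim d e f ef fe zz)
  hence gS: "g\<^sup>T * S * g = symm 1 (hyperbolic 1) \<oplus>\<^sub>m symm 1 (hyperbolic j)"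
    unfolding mat_sum_def by (simp add: carrier_matD[OF hyperbolic_carrier])
  thus s: "symm 1 (hyperbolic 1 \<oplus>\<^sub>m hyperbolic j) = g\<^sup>T * symm 1 \<psi> * g"
    unfolding symm_mat_sum[OF hyperbolic_carrier hyperbolic_carrier] S_def by simp
  have gc: "g \<in> carrier_mat n n" unfolding g_def n by (rule carrier_matI) (simp_all add: d n)
  have "unimod n (symm 1 (hyperbolic 1 \<oplus>\<^sub>m hyperbolic j))"
    unfolding symm_mat_sum[OF hyperbolic_carrier hyperbolic_carrier]
    using unimod_mat_sum[OF unimod_hyperbolic[of 1] unimod_hyperbolic[of j]] by (simp add: n)
  hence "\<bar>det g * det g * det (symm 1 \<psi>)\<bar> = 1" unfolding s unimod_iff_det
    using det_congruence[of "symm 1 \<psi>" n g] \<psi> gc by simp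
  hence "\<bar>det g\<bar> * \<bar>det g\<bar> * 1 = 1" using ns unfolding unimod_iff_det by (simp only: abs_mult)
  hence "\<bar>det g * det g\<bar> = 1" unfolding abs_mult mult_1_right .
  hence "\<bar>det g\<bar> = 1" by (rule abs_zmult_eq_1)
  thus "unimod n g" unfolding unimod_iff_det using gc by simp
  have l1: "(A @\<^sub>c C) * std_lag a = A" "(A @\<^sub>c C) * std_colag a = C" if "A \<in> carrier_mat n a" "C \<in> carrier_mat n a" for A C a
    unfolding std_lag_def std_colag_def using that by (simp_all add: append_cols_mult_rows mat_arith)
  have g: "g * (Y \<oplus>\<^sub>m X) = (p @\<^sub>c q) * Y @\<^sub>c (E0 @\<^sub>c F0) * X"
    if "Y \<in> carrier_mat (1 + 1) 1" "X \<in> carrier_mat (j + j) l" for X Y l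
    unfolding g_def by (rule append_cols_mult_sum) (use that in \<open>simp_all add: d\<close>)
  show "g * (std_lag 1 \<oplus>\<^sub>m X) = p @\<^sub>c (E0 @\<^sub>c F0) * X" if "X \<in> carrier_mat (j + j) l" for X l
    unfolding g[OF std_lag_carrier(1) that] l1(1)[OF c(1,2)] ..
  show "g * (std_colag 1 \<oplus>\<^sub>m X) = q @\<^sub>c (E0 @\<^sub>c F0) * X" if "X \<in> carrier_mat (j + j) l" for X l
    unfolding g[OF std_lag_carrier(2) that] l1(2)[OF c(1,2)] ..
  show "(E0 @\<^sub>c F0) * std_lag j = E0" by (rule l1(1)[OF c(3,4)])
qed

section \<open>Bases adapted to direct summands\<close>

lemma append_rows_split:
  assumes "M \<in> carrier_mat (n + m) r"
  obtains A B where "A \<in> carrier_mat n r" "B \<in> carrier_mat m r" "M = A @\<^sub>r (B :: int mat)"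
proof
  let ?A = "mat n r (\<lambda>(i, j). M $$ (i, j))" and ?B = "mat m r (\<lambda>(i, j). M $$ (i + n, j))"
  show "?A \<in> carrier_mat n r" "?B \<in> carrier_mat m r" by auto
  show "M = ?A @\<^sub>r ?B" unfolding append_rows_def using assms by (intro eq_matI) auto
qed

lemma primitive_unimod:
  assumes "primitive_mat n r B" "unimod r U"
  shows "primitive_mat n r (B * U)"
proof -
  obtain C where B: "B \<in> carrier_mat n r" and C: "C \<in> carrier_mat r n" "C * B = 1\<^sub>m r" by (rule primitive_matE[OF assms(1)])
  obtain V where V: "V \<in> carrier_mat r r" "V * U = 1\<^sub>m r" using unimod_inverse[OF assms(2)] by metis
  note U = unimod_carrier[OF assms(2)]
  have "(V * C) * (B * U) = V * (C * B) * U" using B C(1) V(1) U by (simp add: mat_assoc)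
  also have "\<dots> = 1\<^sub>m r" unfolding C(2) using V U by (simp add: mat_mult_one)
  finally show ?thesis by (intro primitive_matI[of _ _ _ "V * C"] mult_carrier_mat[OF B U] mult_carrier_mat[OF V(1) C(1)])
qed

lemma primitive_factor:
  assumes A: "A \<in> carrier_mat n m" and X: "X \<in> carrier_mat m r" and p: "primitive_mat n r (A * X)"
  shows "primitive_mat m r X"
proof -
  obtain C where C: "C \<in> carrier_mat r n" "C * (A * X) = 1\<^sub>m r" by (rule primitive_matE[OF p])
  have "(C * A) * X = 1\<^sub>m r" using C A X by (simp add: mat_assoc)
  thus ?thesis by (intro primitive_matI[of _ _ _ "C * A"] X mult_carrier_mat[OF C(1) A])
qed

lemma primitive_append_cols:
  assumes A: "A \<in> carrier_mat n r" and B: "B \<in> carrier_mat n s" and p: "primitive_mat n (r + s) (A @\<^sub>c B)"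
  shows "primitive_mat n r A" "primitive_mat n s B"
proof -
  obtain C where C: "C \<in> carrier_mat (r + s) n" "C * (A @\<^sub>c B) = 1\<^sub>m (r + s)" by (rule primitive_matE[OF p])
  obtain C1 C2 where c: "C1 \<in> carrier_mat r n" "C2 \<in> carrier_mat s n" and Ce: "C = C1 @\<^sub>r C2"
    using append_rows_split[OF C(1)] by metis
  note d = carrier_matD[OF A] carrier_matD[OF B] carrier_matD[OF c(1)] carrier_matD[OF c(2)]
  have o: "1\<^sub>m (r + s) = four_block_mat (1\<^sub>m r) (0\<^sub>m r s) (0\<^sub>m s r) (1\<^sub>m s)" by simp
  have m: "(C1 @\<^sub>r C2) * (A @\<^sub>c B) = four_block_mat (C1 * A) (C1 * B) (C2 * A) (C2 * B)"
    by (rule append_rows_mult_cols) (simp_all add: d)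
  have e: "four_block_mat (C1 * A) (C1 * B) (C2 * A) (C2 * B) = four_block_mat (1\<^sub>m r) (0\<^sub>m r s) (0\<^sub>m s r) (1\<^sub>m s)"
    using C(2) unfolding Ce m o .
  have 1: "C1 * A = 1\<^sub>m r" "C2 * B = 1\<^sub>m s" by (rule four_block_eqD[OF e]; simp add: d)+
  show "primitive_mat n r A" by (rule primitive_matI[OF A c(1) 1(1)])
  show "primitive_mat n s B" by (rule primitive_matI[OF B c(2) 1(2)])
qed

lemma rows_append_cols:
  assumes "dim_row A = dim_row B" "dim_row C = dim_row D" "dim_col A = dim_col C" "dim_col B = dim_col D"
  shows "(A @\<^sub>r C) @\<^sub>c (B @\<^sub>r D) = four_block_mat A B C D"
  unfolding append_rows_def using assms by (intro eq_matI) (auto simp: append_cols_index)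

text \<open>
  A primitive family extends to a basis. By column reduction the first vector may be taken to be a multiple of the first
  unit vector; a left inverse shows that the multiple is a unit and that the remaining vectors stay primitive after
  deleting the first coordinate.
\<close>

lemma primitive_completion:
  assumes "primitive_mat n r B"
  shows "\<exists>s B1. n = r + s \<and> B1 \<in> carrier_mat n s \<and> unimod n (B @\<^sub>c B1)"
  using assms
proof (induction r arbitrary: n B)
  case 0
  note B = carrier_matD[OF primitive_carrier[OF 0]]
  have "B @\<^sub>c 1\<^sub>m n = 1\<^sub>m n" by (rule eq_matI) (simp_all add: append_cols_index B)
  thus ?case by (intro exI[of _ n] exI[of _ "1\<^sub>m n"]) simp
next
  case (Suc r)
  have p: "primitive_mat n (1 + r) B" using Suc.prems by simp
  obtain C where B: "B \<in> carrier_mat n (1 + r)" and C: "C \<in> carrier_mat (1 + r) n" "C * B = 1\<^sub>m (1 + r)"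
    by (rule primitive_matE[OF p])
  have "n \<noteq> 0"
  proof
    assume "n = 0"
    hence "(C * B) $$ (0, 0) = 0" using C(1) B by (simp add: scalar_prod_def)
    thus False unfolding C(2) by simp
  qed
  then obtain k where n: "n = 1 + k" by (metis not0_implies_Suc plus_1_eq_Suc)
  obtain b B' where b: "b \<in> carrier_mat n 1" "B' \<in> carrier_mat n r" and Be: "B = b @\<^sub>c B'" using append_cols_split[OF B] by metis
  obtain h d where h: "unimod (1 + k) h" and hb: "h * b = d \<cdot>\<^sub>m 1\<^sub>m 1 @\<^sub>r 0\<^sub>m k 1"
    using unimod_column[OF b(1)[unfolded n]] by metis
  obtain g where g: "g \<in> carrier_mat (1 + k) (1 + k)" "g * h = 1\<^sub>m (1 + k)" "h * g = 1\<^sub>m (1 + k)" using unimod_inverse[OF h] by metis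
  note hc = unimod_carrier[OF h]
  obtain w B2 where w: "w \<in> carrier_mat 1 r" "B2 \<in> carrier_mat k r" and hB': "h * B' = w @\<^sub>r B2"
    using append_rows_split[OF mult_carrier_mat[OF hc b(2)[unfolded n]]] by metis
  have nk: "dim_row b = 1 + k" "dim_row B' = 1 + k" "dim_row B = 1 + k" "dim_col C = 1 + k" using b B C(1) n by simp_all
  note dd = carrier_matD(2)[OF b(1)] carrier_matD(2)[OF b(2)] carrier_matD(2)[OF B] carrier_matD(1)[OF C(1)] nk
    carrier_matD[OF w(1)] carrier_matD[OF w(2)] carrier_matD[OF g(1)] carrier_matD[OF hc]
  have hB: "h * B = four_block_mat (d \<cdot>\<^sub>m 1\<^sub>m 1) w (0\<^sub>m k 1) B2"
  proof -
    have "h * B = (d \<cdot>\<^sub>m 1\<^sub>m 1 @\<^sub>r 0\<^sub>m k 1) @\<^sub>c (w @\<^sub>r B2)" unfolding Be hb[symmetric] hB'[symmetric] by (rule mult_append_cols) (simp_all add: dd)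
    thus ?thesis by (subst (asm) rows_append_cols) (simp_all add: dd)
  qed
  have Cg: "C * g \<in> carrier_mat (1 + r) (1 + k)" by (rule carrier_matI) (simp_all add: dd)
  obtain c0 c1 c2 C2 where c: "c0 \<in> carrier_mat 1 1" "c1 \<in> carrier_mat 1 k" "c2 \<in> carrier_mat r 1" "C2 \<in> carrier_mat r k"
    and Cge: "C * g = four_block_mat c0 c1 c2 C2" using four_block_split[OF Cg] by metis
  note dc = c[THEN carrier_matD(1)] c[THEN carrier_matD(2)]
  have "(C * g) * (h * B) = C * ((g * h) * B)" by (simp add: mat_assoc dd)
  also have "\<dots> = 1\<^sub>m (1 + r)" unfolding g(2) using C(2) by (simp add: mat_one_mult dd)
  finally have "four_block_mat (c0 * (d \<cdot>\<^sub>m 1\<^sub>m 1) + c1 * 0\<^sub>m k 1) (c0 * w + c1 * B2) (c2 * (d \<cdot>\<^sub>m 1\<^sub>m 1) + C2 * 0\<^sub>m k 1) (c2 * w + C2 * B2)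
      = 1\<^sub>m (1 + r)"
    unfolding Cge hB by (subst (asm) four_block_mult) (simp_all only: dc dd index_smult_mat index_one_mat index_zero_mat)
  hence e: "four_block_mat (c0 * (d \<cdot>\<^sub>m 1\<^sub>m 1) + c1 * 0\<^sub>m k 1) (c0 * w + c1 * B2) (c2 * (d \<cdot>\<^sub>m 1\<^sub>m 1) + C2 * 0\<^sub>m k 1) (c2 * w + C2 * B2)
      = four_block_mat (1\<^sub>m 1) (0\<^sub>m 1 r) (0\<^sub>m r 1) (1\<^sub>m r)" by simp
  have e1: "c0 * (d \<cdot>\<^sub>m 1\<^sub>m 1) + c1 * 0\<^sub>m k 1 = 1\<^sub>m 1" "c2 * (d \<cdot>\<^sub>m 1\<^sub>m 1) + C2 * 0\<^sub>m k 1 = 0\<^sub>m r 1" "c2 * w + C2 * B2 = 1\<^sub>m r"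
    by (rule four_block_eqD[OF e]; simp add: dc dd)+
  have "d \<cdot>\<^sub>m c0 = 1\<^sub>m 1" using e1(1) by (simp add: mat_mult_smult mat_mult_one mat_mult_zero mat_add_zero dc)
  hence "(d \<cdot>\<^sub>m c0) $$ (0, 0) = 1" by simp
  hence "d * c0 $$ (0, 0) = 1" by (simp add: dc)
  hence dabs: "\<bar>d\<bar> = 1" using abs_zmult_eq_1[of d "c0 $$ (0, 0)"] by simp
  have dc2: "d \<cdot>\<^sub>m c2 = 0\<^sub>m r 1" using e1(2) by (simp add: mat_mult_smult mat_mult_one mat_mult_zero mat_add_zero dc)
  have "c2 = 0\<^sub>m r 1"
  proof (rule eq_matI)
    fix i j assume ij: "i < dim_row (0\<^sub>m r 1 :: int mat)" "j < dim_col (0\<^sub>m r 1 :: int mat)"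
    have "d * c2 $$ (i, j) = 0" using arg_cong[OF dc2, of "\<lambda>M. M $$ (i, j)"] ij by (simp add: dc)
    thus "c2 $$ (i, j) = 0\<^sub>m r 1 $$ (i, j)" using dabs ij by auto
  qed (simp_all add: dc)
  hence "C2 * B2 = 1\<^sub>m r" using e1(3) by (simp add: mat_zero_mult mat_zero_add dc dd)
  from Suc.IH[OF primitive_matI[OF w(2) c(4) this]]
  obtain s B3 where k: "k = r + s" and B3: "B3 \<in> carrier_mat k s" and u: "unimod k (B2 @\<^sub>c B3)" by blast
  let ?B1 = "g * (0\<^sub>m 1 s @\<^sub>r B3)"
  have B1: "?B1 \<in> carrier_mat n s" by (rule carrier_matI) (simp_all add: dd n)
  let ?M = "four_block_mat (d \<cdot>\<^sub>m 1\<^sub>m 1) (w @\<^sub>c 0\<^sub>m 1 s) (0\<^sub>m k 1) (B2 @\<^sub>c B3)"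
  have hB1: "h * ?B1 = 0\<^sub>m 1 s @\<^sub>r B3"
  proof -
    have "h * ?B1 = (h * g) * (0\<^sub>m 1 s @\<^sub>r B3)" by (simp add: mat_assoc dd carrier_matD[OF B3])
    thus ?thesis unfolding g(3) by (simp add: mat_one_mult carrier_matD[OF B3])
  qed
  have "h * (B @\<^sub>c ?B1) = h * B @\<^sub>c h * ?B1" by (rule mult_append_cols) (simp_all add: dd)
  also have "\<dots> = ?M" unfolding hB1 hB unfolding append_rows_def
    by (rule eq_matI) (auto simp: append_cols_index dd carrier_matD[OF B3])
  finally have "det h * det (B @\<^sub>c ?B1) = det ?M"
    using det_mult[of h "1 + k" "B @\<^sub>c ?B1"] hc append_cols_carrier[OF B B1] unfolding n k by (simp add: add.assoc)
  also have "\<dots> = det (d \<cdot>\<^sub>m 1\<^sub>m 1) * det (B2 @\<^sub>c B3)"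
    by (rule det_four_block_mat_lower_left_zero[of _ 1 _ k]) (use unimod_carrier[OF u] in \<open>auto intro!: carrier_matI simp: dd carrier_matD[OF B3] k\<close>)
  also have "det (d \<cdot>\<^sub>m 1\<^sub>m 1) = d" by (simp add: det_single)
  finally have "\<bar>det h\<bar> * \<bar>det (B @\<^sub>c ?B1)\<bar> = \<bar>d\<bar> * \<bar>det (B2 @\<^sub>c B3)\<bar>" unfolding abs_mult[symmetric] by simp
  hence "\<bar>det (B @\<^sub>c ?B1)\<bar> = 1" using dabs h u unfolding unimod_iff_det by simp
  moreover have "B @\<^sub>c ?B1 \<in> carrier_mat n n" by (rule carrier_matI) (simp_all add: dd n k carrier_matD[OF B3])
  ultimately show ?case using n k B1 unfolding unimod_iff_det by (intro exI[of _ s] exI[of _ ?B1]) simp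
qed

lemma hyperbolic_expansion:
  assumes S: "S \<in> carrier_mat n n" "S\<^sup>T = S" and E: "E \<in> carrier_mat n k" and F: "F \<in> carrier_mat n k"
    and g: "E\<^sup>T * S * E = 0\<^sub>m k k" "F\<^sup>T * S * F = 0\<^sub>m k k" "E\<^sup>T * S * F = 1\<^sub>m k" "F\<^sup>T * S * E = (1\<^sub>m k :: int mat)" and n: "n = k + k"
  shows "E * (F\<^sup>T * S) + F * (E\<^sup>T * S) = 1\<^sub>m n" "unimod n (E @\<^sub>c F)"
proof -
  note hi = hyperbolic_basis_inverse[OF S E F g]
  have c: "(F\<^sup>T * S) @\<^sub>r (E\<^sup>T * S) \<in> carrier_mat (k + k) (k + k)" "E @\<^sub>c F \<in> carrier_mat (k + k) (k + k)"
    using S(1) E F unfolding n by (intro carrier_matI; simp)+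
  show "E * (F\<^sup>T * S) + F * (E\<^sup>T * S) = 1\<^sub>m n" unfolding hi(2)[symmetric] n by (rule unimodI(3)[OF c hi(1)])
  show "unimod n (E @\<^sub>c F)" unfolding n by (rule unimodI(2)[OF c hi(1)])
qed

lemma expansion_apply:
  assumes e: "E * (F\<^sup>T * S) + F * (E\<^sup>T * S) = (1\<^sub>m n :: int mat)"
    and c: "S \<in> carrier_mat n n" "E \<in> carrier_mat n k" "F \<in> carrier_mat n k" "Y \<in> carrier_mat n l"
  shows "Y = E * (F\<^sup>T * S * Y) + F * (E\<^sup>T * S * Y)"
proof -
  note d = c[THEN carrier_matD(1)] c[THEN carrier_matD(2)]
  have "Y = (E * (F\<^sup>T * S) + F * (E\<^sup>T * S)) * Y" unfolding e by (simp add: mat_one_mult d)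
  also have "\<dots> = E * (F\<^sup>T * S * Y) + F * (E\<^sup>T * S * Y)" by (simp add: mat_add_mult mat_assoc d)
  finally show ?thesis .
qed

text \<open>
  The projection along a line in the radical and the inclusion of a complement are inverse to each other up to the radical.
\<close>

lemma zs_equiv_radical:
  assumes v: "v \<in> carrier_mat (1 + j) (1 + j)" and w: "w \<in> carrier_mat j j" and U: "unimod (1 + j) U"
    and e: "U\<^sup>T * symm 1 v * U = 0\<^sub>m 1 1 \<oplus>\<^sub>m symm 1 w"
  shows "zs_equiv v w"
proof -
  define n where "n = 1 + j"
  note v = v[folded n_def] and U = U[folded n_def]
  note Uc = unimod_carrier[OF U]
  obtain V where V: "V \<in> carrier_mat n n" "U * V = 1\<^sub>m n" "V * U = 1\<^sub>m n" using unimod_inverse[OF U] by metis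
  define P where "P = (0\<^sub>m j 1 @\<^sub>c 1\<^sub>m j :: int mat)"
  have P: "P \<in> carrier_mat j n" unfolding P_def n_def by (rule append_cols_carrier) simp_all
  have PT: "P\<^sup>T = 0\<^sub>m 1 j @\<^sub>r 1\<^sub>m j" unfolding P_def by (subst transpose_append_cols) simp_all
  have PP: "P * P\<^sup>T = 1\<^sub>m j" unfolding PT unfolding P_def by (subst append_cols_mult_rows) (simp_all add: mat_arith)
  note d = carrier_matD[OF Uc] carrier_matD[OF V(1)] carrier_matD[OF P] carrier_matD[OF v] carrier_matD[OF w]
  have PwP: "P\<^sup>T * symm 1 w * P = 0\<^sub>m 1 1 \<oplus>\<^sub>m symm 1 w"
  proof -
    have "P\<^sup>T * symm 1 w = 0\<^sub>m 1 j @\<^sub>r symm 1 w" unfolding PT by (subst append_rows_mult) (simp_all add: mat_arith d)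
    thus ?thesis unfolding P_def by (simp add: append_rows_mult_cols mat_arith d mat_sum_def)
  qed
  have VT: "V\<^sup>T * U\<^sup>T = 1\<^sub>m n" using arg_cong[OF V(2), of transpose_mat] by (simp add: mat_transpose_mult d)
  have "symm 1 v = (V\<^sup>T * U\<^sup>T) * symm 1 v * (U * V)" unfolding VT V(2) by (simp add: mat_arith d)
  also have "\<dots> = V\<^sup>T * (U\<^sup>T * symm 1 v * U) * V" by (simp add: mat_assoc d)
  also have "\<dots> = (P * V)\<^sup>T * symm 1 w * (P * V)" unfolding e PwP[symmetric] by (simp add: mat_assoc mat_transpose_mult d)
  finally have 1: "symm 1 v = (P * V)\<^sup>T * symm 1 w * (P * V)" .
  have "symm 1 w * (P * V) * (U * P\<^sup>T) = symm 1 w * (P * ((V * U) * P\<^sup>T))" by (simp add: mat_assoc d)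
  also have "\<dots> = symm 1 w" unfolding V(3) by (simp add: mat_one_mult d PP mat_mult_one)
  finally have 2: "symm 1 w * (P * V) * (U * P\<^sup>T) = symm 1 w" .
  show ?thesis
    by (rule zs_equivI[OF v w _ _ 1 2]) (rule carrier_matI; simp add: d)+
qed

lemma zs_equiv_congruence:
  assumes v: "v \<in> carrier_mat n n" and U: "unimod n U"
  shows "zs_equiv v (U\<^sup>T * v * U)"
proof -
  note Uc = unimod_carrier[OF U]
  obtain V where V: "V \<in> carrier_mat n n" "U * V = 1\<^sub>m n" "V * U = 1\<^sub>m n" using unimod_inverse[OF U] by metis
  note d = carrier_matD[OF Uc] carrier_matD[OF V(1)] carrier_matD[OF v]
  have c: "U\<^sup>T * v * U \<in> carrier_mat n n" by (rule carrier_matI) (simp_all add: d)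
  have VT: "V\<^sup>T * U\<^sup>T = 1\<^sub>m n" using arg_cong[OF V(2), of transpose_mat] by (simp add: mat_transpose_mult d)
  have "symm 1 v = (V\<^sup>T * U\<^sup>T) * symm 1 v * (U * V)" unfolding VT V(2) by (simp add: mat_arith d)
  also have "\<dots> = V\<^sup>T * symm 1 (U\<^sup>T * v * U) * V" unfolding symm_congruence[OF v Uc] by (simp add: mat_assoc d)
  finally have 1: "symm 1 v = V\<^sup>T * symm 1 (U\<^sup>T * v * U) * V" .
  have "symm 1 (U\<^sup>T * v * U) * V * U = symm 1 (U\<^sup>T * v * U) * (V * U)" by (rule mat_assoc) (simp_all add: d)
  hence 2: "symm 1 (U\<^sup>T * v * U) * V * U = symm 1 (U\<^sup>T * v * U)" unfolding V(3) by (simp add: mat_mult_one d)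
  show ?thesis by (rule zs_equivI[OF v c V(1) Uc 1 2])
qed

lemma qf_valid_unimod:
  assumes v: "qf_valid n k \<psi> E B" and U: "unimod k U" and W: "unimod k W"
  shows "qf_valid n k \<psi> (E * U) (B * W)" "qf_of \<psi> (E * U) (B * W) = qf_of \<psi> E B"
proof -
  note d = qf_validD[OF v]
  have "(E * U)\<^sup>T * symm 1 \<psi> * (E * U) = U\<^sup>T * (E\<^sup>T * symm 1 \<psi> * E) * U"
    by (rule congruence_mult[OF symm_carrier[OF d(2)] d(7) unimod_carrier[OF U]])
  also have "\<dots> = 0\<^sub>m k k" unfolding d(5) using unimod_carrier[OF U] by (simp add: mat_arith)
  finally show "qf_valid n k \<psi> (E * U) (B * W)" by (intro qf_validI d(1-3) primitive_unimod[OF d(4) U] primitive_unimod[OF d(6) W])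
  show "qf_of \<psi> (E * U) (B * W) = qf_of \<psi> E B"
    unfolding qf_of_def mat_image_unimod[OF d(7) U] mat_image_unimod[OF d(8) W] ..
qed

text \<open>Together with a dual isotropic family, a basis of a Lagrangian identifies the form with the standard hyperbolic one.\<close>

lemma lagrangian_standard:
  assumes v: "qf_valid n k \<psi> E B"
  obtains X where "qf_valid (k + k) k (hyperbolic k) (std_lag k) X" "l1_eq (qf_of (hyperbolic k) (std_lag k) X) (qf_of \<psi> E B)"
    "symm 1 (X\<^sup>T * hyperbolic k * X) = symm 1 (B\<^sup>T * \<psi> * B)"
    "l1_null (qf_of \<psi> E E)"
proof -
  note d = qf_validD[OF v]
  have S: "symm 1 \<psi> \<in> carrier_mat n n" "(symm 1 \<psi>)\<^sup>T = symm 1 \<psi>" using d(2) symm_transpose[OF d(2)] by simp_all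
  obtain F where F: "F \<in> carrier_mat n k" "F\<^sup>T * symm 1 \<psi> * F = 0\<^sub>m k k" "E\<^sup>T * symm 1 \<psi> * F = 1\<^sub>m k"
    "F\<^sup>T * symm 1 \<psi> * E = 1\<^sub>m k" by (rule dual_basis[OF d(2,3,4,5)])
  note ex = hyperbolic_expansion[OF S d(7) F(1) d(5) F(2-4) d(1)]
  define X where "X = F\<^sup>T * symm 1 \<psi> * B @\<^sub>r E\<^sup>T * symm 1 \<psi> * B"
  note dm = carrier_matD[OF d(7)] carrier_matD[OF d(8)] carrier_matD[OF F(1)] carrier_matD[OF d(2)]
  have X: "X \<in> carrier_mat (k + k) k" unfolding X_def by (rule carrier_matI) (simp_all add: dm)
  have gX: "(E @\<^sub>c F) * X = B" unfolding X_def
    by (subst append_cols_mult_rows) (simp_all add: dm expansion_apply[OF ex(1) S(1) d(7) F(1) d(8), symmetric])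
  have gl: "(E @\<^sub>c F) * std_lag k = E" unfolding std_lag_def by (subst append_cols_mult_rows) (simp_all add: dm mat_arith)
  have pX: "primitive_mat (k + k) k X"
    by (rule primitive_factor[of "E @\<^sub>c F" n]) (use append_cols_carrier[OF d(7) F(1)] X d(6) in \<open>simp_all add: gX\<close>)
  have s: "symm 1 (hyperbolic k) = (E @\<^sub>c F)\<^sup>T * symm 1 \<psi> * (E @\<^sub>c F)"
    unfolding symm_hyperbolic by (subst gram_append_cols[OF S(1)]) (simp_all add: dm d(5) F)
  note st = std_valid(1)[OF pX] std_valid(1)[OF std_primitive(1)[of k]]
  note iso = l1_eq_isoI(1)[OF st(1)[folded d(1)] ex(2) d(2) s, unfolded gX gl]
  note iso' = l1_eq_isoI(1)[OF st(2)[folded d(1)] ex(2) d(2) s, unfolded gl]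
  have "symm 1 (X\<^sup>T * hyperbolic k * X) = X\<^sup>T * ((E @\<^sub>c F)\<^sup>T * symm 1 \<psi> * (E @\<^sub>c F)) * X"
    unfolding symm_congruence[OF hyperbolic_carrier X] s ..
  also have "\<dots> = B\<^sup>T * symm 1 \<psi> * B" unfolding congruence_mult[OF S(1) append_cols_carrier[OF d(7) F(1)] X, symmetric] gX ..
  finally have "symm 1 (X\<^sup>T * hyperbolic k * X) = symm 1 (B\<^sup>T * \<psi> * B)" unfolding symm_congruence[OF d(2) d(8)] .
  thus ?thesis by (rule that[OF st(1) iso _ l1_null_eq[OF l1_eq.sym[OF iso'] l1_null_same]])
qed

section \<open>Reduction to nonsingular restrictions\<close>

lemma l1_null_flip_first:
  "qf_valid ((1 + 1) + (j + j)) (1 + j) (hyperbolic 1 \<oplus>\<^sub>m hyperbolic j) (std_colag 1 \<oplus>\<^sub>m std_lag j) (std_lag 1 \<oplus>\<^sub>m std_lag j)"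
  "l1_null (qf_of (hyperbolic 1 \<oplus>\<^sub>m hyperbolic j) (std_colag 1 \<oplus>\<^sub>m std_lag j) (std_lag 1 \<oplus>\<^sub>m std_lag j))"
proof -
  show "qf_valid ((1 + 1) + (j + j)) (1 + j) (hyperbolic 1 \<oplus>\<^sub>m hyperbolic j) (std_colag 1 \<oplus>\<^sub>m std_lag j) (std_lag 1 \<oplus>\<^sub>m std_lag j)"
    by (rule qf_valid_sum[OF std_valid(2)[OF std_primitive(1)] std_valid(1)[OF std_primitive(1)]])
  have "qf_sum (qf_of (hyperbolic 1) (std_colag 1) (std_lag 1)) (qf_of (hyperbolic j) (std_lag j) (std_lag j)) =
      qf_of (hyperbolic 1 \<oplus>\<^sub>m hyperbolic j) (std_colag 1 \<oplus>\<^sub>m std_lag j) (std_lag 1 \<oplus>\<^sub>m std_lag j)"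
    by (rule qf_sum_of) (rule std_lag_carrier)+
  from l1_null_add[OF l1_null_flip[of 1] l1_null_same[of j], unfolded this]
  show "l1_null (qf_of (hyperbolic 1 \<oplus>\<^sub>m hyperbolic j) (std_colag 1 \<oplus>\<^sub>m std_lag j) (std_lag 1 \<oplus>\<^sub>m std_lag j))" .
qed

text \<open>
  Every isotropic vector \<open>y\<close> lies in a Lagrangian that differs from the given one by a trivial class. The basis of the
  given Lagrangian can be chosen such that only its first vector \<open>e\<close> pairs nontrivially with \<open>y\<close>. Since \<open>y\<close> is isotropic,
  it is then a combination of the dual vector \<open>f\<close> and the remaining basis vectors, and exchanging \<open>e\<close> for \<open>f\<close>
  is a flip of one hyperbolic plane.
\<close>

lemma isotropic_column_in_lagrangian:
  assumes v: "qf_valid n k \<psi> E B" and y: "y \<in> carrier_mat n 1" "y\<^sup>T * symm 1 \<psi> * y = 0\<^sub>m 1 1"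
  shows "\<exists>E' a. qf_valid n k \<psi> E' B \<and> a \<in> carrier_mat k 1 \<and> y = E' * a \<and> l1_null (qf_of \<psi> E' E)"
proof -
  note d = qf_validD[OF v]
  define S where "S = symm 1 \<psi>"
  have S: "S \<in> carrier_mat n n" "S\<^sup>T = S" unfolding S_def using d(2) symm_transpose[OF d(2)] by simp_all
  obtain F where F: "F \<in> carrier_mat n k" "F\<^sup>T * S * F = 0\<^sub>m k k" "E\<^sup>T * S * F = 1\<^sub>m k" "F\<^sup>T * S * E = 1\<^sub>m k"
    unfolding S_def by (rule dual_basis[OF d(2,3,4,5)])
  have EE: "E\<^sup>T * S * E = 0\<^sub>m k k" unfolding S_def by (rule d(5))
  note ex = hyperbolic_expansion[OF S d(7) F(1) EE F(2-4) d(1)]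
  note yex = expansion_apply[OF ex(1) S(1) d(7) F(1) y(1)]
  define c where "c = E\<^sup>T * S * y"
  note dm = carrier_matD[OF d(7)] carrier_matD[OF F(1)] carrier_matD[OF S(1)] carrier_matD[OF y(1)]
  have c: "c \<in> carrier_mat k 1" unfolding c_def by (rule carrier_matI) (simp_all add: dm)
  show ?thesis
  proof (cases "c = 0\<^sub>m k 1")
    case True
    have "y = E * (F\<^sup>T * S * y) + F * 0\<^sub>m k 1" using yex unfolding c_def[symmetric] True .
    hence "y = E * (F\<^sup>T * S * y)" by (simp add: mat_arith dm)
    moreover have "F\<^sup>T * S * y \<in> carrier_mat k 1" by (rule carrier_matI) (simp_all add: dm)
    moreover have "l1_null (qf_of \<psi> E E)" by (rule lagrangian_standard[OF v])
    ultimately show ?thesis using v by (intro exI[of _ E] exI[of _ "F\<^sup>T * S * y"] conjI)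
  next
    case False
    have "k \<noteq> 0"
    proof
      assume "k = 0"
      hence "c = 0\<^sub>m k 1" using carrier_matD[OF c] by (intro eq_matI) simp_all
      with False show False ..
    qed
    then obtain j where k: "k = 1 + j" by (metis not0_implies_Suc plus_1_eq_Suc)
    obtain h x where h: "unimod k h" and hc: "h * c = x \<cdot>\<^sub>m 1\<^sub>m 1 @\<^sub>r 0\<^sub>m j 1"
      using unimod_column[OF c[unfolded k]] unfolding k by metis
    obtain g where g: "unimod k g" "g \<in> carrier_mat k k" "h * g = 1\<^sub>m k" "g * h = 1\<^sub>m k" using unimod_inverse[OF h] by metis
    note hcar = unimod_carrier[OF h]
    note dm = dm carrier_matD[OF g(2)] carrier_matD[OF hcar] carrier_matD[OF c]
    have x: "x \<noteq> 0"
    proof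
      assume "x = 0"
      hence "h * c = 0\<^sub>m k 1" unfolding hc k by (intro eq_matI) (auto simp: append_rows_def)
      hence "g * (h * c) = 0\<^sub>m k 1" by (simp add: mat_mult_zero dm)
      moreover have "g * (h * c) = (g * h) * c" by (simp add: mat_assoc dm)
      ultimately have "c = 0\<^sub>m k 1" unfolding g(4) by (simp add: mat_one_mult dm)
      with False show False ..
    qed
    define E1 F1 where "E1 = E * h\<^sup>T" and "F1 = F * g"
    have E1: "E1 \<in> carrier_mat n k" and F1: "F1 \<in> carrier_mat n k" unfolding E1_def F1_def by (rule carrier_matI; simp add: dm)+
    note dm = dm carrier_matD[OF E1] carrier_matD[OF F1]
    have gh: "g\<^sup>T * h\<^sup>T = 1\<^sub>m k" using arg_cong[OF g(3), of transpose_mat] by (simp add: mat_transpose_mult dm)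
    have 1: "E1\<^sup>T * S * E1 = 0\<^sub>m k k"
    proof -
      have "E1\<^sup>T * S * E1 = h * (E\<^sup>T * S * E) * h\<^sup>T" unfolding E1_def by (simp add: mat_assoc mat_transpose_mult dm)
      thus ?thesis unfolding EE by (simp add: mat_arith dm)
    qed
    have 2: "F1\<^sup>T * S * F1 = 0\<^sub>m k k"
    proof -
      have "F1\<^sup>T * S * F1 = g\<^sup>T * (F\<^sup>T * S * F) * g" unfolding F1_def by (simp add: mat_assoc mat_transpose_mult dm)
      thus ?thesis unfolding F(2) by (simp add: mat_arith dm)
    qed
    have 3: "E1\<^sup>T * S * F1 = 1\<^sub>m k"
    proof -
      have "E1\<^sup>T * S * F1 = h * (E\<^sup>T * S * F) * g" unfolding E1_def F1_def by (simp add: mat_assoc mat_transpose_mult dm)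
      thus ?thesis unfolding F(3) by (simp add: mat_arith dm g(3))
    qed
    have 4: "F1\<^sup>T * S * E1 = 1\<^sub>m k"
      using arg_cong[OF 3, of transpose_mat] S(2) by (simp add: mat_transpose_mult mat_assoc dm)
    note ex1 = hyperbolic_expansion[OF S E1 F1 1 2 3 4 d(1)]
    obtain e E0 where e: "e \<in> carrier_mat n 1" "E0 \<in> carrier_mat n j" and E1e: "E1 = e @\<^sub>c E0" using append_cols_split[OF E1[unfolded k]] by metis
    obtain f F0 where f: "f \<in> carrier_mat n 1" "F0 \<in> carrier_mat n j" and F1e: "F1 = f @\<^sub>c F0" using append_cols_split[OF F1[unfolded k]] by metis
    have E1y: "E1\<^sup>T * S * y = x \<cdot>\<^sub>m 1\<^sub>m 1 @\<^sub>r 0\<^sub>m j 1"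
      unfolding hc[symmetric] c_def E1_def by (simp add: mat_assoc mat_transpose_mult dm)
    have F1y: "F1\<^sup>T * S * y \<in> carrier_mat (1 + j) 1" unfolding k[symmetric] by (rule carrier_matI) (simp_all add: dm)
    obtain \<alpha> a0 where a: "\<alpha> \<in> carrier_mat 1 1" "a0 \<in> carrier_mat j 1" and F1ye: "F1\<^sup>T * S * y = \<alpha> @\<^sub>r a0"
      using append_rows_split[OF F1y] by metis
    note yex1 = expansion_apply[OF ex1(1) S(1) E1 F1 y(1)]
    note de = carrier_matD[OF e(1)] carrier_matD[OF e(2)] carrier_matD[OF f(1)] carrier_matD[OF f(2)] carrier_matD[OF a(1)] carrier_matD[OF a(2)]
    have yE: "y\<^sup>T * S * E1 = (E1\<^sup>T * S * y)\<^sup>T" "y\<^sup>T * S * F1 = (F1\<^sup>T * S * y)\<^sup>T"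
      using S(2) by (simp_all add: mat_transpose_mult mat_assoc dm)
    have "y\<^sup>T * S * y = y\<^sup>T * S * (E1 * (F1\<^sup>T * S * y) + F1 * (E1\<^sup>T * S * y))" using yex1 by simp
    also have "\<dots> = (E1\<^sup>T * S * y)\<^sup>T * (F1\<^sup>T * S * y) + (F1\<^sup>T * S * y)\<^sup>T * (E1\<^sup>T * S * y)"
      unfolding yE[symmetric] by (simp add: mat_mult_add mat_assoc dm)
    also have "(E1\<^sup>T * S * y)\<^sup>T * (F1\<^sup>T * S * y) = x \<cdot>\<^sub>m \<alpha>"
    proof -
      have t: "(x \<cdot>\<^sub>m 1\<^sub>m 1 @\<^sub>r 0\<^sub>m j 1)\<^sup>T = x \<cdot>\<^sub>m 1\<^sub>m 1 @\<^sub>c 0\<^sub>m 1 j" by (rule eq_matI) (auto simp: append_rows_def append_cols_index)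
      show ?thesis unfolding E1y F1ye t by (subst append_cols_mult_rows) (simp_all add: mat_arith de)
    qed
    also have "(F1\<^sup>T * S * y)\<^sup>T * (E1\<^sup>T * S * y) = x \<cdot>\<^sub>m \<alpha>\<^sup>T"
    proof -
      have t: "(\<alpha> @\<^sub>r a0)\<^sup>T = \<alpha>\<^sup>T @\<^sub>c a0\<^sup>T" by (rule eq_matI) (auto simp: append_rows_def append_cols_index de)
      show ?thesis unfolding E1y F1ye t by (subst append_cols_mult_rows) (simp_all add: mat_arith de)
    qed
    finally have "x \<cdot>\<^sub>m \<alpha> + x \<cdot>\<^sub>m \<alpha>\<^sup>T = 0\<^sub>m 1 1" using y(2) unfolding S_def[symmetric] by simp
    hence "(x \<cdot>\<^sub>m \<alpha> + x \<cdot>\<^sub>m \<alpha>\<^sup>T) $$ (0, 0) = 0" by simp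
    hence "2 * (x * \<alpha> $$ (0, 0)) = 0" by (simp add: de)
    hence "\<alpha> $$ (0, 0) = 0" using x by simp
    hence \<alpha>: "\<alpha> = 0\<^sub>m 1 1" by (intro eq_matI) (simp_all add: de)
    have "y = E1 * (\<alpha> @\<^sub>r a0) + F1 * (x \<cdot>\<^sub>m 1\<^sub>m 1 @\<^sub>r 0\<^sub>m j 1)" using yex1 unfolding E1y F1ye .
    also have "E1 * (\<alpha> @\<^sub>r a0) = E0 * a0" unfolding E1e \<alpha> by (subst append_cols_mult_rows) (simp_all add: mat_arith de)
    also have "F1 * (x \<cdot>\<^sub>m 1\<^sub>m 1 @\<^sub>r 0\<^sub>m j 1) = x \<cdot>\<^sub>m f" unfolding F1e by (subst append_cols_mult_rows) (simp_all add: mat_arith de)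
    also have "E0 * a0 + x \<cdot>\<^sub>m f = (f @\<^sub>c E0) * (x \<cdot>\<^sub>m 1\<^sub>m 1 @\<^sub>r a0)"
      by (subst append_cols_mult_rows) (auto simp: mat_mult_smult mat_mult_one de intro!: comm_add_mat[of _ n 1] carrier_matI)
    finally have ye: "y = (f @\<^sub>c E0) * (x \<cdot>\<^sub>m 1\<^sub>m 1 @\<^sub>r a0)" .
    have ac: "x \<cdot>\<^sub>m 1\<^sub>m 1 @\<^sub>r a0 \<in> carrier_mat k 1" unfolding k by (rule carrier_matI) (simp_all add: de)
    have n: "n = (1 + j) + (1 + j)" using d(1) unfolding k .
    note sp = split_hyperbolic_plane[OF d(2,3) n e(1) f(1) e(2) f(2) 1[unfolded E1e k S_def] 2[unfolded F1e k S_def] 3[unfolded E1e F1e k S_def]]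
    define G where "G = (e @\<^sub>c f) @\<^sub>c (E0 @\<^sub>c F0)"
    note sp = sp[folded G_def]
    have n': "n = (1 + 1) + (j + j)" using n by simp
    have i1: "G * (std_lag 1 \<oplus>\<^sub>m std_lag j) = E1" unfolding sp(4)[OF std_lag_carrier(1)] sp(6) E1e ..
    have i2: "G * (std_colag 1 \<oplus>\<^sub>m std_lag j) = f @\<^sub>c E0" unfolding sp(5)[OF std_lag_carrier(1)] sp(6) ..
    note iso = l1_eq_isoI[OF l1_null_flip_first(1)[of j, folded n' k] sp(1) d(2) sp(2), unfolded i1 i2]
    have im: "qf_of \<psi> (f @\<^sub>c E0) E1 = qf_of \<psi> (f @\<^sub>c E0) E"
      unfolding qf_of_def E1_def mat_image_unimod[OF d(7) unimod_transpose[OF h]] ..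
    have "l1_null (qf_of \<psi> (f @\<^sub>c E0) E)"
      by (rule l1_null_eq[OF l1_eq.sym[OF iso(1)[unfolded im]] l1_null_flip_first(2)])
    moreover have "qf_valid n k \<psi> (f @\<^sub>c E0) B" by (intro qf_validI d(1-3) qf_validD(4,5)[OF iso(2)] d(6))
    ultimately show ?thesis using ye ac by (intro exI[of _ "f @\<^sub>c E0"] exI[of _ "x \<cdot>\<^sub>m 1\<^sub>m 1 @\<^sub>r a0"] conjI)
  qed
qed

text \<open>
  If the Lagrangian and the summand share a vector \<open>y\<close> that is orthogonal to the summand, then \<open>y\<close> can be divided out, as in
  algebraic surgery: the form is a hyperbolic plane containing \<open>y\<close> plus the form on \<open>y\<^sup>\<bottom>/y\<close>, the summand
  is compatible with this decomposition, and on the plane the quasi-formation becomes trivial after a flip.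
\<close>

lemma reduce_common_column:
  assumes v: "qf_valid n (1 + j) \<psi> (y @\<^sub>c E0) (y @\<^sub>c B')"
    and c: "y \<in> carrier_mat n 1" "E0 \<in> carrier_mat n j" "B' \<in> carrier_mat n j" and yB: "y\<^sup>T * symm 1 \<psi> * B' = 0\<^sub>m 1 j"
  shows "\<exists>B1. qf_valid (j + j) j (hyperbolic j) (std_lag j) B1 \<and>
    l1_eq (qf_of \<psi> (y @\<^sub>c E0) (y @\<^sub>c B')) (qf_of (hyperbolic j) (std_lag j) B1) \<and>
    zs_equiv ((y @\<^sub>c B')\<^sup>T * \<psi> * (y @\<^sub>c B')) (B1\<^sup>T * hyperbolic j * B1)"
proof -
  note d = qf_validD[OF v]
  define S where "S = symm 1 \<psi>"
  have S: "S \<in> carrier_mat n n" "S\<^sup>T = S" unfolding S_def using d(2) symm_transpose[OF d(2)] by simp_all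
  obtain F where F: "F \<in> carrier_mat n (1 + j)" "F\<^sup>T * S * F = 0\<^sub>m (1 + j) (1 + j)" "(y @\<^sub>c E0)\<^sup>T * S * F = 1\<^sub>m (1 + j)"
    "F\<^sup>T * S * (y @\<^sub>c E0) = 1\<^sub>m (1 + j)" unfolding S_def by (rule dual_basis[OF d(2,3,4,5)])
  note EE = d(5)[folded S_def]
  note ex = hyperbolic_expansion[OF S d(7) F(1) EE F(2-4) d(1)]
  obtain z F0 where z: "z \<in> carrier_mat n 1" "F0 \<in> carrier_mat n j" and Fe: "F = z @\<^sub>c F0" using append_cols_split[OF F(1)] by metis
  note dm = c[THEN carrier_matD(1)] c[THEN carrier_matD(2)] z[THEN carrier_matD(1)] z[THEN carrier_matD(2)] carrier_matD[OF S(1)]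
  define G where "G = (y @\<^sub>c z) @\<^sub>c (E0 @\<^sub>c F0)"
  note sp = split_hyperbolic_plane[OF d(2,3,1) c(1) z(1) c(2) z(2) EE[unfolded S_def] F(2,3)[unfolded Fe S_def], folded G_def]
  have o: "1\<^sub>m (1 + j) = four_block_mat (1\<^sub>m 1) (0\<^sub>m 1 j) (0\<^sub>m j 1) (1\<^sub>m j)"
    and o0: "0\<^sub>m (1 + j) (1 + j) = four_block_mat (0\<^sub>m 1 1) (0\<^sub>m 1 j) (0\<^sub>m j 1) (0\<^sub>m j j)" by simp_all
  have FE: "four_block_mat (z\<^sup>T * S * y) (z\<^sup>T * S * E0) (F0\<^sup>T * S * y) (F0\<^sup>T * S * E0) = four_block_mat (1\<^sub>m 1) (0\<^sub>m 1 j) (0\<^sub>m j 1) (1\<^sub>m j)"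
    using F(4) unfolding Fe o by (subst (asm) gram_append_cols[OF S(1)]) (simp_all only: dm)
  have EE': "four_block_mat (y\<^sup>T * S * y) (y\<^sup>T * S * E0) (E0\<^sup>T * S * y) (E0\<^sup>T * S * E0) = four_block_mat (0\<^sub>m 1 1) (0\<^sub>m 1 j) (0\<^sub>m j 1) (0\<^sub>m j j)"
    using EE unfolding o0 by (subst (asm) gram_append_cols[OF S(1)]) (simp_all only: dm)
  have zy: "z\<^sup>T * S * y = 1\<^sub>m 1" by (rule four_block_eqD(1)[OF FE]) (simp_all add: dm)
  have yy: "y\<^sup>T * S * y = 0\<^sub>m 1 1" by (rule four_block_eqD(1)[OF EE']) (simp_all add: dm)
  \<comment> \<open>Adding \<open>y * w\<close> makes \<open>B'\<close> orthogonal to the dual vector \<open>z\<close>.\<close>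
  define w where "w = - (z\<^sup>T * S * B')"
  have w: "w \<in> carrier_mat 1 j" unfolding w_def by (rule carrier_matI) (simp_all add: dm)
  define B2 where "B2 = y * w + B'"
  have B2: "B2 \<in> carrier_mat n j" unfolding B2_def by (rule carrier_matI) (simp_all add: dm)
  note dm = dm carrier_matD[OF w] carrier_matD[OF B2]
  define U where "U = four_block_mat (1\<^sub>m 1) w (0\<^sub>m j 1) (1\<^sub>m j)"
  have "det U = det (1\<^sub>m 1) * det (1\<^sub>m j)" unfolding U_def by (rule det_four_block_mat_lower_left_zero[OF one_carrier_mat w refl one_carrier_mat])
  moreover have "U \<in> carrier_mat (1 + j) (1 + j)" unfolding U_def by (rule four_block_carrier_mat[OF one_carrier_mat one_carrier_mat])
  ultimately have U: "unimod (1 + j) U" unfolding unimod_iff_det by simp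
  have U': "U = (1\<^sub>m 1 @\<^sub>c w) @\<^sub>r (0\<^sub>m j 1 @\<^sub>c 1\<^sub>m j)" unfolding U_def by (rule append_cols_rows[symmetric]) (simp_all add: dm)
  have BU: "(y @\<^sub>c B') * U = y @\<^sub>c B2"
  proof -
    have "(y @\<^sub>c B') * U = y * (1\<^sub>m 1 @\<^sub>c w) + B' * (0\<^sub>m j 1 @\<^sub>c 1\<^sub>m j)" unfolding U' by (rule append_cols_mult_rows) (simp_all add: dm)
    also have "y * (1\<^sub>m 1 @\<^sub>c w) = y @\<^sub>c y * w" by (subst mult_append_cols) (simp_all add: dm mat_mult_one)
    also have "B' * (0\<^sub>m j 1 @\<^sub>c 1\<^sub>m j) = 0\<^sub>m n 1 @\<^sub>c B'" by (subst mult_append_cols) (simp_all add: dm mat_mult_one mat_mult_zero)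
    also have "(y @\<^sub>c y * w) + (0\<^sub>m n 1 @\<^sub>c B') = y @\<^sub>c B2" unfolding B2_def
      by (subst append_cols_add) (simp_all add: dm mat_add_zero)
    finally show ?thesis .
  qed
  have zB2: "z\<^sup>T * S * B2 = 0\<^sub>m 1 j"
  proof -
    have "z\<^sup>T * S * B2 = (z\<^sup>T * S * y) * w + z\<^sup>T * S * B'" unfolding B2_def by (simp add: mat_mult_add mat_assoc dm)
    also have "\<dots> = w + z\<^sup>T * S * B'" unfolding zy by (simp add: mat_one_mult dm)
    also have "\<dots> = 0\<^sub>m 1 j" unfolding w_def by (rule uminus_l_inv_mat) (rule carrier_matI; simp add: dm)
    finally show ?thesis .
  qed
  have yB2: "y\<^sup>T * S * B2 = 0\<^sub>m 1 j"
  proof -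
    have "y\<^sup>T * S * B2 = (y\<^sup>T * S * y) * w + y\<^sup>T * S * B'" unfolding B2_def by (simp add: mat_mult_add mat_assoc dm)
    thus ?thesis unfolding yy yB[folded S_def] by (simp add: mat_arith dm)
  qed
  define B1 where "B1 = F0\<^sup>T * S * B2 @\<^sub>r E0\<^sup>T * S * B2"
  have B1: "B1 \<in> carrier_mat (j + j) j" unfolding B1_def by (rule carrier_matI) (simp_all add: dm)
  have B2e: "(E0 @\<^sub>c F0) * B1 = B2"
  proof -
    have 1: "(z @\<^sub>c F0)\<^sup>T * S * B2 = z\<^sup>T * S * B2 @\<^sub>r F0\<^sup>T * S * B2" "(y @\<^sub>c E0)\<^sup>T * S * B2 = y\<^sup>T * S * B2 @\<^sub>r E0\<^sup>T * S * B2"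
      by (simp_all add: transpose_append_cols append_rows_mult dm)
    note 1 = 1[unfolded zB2 yB2]
    have "B2 = (y @\<^sub>c E0) * (0\<^sub>m 1 j @\<^sub>r F0\<^sup>T * S * B2) + (z @\<^sub>c F0) * (0\<^sub>m 1 j @\<^sub>r E0\<^sup>T * S * B2)"
      using expansion_apply[OF ex(1) S(1) d(7) F(1) B2] unfolding Fe 1 .
    also have "(y @\<^sub>c E0) * (0\<^sub>m 1 j @\<^sub>r F0\<^sup>T * S * B2) = E0 * (F0\<^sup>T * S * B2)"
      by (subst append_cols_mult_rows) (simp_all add: mat_mult_zero mat_zero_add dm)
    also have "(z @\<^sub>c F0) * (0\<^sub>m 1 j @\<^sub>r E0\<^sup>T * S * B2) = F0 * (E0\<^sup>T * S * B2)"
      by (subst append_cols_mult_rows) (simp_all add: mat_mult_zero mat_zero_add dm)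
    also have "E0 * (F0\<^sup>T * S * B2) + F0 * (E0\<^sup>T * S * B2) = (E0 @\<^sub>c F0) * B1" unfolding B1_def
      by (rule append_cols_mult_rows[symmetric]) (simp_all add: dm)
    finally show ?thesis by (rule HOL.sym)
  qed
  have i1: "G * (std_lag 1 \<oplus>\<^sub>m std_lag j) = y @\<^sub>c E0" unfolding sp(4)[OF std_lag_carrier(1)] sp(6) ..
  have i2: "G * (std_lag 1 \<oplus>\<^sub>m B1) = y @\<^sub>c B2" unfolding sp(4)[OF B1] B2e ..
  have p: "primitive_mat n j B2"
    by (rule primitive_append_cols(2)[OF c(1) B2 primitive_unimod[OF d(6) U, unfolded BU]])
  have pB1: "primitive_mat (j + j) j B1"
    by (rule primitive_factor[OF append_cols_carrier[OF c(2) z(2)] B1]) (unfold B2e, rule p)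
  have n': "n = (1 + 1) + (j + j)" using d(1) by simp
  note v1 = qf_valid_sum[OF std_valid(1)[OF std_primitive(1)] std_valid(1)[OF pB1], of 1]
  note v2 = qf_valid_sum[OF std_valid(2)[OF std_primitive(1)] std_valid(1)[OF pB1], of 1]
  have im: "qf_of \<psi> (y @\<^sub>c E0) (y @\<^sub>c B2) = qf_of \<psi> (y @\<^sub>c E0) (y @\<^sub>c B')"
    unfolding qf_of_def BU[symmetric] mat_image_unimod[OF d(8) U] ..
  have e1: "l1_eq (qf_of (hyperbolic 1 \<oplus>\<^sub>m hyperbolic j) (std_lag 1 \<oplus>\<^sub>m std_lag j) (std_lag 1 \<oplus>\<^sub>m B1)) (qf_of \<psi> (y @\<^sub>c E0) (y @\<^sub>c B'))"
    using l1_eq_isoI(1)[OF v1[folded n'] sp(1) d(2) sp(2)] unfolding i1 i2 im .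
  have e2: "l1_eq (qf_of (hyperbolic 1 \<oplus>\<^sub>m hyperbolic j) (std_lag 1 \<oplus>\<^sub>m std_lag j) (std_lag 1 \<oplus>\<^sub>m B1))
      (qf_of (hyperbolic 1 \<oplus>\<^sub>m hyperbolic j) (std_colag 1 \<oplus>\<^sub>m std_lag j) (std_lag 1 \<oplus>\<^sub>m B1))"
    by (rule l1_change_lagrangian[OF v1 v2 l1_null_flip_first(2)])
  have su: "qf_sum (qf_of (hyperbolic 1) (std_colag 1) (std_lag 1)) (qf_of (hyperbolic j) (std_lag j) B1) =
      qf_of (hyperbolic 1 \<oplus>\<^sub>m hyperbolic j) (std_colag 1 \<oplus>\<^sub>m std_lag j) (std_lag 1 \<oplus>\<^sub>m B1)"
    by (rule qf_sum_of) (rule std_lag_carrier B1)+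
  have v3: "qf_valid (j + j) j (hyperbolic j) (std_lag j) B1" by (rule std_valid(1)[OF pB1])
  have e3: "l1_eq (qf_of (hyperbolic 1 \<oplus>\<^sub>m hyperbolic j) (std_colag 1 \<oplus>\<^sub>m std_lag j) (std_lag 1 \<oplus>\<^sub>m B1)) (qf_of (hyperbolic j) (std_lag j) B1)"
    using l1_null_sum[OF l1_null_flip[of 1] qf_valid_quasi_formation[OF v3]] unfolding su .
  have e: "l1_eq (qf_of \<psi> (y @\<^sub>c E0) (y @\<^sub>c B')) (qf_of (hyperbolic j) (std_lag j) B1)"
    by (rule l1_eq.trans[OF l1_eq.sym[OF e1] l1_eq.trans[OF e2 e3]])
  let ?W = "y @\<^sub>c B'" and ?L = "std_lag 1 \<oplus>\<^sub>m B1"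
  have Wc: "?W\<^sup>T * \<psi> * ?W \<in> carrier_mat (1 + j) (1 + j)" by (rule carrier_matI) (simp_all add: dm)
  have hc: "B1\<^sup>T * hyperbolic j * B1 \<in> carrier_mat j j" by (rule carrier_matI) (simp_all add: carrier_matD[OF B1])
  have Lc: "?L \<in> carrier_mat n (1 + j)" unfolding n' by (rule mat_sum_carrier[OF std_lag_carrier(1) B1])
  have "U\<^sup>T * symm 1 (?W\<^sup>T * \<psi> * ?W) * U = (?W * U)\<^sup>T * symm 1 \<psi> * (?W * U)"
    unfolding symm_congruence[OF d(2,8)] congruence_mult[OF symm_carrier[OF d(2)] d(8) unimod_carrier[OF U]] ..
  also have "\<dots> = ?L\<^sup>T * symm 1 (hyperbolic 1 \<oplus>\<^sub>m hyperbolic j) * ?L"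
    unfolding BU i2[symmetric] sp(2) by (rule congruence_mult[OF symm_carrier[OF d(2)] unimod_carrier[OF sp(1)] Lc])
  also have "\<dots> = (std_lag 1)\<^sup>T * symm 1 (hyperbolic 1) * std_lag 1 \<oplus>\<^sub>m B1\<^sup>T * symm 1 (hyperbolic j) * B1"
    unfolding symm_mat_sum[OF hyperbolic_carrier hyperbolic_carrier] mat_sum_transpose
    by (simp add: mat_sum_mult carrier_matD[OF B1] carrier_matD[OF hyperbolic_carrier])
  also have "\<dots> = 0\<^sub>m 1 1 \<oplus>\<^sub>m symm 1 (B1\<^sup>T * hyperbolic j * B1)"
    unfolding std_lag_gram(1) symm_congruence[OF hyperbolic_carrier B1] ..
  finally have "zs_equiv (?W\<^sup>T * \<psi> * ?W) (B1\<^sup>T * hyperbolic j * B1)" by (rule zs_equiv_radical[OF Wc hc U])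
  thus ?thesis using v3 e by (intro exI[of _ B1] conjI)
qed

text \<open>
  A vector in the radical of the restricted form is isotropic, so after a change of the Lagrangian it lies in the
  Lagrangian as well and can be divided out.
\<close>

lemma reduce_singular:
  assumes v: "qf_valid n k \<psi> E B" and z: "det (symm 1 (B\<^sup>T * \<psi> * B)) = 0"
  shows "\<exists>j B1. k = Suc j \<and> qf_valid (j + j) j (hyperbolic j) (std_lag j) B1 \<and>
    l1_eq (qf_of \<psi> E B) (qf_of (hyperbolic j) (std_lag j) B1) \<and> zs_equiv (B\<^sup>T * \<psi> * B) (B1\<^sup>T * hyperbolic j * B1)"
proof -
  note d = qf_validD[OF v]
  define S where "S = symm 1 \<psi>"
  have S: "S \<in> carrier_mat n n" "S\<^sup>T = S" unfolding S_def using d(2) symm_transpose[OF d(2)] by simp_all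
  define Gr where "Gr = B\<^sup>T * S * B"
  note dm = carrier_matD[OF d(7)] carrier_matD[OF d(8)] carrier_matD[OF S(1)]
  have Gr: "Gr \<in> carrier_mat k k" unfolding Gr_def by (rule carrier_matI) (simp_all add: dm)
  have "det Gr = 0" using z unfolding symm_congruence[OF d(2,8)] Gr_def S_def .
  then obtain x where x: "x \<in> carrier_vec k" "x \<noteq> 0\<^sub>v k" "Gr *\<^sub>v x = 0\<^sub>v k" using det_0_iff_vec_prod_zero[OF Gr] by blast
  define c where "c = mat k 1 (\<lambda>(i, j). x $ i)"
  have c: "c \<in> carrier_mat k 1" unfolding c_def by simp
  have cx: "col c 0 = x" unfolding c_def using x(1) by (intro eq_vecI) simp_all
  have Gc: "Gr * c = 0\<^sub>m k 1"
  proof (rule eq_matI)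
    fix i j assume "i < dim_row (0\<^sub>m k 1 :: int mat)" "j < dim_col (0\<^sub>m k 1 :: int mat)"
    hence ij: "i < k" "j = 0" by simp_all
    have "(Gr * c) $$ (i, 0) = row Gr i \<bullet> col c 0" using ij Gr c by simp
    also have "\<dots> = (Gr *\<^sub>v x) $ i" unfolding cx using ij Gr by simp
    finally show "(Gr * c) $$ (i, j) = 0\<^sub>m k 1 $$ (i, j)" unfolding x(3) using ij by simp
  qed (use Gr c in simp_all)
  have c0: "c \<noteq> 0\<^sub>m k 1"
  proof
    assume "c = 0\<^sub>m k 1"
    hence "x = 0\<^sub>v k" unfolding cx[symmetric] by (intro eq_vecI) simp_all
    with x(2) show False ..
  qed
  have "k \<noteq> 0"
  proof
    assume "k = 0"
    hence "c = 0\<^sub>m k 1" using carrier_matD[OF c] by (intro eq_matI) simp_all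
    with c0 show False ..
  qed
  then obtain j where k: "k = 1 + j" by (metis not0_implies_Suc plus_1_eq_Suc)
  obtain h t where h: "unimod k h" and hc: "h * c = t \<cdot>\<^sub>m 1\<^sub>m 1 @\<^sub>r 0\<^sub>m j 1"
    using unimod_column[OF c[unfolded k]] unfolding k by metis
  obtain g where g: "unimod k g" "g \<in> carrier_mat k k" "h * g = 1\<^sub>m k" "g * h = 1\<^sub>m k" using unimod_inverse[OF h] by metis
  note hcar = unimod_carrier[OF h]
  note dm = dm carrier_matD[OF g(2)] carrier_matD[OF hcar] carrier_matD[OF c] carrier_matD[OF Gr]
  have ghc: "g * (h * c) = c"
  proof -
    have "g * (h * c) = (g * h) * c" by (simp add: mat_assoc dm)
    thus ?thesis unfolding g(4) by (simp add: mat_one_mult dm)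
  qed
  have t: "t \<noteq> 0"
  proof
    assume "t = 0"
    hence "h * c = 0\<^sub>m k 1" unfolding hc k by (intro eq_matI) (auto simp: append_rows_def)
    with ghc have "g * 0\<^sub>m k 1 = c" by simp
    hence "c = 0\<^sub>m k 1" by (simp add: mat_mult_zero dm)
    with c0 show False ..
  qed
  have Bgc: "B * g \<in> carrier_mat n (1 + j)" unfolding k[symmetric] by (rule carrier_matI) (simp_all add: dm)
  obtain y B' where y: "y \<in> carrier_mat n 1" "B' \<in> carrier_mat n j" and Bge: "B * g = y @\<^sub>c B'" using append_cols_split[OF Bgc] by metis
  note dm = dm y[THEN carrier_matD(1)] y[THEN carrier_matD(2)]
  have ty: "t \<cdot>\<^sub>m y = B * c"
  proof -
    have "B * c = (B * g) * (h * c)" using ghc by (simp add: mat_assoc dm)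
    also have "\<dots> = t \<cdot>\<^sub>m y" unfolding Bge hc by (subst append_cols_mult_rows) (simp_all add: mat_arith dm)
    finally show ?thesis ..
  qed
  have "t \<cdot>\<^sub>m (B\<^sup>T * S * y) = Gr * c"
  proof -
    have "t \<cdot>\<^sub>m (B\<^sup>T * S * y) = B\<^sup>T * S * (t \<cdot>\<^sub>m y)" by (simp add: mat_mult_smult dm)
    thus ?thesis unfolding ty Gr_def by (simp add: mat_assoc dm)
  qed
  hence tBy: "t \<cdot>\<^sub>m (B\<^sup>T * S * y) = 0\<^sub>m k 1" unfolding Gc .
  have By: "B\<^sup>T * S * y = 0\<^sub>m k 1"
  proof (rule eq_matI)
    fix i l assume il: "i < dim_row (0\<^sub>m k 1 :: int mat)" "l < dim_col (0\<^sub>m k 1 :: int mat)"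
    have "(t \<cdot>\<^sub>m (B\<^sup>T * S * y)) $$ (i, l) = t * (B\<^sup>T * S * y) $$ (i, l)" by (rule index_smult_mat(1)) (use il in \<open>simp_all add: dm\<close>)
    hence "t * (B\<^sup>T * S * y) $$ (i, l) = 0" unfolding tBy using il by simp
    thus "(B\<^sup>T * S * y) $$ (i, l) = 0\<^sub>m k 1 $$ (i, l)" using t il by simp
  qed (simp_all add: dm)
  have yB: "y\<^sup>T * S * B = 0\<^sub>m 1 k"
  proof -
    have "y\<^sup>T * S * B = (B\<^sup>T * S * y)\<^sup>T" using S(2) by (simp add: mat_transpose_mult mat_assoc dm)
    thus ?thesis unfolding By by simp
  qed
  have yBg: "y\<^sup>T * S * (y @\<^sub>c B') = 0\<^sub>m 1 (1 + j)"
  proof -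
    have "y\<^sup>T * S * (y @\<^sub>c B') = (y\<^sup>T * S * B) * g" unfolding Bge[symmetric] by (simp add: mat_assoc dm)
    thus ?thesis unfolding yB k[symmetric] by (simp add: mat_zero_mult dm)
  qed
  have yy: "y\<^sup>T * S * y = 0\<^sub>m 1 1" and yB': "y\<^sup>T * S * B' = 0\<^sub>m 1 j"
  proof -
    have "y\<^sup>T * S * y @\<^sub>c y\<^sup>T * S * B' = 0\<^sub>m 1 (1 + j)" using yBg by (subst (asm) mult_append_cols) (simp_all add: dm)
    hence e: "(y\<^sup>T * S * y @\<^sub>c y\<^sup>T * S * B') * X = 0\<^sub>m 1 (1 + j) * X" for X by simp
    have "(y\<^sup>T * S * y @\<^sub>c y\<^sup>T * S * B') * (1\<^sub>m 1 @\<^sub>r 0\<^sub>m j 1) = y\<^sup>T * S * y"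
      by (subst append_cols_mult_rows) (simp_all add: mat_mult_one mat_mult_zero mat_add_zero dm)
    thus "y\<^sup>T * S * y = 0\<^sub>m 1 1" unfolding e by (simp add: mat_zero_mult)
    have "(y\<^sup>T * S * y @\<^sub>c y\<^sup>T * S * B') * (0\<^sub>m 1 j @\<^sub>r 1\<^sub>m j) = y\<^sup>T * S * B'"
      by (subst append_cols_mult_rows) (simp_all add: mat_mult_one mat_mult_zero mat_zero_add dm)
    thus "y\<^sup>T * S * B' = 0\<^sub>m 1 j" unfolding e by (simp add: mat_zero_mult)
  qed
  have py: "primitive_mat n 1 y" by (rule primitive_append_cols(1)[OF y primitive_unimod[OF d(6) g(1), unfolded Bge, unfolded k]])
  obtain E' a where E': "qf_valid n k \<psi> E' B" and a: "a \<in> carrier_mat k 1" "y = E' * a" and nl: "l1_null (qf_of \<psi> E' E)"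
    using isotropic_column_in_lagrangian[OF v y(1) yy[unfolded S_def]] by blast
  have pa: "primitive_mat k 1 a" by (rule primitive_factor[OF qf_validD(7)[OF E'] a(1)]) (unfold a(2)[symmetric], rule py)
  obtain s U0 where U0: "k = 1 + s" "U0 \<in> carrier_mat k s" "unimod k (a @\<^sub>c U0)" using primitive_completion[OF pa] by blast
  have sj: "s = j" using U0(1) k by simp
  have Ea: "E' * (a @\<^sub>c U0) = y @\<^sub>c E' * U0"
    by (subst mult_append_cols) (use a U0 carrier_matD[OF qf_validD(7)[OF E']] in simp_all)
  note vu = qf_valid_unimod[OF E' U0(3) g(1), unfolded Ea Bge]
  have E0: "E' * U0 \<in> carrier_mat n j" by (rule mult_carrier_mat[OF qf_validD(7)[OF E'] U0(2)[unfolded sj]])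
  obtain B1 where B1: "qf_valid (j + j) j (hyperbolic j) (std_lag j) B1"
    "l1_eq (qf_of \<psi> (y @\<^sub>c E' * U0) (y @\<^sub>c B')) (qf_of (hyperbolic j) (std_lag j) B1)"
    "zs_equiv ((y @\<^sub>c B')\<^sup>T * \<psi> * (y @\<^sub>c B')) (B1\<^sup>T * hyperbolic j * B1)"
    using reduce_common_column[OF vu(1)[unfolded k] y(1) E0 y(2) yB'[unfolded S_def]] by blast
  have e: "l1_eq (qf_of \<psi> E B) (qf_of (hyperbolic j) (std_lag j) B1)"
    by (rule l1_eq.trans[OF l1_change_lagrangian[OF v E' nl] B1(2)[unfolded vu(2)]])
  have vc: "B\<^sup>T * \<psi> * B \<in> carrier_mat k k" by (rule carrier_matI) (simp_all add: dm)
  have wc: "B1\<^sup>T * hyperbolic j * B1 \<in> carrier_mat j j" by (rule carrier_matI) (simp_all add: carrier_matD[OF qf_validD(8)[OF B1(1)]])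
  have uc: "g\<^sup>T * (B\<^sup>T * \<psi> * B) * g \<in> carrier_mat k k" by (rule carrier_matI) (simp_all add: dm)
  have "zs_equiv (B\<^sup>T * \<psi> * B) (B1\<^sup>T * hyperbolic j * B1)"
    by (rule zs_equiv_trans[OF zs_equiv_congruence[OF vc g(1)] B1(3)[folded Bge, unfolded congruence_mult[OF d(2,8) g(2)]] vc uc wc])
  thus ?thesis using e B1(1) k by (intro exI[of _ j] exI[of _ B1] conjI) simp_all
qed

text \<open>Every quasi-formation is related to one whose restricted form is nonsingular over the rationals.\<close>

lemma nonsingular_representative:
  assumes "qf_valid n k \<psi> E B"
  shows "\<exists>m B0. qf_valid (m + m) m (hyperbolic m) (std_lag m) B0 \<and> det (symm 1 (B0\<^sup>T * hyperbolic m * B0)) \<noteq> 0 \<and>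
    l1_eq (qf_of \<psi> E B) (qf_of (hyperbolic m) (std_lag m) B0) \<and> zs_equiv (B\<^sup>T * \<psi> * B) (B0\<^sup>T * hyperbolic m * B0)"
  using assms
proof (induction k arbitrary: n \<psi> E B rule: less_induct)
  case (less k)
  note v = less.prems
  note d = qf_validD[OF v]
  have vc: "B\<^sup>T * \<psi> * B \<in> carrier_mat k k" by (rule carrier_matI) (simp_all add: carrier_matD[OF d(8)])
  have wc: "X\<^sup>T * hyperbolic m * X \<in> carrier_mat m m" if "X \<in> carrier_mat (m + m) m" for X m
    by (rule carrier_matI) (simp_all add: carrier_matD[OF that])
  show ?case
  proof (cases "det (symm 1 (B\<^sup>T * \<psi> * B)) = 0")
    case True
    obtain j B1 where k: "k = Suc j" and B1: "qf_valid (j + j) j (hyperbolic j) (std_lag j) B1"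
      "l1_eq (qf_of \<psi> E B) (qf_of (hyperbolic j) (std_lag j) B1)" "zs_equiv (B\<^sup>T * \<psi> * B) (B1\<^sup>T * hyperbolic j * B1)"
      using reduce_singular[OF v True] by blast
    obtain m B0 where B0: "qf_valid (m + m) m (hyperbolic m) (std_lag m) B0" "det (symm 1 (B0\<^sup>T * hyperbolic m * B0)) \<noteq> 0"
      "l1_eq (qf_of (hyperbolic j) (std_lag j) B1) (qf_of (hyperbolic m) (std_lag m) B0)"
      "zs_equiv (B1\<^sup>T * hyperbolic j * B1) (B0\<^sup>T * hyperbolic m * B0)"
      using less.IH[OF _ B1(1)] k by blast
    show ?thesis
      by (intro exI[of _ m] exI[of _ B0] conjI B0(1,2) l1_eq.trans[OF B1(2) B0(3)]
          zs_equiv_trans[OF B1(3) B0(4) vc wc[OF qf_validD(8)[OF B1(1)]] wc[OF qf_validD(8)[OF B0(1)]]])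
  next
    case False
    obtain X where X: "qf_valid (k + k) k (hyperbolic k) (std_lag k) X" "l1_eq (qf_of (hyperbolic k) (std_lag k) X) (qf_of \<psi> E B)"
      "symm 1 (X\<^sup>T * hyperbolic k * X) = symm 1 (B\<^sup>T * \<psi> * B)" "l1_null (qf_of \<psi> E E)" by (rule lagrangian_standard[OF v])
    have sc: "symm 1 (B\<^sup>T * \<psi> * B) \<in> carrier_mat k k" by (rule symm_carrier[OF vc])
    have "zs_equiv (B\<^sup>T * \<psi> * B) (X\<^sup>T * hyperbolic k * X)"
      by (rule zs_equivI[OF vc wc[OF qf_validD(8)[OF X(1)]] one_carrier_mat one_carrier_mat])
        (simp_all only: X(3) transpose_one left_mult_one_mat[OF sc] right_mult_one_mat[OF sc])
    thus ?thesis using X(1) False l1_eq.sym[OF X(2)] unfolding X(3)[symmetric] by (intro exI[of _ k] exI[of _ X] conjI)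
  qed
qed

text \<open>In particular two Lagrangians differ by a trivial class: this is the vanishing of \<open>L\<^sub>1(\<int>)\<close>.\<close>

lemma l1_null_lagrangians:
  assumes v: "qf_valid n k \<psi> E B" and z: "B\<^sup>T * symm 1 \<psi> * B = 0\<^sub>m k k"
  shows "l1_null (qf_of \<psi> E B)"
proof -
  note d = qf_validD[OF v]
  obtain m B0 where B0: "qf_valid (m + m) m (hyperbolic m) (std_lag m) B0" "det (symm 1 (B0\<^sup>T * hyperbolic m * B0)) \<noteq> 0"
    "l1_eq (qf_of \<psi> E B) (qf_of (hyperbolic m) (std_lag m) B0)" "zs_equiv (B\<^sup>T * \<psi> * B) (B0\<^sup>T * hyperbolic m * B0)"
    using nonsingular_representative[OF v] by blast
  note B0c = qf_validD(8)[OF B0(1)]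
  have vc: "B\<^sup>T * \<psi> * B \<in> carrier_mat k k" by (rule carrier_matI) (simp_all add: carrier_matD[OF d(8)])
  have wc: "B0\<^sup>T * hyperbolic m * B0 \<in> carrier_mat m m" by (rule carrier_matI) (simp_all add: carrier_matD[OF B0c])
  obtain X Y where Y: "Y \<in> carrier_mat k m" and e: "symm 1 (B0\<^sup>T * hyperbolic m * B0) = Y\<^sup>T * symm 1 (B\<^sup>T * \<psi> * B) * Y"
    using zs_equivE[OF B0(4) vc wc] by metis
  have e0: "symm 1 (B0\<^sup>T * hyperbolic m * B0) = 0\<^sub>m m m"
    unfolding e symm_congruence[OF d(2,8)] z using Y by (simp add: mat_arith)
  have "m = 0"
  proof (rule ccontr)
    assume "m \<noteq> 0"
    hence "det (0\<^sub>m m m :: int mat) = 0" by (intro det_zero) simp_all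
    with B0(2) show False unfolding e0 by simp
  qed
  hence "B0 = 0\<^sub>m 0 0" using B0c by (intro eq_matI) simp_all
  hence "qf_of (hyperbolic m) (std_lag m) B0 = qf_triv 0" unfolding qf_triv_eq \<open>m = 0\<close> std_lag_0 by simp
  thus ?thesis using B0(3) unfolding l1_null_def by simp
qed

section \<open>Finiteness of the fibres\<close>

text \<open>
  A nonsingular half-rank summand together with its orthogonal complement spans a sublattice of bounded index.
  By the finiteness of class numbers its Gram matrix can be chosen in a finite set. The code of a summand records the
  Gram matrix of such a basis \<open>T\<close>, the first half of which spans the summand, and the residues of \<open>T\<close> modulo the
  index; these residues determine \<open>T\<close> up to a unimodular factor.
\<close>

definition std_code :: "nat \<Rightarrow> int \<Rightarrow> int mat \<Rightarrow> int mat \<times> int mat \<Rightarrow> bool" where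
  "std_code m e B k \<longleftrightarrow> (\<exists>T h. T \<in> carrier_mat (m + m) (m + m) \<and> \<bar>det T\<bar> = e ^ m \<and> unimod m h \<and> T * std_lag m = B * h \<and>
     k = (T\<^sup>T * symm 1 (hyperbolic m) * T, map_mat (\<lambda>x. x mod e ^ m) T))"

text \<open>
  Equal Gram matrices and equal residues yield an isometry of the hyperbolic form that carries one summand to the other.
  It moves the standard Lagrangian, but only to another Lagrangian, which does not affect the class.
\<close>

lemma same_std_code:
  assumes p: "primitive_mat (m + m) m B" "primitive_mat (m + m) m B'" and c: "std_code m e B k" "std_code m e B' k" and e: "e \<noteq> 0"
  shows "l1_eq (qf_of (hyperbolic m) (std_lag m) B) (qf_of (hyperbolic m) (std_lag m) B')"
proof -
  let ?J = "symm 1 (hyperbolic m)"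
  have J: "?J \<in> carrier_mat (m + m) (m + m)" by (rule symm_carrier[OF hyperbolic_carrier])
  obtain T h where T: "T \<in> carrier_mat (m + m) (m + m)" "\<bar>det T\<bar> = e ^ m" "unimod m h" "T * std_lag m = B * h"
    and k: "k = (T\<^sup>T * ?J * T, map_mat (\<lambda>x. x mod e ^ m) T)" using c(1) unfolding std_code_def by blast
  obtain T' h' where T': "T' \<in> carrier_mat (m + m) (m + m)" "\<bar>det T'\<bar> = e ^ m" "unimod m h'" "T' * std_lag m = B' * h'"
    and k': "k = (T'\<^sup>T * ?J * T', map_mat (\<lambda>x. x mod e ^ m) T')" using c(2) unfolding std_code_def by blast
  have gr: "T\<^sup>T * ?J * T = T'\<^sup>T * ?J * T'" and md: "map_mat (\<lambda>x. x mod e ^ m) T = map_mat (\<lambda>x. x mod e ^ m) T'"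
    using k k' by simp_all
  have em: "e ^ m \<noteq> 0" using e by simp
  obtain U where U: "unimod (m + m) U" "T' = U * T" using unimod_quotient[OF T(1) T'(1) T(2) T'(2) em md] by metis
  note Uc = unimod_carrier[OF U(1)] and Bc = primitive_carrier[OF p(1)] and B'c = primitive_carrier[OF p(2)]
  note d = carrier_matD[OF Uc] carrier_matD[OF T(1)] carrier_matD[OF Bc] carrier_matD[OF unimod_carrier[OF T(3)]]
  have "T\<^sup>T * ?J * T = T\<^sup>T * (U\<^sup>T * ?J * U) * T" unfolding gr U(2) by (rule congruence_mult[OF J Uc T(1)])
  moreover have "det T \<noteq> 0" using T(2) em by auto
  ultimately have s: "?J = U\<^sup>T * ?J * U"
    by (intro congruence_cancel[OF T(1) J]) (rule carrier_matI; simp add: d carrier_matD[OF hyperbolic_carrier])+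
  have "U * B * h = B' * h'" unfolding T'(4)[symmetric] U(2) using T(4) by (simp add: mat_assoc d)
  hence "mat_image (U * B * h) = mat_image (B' * h')" by simp
  hence im: "mat_image (U * B) = mat_image B'"
    unfolding mat_image_unimod[OF mult_carrier_mat[OF Uc Bc] T(3)] mat_image_unimod[OF B'c T'(3)] .
  note v = std_valid(1)[OF p(1)] and v' = std_valid(1)[OF p(2)]
  note iso = l1_eq_isoI[OF v U(1) hyperbolic_carrier s]
  have e1: "l1_eq (qf_of (hyperbolic m) (std_lag m) B) (qf_of (hyperbolic m) (U * std_lag m) B')"
    using iso(1) unfolding qf_of_def im .
  have vU: "qf_valid (m + m) m (hyperbolic m) (U * std_lag m) B'"
    by (intro qf_validI qf_validD(1-5)[OF iso(2)] p(2))
  have vL: "qf_valid (m + m) m (hyperbolic m) (std_lag m) (U * std_lag m)"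
    by (rule std_valid(1)[OF qf_validD(4)[OF vU]])
  have "l1_null (qf_of (hyperbolic m) (std_lag m) (U * std_lag m))"
    by (rule l1_null_lagrangians[OF vL qf_validD(5)[OF vU]])
  from l1_change_lagrangian[OF vU v' this] show ?thesis by (rule l1_eq.trans[OF e1])
qed

text \<open>
  If \<open>B\<^sup>T S B\<close> is nonsingular, the orthogonal projections of the complementary basis vectors become integral after
  multiplication by its determinant, by Cramer's rule; these multiples are the columns of \<open>X\<close>.
\<close>

lemma orthogonal_complement_basis:
  fixes S :: "int mat"
  assumes S: "S \<in> carrier_mat n n" "S\<^sup>T = S" and n: "n = m + s" and B: "B \<in> carrier_mat n m" "B1 \<in> carrier_mat n s" "unimod n (B @\<^sub>c B1)"
  obtains X where "X \<in> carrier_mat n s" "B\<^sup>T * S * X = 0\<^sub>m m s" "X\<^sup>T * S * B = 0\<^sub>m s m"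
    "\<bar>det (B @\<^sub>c X)\<bar> = \<bar>det (B\<^sup>T * S * B)\<bar> ^ s"
proof -
  define G where "G = B\<^sup>T * S * B"
  have G: "G \<in> carrier_mat m m" unfolding G_def by (rule carrier_matI) (use B in simp_all)
  note A = adj_mat[OF G]
  define w where "w = - (adj_mat G * (B\<^sup>T * S * B1))"
  note d0 = carrier_matD[OF B(1)] carrier_matD[OF B(2)] carrier_matD[OF S(1)] carrier_matD[OF G] carrier_matD[OF A(1)]
  have w: "w \<in> carrier_mat m s" unfolding w_def by (rule carrier_matI) (simp_all add: d0)
  define X where "X = B * w + det G \<cdot>\<^sub>m B1"
  have X: "X \<in> carrier_mat n s" unfolding X_def by (rule carrier_matI) (simp_all add: d0)
  note d = d0 carrier_matD[OF w] carrier_matD[OF X]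
  have um: "Y * (- Z) = - (Y * Z)" if "dim_col Y = dim_row Z" for Y Z :: "int mat" using that by auto
  have "G * w = - ((G * adj_mat G) * (B\<^sup>T * S * B1))" unfolding w_def by (subst um) (simp_all add: mat_assoc d0)
  also have "\<dots> = - (det G \<cdot>\<^sub>m (B\<^sup>T * S * B1))" unfolding A(2) by (simp add: mat_smult_mult mat_one_mult d0)
  finally have Gw: "G * w = - (det G \<cdot>\<^sub>m (B\<^sup>T * S * B1))" .
  have "B\<^sup>T * S * X = G * w + det G \<cdot>\<^sub>m (B\<^sup>T * S * B1)" unfolding X_def by (simp add: G_def mat_mult_add mat_mult_smult mat_assoc d0 carrier_matD[OF w])
  also have "\<dots> = 0\<^sub>m m s" unfolding Gw by (rule uminus_l_inv_mat) (rule carrier_matI; simp add: d0)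
  finally have BX: "B\<^sup>T * S * X = 0\<^sub>m m s" .
  have XB: "X\<^sup>T * S * B = 0\<^sub>m s m" using arg_cong[OF BX, of transpose_mat] S(2) by (simp add: mat_transpose_mult mat_assoc d)
  define M where "M = four_block_mat (1\<^sub>m m) w (0\<^sub>m s m) (det G \<cdot>\<^sub>m 1\<^sub>m s)"
  have M': "M = (1\<^sub>m m @\<^sub>c w) @\<^sub>r (0\<^sub>m s m @\<^sub>c det G \<cdot>\<^sub>m 1\<^sub>m s)" unfolding M_def by (rule append_cols_rows[symmetric]) (simp_all add: d)
  have "(B @\<^sub>c B1) * M = B * (1\<^sub>m m @\<^sub>c w) + B1 * (0\<^sub>m s m @\<^sub>c det G \<cdot>\<^sub>m 1\<^sub>m s)" unfolding M' by (rule append_cols_mult_rows) (simp_all add: d)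
  also have "B * (1\<^sub>m m @\<^sub>c w) = B @\<^sub>c B * w" by (subst mult_append_cols) (simp_all add: d mat_mult_one)
  also have "B1 * (0\<^sub>m s m @\<^sub>c det G \<cdot>\<^sub>m 1\<^sub>m s) = 0\<^sub>m n m @\<^sub>c det G \<cdot>\<^sub>m B1"
    by (subst mult_append_cols) (simp_all add: d mat_mult_one mat_mult_zero mat_mult_smult)
  also have "(B @\<^sub>c B * w) + (0\<^sub>m n m @\<^sub>c det G \<cdot>\<^sub>m B1) = B @\<^sub>c X" unfolding X_def
    by (subst append_cols_add) (simp_all add: d mat_add_zero)
  finally have TM: "(B @\<^sub>c B1) * M = B @\<^sub>c X" .
  have Mc: "M \<in> carrier_mat n n" unfolding M_def n by (rule four_block_carrier_mat[OF one_carrier_mat]) simp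
  have "det M = det (1\<^sub>m m) * det (det G \<cdot>\<^sub>m 1\<^sub>m s)" unfolding M_def by (rule det_four_block_mat_lower_left_zero[OF one_carrier_mat w refl]) simp
  hence "det M = det G ^ s" by simp
  hence "det (B @\<^sub>c X) = det (B @\<^sub>c B1) * det G ^ s" using det_mult[OF unimod_carrier[OF B(3)] Mc] unfolding TM by simp
  hence "\<bar>det (B @\<^sub>c X)\<bar> = \<bar>det G\<bar> ^ s" using B(3) unfolding unimod_iff_det by (simp add: abs_mult power_abs)
  thus ?thesis using that[OF X BX XB] unfolding G_def by blast
qed

lemma congruence_symmetric:
  assumes "S \<in> carrier_mat n n" "S\<^sup>T = S" "B \<in> carrier_mat n m"
  shows "B\<^sup>T * S * B \<in> carrier_mat m m" "(B\<^sup>T * S * B)\<^sup>T = B\<^sup>T * S * (B :: int mat)"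
proof -
  note d = carrier_matD[OF assms(1)] carrier_matD[OF assms(3)]
  show "B\<^sup>T * S * B \<in> carrier_mat m m" by (rule carrier_matI) (simp_all add: d)
  show "(B\<^sup>T * S * B)\<^sup>T = B\<^sup>T * S * B" by (simp add: mat_transpose_mult mat_assoc d assms(2))
qed

text \<open>
  The determinant of \<open>B\<^sup>T S B\<close> is fixed and determines the index of the sublattice spanned by \<open>B\<close> and the scaled complement.
  As the ambient form is unimodular, the determinant of the Gram matrix of the complement is bounded too, so both Gram
  matrices range over finitely many classes.
\<close>

lemma finite_std_codes:
  assumes e: "e > 0"
  shows "\<exists>K. finite K \<and> (\<forall>B. primitive_mat (m + m) m B \<longrightarrow> \<bar>det (B\<^sup>T * symm 1 (hyperbolic m) * B)\<bar> = e \<longrightarrow> (\<exists>k \<in> K. std_code m e B k))"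
proof -
  define n where "n = m + m"
  let ?J = "symm 1 (hyperbolic m)"
  have J: "?J \<in> carrier_mat n n" "?J\<^sup>T = ?J" unfolding n_def using symm_transpose[OF hyperbolic_carrier] by simp_all
  obtain R1 where R1: "finite R1" "\<And>S. S \<in> carrier_mat m m \<Longrightarrow> S\<^sup>T = S \<Longrightarrow> det S \<noteq> 0 \<Longrightarrow> \<bar>det S\<bar> \<le> e \<Longrightarrow> \<exists>U. unimod m U \<and> U\<^sup>T * S * U \<in> R1"
    using finite_class_number[of m e] by blast
  obtain R2 where R2: "finite R2" "\<And>S. S \<in> carrier_mat m m \<Longrightarrow> S\<^sup>T = S \<Longrightarrow> det S \<noteq> 0 \<Longrightarrow> \<bar>det S\<bar> \<le> e ^ m * e ^ m \<Longrightarrow> \<exists>U. unimod m U \<and> U\<^sup>T * S * U \<in> R2"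
    using finite_class_number[of m "e ^ m * e ^ m"] by blast
  let ?K = "((\<lambda>(a, b). a \<oplus>\<^sub>m b) ` (R1 \<times> R2)) \<times> {M \<in> carrier_mat n n. \<forall>i<n. \<forall>j<n. M $$ (i, j) \<in> {0..e ^ m}}"
  have em: "e ^ m > 0" using e by simp
  have "\<exists>k \<in> ?K. std_code m e B k" if p: "primitive_mat n m B" and de: "\<bar>det (B\<^sup>T * ?J * B)\<bar> = e" for B
  proof -
    note B = primitive_carrier[OF p]
    obtain s B1 where s: "n = m + s" and B1: "B1 \<in> carrier_mat n s" "unimod n (B @\<^sub>c B1)" using primitive_completion[OF p] by blast
    have sm: "s = m" using s unfolding n_def by simp
    obtain X where X: "X \<in> carrier_mat n m" "B\<^sup>T * ?J * X = 0\<^sub>m m m" "X\<^sup>T * ?J * B = 0\<^sub>m m m"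
      and dX: "\<bar>det (B @\<^sub>c X)\<bar> = e ^ m"
      using orthogonal_complement_basis[OF J s B B1] unfolding sm de by metis
    define G N where "G = B\<^sup>T * ?J * B" and "N = X\<^sup>T * ?J * X"
    note d = carrier_matD[OF B] carrier_matD[OF X(1)] carrier_matD[OF J(1)]
    note G = congruence_symmetric[OF J B, folded G_def] and N = congruence_symmetric[OF J X(1), folded N_def]
    have BXc: "B @\<^sub>c X \<in> carrier_mat n n" using append_cols_carrier[OF B X(1)] unfolding n_def .
    have gram: "(B @\<^sub>c X)\<^sup>T * ?J * (B @\<^sub>c X) = G \<oplus>\<^sub>m N"
      by (subst gram_append_cols[OF J(1)]) (simp_all add: d X G_def[symmetric] N_def[symmetric] mat_sum_def carrier_matD[OF G(1)] carrier_matD[OF N(1)])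
    have "det (B @\<^sub>c X) * det (B @\<^sub>c X) * det ?J = det G * det N"
      using det_congruence[OF J(1) BXc] unfolding gram det_mat_sum[OF G(1) N(1)] by simp
    hence "\<bar>det (B @\<^sub>c X)\<bar> * \<bar>det (B @\<^sub>c X)\<bar> * \<bar>det ?J\<bar> = \<bar>det G\<bar> * \<bar>det N\<bar>" unfolding abs_mult[symmetric] by simp
    hence dN: "e ^ m * e ^ m = e * \<bar>det N\<bar>"
      using unimod_hyperbolic[of m] de unfolding dX unimod_iff_det G_def[symmetric] by simp
    have N0: "det N \<noteq> 0"
    proof
      assume "det N = 0"
      hence "e ^ m * e ^ m = 0" using dN by simp
      moreover have "e ^ m * e ^ m > 0" by (rule mult_pos_pos[OF em em])
      ultimately show False by linarith
    qed
    have Ne: "\<bar>det N\<bar> \<le> e ^ m * e ^ m" using e mult_right_mono[of 1 e "\<bar>det N\<bar>"] unfolding dN by simp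
    from R2(2)[OF N N0 Ne] obtain h2 where h2: "unimod m h2" "h2\<^sup>T * N * h2 \<in> R2" by (elim exE conjE)
    have Ge: "\<bar>det G\<bar> \<le> e" using de unfolding G_def by (rule eq_refl)
    have G0: "det G \<noteq> 0"
    proof
      assume "det G = 0"
      with de have "e = 0" unfolding G_def by simp
      with e show False by simp
    qed
    from R1(2)[OF G G0 Ge] obtain h1 where h1: "unimod m h1" "h1\<^sup>T * G * h1 \<in> R1" by (elim exE conjE)
    note hc = unimod_carrier[OF h1(1)] unimod_carrier[OF h2(1)]
    note dh = carrier_matD[OF hc(1)] carrier_matD[OF hc(2)]
    have hs: "h1 \<oplus>\<^sub>m h2 \<in> carrier_mat n n" unfolding n_def by (rule mat_sum_carrier[OF hc])
    define T where "T = (B @\<^sub>c X) * (h1 \<oplus>\<^sub>m h2)"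
    have T: "T \<in> carrier_mat n n" unfolding T_def by (rule mult_carrier_mat[OF BXc hs])
    have Te: "T = B * h1 @\<^sub>c X * h2" unfolding T_def by (rule append_cols_mult_sum) (simp_all add: d dh)
    have 1: "\<bar>det T\<bar> = e ^ m"
      using unimod_mat_sum[OF h1(1) h2(1)] dX unfolding T_def det_mult[OF BXc hs] abs_mult unimod_iff_det by simp
    have 2: "T * std_lag m = B * h1" unfolding Te std_lag_def
      by (subst append_cols_mult_rows) (simp_all add: d dh mat_mult_one mat_mult_zero mat_add_zero)
    have 3: "T\<^sup>T * ?J * T = h1\<^sup>T * G * h1 \<oplus>\<^sub>m h2\<^sup>T * N * h2"
      unfolding T_def congruence_mult[OF J(1) BXc hs] gram mat_sum_transpose
      by (simp add: mat_sum_mult carrier_matD[OF G(1)] carrier_matD[OF N(1)] dh)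
    have "T\<^sup>T * ?J * T \<in> (\<lambda>(a, b). a \<oplus>\<^sub>m b) ` (R1 \<times> R2)" unfolding 3 using h1(2) h2(2) by (intro image_eqI[of _ _ "(h1\<^sup>T * G * h1, h2\<^sup>T * N * h2)"]) simp_all
    moreover have "map_mat (\<lambda>x. x mod e ^ m) T \<in> {M \<in> carrier_mat n n. \<forall>i<n. \<forall>j<n. M $$ (i, j) \<in> {0..e ^ m}}"
      using T pos_mod_bound[OF em] em by (auto intro: less_imp_le)
    ultimately have "(T\<^sup>T * ?J * T, map_mat (\<lambda>x. x mod e ^ m) T) \<in> ?K" by (rule SigmaI)
    moreover have "std_code m e B (T\<^sup>T * ?J * T, map_mat (\<lambda>x. x mod e ^ m) T)"
      unfolding std_code_def by (rule exI[of _ T], rule exI[of _ h1]) (intro conjI T[unfolded n_def] 1 h1(1) 2 refl)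
    ultimately show ?thesis by (rule bexI[rotated])
  qed
  moreover have "finite ?K" using R1(1) R2(1) finite_mats[of "{0..e ^ m}" n n] by (intro finite_cartesian_product finite_imageI) simp_all
  ultimately have "\<exists>K. finite K \<and> (\<forall>B. primitive_mat n m B \<longrightarrow> \<bar>det (B\<^sup>T * ?J * B)\<bar> = e \<longrightarrow> (\<exists>k \<in> K. std_code m e B k))"
    by (intro exI[of _ ?K] conjI allI impI)
  thus ?thesis unfolding n_def .
qed

text \<open>
  A class in \<open>l\<^sub>1(v)\<close> contains a quasi-formation whose restriction to the summand is equivalent to \<open>v\<close> up to zero forms, and
  this equivalence persists for the nonsingular representative.
\<close>

lemma l1_form_representative:
  assumes v: "v \<in> qforms" and c: "c \<in> l1_form v"
  obtains m B where "qf_valid (m + m) m (hyperbolic m) (std_lag m) B" "det (symm 1 (B\<^sup>T * hyperbolic m * B)) \<noteq> 0"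
    "zs_equiv v (B\<^sup>T * hyperbolic m * B)" "c = {y. l1_eq (qf_of (hyperbolic m) (std_lag m) B) y}"
proof -
  obtain v' x where c1: "c \<in> l1" and xc: "x \<in> c" and bx: "qf_b x = (zs_class v, zs_class v')"
    using c unfolding l1_form_def l1_pair_def by blast
  obtain x0 where "c = {y. l1_eq x0 y}" using c1 unfolding l1_def quotient_def by blast
  hence x0: "l1_eq x0 x" and ce: "c = {y. l1_eq x0 y}" using xc by simp_all
  obtain n k \<psi> E B where w: "qf_valid n k \<psi> E B" and x: "x = qf_of \<psi> E B"
    using conjunct2[OF l1_eq_quasi_formation[OF x0]] unfolding quasi_formation_iff by blast
  note d = qf_validD[OF w]
  have Bc: "B\<^sup>T * \<psi> * B \<in> carrier_mat k k" by (rule carrier_matI) (simp_all add: carrier_matD[OF d(8)])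
  note Bq = carrier_qforms[OF Bc]
  have "zs_restrict \<psi> (mat_image B) = zs_class v" using bx unfolding x qf_of_def by simp
  moreover have "B\<^sup>T * \<psi> * B \<in> zs_restrict \<psi> (mat_image B)"
  proof -
    have "B\<^sup>T * \<psi> * B \<in> zs_class (B\<^sup>T * \<psi> * B)" unfolding zs_class_iff[OF Bq] by (intro conjI Bq zs_equiv_refl[OF Bc])
    moreover have "zbasis (dim_row \<psi>) k B (mat_image B)" unfolding carrier_matD(1)[OF d(2)] by (rule primitive_zbasis(1)[OF d(6)])
    ultimately show ?thesis unfolding zs_restrict_def by (intro UnionI[of "zs_class (B\<^sup>T * \<psi> * B)"] CollectI exI[of _ k] exI[of _ B] conjI refl)
  qed
  ultimately have vB: "zs_equiv v (B\<^sup>T * \<psi> * B)" using zs_class_iff[OF v] by simp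
  obtain m B0 where B0: "qf_valid (m + m) m (hyperbolic m) (std_lag m) B0" "det (symm 1 (B0\<^sup>T * hyperbolic m * B0)) \<noteq> 0"
    "l1_eq (qf_of \<psi> E B) (qf_of (hyperbolic m) (std_lag m) B0)" "zs_equiv (B\<^sup>T * \<psi> * B) (B0\<^sup>T * hyperbolic m * B0)"
    using nonsingular_representative[OF w] by blast
  have wc: "B0\<^sup>T * hyperbolic m * B0 \<in> carrier_mat m m" by (rule carrier_matI) (simp_all add: carrier_matD[OF qf_validD(8)[OF B0(1)]])
  have x0B: "l1_eq x0 (qf_of (hyperbolic m) (std_lag m) B0)" by (rule l1_eq.trans[OF x0 B0(3)[folded x]])
  have "c = {y. l1_eq (qf_of (hyperbolic m) (std_lag m) B0) y}" unfolding ce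
    using l1_eq.trans[OF x0B] l1_eq.trans[OF l1_eq.sym[OF x0B]] by (intro Collect_cong iffI)
  thus ?thesis by (rule that[OF B0(1,2) zs_equiv_trans[OF vB B0(4) qforms_carrier[OF v] Bc wc]])
qed

text \<open>
  All nonsingular representatives have restrictions that are equivalent up to zero forms to \<open>v\<close>, hence equivalent to each other;
  in particular they have the same rank and the same determinant, and the finitely many codes separate the classes.
\<close>

theorem finite_l1_form:
  assumes v: "v \<in> qforms"
  shows "finite (l1_form v)"
proof (cases "l1_form v = {}")
  case False
  then obtain c0 where "c0 \<in> l1_form v" by blast
  from l1_form_representative[OF v this] obtain m B0 where B0: "qf_valid (m + m) m (hyperbolic m) (std_lag m) B0"
    "det (symm 1 (B0\<^sup>T * hyperbolic m * B0)) \<noteq> 0" "zs_equiv v (B0\<^sup>T * hyperbolic m * B0)" by blast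
  define e where "e = \<bar>det (symm 1 (B0\<^sup>T * hyperbolic m * B0))\<bar>"
  have e: "e > 0" unfolding e_def using B0(2) by simp
  have fc: "B\<^sup>T * hyperbolic l * B \<in> carrier_mat l l" if "qf_valid (l + l) l (hyperbolic l) (std_lag l) B" for l B
    by (rule carrier_matI) (simp_all add: carrier_matD[OF qf_validD(8)[OF that]])
  have rep: "\<exists>B. primitive_mat (m + m) m B \<and> \<bar>det (B\<^sup>T * symm 1 (hyperbolic m) * B)\<bar> = e \<and>
      c = {y. l1_eq (qf_of (hyperbolic m) (std_lag m) B) y}" if c: "c \<in> l1_form v" for c
  proof -
    obtain l B where B: "qf_valid (l + l) l (hyperbolic l) (std_lag l) B" "det (symm 1 (B\<^sup>T * hyperbolic l * B)) \<noteq> 0"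
      "zs_equiv v (B\<^sup>T * hyperbolic l * B)" "c = {y. l1_eq (qf_of (hyperbolic l) (std_lag l) B) y}"
      by (rule l1_form_representative[OF v c])
    note vc = qforms_carrier[OF v]
    have q: "zs_equiv (B\<^sup>T * hyperbolic l * B) (B0\<^sup>T * hyperbolic m * B0)"
      by (rule zs_equiv_trans[OF zs_equiv_sym[OF B(3) vc fc[OF B(1)]] B0(3) fc[OF B(1)] vc fc[OF B0(1)]])
    note nsg = zs_equiv_nonsingular[OF q fc[OF B(1)] fc[OF B0(1)] B(2) B0(2)]
    obtain X where X: "unimod l X" "symm 1 (B\<^sup>T * hyperbolic l * B) = X\<^sup>T * symm 1 (B0\<^sup>T * hyperbolic m * B0) * X" using nsg(2) by blast
    note lm = nsg(1)
    have "det (symm 1 (B\<^sup>T * hyperbolic m * B)) = det X * det X * det (symm 1 (B0\<^sup>T * hyperbolic m * B0))"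
      unfolding X(2)[unfolded lm] by (rule det_congruence[OF symm_carrier[OF fc[OF B0(1)]] unimod_carrier[OF X(1)[unfolded lm]]])
    hence "\<bar>det (symm 1 (B\<^sup>T * hyperbolic m * B))\<bar> = e" using X(1) unfolding e_def unimod_iff_det by (simp add: abs_mult)
    hence "\<bar>det (B\<^sup>T * symm 1 (hyperbolic m) * B)\<bar> = e"
      unfolding symm_congruence[OF hyperbolic_carrier qf_validD(8)[OF B(1)[unfolded lm]]] .
    thus ?thesis using qf_validD(6)[OF B(1)] B(4) unfolding lm by (intro exI[of _ B] conjI)
  qed
  from finite_std_codes[OF e, of m] obtain K where K: "finite K"
    and codes: "\<forall>B. primitive_mat (m + m) m B \<longrightarrow> \<bar>det (B\<^sup>T * symm 1 (hyperbolic m) * B)\<bar> = e \<longrightarrow> (\<exists>k \<in> K. std_code m e B k)"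
    by (elim exE conjE)
  have "\<exists>k. k \<in> K \<and> (\<exists>B. primitive_mat (m + m) m B \<and> std_code m e B k \<and> c = {y. l1_eq (qf_of (hyperbolic m) (std_lag m) B) y})"
    if c: "c \<in> l1_form v" for c
  proof -
    from rep[OF c] obtain B where B: "primitive_mat (m + m) m B" "\<bar>det (B\<^sup>T * symm 1 (hyperbolic m) * B)\<bar> = e"
      "c = {y. l1_eq (qf_of (hyperbolic m) (std_lag m) B) y}" by (elim exE conjE)
    from codes[rule_format, OF B(1,2)] obtain k where "k \<in> K" "std_code m e B k" by (rule bexE)
    thus ?thesis using B(1,3) by (intro exI[of _ k] exI[of _ B] conjI)
  qed
  then obtain f where f: "\<And>c. c \<in> l1_form v \<Longrightarrow> f c \<in> K"
    "\<And>c. c \<in> l1_form v \<Longrightarrow> \<exists>B. primitive_mat (m + m) m B \<and> std_code m e B (f c) \<and> c = {y. l1_eq (qf_of (hyperbolic m) (std_lag m) B) y}"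
    by metis
  have "inj_on f (l1_form v)"
  proof (rule inj_onI)
    fix c c' assume c: "c \<in> l1_form v" "c' \<in> l1_form v" and fe: "f c = f c'"
    obtain B where B: "primitive_mat (m + m) m B" "std_code m e B (f c)" "c = {y. l1_eq (qf_of (hyperbolic m) (std_lag m) B) y}"
      using f(2)[OF c(1)] by blast
    obtain B' where B': "primitive_mat (m + m) m B'" "std_code m e B' (f c)" "c' = {y. l1_eq (qf_of (hyperbolic m) (std_lag m) B') y}"
      using f(2)[OF c(2)] unfolding fe by blast
    have q: "l1_eq (qf_of (hyperbolic m) (std_lag m) B) (qf_of (hyperbolic m) (std_lag m) B')"
      by (rule same_std_code[OF B(1) B'(1) B(2) B'(2)]) (use e in simp)
    show "c = c'" unfolding B(3) B'(3)
      using l1_eq.trans[OF q] l1_eq.trans[OF l1_eq.sym[OF q]] by (intro Collect_cong iffI)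
  qed
  thus ?thesis by (rule finite_imageD[rotated]) (rule finite_subset[OF image_subsetI[OF f(1)] K])
qed simp

section \<open>Stable automorphisms of a boundary\<close>

lemma one_mat_0 [simp]: "1\<^sub>m 0 = (0\<^sub>m 0 0 :: int mat)"
  by (rule eq_matI) auto

lemma mat_inv_one [simp]: "mat_inv (1\<^sub>m n) = 1\<^sub>m n"
  by (rule mat_inv_eqI[of _ n]) (auto simp: mat_arith)

lemma mat_inv_carrier: "unimod n U \<Longrightarrow> mat_inv U \<in> carrier_mat n n"
  by (erule unimod_inverse) simp

lemma mat_inv_mat_sum:
  assumes "unimod n U" "unimod m V"
  shows "mat_inv (U \<oplus>\<^sub>m V) = mat_inv U \<oplus>\<^sub>m mat_inv V"
proof -
  obtain U' where U': "U' \<in> carrier_mat n n" "U * U' = 1\<^sub>m n" "mat_inv U = U'" using unimod_inverse[OF assms(1)] by metis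
  obtain V' where V': "V' \<in> carrier_mat m m" "V * V' = 1\<^sub>m m" "mat_inv V = V'" using unimod_inverse[OF assms(2)] by metis
  note c = unimod_carrier[OF assms(1)] unimod_carrier[OF assms(2)]
  have "(U \<oplus>\<^sub>m V) * (U' \<oplus>\<^sub>m V') = 1\<^sub>m (n + m)" using U' V' c by (simp add: mat_sum_mult mat_sum_one)
  thus ?thesis unfolding U'(3) V'(3) using U' V' c by (intro mat_inv_eqI[of _ "n + m"]) auto
qed

lemma stab_bd_eq:
  assumes "w \<in> carrier_mat m m"
  shows "stab_bd p w = (0\<^sub>m p p \<oplus>\<^sub>m 1\<^sub>m m, 1\<^sub>m p \<oplus>\<^sub>m symm 1 w, 0\<^sub>m p p \<oplus>\<^sub>m w)"
  using assms unfolding sf_triv_def boundary_def by simp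

lemma stable_auts_iff:
  assumes w: "w \<in> carrier_mat m m"
  shows "(p, (\<alpha>, \<beta>, \<nu>)) \<in> stable_auts w \<longleftrightarrow>
    unimod (p + m) \<alpha> \<and> unimod (p + m) \<beta> \<and> \<nu> \<in> carrier_mat (p + m) (p + m) \<and>
    \<alpha> * (0\<^sub>m p p \<oplus>\<^sub>m 1\<^sub>m m) + \<alpha> * symm 1 \<nu> * (1\<^sub>m p \<oplus>\<^sub>m symm 1 w) = (0\<^sub>m p p \<oplus>\<^sub>m 1\<^sub>m m) * \<beta> \<and>
    (mat_inv \<alpha>)\<^sup>T * (1\<^sub>m p \<oplus>\<^sub>m symm 1 w) = (1\<^sub>m p \<oplus>\<^sub>m symm 1 w) * \<beta> \<and>
    (0\<^sub>m p p \<oplus>\<^sub>m symm 1 w) + (1\<^sub>m p \<oplus>\<^sub>m symm 1 w) * symm 1 \<nu> * (1\<^sub>m p \<oplus>\<^sub>m symm 1 w) =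
      \<beta>\<^sup>T * (0\<^sub>m p p \<oplus>\<^sub>m symm 1 w) * \<beta>"
proof -
  let ?M = "1\<^sub>m p \<oplus>\<^sub>m symm 1 w" and ?T = "0\<^sub>m p p \<oplus>\<^sub>m w"
  have Mc: "?M \<in> carrier_mat (p + m) (p + m)" and Tc: "?T \<in> carrier_mat (p + m) (p + m)" using w by auto
  have Mt: "?M\<^sup>T = ?M" using symm_transpose[OF w] by (simp add: mat_sum_transpose)
  have T: "symm 1 ?T = 0\<^sub>m p p \<oplus>\<^sub>m symm 1 w" using symm_mat_sum[OF zero_carrier_mat w] by simp
  have Q: "Q_eq 1 (p + m) (?T + ?M\<^sup>T * \<nu> * ?M) (\<beta>\<^sup>T * ?T * \<beta>) \<longleftrightarrow>
      (0\<^sub>m p p \<oplus>\<^sub>m symm 1 w) + ?M * symm 1 \<nu> * ?M = \<beta>\<^sup>T * (0\<^sub>m p p \<oplus>\<^sub>m symm 1 w) * \<beta>"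
    if \<nu>: "\<nu> \<in> carrier_mat (p + m) (p + m)" and \<beta>: "\<beta> \<in> carrier_mat (p + m) (p + m)"
  proof -
    have c: "?M\<^sup>T * \<nu> * ?M \<in> carrier_mat (p + m) (p + m)" "\<beta>\<^sup>T * ?T * \<beta> \<in> carrier_mat (p + m) (p + m)"
      using Mc \<beta> by (auto intro!: carrier_matI)
    have "symm 1 (?T + ?M\<^sup>T * \<nu> * ?M) = symm 1 ?T + symm 1 (?M\<^sup>T * \<nu> * ?M)"
      by (rule symm_add[OF Tc c(1)])
    also have "\<dots> = (0\<^sub>m p p \<oplus>\<^sub>m symm 1 w) + ?M * symm 1 \<nu> * ?M"
      unfolding T by (subst symm_congruence[OF \<nu> Mc]) (simp only: Mt)
    finally have 1: "symm 1 (?T + ?M\<^sup>T * \<nu> * ?M) = (0\<^sub>m p p \<oplus>\<^sub>m symm 1 w) + ?M * symm 1 \<nu> * ?M" .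
    show ?thesis using Q_eq_iff_symm[OF add_carrier_mat[OF c(1), of ?T] c(2)] unfolding 1 symm_congruence[OF Tc \<beta>] T .
  qed
  have inv: "U \<in> carrier_mat (p + m) (p + m) \<and> invertible_mat U \<longleftrightarrow> unimod (p + m) U" for U
    by (rule carrier_invertible_iff)
  have "(p, (\<alpha>, \<beta>, \<nu>)) \<in> stable_auts w \<longleftrightarrow>
    unimod (p + m) \<alpha> \<and> unimod (p + m) \<beta> \<and> \<nu> \<in> carrier_mat (p + m) (p + m) \<and>
    \<alpha> * (0\<^sub>m p p \<oplus>\<^sub>m 1\<^sub>m m) + \<alpha> * (symm 1 \<nu>)\<^sup>T * ?M = (0\<^sub>m p p \<oplus>\<^sub>m 1\<^sub>m m) * \<beta> \<and>
    (mat_inv \<alpha>)\<^sup>T * ?M = ?M * \<beta> \<and> Q_eq 1 (p + m) (?T + ?M\<^sup>T * \<nu> * ?M) (\<beta>\<^sup>T * ?T * \<beta>)"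
    unfolding stable_auts_def mem_Collect_eq case_prod_conv stab_bd_eq[OF w] sf_iso.simps inv[symmetric]
    by (simp only: mat_sum_dim index_zero_mat index_one_mat conj_assoc)
  note base = this
  show ?thesis
  proof (cases "unimod (p + m) \<beta> \<and> \<nu> \<in> carrier_mat (p + m) (p + m)")
    case True
    hence \<nu>: "\<nu> \<in> carrier_mat (p + m) (p + m)" and \<beta>: "\<beta> \<in> carrier_mat (p + m) (p + m)"
      using unimod_carrier by blast+
    show ?thesis using Q[OF \<nu> \<beta>] unfolding base symm_transpose[OF \<nu>] by blast
  next
    case False
    thus ?thesis unfolding base by blast
  qed
qed

lemma add_zero_stable_auts:
  assumes w: "w \<in> carrier_mat m m" and x: "x \<in> stable_auts w"
  shows "add_zero k x \<in> stable_auts (w \<oplus>\<^sub>m zero_form k)"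
proof -
  obtain p \<alpha> \<beta> \<nu> where xe: "x = (p, (\<alpha>, \<beta>, \<nu>))" by (metis surj_pair)
  from x[unfolded xe stable_auts_iff[OF w]]
  have u: "unimod (p + m) \<alpha>" "unimod (p + m) \<beta>" and \<nu>: "\<nu> \<in> carrier_mat (p + m) (p + m)"
    and 1: "\<alpha> * (0\<^sub>m p p \<oplus>\<^sub>m 1\<^sub>m m) + \<alpha> * symm 1 \<nu> * (1\<^sub>m p \<oplus>\<^sub>m symm 1 w) = (0\<^sub>m p p \<oplus>\<^sub>m 1\<^sub>m m) * \<beta>"
    and 2: "(mat_inv \<alpha>)\<^sup>T * (1\<^sub>m p \<oplus>\<^sub>m symm 1 w) = (1\<^sub>m p \<oplus>\<^sub>m symm 1 w) * \<beta>"
    and 3: "(0\<^sub>m p p \<oplus>\<^sub>m symm 1 w) + (1\<^sub>m p \<oplus>\<^sub>m symm 1 w) * symm 1 \<nu> * (1\<^sub>m p \<oplus>\<^sub>m symm 1 w) =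
      \<beta>\<^sup>T * (0\<^sub>m p p \<oplus>\<^sub>m symm 1 w) * \<beta>" by auto
  have wk: "w \<oplus>\<^sub>m zero_form k \<in> carrier_mat (m + k) (m + k)" using w by auto
  have sw: "symm 1 (w \<oplus>\<^sub>m zero_form k) = symm 1 w \<oplus>\<^sub>m 0\<^sub>m k k" using symm_mat_sum[OF w zero_carrier_mat] by simp
  have s\<nu>: "symm 1 (\<nu> \<oplus>\<^sub>m 0\<^sub>m k k) = symm 1 \<nu> \<oplus>\<^sub>m 0\<^sub>m k k" using symm_mat_sum[OF \<nu> zero_carrier_mat] by simp
  have as: "A \<oplus>\<^sub>m (B \<oplus>\<^sub>m C) = (A \<oplus>\<^sub>m B) \<oplus>\<^sub>m C" for A B C by (simp add: mat_sum_assoc)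
  have one: "1\<^sub>m (m + k) = 1\<^sub>m m \<oplus>\<^sub>m 1\<^sub>m k" by (simp add: mat_sum_one)
  have u': "unimod (p + (m + k)) (\<alpha> \<oplus>\<^sub>m 1\<^sub>m k)" "unimod (p + (m + k)) (\<beta> \<oplus>\<^sub>m 1\<^sub>m k)"
    using unimod_mat_sum[OF u(1) unimod_one[of k]] unimod_mat_sum[OF u(2) unimod_one[of k]] by (simp_all add: add.assoc)
  have \<nu>': "\<nu> \<oplus>\<^sub>m 0\<^sub>m k k \<in> carrier_mat (p + (m + k)) (p + (m + k))"
    using mat_sum_carrier[OF \<nu> zero_carrier_mat[of k k]] by (simp add: add.assoc)
  note [simp] = carrier_matD[OF unimod_carrier[OF u(1)]] carrier_matD[OF unimod_carrier[OF u(2)]] carrier_matD[OF \<nu>] carrier_matD[OF w]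
    carrier_matD[OF mat_inv_carrier[OF u(1)]]
  have "(p, (\<alpha> \<oplus>\<^sub>m 1\<^sub>m k, \<beta> \<oplus>\<^sub>m 1\<^sub>m k, \<nu> \<oplus>\<^sub>m 0\<^sub>m k k)) \<in> stable_auts (w \<oplus>\<^sub>m zero_form k)"
    unfolding stable_auts_iff[OF wk] sw s\<nu> as one mat_inv_mat_sum[OF u(1) unimod_one] mat_sum_transpose
    using u' \<nu>' by (simp add: mat_sum_mult mat_sum_add mat_sum_transpose 1 2 3
        mat_one_mult mat_mult_one mat_zero_mult mat_mult_zero mat_add_zero)
  thus ?thesis by (simp add: xe bd_mor_def)
qed

lemma triv_id_bd_id: "mor_sum (triv_id p) (bd_mor (1\<^sub>m m)) = (1\<^sub>m (p + m), 1\<^sub>m (p + m), 0\<^sub>m (p + m) (p + m))"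
  unfolding triv_id_def bd_mor_def by (simp add: mat_sum_one mat_sum_zero)

lemma sf_comp_id_right:
  assumes "\<alpha> \<in> carrier_mat n n" "\<beta> \<in> carrier_mat n n" "\<nu> \<in> carrier_mat n n"
  shows "sf_comp (\<alpha>, \<beta>, \<nu>) (1\<^sub>m n, 1\<^sub>m n, 0\<^sub>m n n) = (\<alpha>, \<beta>, \<nu>)"
  using assms by (simp add: mat_arith)

lemma sf_comp_id_left:
  assumes "unimod n \<alpha>" "\<beta> \<in> carrier_mat n n" "\<nu> \<in> carrier_mat n n"
  shows "sf_comp (1\<^sub>m n, 1\<^sub>m n, 0\<^sub>m n n) (\<alpha>, \<beta>, \<nu>) = (\<alpha>, \<beta>, \<nu>)"
  using assms mat_inv_carrier[OF assms(1)] unimod_carrier[OF assms(1)] by (simp add: mat_arith)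

lemma stably_homotopic_refl:
  assumes w: "w \<in> carrier_mat m m" and x: "x \<in> stable_auts w"
  shows "stably_homotopic w x x"
proof -
  obtain p \<alpha> \<beta> \<nu> where xe: "x = (p, (\<alpha>, \<beta>, \<nu>))" by (metis surj_pair)
  from x[unfolded xe stable_auts_iff[OF w]]
  have u: "unimod (p + m) \<alpha>" "unimod (p + m) \<beta>" and \<nu>: "\<nu> \<in> carrier_mat (p + m) (p + m)" by auto
  note c = unimod_carrier[OF u(1)] unimod_carrier[OF u(2)] \<nu> mat_inv_carrier[OF u(2)]
  note [simp] = c[THEN carrier_matD(1)] c[THEN carrier_matD(2)] carrier_matD[OF w]
  have "sf_iso (sf_triv p) (sf_triv p) (triv_id p)"
    unfolding sf_triv_def triv_id_def sf_iso.simps invertible_mat_unimod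
    by (auto simp: mat_arith Q_eq_def intro!: bexI[of _ "0\<^sub>m p p"])
  moreover have "sf_comp (mor_sum (triv_id p) (bd_mor (1\<^sub>m (dim_row w))))
      (sf_comp (mor_sum (triv_id 0) (\<alpha>, \<beta>, \<nu>)) (mor_sum (triv_id p) (bd_mor (1\<^sub>m (dim_row w))))) = (\<alpha>, \<beta>, \<nu>)"
    unfolding triv_id_bd_id using sf_comp_id_left[OF u(1) c(2,3)] sf_comp_id_right[OF c(1-3)]
    by (simp add: triv_id_def del: sf_comp.simps)
  moreover have "homotopic (stab_bd p w) (stab_bd p w) (\<alpha>, \<beta>, \<nu>) (\<alpha>, \<beta>, \<nu>)"
    unfolding stab_bd_eq[OF w] homotopic.simps
    by (intro bexI[of _ "0\<^sub>m (p + m) (p + m)"])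
      (auto simp: mat_arith Q_eq_def intro!: bexI[of _ "0\<^sub>m (p + m) (p + m)"])
  ultimately show ?thesis unfolding xe stably_homotopic.simps
    by (intro exI[of _ 0] exI[of _ "triv_id p"]) (simp add: triv_id_def del: sf_comp.simps homotopic.simps sf_iso.simps)
qed

lemma bd_act_id:
  assumes w: "w \<in> carrier_mat m m" and x: "x \<in> stable_auts w"
  shows "bd_act (1\<^sub>m m) (1\<^sub>m m) x = x"
proof -
  obtain p \<alpha> \<beta> \<nu> where xe: "x = (p, (\<alpha>, \<beta>, \<nu>))" by (metis surj_pair)
  from x[unfolded xe stable_auts_iff[OF w]]
  have u: "unimod (p + m) \<alpha>" "unimod (p + m) \<beta>" and \<nu>: "\<nu> \<in> carrier_mat (p + m) (p + m)" by auto
  show ?thesis unfolding xe bd_act.simps mat_inv_one triv_id_bd_id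
    using sf_comp_id_left[OF u(1) unimod_carrier[OF u(2)] \<nu>]
      sf_comp_id_right[OF unimod_carrier[OF u(1)] unimod_carrier[OF u(2)] \<nu>]
    by (simp del: sf_comp.simps)
qed

lemma Aut_iff:
  "w \<in> carrier_mat m m \<Longrightarrow> g \<in> Aut w \<longleftrightarrow> unimod m g \<and> symm 1 w = g\<^sup>T * symm 1 w * g"
  unfolding Aut_def using isometry_iff[of w m w m g] by auto

lemma Aut_inverse:
  assumes w: "w \<in> carrier_mat m m" and g: "g \<in> Aut w"
  shows "mat_inv g \<in> Aut w"
proof -
  from g[unfolded Aut_iff[OF w]] have gu: "unimod m g" and ge: "symm 1 w = g\<^sup>T * symm 1 w * g" by auto
  note gc = unimod_carrier[OF gu]
  obtain k where k: "unimod m k" "k \<in> carrier_mat m m" "g * k = 1\<^sub>m m" "mat_inv g = k"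
    using unimod_inverse[OF gu] by metis
  note d = carrier_matD[OF gc] carrier_matD[OF k(2)] carrier_matD[OF w]
  have t: "k\<^sup>T * g\<^sup>T = 1\<^sub>m m" using arg_cong[OF k(3), of transpose_mat] d by (simp add: mat_transpose_mult)
  have "k\<^sup>T * symm 1 w * k = k\<^sup>T * (g\<^sup>T * symm 1 w * g) * k" using ge by simp
  also have "\<dots> = (k\<^sup>T * g\<^sup>T) * symm 1 w * (g * k)" by (simp add: mat_assoc d)
  also have "\<dots> = symm 1 w" unfolding t k(3) by (simp add: mat_one_mult mat_mult_one d)
  finally show ?thesis unfolding Aut_iff[OF w] k(4) using k(1) by simp
qed

lemma bAut_class_eqD:
  assumes w: "w \<in> carrier_mat m m" and x: "x \<in> stable_auts w" and y: "y \<in> stable_auts w"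
    and e: "bAut_class w x = bAut_class w y"
  obtains g h where "g \<in> Aut w" "h \<in> Aut w" "stably_homotopic w (bd_act g h y) x"
proof -
  have "1\<^sub>m m \<in> Aut w" unfolding Aut_iff[OF w] using w by (auto simp: mat_arith)
  hence "sh_class w (bd_act (1\<^sub>m m) (1\<^sub>m m) x) \<in> bAut_class w x" unfolding bAut_class_def by blast
  hence "sh_class w x \<in> bAut_class w y" unfolding bd_act_id[OF w x] e .
  then obtain g h where gh: "g \<in> Aut w" "h \<in> Aut w" "sh_class w x = sh_class w (bd_act g h y)"
    unfolding bAut_class_def by blast
  have "x \<in> sh_class w x" unfolding sh_class_def using x stably_homotopic_refl[OF w x] by simp
  hence "stably_homotopic w (bd_act g h y) x" unfolding gh(3) unfolding sh_class_def by simp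
  thus ?thesis using gh that by blast
qed

section \<open>The action on the discriminant group of a scaled hyperbolic plane\<close>

definition scaled_plane :: "int \<Rightarrow> int mat" where
  "scaled_plane n = mat2 0 n 0 0"

lemma scaled_plane_carrier [simp]: "scaled_plane n \<in> carrier_mat 2 2"
  unfolding scaled_plane_def by simp

lemma symm_scaled_plane: "symm 1 (scaled_plane n) = mat2 0 n n 0"
  unfolding scaled_plane_def symm_def mat2_def by (rule eq_matI) (auto simp: less_2_cases_iff)

abbreviation zs_plane :: "int \<Rightarrow> nat \<Rightarrow> int mat" where
  "zs_plane n q \<equiv> scaled_plane n \<oplus>\<^sub>m zero_form q"

lemma zs_plane_carrier: "zs_plane n q \<in> carrier_mat (2 + q) (2 + q)"
  by (rule mat_sum_carrier[OF scaled_plane_carrier zero_carrier_mat])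

lemma symm_zs_plane: "symm 1 (zs_plane n q) = mat2 0 n n 0 \<oplus>\<^sub>m 0\<^sub>m q q"
  using symm_mat_sum[OF scaled_plane_carrier zero_carrier_mat] by (simp add: symm_scaled_plane)

definition signed_perms :: "int mat set" where
  "signed_perms = {mat2 1 0 0 1, mat2 (-1) 0 0 (-1), mat2 0 1 1 0, mat2 0 (-1) (-1) 0}"

lemma signed_perms_carrier: "P \<in> signed_perms \<Longrightarrow> P \<in> carrier_mat 2 2"
  unfolding signed_perms_def by (elim insertE emptyE) simp_all

lemma mat2_plane_kernel:
  assumes "n \<noteq> 0" "B \<in> carrier_mat 2 q" "mat2 0 n n 0 * B = 0\<^sub>m 2 q"
  shows "B = (0\<^sub>m 2 q :: int mat)"
proof -
  have "mat2 0 n n 0 * (mat2 0 n n 0 * B) = (mat2 0 n n 0 * mat2 0 n n 0) * B" using assms(2) by (simp add: mat_assoc)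
  also have "\<dots> = n\<^sup>2 \<cdot>\<^sub>m (1\<^sub>m 2 * B)" unfolding mat2_mult using assms(2)
    by (simp add: mat2_scalar[symmetric] power2_eq_square mat_smult_mult)
  finally have "n\<^sup>2 \<cdot>\<^sub>m B = 0\<^sub>m 2 q" using assms(2,3) by (simp add: mat_arith)
  hence e: "(n\<^sup>2 \<cdot>\<^sub>m B) $$ (i, j) = 0\<^sub>m 2 q $$ (i, j)" for i j by simp
  show ?thesis
  proof (rule eq_matI)
    fix i j assume "i < dim_row (0\<^sub>m 2 q :: int mat)" "j < dim_col (0\<^sub>m 2 q :: int mat)"
    thus "B $$ (i, j) = 0\<^sub>m 2 q $$ (i, j)" using e[of i j] assms by simp
  qed (use assms in auto)
qed

text \<open>Isometries preserve the two isotropic lines of the hyperbolic plane, and they preserve the radical.\<close>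

lemma Aut_zs_plane:
  assumes n: "n \<noteq> 0" and h: "h \<in> Aut (zs_plane n q)"
  obtains P C D where "P \<in> signed_perms" "C \<in> carrier_mat q 2" "D \<in> carrier_mat q q"
    "h = four_block_mat P (0\<^sub>m 2 q) C D"
proof -
  let ?S = "mat2 0 n n 0"
  from h[unfolded Aut_iff[OF zs_plane_carrier] symm_zs_plane]
  have u: "unimod (2 + q) h" and e: "?S \<oplus>\<^sub>m 0\<^sub>m q q = h\<^sup>T * (?S \<oplus>\<^sub>m 0\<^sub>m q q) * h" by auto
  obtain k where k: "k \<in> carrier_mat (2 + q) (2 + q)" "h * k = 1\<^sub>m (2 + q)" using unimod_inverse[OF u] by metis
  obtain P B C D where b: "P \<in> carrier_mat 2 2" "B \<in> carrier_mat 2 q" "C \<in> carrier_mat q 2" "D \<in> carrier_mat q q"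
    and he: "h = four_block_mat P B C D" using four_block_split[OF unimod_carrier[OF u]] by metis
  obtain P' B' C' D' where b': "P' \<in> carrier_mat 2 2" "B' \<in> carrier_mat 2 q" "C' \<in> carrier_mat q 2" "D' \<in> carrier_mat q q"
    and ke: "k = four_block_mat P' B' C' D'" using four_block_split[OF k(1)] by metis
  note [simp] = b[THEN carrier_matD(1)] b[THEN carrier_matD(2)] b'[THEN carrier_matD(1)] b'[THEN carrier_matD(2)]
  have hc: "dim_row h = 2 + q" "dim_col h = 2 + q" "dim_row k = 2 + q" "dim_col k = 2 + q" unfolding he ke by auto
  have Se: "?S \<oplus>\<^sub>m 0\<^sub>m q q = four_block_mat ?S (0\<^sub>m 2 q) (0\<^sub>m q 2) (0\<^sub>m q q)" by (simp add: mat_sum_def)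
  have kh: "k\<^sup>T * h\<^sup>T = 1\<^sub>m (2 + q)" using arg_cong[OF k(2), of transpose_mat] hc by (simp add: mat_transpose_mult)
  have "k\<^sup>T * (?S \<oplus>\<^sub>m 0\<^sub>m q q) = k\<^sup>T * h\<^sup>T * ((?S \<oplus>\<^sub>m 0\<^sub>m q q) * h)" by (subst e) (simp add: mat_assoc hc)
  also have "\<dots> = (?S \<oplus>\<^sub>m 0\<^sub>m q q) * h" unfolding kh by (simp add: mat_one_mult)
  finally have "four_block_mat (?S * P) (?S * B) (0\<^sub>m q 2) (0\<^sub>m q q) = four_block_mat (P'\<^sup>T * ?S) (0\<^sub>m 2 q) (B'\<^sup>T * ?S) (0\<^sub>m q q)"
    unfolding Se he ke by (simp add: four_block_mult four_block_transpose mat_arith)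
  hence "?S * B = 0\<^sub>m 2 q" by (rule four_block_eqD(2)) simp_all
  hence B: "B = 0\<^sub>m 2 q" by (rule mat2_plane_kernel[OF n b(2)])
  have "four_block_mat ?S (0\<^sub>m 2 q) (0\<^sub>m q 2) (0\<^sub>m q q) = four_block_mat (P\<^sup>T * ?S * P) (0\<^sub>m 2 q) (0\<^sub>m q 2) (0\<^sub>m q q)"
    using e unfolding Se he B by (simp add: four_block_mult four_block_transpose mat_arith)
  hence e2: "?S = P\<^sup>T * ?S * P" by (rule four_block_eqD(1)) simp_all
  obtain a b' c d where Pe: "P = mat2 a b' c d" using mat2_cases[OF b(1)] by metis
  have 1: "n * (a * c) * 2 = 0" "n * (a * d + b' * c) = n * 1" "n * (b' * d) * 2 = 0"
    using e2 unfolding Pe mat2_transpose mat2_mult mat2_eq_iff by (simp_all add: algebra_simps)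
  have ac: "a = 0 \<or> c = 0" and bd: "b' = 0 \<or> d = 0" using 1 n by auto
  have 2: "a * d + b' * c = 1" using 1(2) by (simp only: mult_left_cancel[OF n])
  have "(a = 0 \<and> d = 0 \<and> b' * c = 1) \<or> (b' = 0 \<and> c = 0 \<and> a * d = 1)"
    using ac bd 2 by auto
  hence "P \<in> signed_perms" unfolding Pe signed_perms_def zmult_eq_1_iff by auto
  thus ?thesis using that b(3,4) he unfolding B by blast
qed

text \<open>
  A stable automorphism \<open>\<alpha>\<close> acts on the cokernel of the symmetrisation, and the middle block of
  \<open>\<alpha>\<close>, modulo \<open>n\<close>, is its action on the torsion subgroup \<open>(\<int>/n)\<^sup>2\<close>. Isometries of the form
  change this block by signed permutations only, hence the set of its entries up to sign is an invariant.
\<close>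

definition middle_block :: "nat \<Rightarrow> int mat \<Rightarrow> int mat" where
  "middle_block p \<alpha> = mat 2 2 (\<lambda>(i, j). \<alpha> $$ (p + i, p + j))"

definition has_entry :: "int \<Rightarrow> int \<Rightarrow> int mat \<Rightarrow> bool" where
  "has_entry n s A \<longleftrightarrow> (\<exists>i<2. \<exists>j<2. n dvd A $$ (i, j) - s \<or> n dvd A $$ (i, j) + s)"

lemma has_entry_mat2:
  "has_entry n s (mat2 a b c d) \<longleftrightarrow> (\<exists>x \<in> {a, b, c, d}. n dvd x - s \<or> n dvd x + s)"
proof -
  have "(\<exists>i<2. P i) \<longleftrightarrow> P 0 \<or> P (1::nat)" for P by (auto simp: less_2_cases_iff)
  thus ?thesis unfolding has_entry_def mat2_def by auto
qed

lemma has_entry_signed_perms: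
  assumes "P \<in> signed_perms" "P' \<in> signed_perms" "A \<in> carrier_mat 2 2"
  shows "has_entry n s (P * A * P') \<longleftrightarrow> has_entry n s A"
proof -
  obtain a b c d where A: "A = mat2 a b c d" using mat2_cases[OF assms(3)] by metis
  define pm where "pm x \<longleftrightarrow> n dvd x - s \<or> n dvd x + s" for x
  have m: "pm (- x) \<longleftrightarrow> pm x" for x
    using dvd_minus_iff[of n "x + s"] dvd_minus_iff[of n "x - s"] unfolding pm_def
    by (simp only: minus_add_distrib add_uminus_conv_diff minus_diff_eq uminus_add_conv_diff) blast
  have e: "has_entry n s (mat2 a b c d) \<longleftrightarrow> pm a \<or> pm b \<or> pm c \<or> pm d" for a b c d
    unfolding has_entry_mat2 pm_def by blast
  have l: "has_entry n s (P * mat2 a b c d) \<longleftrightarrow> has_entry n s (mat2 a b c d)" for a b c d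
    using assms(1) unfolding signed_perms_def by (elim insertE emptyE) (auto simp: mat2_mult e m)
  have r: "has_entry n s (mat2 a b c d * P') \<longleftrightarrow> has_entry n s (mat2 a b c d)" for a b c d
    using assms(2) unfolding signed_perms_def by (elim insertE emptyE) (auto simp: mat2_mult e m)
  have "P \<in> carrier_mat 2 2" by (rule signed_perms_carrier[OF assms(1)])
  hence "P * A \<in> carrier_mat 2 2" using assms(3) by simp
  then obtain a' b' c' d' where PA: "P * A = mat2 a' b' c' d'" by (rule mat2_cases)
  show ?thesis using l[of a b c d] r[of a' b' c' d'] unfolding A[symmetric] PA by simp
qed

lemma has_entry_cong:
  assumes "\<And>i j. i < 2 \<Longrightarrow> j < 2 \<Longrightarrow> n dvd A $$ (i, j) - B $$ (i, j)"
  shows "has_entry n s A \<longleftrightarrow> has_entry n s B"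
proof -
  have 1: "n dvd x - s \<longleftrightarrow> n dvd y - s" "n dvd x + s \<longleftrightarrow> n dvd y + s" if "n dvd x - y" for x y
    using dvd_add_right_iff[OF that, of "y - s"] dvd_add_right_iff[OF that, of "y + s"] by (simp_all add: algebra_simps)
  show ?thesis unfolding has_entry_def using 1[OF assms] by blast
qed

fun entry_invariant :: "int \<Rightarrow> int \<Rightarrow> nat \<times> smor \<Rightarrow> bool" where
  "entry_invariant n s (p, (\<alpha>, \<beta>, \<nu>)) \<longleftrightarrow> has_entry n s (middle_block p \<alpha>)"

lemma middle_block_four_block:
  assumes "A \<in> carrier_mat p p" "D \<in> carrier_mat (2 + q) (2 + q)"
  shows "middle_block p (four_block_mat A B C D) = middle_block 0 D"
  using assms unfolding middle_block_def by (intro eq_matI) auto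

lemma middle_block_four_block_0:
  assumes "A \<in> carrier_mat 2 2"
  shows "middle_block 0 (four_block_mat A B C D) = A"
  using assms unfolding middle_block_def by (intro eq_matI) auto

text \<open>
  The three identities behind the invariance: homotopies change \<open>\<alpha>\<close> by a multiple of the symmetrisation,
  automorphisms of trivial formations do not meet the middle block, and the last columns of \<open>\<alpha>\<close>
  vanish there because the torsion subgroup is preserved.
\<close>

lemma entry_invariant_homotopic:
  assumes x: "\<alpha> \<in> carrier_mat (p + (2 + q)) (p + (2 + q))"
    and x': "\<alpha>' \<in> carrier_mat (p' + (2 + q)) (p' + (2 + q))"
    and h: "stably_homotopic (zs_plane n q) (p, (\<alpha>, \<beta>, \<nu>)) (p', (\<alpha>', \<beta>', \<nu>'))"
  shows "entry_invariant n s (p, (\<alpha>, \<beta>, \<nu>)) \<longleftrightarrow> entry_invariant n s (p', (\<alpha>', \<beta>', \<nu>'))"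
proof -
  let ?w = "zs_plane n q"
  define m where "m = 2 + q"
  note x = x[folded m_def] and x' = x'[folded m_def]
  have wc: "?w \<in> carrier_mat m m" using zs_plane_carrier unfolding m_def .
  have dw: "dim_row ?w = m" by (rule carrier_matD(1)[OF wc])
  obtain r r' s1 t1 where rp: "r + p = r' + p'" and s1: "sf_iso (sf_triv (r + p)) (sf_triv (r + p)) s1"
    and t1: "sf_iso (sf_triv (r + p)) (sf_triv (r + p)) t1"
    and h: "homotopic (stab_bd (r + p) ?w) (stab_bd (r + p) ?w) (mor_sum (triv_id r) (\<alpha>, \<beta>, \<nu>))
      (sf_comp (mor_sum t1 (bd_mor (1\<^sub>m m))) (sf_comp (mor_sum (triv_id r') (\<alpha>', \<beta>', \<nu>')) (mor_sum s1 (bd_mor (1\<^sub>m m)))))"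
    using h unfolding stably_homotopic.simps dw by blast
  define R where "R = r + p"
  obtain a b c where s1e: "s1 = (a, b, c)" by (metis surj_pair)
  obtain a' b' c' where t1e: "t1 = (a', b', c')" by (metis surj_pair)
  have a: "a \<in> carrier_mat R R" "a' \<in> carrier_mat R R"
    using s1 t1 unfolding s1e t1e sf_triv_def sf_iso.simps R_def by auto
  let ?A = "1\<^sub>m r \<oplus>\<^sub>m \<alpha>" and ?A' = "(a' \<oplus>\<^sub>m 1\<^sub>m m) * ((1\<^sub>m r' \<oplus>\<^sub>m \<alpha>') * (a \<oplus>\<^sub>m 1\<^sub>m m))"
  have ac: "?A \<in> carrier_mat (R + m) (R + m)"
    using mat_sum_carrier[OF one_carrier_mat[of r] x] unfolding R_def by (simp only: add.assoc)
  have bc: "1\<^sub>m r' \<oplus>\<^sub>m \<alpha>' \<in> carrier_mat (R + m) (R + m)"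
    using mat_sum_carrier[OF one_carrier_mat[of r'] x'] unfolding R_def rp by (simp only: add.assoc)
  obtain \<Delta> where D: "\<Delta> \<in> carrier_mat (R + m) (R + m)" "?A' - ?A = \<Delta> * (1\<^sub>m R \<oplus>\<^sub>m symm 1 ?w)\<^sup>T"
    using h unfolding stab_bd_eq[OF wc] s1e t1e triv_id_def bd_mor_def R_def[symmetric]
    by auto
  have mb: "middle_block R (1\<^sub>m r' \<oplus>\<^sub>m \<alpha>') = middle_block p' \<alpha>'"
  proof (rule eq_matI)
    fix i j assume "i < dim_row (middle_block p' \<alpha>')" "j < dim_col (middle_block p' \<alpha>')"
    hence "i < 2" "j < 2" "i < m" "j < m" unfolding middle_block_def m_def by auto
    thus "middle_block R (1\<^sub>m r' \<oplus>\<^sub>m \<alpha>') $$ (i, j) = middle_block p' \<alpha>' $$ (i, j)"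
      using x' unfolding middle_block_def R_def rp mat_sum_def by simp
  qed (auto simp: middle_block_def)
  have ma: "middle_block R ?A = middle_block p \<alpha>"
  proof (rule eq_matI)
    fix i j assume "i < dim_row (middle_block p \<alpha>)" "j < dim_col (middle_block p \<alpha>)"
    hence "i < 2" "j < 2" "i < m" "j < m" unfolding middle_block_def m_def by auto
    thus "middle_block R ?A $$ (i, j) = middle_block p \<alpha> $$ (i, j)"
      using x unfolding middle_block_def R_def mat_sum_def by simp
  qed (auto simp: middle_block_def)
  have mc: "middle_block R ?A' = middle_block p' \<alpha>'"
  proof -
    obtain X Y Z W where XY: "X \<in> carrier_mat R R" "Y \<in> carrier_mat R m" "Z \<in> carrier_mat m R" "W \<in> carrier_mat m m"
      and e: "1\<^sub>m r' \<oplus>\<^sub>m \<alpha>' = four_block_mat X Y Z W" using four_block_split[OF bc] by metis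
    note d = XY[THEN carrier_matD(1)] XY[THEN carrier_matD(2)] a[THEN carrier_matD(1)] a[THEN carrier_matD(2)]
    have "?A' = four_block_mat (a' * (X * a)) (a' * Y) (Z * a) W"
      unfolding e mat_sum_def[of a'] mat_sum_def[of a] by (simp add: four_block_mult mat_arith d)
    hence "middle_block R ?A' = middle_block 0 W"
      using middle_block_four_block[OF _ XY(4)[unfolded m_def], of "a' * (X * a)" R] XY a by simp
    also have "\<dots> = middle_block R (four_block_mat X Y Z W)" using middle_block_four_block[OF XY(1) XY(4)[unfolded m_def]] by simp
    finally show ?thesis unfolding e[symmetric] mb .
  qed
  have dv: "n dvd middle_block R ?A' $$ (i, j) - middle_block R ?A $$ (i, j)" if ij: "i < 2" "j < 2" for i j
  proof -
    have dA: "dim_row ?A' = R + m" "dim_col ?A' = R + m" "dim_row ?A = R + m" "dim_col ?A = R + m"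
      using a ac by (auto simp: carrier_matD[OF ac])
    have "middle_block R ?A' $$ (i, j) - middle_block R ?A $$ (i, j) = (?A' - ?A) $$ (R + i, R + j)"
      using ij dA unfolding middle_block_def by (simp add: m_def del: index_mult_mat(1))
    also have "\<dots> = (\<Sum>k\<in>{0..<R + m}. \<Delta> $$ (R + i, k) * (1\<^sub>m R \<oplus>\<^sub>m symm 1 ?w) $$ (R + j, k))"
      unfolding D(2) using ij D(1) carrier_matD[OF wc] by (simp add: scalar_prod_def m_def)
    finally have e: "middle_block R ?A' $$ (i, j) - middle_block R ?A $$ (i, j)
      = (\<Sum>k\<in>{0..<R + m}. \<Delta> $$ (R + i, k) * (1\<^sub>m R \<oplus>\<^sub>m symm 1 ?w) $$ (R + j, k))" .
    have "n dvd (1\<^sub>m R \<oplus>\<^sub>m symm 1 ?w) $$ (R + j, k)" if "k < R + m" for k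
      using ij that unfolding symm_zs_plane m_def by (auto simp: mat_sum_def mat2_def less_2_cases_iff)
    thus ?thesis unfolding e by (intro dvd_sum dvd_mult) auto
  qed
  show ?thesis unfolding entry_invariant.simps ma[symmetric] mc[symmetric] using has_entry_cong[OF dv] by blast
qed

lemma stable_auts_zs_plane_block:
  assumes n: "n \<noteq> 0" and x: "(p, (\<alpha>, \<beta>, \<nu>)) \<in> stable_auts (zs_plane n q)"
  obtains X Y Z A C D where "X \<in> carrier_mat p p" "Y \<in> carrier_mat p (2 + q)" "Z \<in> carrier_mat (2 + q) p"
    "A \<in> carrier_mat 2 2" "C \<in> carrier_mat q 2" "D \<in> carrier_mat q q"
    "\<alpha> = four_block_mat X Y Z (four_block_mat A (0\<^sub>m 2 q) C D)"
proof -
  let ?M = "1\<^sub>m p \<oplus>\<^sub>m (mat2 0 n n 0 \<oplus>\<^sub>m 0\<^sub>m q q)" and ?m = "2 + q"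
  from x[unfolded stable_auts_iff[OF zs_plane_carrier] symm_zs_plane]
  have u: "unimod (p + ?m) \<alpha>" "unimod (p + ?m) \<beta>" and e: "(mat_inv \<alpha>)\<^sup>T * ?M = ?M * \<beta>" by auto
  note \<alpha>c = unimod_carrier[OF u(1)] 
  obtain \<alpha>' where \<alpha>': "\<alpha>' \<in> carrier_mat (p + ?m) (p + ?m)" "\<alpha>' * \<alpha> = 1\<^sub>m (p + ?m)" "mat_inv \<alpha> = \<alpha>'"
    using unimod_inverse[OF u(1)] by metis
  obtain \<beta>' where \<beta>': "\<beta>' \<in> carrier_mat (p + ?m) (p + ?m)" "\<beta> * \<beta>' = 1\<^sub>m (p + ?m)"
    using unimod_inverse[OF u(2)] by metis
  note d = carrier_matD[OF \<alpha>c] carrier_matD[OF \<alpha>'(1)] carrier_matD[OF \<beta>'(1)] carrier_matD[OF unimod_carrier[OF u(2)]]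
  have at: "\<alpha>\<^sup>T * \<alpha>'\<^sup>T = 1\<^sub>m (p + ?m)" using arg_cong[OF \<alpha>'(2), of transpose_mat] d by (simp add: mat_transpose_mult)
  have "\<alpha>\<^sup>T * ?M = \<alpha>\<^sup>T * ((?M * \<beta>) * \<beta>')"
    using \<beta>'(2) d by (simp add: mat_assoc mat_mult_one)
  also have "\<dots> = (\<alpha>\<^sup>T * \<alpha>'\<^sup>T) * (?M * \<beta>')" unfolding e[symmetric] \<alpha>'(3) using d by (simp add: mat_assoc)
  also have "\<dots> = ?M * \<beta>'" unfolding at using d by (simp add: mat_one_mult)
  finally have aM: "\<alpha>\<^sup>T * ?M = ?M * \<beta>'" .
  obtain X Y Z W where XY: "X \<in> carrier_mat p p" "Y \<in> carrier_mat p ?m" "Z \<in> carrier_mat ?m p" "W \<in> carrier_mat ?m ?m"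
    and \<alpha>e: "\<alpha> = four_block_mat X Y Z W" using four_block_split[OF \<alpha>c] by metis
  obtain X' Y' Z' W' where XY': "X' \<in> carrier_mat p p" "Y' \<in> carrier_mat p ?m" "Z' \<in> carrier_mat ?m p" "W' \<in> carrier_mat ?m ?m"
    and \<beta>e: "\<beta>' = four_block_mat X' Y' Z' W'" using four_block_split[OF \<beta>'(1)] by metis
  obtain A B C D where AB: "A \<in> carrier_mat 2 2" "B \<in> carrier_mat 2 q" "C \<in> carrier_mat q 2" "D \<in> carrier_mat q q"
    and We: "W = four_block_mat A B C D" using four_block_split[OF XY(4)] by metis
  obtain A' B' C' D' where AB': "A' \<in> carrier_mat 2 2" "B' \<in> carrier_mat 2 q" "C' \<in> carrier_mat q 2" "D' \<in> carrier_mat q q"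
    and We': "W' = four_block_mat A' B' C' D'" using four_block_split[OF XY'(4)] by metis
  note d2 = XY[THEN carrier_matD(1)] XY[THEN carrier_matD(2)] XY'[THEN carrier_matD(1)] XY'[THEN carrier_matD(2)]
    AB[THEN carrier_matD(1)] AB[THEN carrier_matD(2)] AB'[THEN carrier_matD(1)] AB'[THEN carrier_matD(2)]
  let ?S = "mat2 0 n n 0 \<oplus>\<^sub>m 0\<^sub>m q q"
  have "four_block_mat X\<^sup>T (Z\<^sup>T * ?S) Y\<^sup>T (W\<^sup>T * ?S) = four_block_mat X' Y' (?S * Z') (?S * W')"
    using aM unfolding \<alpha>e \<beta>e mat_sum_def[of "1\<^sub>m p"] by (simp add: four_block_mult four_block_transpose mat_arith d2)
  hence "W\<^sup>T * ?S = ?S * W'" by (rule four_block_eqD(4)) (simp_all add: d2)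
  hence "four_block_mat (A\<^sup>T * mat2 0 n n 0) (0\<^sub>m 2 q) (B\<^sup>T * mat2 0 n n 0) (0\<^sub>m q q)
      = four_block_mat (mat2 0 n n 0 * A') (mat2 0 n n 0 * B') (0\<^sub>m q 2) (0\<^sub>m q q)"
    unfolding We We' mat_sum_def by (simp add: four_block_mult four_block_transpose mat_arith d2)
  hence "B\<^sup>T * mat2 0 n n 0 = 0\<^sub>m q 2" by (rule four_block_eqD(3)) (simp_all add: d2)
  hence "(B\<^sup>T * mat2 0 n n 0)\<^sup>T = 0\<^sub>m 2 q" by simp
  hence "mat2 0 n n 0 * B = 0\<^sub>m 2 q" by (simp add: mat_transpose_mult mat2_transpose d2)
  hence B: "B = 0\<^sub>m 2 q" by (rule mat2_plane_kernel[OF n AB(2)])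
  show ?thesis by (rule that[OF XY(1-3) AB(1,3,4)]) (simp only: \<alpha>e We B)
qed

lemma entry_invariant_bd_act:
  assumes n: "n \<noteq> 0" and y: "y \<in> stable_auts (zs_plane n q)"
    and gh: "g \<in> Aut (zs_plane n q)" "h \<in> Aut (zs_plane n q)"
  shows "entry_invariant n s (bd_act g h y) \<longleftrightarrow> entry_invariant n s y"
    "\<exists>\<alpha> \<beta> \<nu>. bd_act g h y = (fst y, (\<alpha>, \<beta>, \<nu>)) \<and> \<alpha> \<in> carrier_mat (fst y + (2 + q)) (fst y + (2 + q))"
proof -
  let ?w = "zs_plane n q" and ?m = "2 + q"
  note w = zs_plane_carrier[of n q]
  obtain p \<alpha> \<beta> \<nu> where ye: "y = (p, (\<alpha>, \<beta>, \<nu>))" by (metis surj_pair)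
  define k where "k = mat_inv g"
  have kA: "k \<in> Aut ?w" unfolding k_def by (rule Aut_inverse[OF w gh(1)])
  note kc = unimod_carrier[OF conjunct1[OF kA[unfolded Aut_iff[OF w]]]]
  obtain P C D where P: "P \<in> signed_perms" "C \<in> carrier_mat q 2" "D \<in> carrier_mat q q"
    and he: "h = four_block_mat P (0\<^sub>m 2 q) C D" using Aut_zs_plane[OF n gh(2)] by metis
  obtain P' C' D' where P': "P' \<in> signed_perms" "C' \<in> carrier_mat q 2" "D' \<in> carrier_mat q q"
    and ke: "k = four_block_mat P' (0\<^sub>m 2 q) C' D'" using Aut_zs_plane[OF n kA] by metis
  obtain X Y Z A E F where X: "X \<in> carrier_mat p p" "Y \<in> carrier_mat p ?m" "Z \<in> carrier_mat ?m p"
    and A: "A \<in> carrier_mat 2 2" "E \<in> carrier_mat q 2" "F \<in> carrier_mat q q"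
    and \<alpha>e: "\<alpha> = four_block_mat X Y Z (four_block_mat A (0\<^sub>m 2 q) E F)"
    using stable_auts_zs_plane_block[OF n y[unfolded ye]] by metis
  note Pc = signed_perms_carrier[OF P(1)] signed_perms_carrier[OF P'(1)]
  note hc = unimod_carrier[OF conjunct1[OF gh(2)[unfolded Aut_iff[OF w]]]]
  note d = X[THEN carrier_matD(1)] X[THEN carrier_matD(2)] A[THEN carrier_matD(1)] A[THEN carrier_matD(2)]
    P(2,3)[THEN carrier_matD(1)] P(2,3)[THEN carrier_matD(2)] P'(2,3)[THEN carrier_matD(1)] P'(2,3)[THEN carrier_matD(2)]
    Pc[THEN carrier_matD(1)] Pc[THEN carrier_matD(2)]
  let ?W = "four_block_mat A (0\<^sub>m 2 q) E F" and ?N = "(1\<^sub>m p \<oplus>\<^sub>m h) * (\<alpha> * (1\<^sub>m p \<oplus>\<^sub>m k))"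
  have Wk: "h * (?W * k) = four_block_mat (P * (A * P')) (0\<^sub>m 2 q) (C * (A * P') + D * (E * P' + F * C')) (D * (F * D'))"
    unfolding he ke by (simp add: four_block_mult mat_arith d)
  have Ne: "?N = four_block_mat X (Y * k) (h * Z) (h * (?W * k))"
    unfolding \<alpha>e mat_sum_def using carrier_matD[OF hc] carrier_matD[OF kc]
    by (simp add: four_block_mult mat_zero_mult mat_mult_zero mat_one_mult mat_mult_one mat_add_zero mat_zero_add d)
  have hWk: "h * (?W * k) \<in> carrier_mat ?m ?m" using hc kc by (intro carrier_matI) simp_all
  have W: "?W \<in> carrier_mat ?m ?m" using A by (intro four_block_carrier_mat) 
  have "middle_block p ?N = P * (A * P')"
    unfolding Ne middle_block_four_block[OF X(1) hWk] unfolding Wk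
    by (rule middle_block_four_block_0) (use Pc A in auto)
  also have "\<dots> = P * A * P'" by (simp add: mat_assoc d)
  finally have N: "middle_block p ?N = P * A * P'" .
  have \<alpha>m: "middle_block p \<alpha> = A"
    unfolding \<alpha>e middle_block_four_block[OF X(1) W] by (rule middle_block_four_block_0[OF A(1)])
  have act: "bd_act g h y = (p, (?N, fst (snd (snd (bd_act g h y))), snd (snd (snd (bd_act g h y)))))"
    unfolding ye bd_act.simps triv_id_def bd_mor_def k_def[symmetric] by simp
  show "entry_invariant n s (bd_act g h y) \<longleftrightarrow> entry_invariant n s y"
    by (subst act) (simp only: ye entry_invariant.simps N \<alpha>m has_entry_signed_perms[OF P(1) P'(1) A(1)])
  have "?N \<in> carrier_mat (p + ?m) (p + ?m)"
    using carrier_matD[OF hc] carrier_matD[OF kc] by (intro carrier_matI) simp_all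
  thus "\<exists>\<alpha> \<beta> \<nu>. bd_act g h y = (fst y, (\<alpha>, \<beta>, \<nu>)) \<and> \<alpha> \<in> carrier_mat (fst y + ?m) (fst y + ?m)"
    using act unfolding ye fst_conv by (intro exI conjI)
qed

lemma entry_invariant_bAut_class:
  assumes n: "n \<noteq> 0" and x: "x \<in> stable_auts (zs_plane n q)" and y: "y \<in> stable_auts (zs_plane n q)"
    and e: "bAut_class (zs_plane n q) x = bAut_class (zs_plane n q) y"
  shows "entry_invariant n s x \<longleftrightarrow> entry_invariant n s y"
proof -
  obtain g h where gh: "g \<in> Aut (zs_plane n q)" "h \<in> Aut (zs_plane n q)" and sh: "stably_homotopic (zs_plane n q) (bd_act g h y) x"
    using bAut_class_eqD[OF zs_plane_carrier x y e] by metis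
  obtain p \<alpha> \<beta> \<nu> where xe: "x = (p, (\<alpha>, \<beta>, \<nu>))" by (metis surj_pair)
  have \<alpha>: "\<alpha> \<in> carrier_mat (p + (2 + q)) (p + (2 + q))"
    by (rule unimod_carrier[OF conjunct1[OF x[unfolded xe stable_auts_iff[OF zs_plane_carrier]]]])
  obtain \<alpha>' \<beta>' \<nu>' where act: "bd_act g h y = (fst y, (\<alpha>', \<beta>', \<nu>'))"
    and \<alpha>': "\<alpha>' \<in> carrier_mat (fst y + (2 + q)) (fst y + (2 + q))"
    using entry_invariant_bd_act(2)[OF n y gh] by blast
  have "entry_invariant n s (bd_act g h y) \<longleftrightarrow> entry_invariant n s x"
    unfolding act xe by (rule entry_invariant_homotopic[OF \<alpha>' \<alpha> sh[unfolded act xe]])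
  thus ?thesis using entry_invariant_bd_act(1)[OF n y gh] by blast
qed

lemma entry_invariant_add_zero:
  assumes x: "x \<in> stable_auts (zs_plane n q)"
  shows "entry_invariant n s (add_zero k x) \<longleftrightarrow> entry_invariant n s x"
proof -
  obtain p \<alpha> \<beta> \<nu> where xe: "x = (p, (\<alpha>, \<beta>, \<nu>))" by (metis surj_pair)
  have \<alpha>: "\<alpha> \<in> carrier_mat (p + (2 + q)) (p + (2 + q))"
    by (rule unimod_carrier[OF conjunct1[OF x[unfolded xe stable_auts_iff[OF zs_plane_carrier]]]])
  have "middle_block p (\<alpha> \<oplus>\<^sub>m 1\<^sub>m k) = middle_block p \<alpha>"
    unfolding middle_block_def mat_sum_def using carrier_matD[OF \<alpha>] by (intro eq_matI) auto
  thus ?thesis by (simp add: xe bd_mor_def)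
qed

text \<open>
  The automorphism of the boundary of \<open>n H\<close> that acts on the discriminant group \<open>(\<int>/n)\<^sup>2\<close> by
  \<open>diag (s\<^sup>-\<^sup>1, s)\<close>. An isometry of \<open>H \<oplus> n H\<close> induces it: on
  the span of the first basis vectors of the two planes it is the matrix with rows \<open>(s, n)\<close>, \<open>(-1, -m)\<close> of determinant one,
  on the span of the second ones the dual matrix. The boundary of \<open>H\<close> is identified with a
  trivial formation by interchanging the two basis vectors, which is how \<open>\<beta>\<close> arises from \<open>\<alpha>\<close>; the equations
  then determine the symmetrisation of \<open>\<nu>\<close>.
\<close>

definition unit_aut :: "int \<Rightarrow> int \<Rightarrow> int \<Rightarrow> nat \<times> smor" where
  "unit_aut n m s = (2,
     (mat4 [[s, 0, n, 0], [0, -m, 0, n], [-1, 0, -m, 0], [0, -1, 0, s]],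
      mat4 [[-m, 0, 0, n], [0, s, n, 0], [0, -1, -m, 0], [-1, 0, 0, s]],
      mat4 [[0, n, 0, m], [0, 0, -s, 0], [0, 0, 0, -1], [0, 0, 0, 0]]))"

lemma mat4_sum:
  "mat2 a b c d \<oplus>\<^sub>m mat2 a' b' c' d' = mat4 [[a, b, 0, 0], [c, d, 0, 0], [0, 0, a', b'], [0, 0, c', d']]"
  by (rule mat4_eqI) (auto simp: mat_sum_def mat2_def mat4_def carrier_matI)

lemma mat4_add:
  "mat4 [[a1, a2, a3, a4], [b1, b2, b3, b4], [c1, c2, c3, c4], [d1, d2, d3, d4]] +
   mat4 [[w1, w2, w3, w4], [x1, x2, x3, x4], [y1, y2, y3, y4], [z1, z2, z3, z4]] =
   mat4 [[a1 + w1, a2 + w2, a3 + w3, a4 + w4], [b1 + x1, b2 + x2, b3 + x3, b4 + x4],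
     [c1 + y1, c2 + y2, c3 + y3, c4 + y4], [d1 + z1, d2 + z2, d3 + z3, d4 + z4]]"
  by (rule mat4_eqI) (auto simp: mat4_def)

lemma mat2_one_zero: "1\<^sub>m 2 = mat2 1 0 0 1" "0\<^sub>m 2 2 = mat2 0 0 0 0"
  by (rule eq_matI; auto simp: mat2_def less_2_cases_iff)+

lemma unit_aut_stable:
  assumes n: "n = s * m + 1"
  shows "unit_aut n m s \<in> stable_auts (zs_plane n 0)"
proof -
  let ?\<alpha> = "mat4 [[s, 0, n, 0], [0, -m, 0, n], [-1, 0, -m, 0], [0, -1, 0, s]]"
  let ?\<alpha>' = "mat4 [[-m, 0, -n, 0], [0, s, 0, -n], [1, 0, s, 0], [0, 1, 0, -m]]"
  let ?\<beta> = "mat4 [[-m, 0, 0, n], [0, s, n, 0], [0, -1, -m, 0], [-1, 0, 0, s]]"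
  let ?\<beta>' = "mat4 [[s, 0, 0, -n], [0, -m, -n, 0], [0, 1, s, 0], [1, 0, 0, -m]]"
  let ?\<nu> = "mat4 [[0, n, 0, m], [0, 0, -s, 0], [0, 0, 0, -1], [0, 0, 0, 0]]"
  have \<alpha>: "?\<alpha> * ?\<alpha>' = 1\<^sub>m 4" and \<beta>: "?\<beta> * ?\<beta>' = 1\<^sub>m 4"
    unfolding mat4_mult mat4_one n by (simp_all add: algebra_simps)
  have i: "mat_inv ?\<alpha> = ?\<alpha>'" by (rule mat_inv_eqI[OF _ _ \<alpha>]) simp_all
  have \<nu>: "symm 1 ?\<nu> = mat4 [[0, n, 0, m], [n, 0, -s, 0], [0, -s, 0, -1], [m, 0, -1, 0]]"
    unfolding symm_def mat_one_smult mat4_transpose mat4_add by simp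
  have f: "(4::nat) = 2 + 2" by simp
  have u: "unimod (2 + 2) ?\<alpha>" "unimod (2 + 2) ?\<beta>"
    using unimodI(1)[OF _ _ \<alpha>] unimodI(1)[OF _ _ \<beta>] by simp_all
  have \<nu>c: "?\<nu> \<in> carrier_mat (2 + 2) (2 + 2)" by simp
  have w: "zs_plane n 0 = scaled_plane n" by simp
  show ?thesis
    unfolding unit_aut_def w stable_auts_iff[OF scaled_plane_carrier] symm_scaled_plane mat2_one_zero mat4_sum i \<nu>
      mat4_mult mat4_transpose mat4_add
    by (intro conjI u \<nu>c) (simp_all add: n algebra_simps)
qed

lemma unit_aut_invariant:
  "entry_invariant n s (unit_aut n m s') \<longleftrightarrow> (\<exists>x \<in> {-m, 0, s'}. n dvd x - s \<or> n dvd x + s)"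
proof -
  have "middle_block 2 (mat4 [[s', 0, n, 0], [0, -m, 0, n], [-1, 0, -m, 0], [0, -1, 0, s']]) = mat2 (-m) 0 0 s'"
    unfolding middle_block_def mat2_def mat4_def by (rule eq_matI) (auto simp: less_2_cases_iff)
  thus ?thesis unfolding unit_aut_def entry_invariant.simps has_entry_mat2 by (simp only: has_entry_mat2) blast
qed

theorem many_boundary_automorphisms:
  "\<exists>v \<in> qforms. \<exists>S \<subseteq> sbAut v. finite S \<and> card S = N"
proof -
  obtain n where n: "n > 1" and dv: "\<And>s. s \<in> {2..int N + 1} \<Longrightarrow> s dvd n - 1"
    and lt: "\<And>s s'. s \<in> {2..int N + 1} \<Longrightarrow> s' \<in> {2..int N + 1} \<Longrightarrow> (s * s')\<^sup>2 < n"
    using common_modulus[of N] by metis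
  let ?I = "{2..int N + 1}" and ?v = "scaled_plane n"
  define x where "x s = unit_aut n ((n - 1) div s) s" for s
  have m: "n = s * ((n - 1) div s) + 1" if "s \<in> ?I" for s using dv[OF that] by simp
  have v0: "?v = zs_plane n 0" by simp
  have xs: "x s \<in> stable_auts (zs_plane n 0)" if "s \<in> ?I" for s
    unfolding x_def by (rule unit_aut_stable[OF m[OF that]])
  define c where "c s = bAut_class (zs_plane n 0) (x s)" for s
  define E where "E s = sbAut_rel ?v `` {(0::nat, c s)}" for s
  have Es: "E s \<in> sbAut ?v" if "s \<in> ?I" for s
  proof -
    have "c s \<in> bAut (zs_plane n 0)" unfolding c_def bAut_def using xs[OF that] by (rule imageI)
    hence "(0, c s) \<in> (SIGMA q:UNIV. bAut (zs_plane n q))" by blast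
    thus ?thesis unfolding E_def sbAut_def by (rule quotientI)
  qed
  have refl: "((0, c s), (0, c s)) \<in> sbAut_rel ?v" if "s \<in> ?I" for s
    unfolding sbAut_rel_def mem_Collect_eq case_prod_conv
    by (rule exI[of _ "x s"], rule exI[of _ "x s"], rule exI[of _ 0], rule exI[of _ 0])
      (use xs[OF that] in \<open>simp only: c_def simp_thms\<close>)
  have inj: "inj_on E ?I"
  proof (rule inj_onI)
    fix s s' assume s: "s \<in> ?I" "s' \<in> ?I" and e: "E s = E s'"
    have "(0, c s') \<in> E s" unfolding e unfolding E_def using refl[OF s(2)] by blast
    hence "((0, c s), (0, c s')) \<in> sbAut_rel ?v" unfolding E_def by blast
    then obtain y y' k k' where y: "y \<in> stable_auts (zs_plane n 0)" "c s = bAut_class (zs_plane n 0) y"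
      and y': "y' \<in> stable_auts (zs_plane n 0)" "c s' = bAut_class (zs_plane n 0) y'"
      and k: "0 + k = 0 + k'"
      and b: "bAut_class (zs_plane n (0 + k)) (add_zero k y) = bAut_class (zs_plane n (0 + k')) (add_zero k' y')"
      unfolding sbAut_rel_def mem_Collect_eq case_prod_conv by (elim exE conjE)
    have n0: "n \<noteq> 0" using n by simp
    have ze: "zs_plane n 0 \<oplus>\<^sub>m zero_form k = zs_plane n k" by simp
    have b': "bAut_class (zs_plane n k) (add_zero k y) = bAut_class (zs_plane n k) (add_zero k y')"
      using b k by simp
    have az: "add_zero k y \<in> stable_auts (zs_plane n k)" "add_zero k y' \<in> stable_auts (zs_plane n k)"
      using add_zero_stable_auts[OF zs_plane_carrier y(1), of k] add_zero_stable_auts[OF zs_plane_carrier y'(1), of k]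
      unfolding ze .
    have "entry_invariant n s (x s) \<longleftrightarrow> entry_invariant n s y"
      by (rule entry_invariant_bAut_class[OF n0 xs[OF s(1)] y(1) y(2)[unfolded c_def]])
    also have "\<dots> \<longleftrightarrow> entry_invariant n s (add_zero k y)"
      by (rule entry_invariant_add_zero[OF y(1), symmetric])
    also have "\<dots> \<longleftrightarrow> entry_invariant n s (add_zero k y')"
      by (rule entry_invariant_bAut_class[OF n0 az b'])
    also have "\<dots> \<longleftrightarrow> entry_invariant n s y'" by (rule entry_invariant_add_zero[OF y'(1)])
    also have "\<dots> \<longleftrightarrow> entry_invariant n s (x s')"
      by (rule entry_invariant_bAut_class[OF n0 xs[OF s(2)] y'(1) y'(2)[unfolded c_def], symmetric])
    finally have "entry_invariant n s (x s')" unfolding x_def unit_aut_invariant by simp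
    then obtain a where a: "a \<in> {- ((n - 1) div s'), 0, s'}" "n dvd a - s \<or> n dvd a + s"
      unfolding x_def unit_aut_invariant by blast
    have s2: "2 \<le> s" "2 \<le> s'" using s by simp_all
    have ss: "2 * s' \<le> s * s'" "s * 2 \<le> s * s'" by (rule mult_mono; use s2 in simp)+
    have s4: "4 \<le> s * s'" using ss s2 by linarith
    have "4 * (s * s') \<le> (s * s') * (s * s')" by (rule mult_right_mono) (use s4 in linarith)+
    hence big: "4 * (s * s') < n" using lt[OF s] unfolding power2_eq_square by linarith
    have small: "z = 0" if "n dvd z" "\<bar>z\<bar> < n" for z
    proof (rule ccontr)
      assume "z \<noteq> 0"
      hence "\<bar>n\<bar> \<le> \<bar>z\<bar>" using dvd_imp_le_int that(1) by blast
      thus False using that(2) by linarith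
    qed
    have mul: "s' = s" if "n dvd s' - s \<or> n dvd s' + s"
      using that
    proof
      assume "n dvd s' - s"
      moreover have "\<bar>s' - s\<bar> < n" using ss s2 big by linarith
      ultimately show ?thesis using small[of "s' - s"] by simp
    next
      assume "n dvd s' + s"
      moreover have "\<bar>s' + s\<bar> < n" using ss s2 big by linarith
      ultimately have "s' + s = 0" by (rule small)
      thus ?thesis using s2 by linarith
    qed
    consider "a = 0" | "a = s'" | "a = - ((n - 1) div s')" using a(1) by blast
    thus "s = s'"
    proof cases
      case 1
      have "n dvd s" using a(2) unfolding 1 by simp
      moreover have "\<bar>s\<bar> < n" using ss s2 big by linarith
      ultimately have "s = 0" by (rule small)
      thus ?thesis using s2 by linarith
    next
      case 2
      thus ?thesis using a(2) mul by simp
    next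
      case 3
      have am: "s' * a = 1 - n" using m[OF s(2)] unfolding 3 by simp
      have "n dvd s' * (a - s) \<or> n dvd s' * (a + s)" using a(2) by (meson dvd_mult)
      hence "n dvd (1 - n) - s' * s \<or> n dvd (1 - n) + s' * s" unfolding right_diff_distrib distrib_left am .
      moreover have "n dvd x" if "n dvd x - n" for x using dvd_add[OF that dvd_refl] by simp
      moreover have "(1 - n) - s' * s = (1 - s * s') - n" "(1 - n) + s' * s = (1 + s * s') - n" by (simp_all add: algebra_simps)
      ultimately have "n dvd 1 - s * s' \<or> n dvd 1 + s * s'" by metis
      thus ?thesis
      proof
        assume "n dvd 1 - s * s'"
        moreover have "\<bar>1 - s * s'\<bar> < n" using s4 big by linarith
        ultimately have "1 - s * s' = 0" by (rule small)
        thus ?thesis using s4 by linarith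
      next
        assume "n dvd 1 + s * s'"
        moreover have "\<bar>1 + s * s'\<bar> < n" using s4 big by linarith
        ultimately have "1 + s * s' = 0" by (rule small)
        thus ?thesis using s4 by linarith
      qed
    qed
  qed
  have "card (E ` ?I) = N" by (simp add: card_image[OF inj])
  moreover have "E ` ?I \<subseteq> sbAut ?v" by (rule image_subsetI) (rule Es)
  ultimately show ?thesis using carrier_qforms[OF scaled_plane_carrier] by (intro bexI[of _ ?v] exI[of _ "E ` ?I"] conjI) simp_all
qed

section \<open>Finite fibres, many stable classes, many boundary automorphisms\<close>

theorem proposition17:
  shows "(\<forall>v \<in> qforms. finite (l1_form v)) \<and>
    (\<forall>N. \<exists>v \<in> qforms. \<exists>S \<subseteq> {c \<in> F0zs. zs_sim c (zs_class v)}. finite S \<and> card S = N) \<and>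
    (\<forall>N. \<exists>v \<in> qforms. \<exists>S \<subseteq> sbAut v. finite S \<and> card S = N)"
  using finite_l1_form many_stably_equivalent_forms many_boundary_automorphisms by (intro conjI ballI allI)

end
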